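(* Suppose that the system $\dot x=y+X(x,y,\delta),\ \dot y=Y(x,y,\delta)$ satisfies, for all $\delta\in D$ and a fixed integer $n\ge 2$, $g(x,\delta)=x^{2n-1}(a_{2n-1}(\delta)+O(x))$ with $a_{2n-1}(\delta)>0$, and $f(x,\delta)=\sum_{j\ge n-1}b_j(\delta)x^j$ with $b_{n-1}^2(\delta)-4n a_{2n-1}(\delta)<0$. Let $v_j(\delta)$, $j\ge1$, be the coefficients of the expansion $\bar d(x_0,\delta)=\bar P(x_0,\delta)-x_0=\sum_{j\ge1}v_j(\delta)x_0^j$. Then: (1) for $n$ odd, $v_{2k}=O(|v_1,v_3,\dots,v_{2k-1}|)$ for all $k\ge1$; (2) for $n$ even, $v_1=0$ and $v_{2k+1}=O(|v_2,v_4,\dots,v_{2k}|)$ for all $k\ge1$.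
   Context: The planar system is $\dot x=y+X(x,y,\delta),\ \dot y=Y(x,y,\delta)$, where $\delta=(\delta_1,\dots,\delta_m)\in D\subset\mathbb{R}^m$, $D$ is compact, $X,Y$ are real analytic, and $X,Y=O(|x,y|^2)$ for $(x,y)$ near the origin and $\delta\in D$. Let $y=F(x,\delta)$ be the solution of $y+X(x,y,\delta)=0$ with $F(0,\delta)=0$, and define $$g(x,\delta)=-Y(x,F(x,\delta),\delta),\qquad f(x,\delta)=-\left[\frac{\partial X}{\partial x}(x,F(x,\delta),\delta)+\frac{\partial Y}{\partial y}(x,F(x,\delta),\delta)\right].$$ Under the assumptions in the claim the origin is a center or a focus for all $\delta\in D$. Poincaré return map: for $\delta\in D$ and $x_0\ne0$ with $|x_0|$ small, let $(x(t,x_0,\delta),y(t,x_0,\delta))$ be the solution of the system with initial condition $(x_0,F(x_0,\delta))$, and let $\tau>0$ be the least positive number with $y(\tau,x_0,\delta)=F(x(\tau,x_0,\delta),\delta)$ and $x_0\,x(\tau,x_0,\delta)>0$. Put $P(x_0,\delta)=x(\tau,x_0,\delta)$ and $P(0,\delta)=0$. The function $\bar P(x_0,\delta)$ is the unique function analytic in $x_0$ at $x_0=0$ that coincides with $P(x_0,\delta)$ for small $x_0>0$. Notation: for analytic functions $\phi,\phi_1,\dots,\phi_k$ defined on a domain $D$, one writes $\phi=O(|\phi_1,\dots,\phi_k|)$ if there are analytic functions $\psi_1,\dots,\psi_k$ on $D$ such that $\phi=\psi_1\phi_1+\dots+\psi_k\phi_k$ on $D$. *)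

theory Defs
  imports "HOL-Analysis.Analysis" "HOL-Library.Landau_Symbols"
begin

(* HOL-Analysis has no real analyticity in several variables.  A multi-index is a function
   Basis -> nat; for real terms has_sum is absolute convergence, so no order of
   summation has to be chosen. *)
definition real_analytic_at :: "('a::euclidean_space \<Rightarrow> real) \<Rightarrow> 'a \<Rightarrow> bool" where
  "real_analytic_at f p \<longleftrightarrow>
     (\<exists>c :: ('a \<Rightarrow> nat) \<Rightarrow> real. \<forall>\<^sub>F x in nhds p.
        ((\<lambda>\<alpha>. c \<alpha> * (\<Prod>i\<in>Basis. ((x - p) \<bullet> i) ^ \<alpha> i)) has_sum f x) (Basis \<rightarrow>\<^sub>E UNIV))"

(* On a set that need not be open (the parameter set D is compact), analytic means being the
   restriction of an analytic function on an open neighbourhood of the set. *)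
definition real_analytic_on :: "('a::euclidean_space \<Rightarrow> real) \<Rightarrow> 'a set \<Rightarrow> bool" where
  "real_analytic_on f S \<longleftrightarrow>
     (\<exists>U h. open U \<and> S \<subseteq> U \<and> (\<forall>p\<in>U. real_analytic_at h p) \<and> (\<forall>x\<in>S. h x = f x))"

(* The relation phi = O(|phi_i : i in I|) of the paper.  It is a relation between analytic
   functions on D, so their analyticity is part of it. *)
definition analytic_O ::
  "'d::euclidean_space set \<Rightarrow> ('d \<Rightarrow> real) \<Rightarrow> nat set \<Rightarrow> (nat \<Rightarrow> 'd \<Rightarrow> real) \<Rightarrow> bool" where
  "analytic_O D \<phi> I \<Phi> \<longleftrightarrow>
     real_analytic_on \<phi> D \<and> (\<forall>i\<in>I. real_analytic_on (\<Phi> i) D) \<and>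
     (\<exists>\<psi>. (\<forall>i\<in>I. real_analytic_on (\<psi> i) D) \<and> (\<forall>\<delta>\<in>D. \<phi> \<delta> = (\<Sum>i\<in>I. \<psi> i \<delta> * \<Phi> i \<delta>)))"

(* X or Y: analytic for (x,y) near the origin and delta in D, and O(|x,y|^2) there,
   uniformly in delta. *)
definition admissible_perturbation ::
  "'d::euclidean_space set \<Rightarrow> (real \<Rightarrow> real \<Rightarrow> 'd \<Rightarrow> real) \<Rightarrow> bool" where
  "admissible_perturbation D X \<longleftrightarrow>
     (\<exists>\<epsilon>>0. real_analytic_on (\<lambda>(x, y, \<delta>). X x y \<delta>) {(x, y, \<delta>). norm (x, y) < \<epsilon> \<and> \<delta> \<in> D}) \<and>
     (\<lambda>((x, y), \<delta>). X x y \<delta>) \<in> O[nhds (0, 0) \<times>\<^sub>F principal D](\<lambda>((x, y), \<delta>). norm (x, y) ^ 2)"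

(* y = F(x,delta) is the solution of y + X = 0 through the origin.  Continuity at 0 selects
   the branch given by the implicit function theorem; only its germ at x = 0 is determined. *)
definition implicit_branch ::
  "'d set \<Rightarrow> (real \<Rightarrow> real \<Rightarrow> 'd \<Rightarrow> real) \<Rightarrow> (real \<Rightarrow> 'd \<Rightarrow> real) \<Rightarrow> bool" where
  "implicit_branch D X F \<longleftrightarrow>
     (\<forall>\<delta>\<in>D. F 0 \<delta> = 0 \<and> isCont (\<lambda>x. F x \<delta>) 0 \<and>
        (\<forall>\<^sub>F x in nhds 0. F x \<delta> + X x (F x \<delta>) \<delta> = 0))"

definition fun_g ::
  "(real \<Rightarrow> real \<Rightarrow> 'd \<Rightarrow> real) \<Rightarrow> (real \<Rightarrow> 'd \<Rightarrow> real) \<Rightarrow> real \<Rightarrow> 'd \<Rightarrow> real" where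
  "fun_g Y F x \<delta> = - Y x (F x \<delta>) \<delta>"

definition fun_f ::
  "(real \<Rightarrow> real \<Rightarrow> 'd \<Rightarrow> real) \<Rightarrow> (real \<Rightarrow> real \<Rightarrow> 'd \<Rightarrow> real) \<Rightarrow> (real \<Rightarrow> 'd \<Rightarrow> real) \<Rightarrow>
     real \<Rightarrow> 'd \<Rightarrow> real" where
  "fun_f X Y F x \<delta> =
     - (deriv (\<lambda>s. X s (F x \<delta>) \<delta>) x + deriv (\<lambda>s. Y x s \<delta>) (F x \<delta>))"

definition solves_system ::
  "(real \<Rightarrow> real \<Rightarrow> 'd \<Rightarrow> real) \<Rightarrow> (real \<Rightarrow> real \<Rightarrow> 'd \<Rightarrow> real) \<Rightarrow> 'd \<Rightarrow> real \<Rightarrow>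
     (real \<Rightarrow> real) \<Rightarrow> (real \<Rightarrow> real) \<Rightarrow> bool" where
  "solves_system X Y \<delta> T x y \<longleftrightarrow>
     (\<forall>t\<in>{0..T}.
        (x has_real_derivative y t + X (x t) (y t) \<delta>) (at t within {0..T}) \<and>
        (y has_real_derivative Y (x t) (y t) \<delta>) (at t within {0..T}))"

definition first_return ::
  "(real \<Rightarrow> real \<Rightarrow> 'd \<Rightarrow> real) \<Rightarrow> (real \<Rightarrow> real \<Rightarrow> 'd \<Rightarrow> real) \<Rightarrow> (real \<Rightarrow> 'd \<Rightarrow> real) \<Rightarrow> 'd \<Rightarrow>
     real \<Rightarrow> real \<Rightarrow> (real \<Rightarrow> real) \<Rightarrow> (real \<Rightarrow> real) \<Rightarrow> bool" where
  "first_return X Y F \<delta> x\<^sub>0 \<tau> x y \<longleftrightarrow>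
     \<tau> > 0 \<and> solves_system X Y \<delta> \<tau> x y \<and> x 0 = x\<^sub>0 \<and> y 0 = F x\<^sub>0 \<delta> \<and>
     y \<tau> = F (x \<tau>) \<delta> \<and> x\<^sub>0 * x \<tau> > 0 \<and>
     (\<forall>s. 0 < s \<and> s < \<tau> \<longrightarrow> \<not> (y s = F (x s) \<delta> \<and> x\<^sub>0 * x s > 0))"

definition return_map ::
  "(real \<Rightarrow> real \<Rightarrow> 'd \<Rightarrow> real) \<Rightarrow> (real \<Rightarrow> real \<Rightarrow> 'd \<Rightarrow> real) \<Rightarrow> (real \<Rightarrow> 'd \<Rightarrow> real) \<Rightarrow>
     real \<Rightarrow> 'd \<Rightarrow> real" where
  "return_map X Y F x\<^sub>0 \<delta> =
     (if x\<^sub>0 = 0 then 0 else (THE p. \<exists>\<tau> x y. first_return X Y F \<delta> x\<^sub>0 \<tau> x y \<and> p = x \<tau>))"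

(* The analytic germ at 0 that agrees with the return map to the right of 0.  It is unique
   only as a germ, hence SOME rather than THE. *)
definition return_map_bar ::
  "(real \<Rightarrow> real \<Rightarrow> 'd \<Rightarrow> real) \<Rightarrow> (real \<Rightarrow> real \<Rightarrow> 'd \<Rightarrow> real) \<Rightarrow> (real \<Rightarrow> 'd \<Rightarrow> real) \<Rightarrow>
     'd \<Rightarrow> real \<Rightarrow> real" where
  "return_map_bar X Y F \<delta> =
     (SOME p. (\<exists>c. p has_fps_expansion c) \<and>
              (\<forall>\<^sub>F x\<^sub>0 in at_right 0. p x\<^sub>0 = return_map X Y F x\<^sub>0 \<delta>))"

definition displacement_bar ::
  "(real \<Rightarrow> real \<Rightarrow> 'd \<Rightarrow> real) \<Rightarrow> (real \<Rightarrow> real \<Rightarrow> 'd \<Rightarrow> real) \<Rightarrow> (real \<Rightarrow> 'd \<Rightarrow> real) \<Rightarrow>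
     'd \<Rightarrow> real \<Rightarrow> real" where
  "displacement_bar X Y F \<delta> x\<^sub>0 = return_map_bar X Y F \<delta> x\<^sub>0 - x\<^sub>0"

definition focus_coeff ::
  "(real \<Rightarrow> real \<Rightarrow> 'd \<Rightarrow> real) \<Rightarrow> (real \<Rightarrow> real \<Rightarrow> 'd \<Rightarrow> real) \<Rightarrow> (real \<Rightarrow> 'd \<Rightarrow> real) \<Rightarrow>
     nat \<Rightarrow> 'd \<Rightarrow> real" where
  "focus_coeff X Y F j \<delta> =
     fps_nth (THE c. displacement_bar X Y F \<delta> has_fps_expansion c) j"

end

(* The substitution u = y + X turns the system into x' = u,
   u' = x^(2n-1) C0(x) + u x^(n-1) C1(x) + u^2 B(u, x) with C0(0) = -a and C1(0) = -b_(n-1). In the weighted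
   polar coordinates x = r cos phi, u = -r^n sin phi the discriminant condition makes phi strictly
   increasing, so that the orbits solve an equation dr/dphi = f(phi, r, delta), analytic at r = 0, and
   P is its flow over [0, 2 pi]. For n odd, f(phi + pi, r) = - f(phi, -r); for n even,
   f(pi - phi, r) = f(phi, -r). With h = - (flow over [0, pi]) these symmetries give P = h o h in the odd case
   and h o h = id, hence P o h o P = h, in the even case. Comparing coefficients in P o h = h o P,
   respectively P o h o P = h, expresses every coefficient of P - x of the unwanted parity through the
   lower ones, with a leading factor that does not vanish because h'(0) < 0 < P'(0).

   Analytic dependence of the flow on the parameter comes from a contraction in the Banach algebra l1
   of absolutely summable coefficient families, in which power series of several variables
   can be substituted into each other. *)
theory Submission
  imports Defs "HOL-Library.Function_Algebras"
begin

section \<open>Absolutely summable families\<close>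

text \<open>The linear part at the origin is nilpotent and the return time grows like r^(1-n), so
  the return map cannot be read off from a flow in time; taking the angle as independent variable
  leaves the regular equation \<open>polar_f\<close>. The weights 1 and n of x and u are those for
  which the leading terms of x' and u' are homogeneous. The number h(x) is the abscissa at which the
  orbit of x next meets the curve u = 0, on the opposite side, whence the sign in h. Both symmetries
  express that two polar pairs, one of them with negative radius, name the same point of the (x, u)
  plane. Two obstacles shape the proof. Analytic on the compact set D means analytic on an open
  neighbourhood, whereas the vanishing of the low order coefficients is known over D alone; the
  reduced equation is therefore extended off D by deleting these coefficients. And each flow is
  known only as a germ near one parameter value, so that its Taylor coefficients have to be patched
  to functions on one open set; uniqueness of solutions makes them agree.\<close>

lemma summable_on_push:
  fixes F :: "'b \<Rightarrow> real" and \<pi> :: "'b \<Rightarrow> 'k" and w :: "'k \<Rightarrow> real"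
  assumes F: "F summable_on UNIV" and w: "\<And>k. \<bar>w k\<bar> \<le> B"
  defines "G \<equiv> \<lambda>k. infsum F {b. \<pi> b = k}"
  shows "(\<lambda>k. \<bar>G k\<bar>) summable_on UNIV"
    and "infsum (\<lambda>k. \<bar>G k\<bar>) UNIV \<le> infsum (\<lambda>b. \<bar>F b\<bar>) UNIV"
    and "(\<lambda>b. w (\<pi> b) * F b) summable_on UNIV"
    and "((\<lambda>k. w k * G k) has_sum infsum (\<lambda>b. w (\<pi> b) * F b) UNIV) UNIV"
proof -
  \<comment> \<open>Sorting the index set into the fibres of \<pi> turns every claim into Fubini for
    an absolutely summable family, and the fibres may be infinite. Convolution, regrouping by one
    exponent and discarding exponents are all instances.\<close>
  let ?S = "Sigma UNIV (\<lambda>k. {b. \<pi> b = k})"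
  have bij: "bij_betw snd ?S UNIV"
    by (force simp: bij_betw_def inj_on_def)
  have Fabs: "(\<lambda>b. \<bar>F b\<bar>) summable_on UNIV"
    using F summable_on_iff_abs_summable_on_real by force
  have absS: "(\<lambda>p. \<bar>F (snd p)\<bar>) summable_on ?S"
    using summable_on_reindex_bij_betw[OF bij, of "\<lambda>b. \<bar>F b\<bar>"] Fabs by simp
  have sumk: "(\<lambda>b. \<bar>F b\<bar>) summable_on {b. \<pi> b = k}" for k
    using Fabs summable_on_subset_banach by blast
  have sumk': "F summable_on {b. \<pi> b = k}" for k
    using F summable_on_subset_banach by blast
  have A: "(\<lambda>k. infsum (\<lambda>b. \<bar>F b\<bar>) {b. \<pi> b = k}) summable_on UNIV"
    using summable_on_Sigma_banach[of "\<lambda>k b. \<bar>F b\<bar>" UNIV "\<lambda>k. {b. \<pi> b = k}"] absS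
    by (simp add: case_prod_unfold)
  have le: "\<bar>G k\<bar> \<le> infsum (\<lambda>b. \<bar>F b\<bar>) {b. \<pi> b = k}" for k
    unfolding G_def using norm_infsum_bound[of F "{b. \<pi> b = k}"] sumk[of k] by simp
  show 1: "(\<lambda>k. \<bar>G k\<bar>) summable_on UNIV"
    using summable_on_comparison_test[OF A] le by simp
  have "infsum (\<lambda>k. \<bar>G k\<bar>) UNIV \<le> infsum (\<lambda>k. infsum (\<lambda>b. \<bar>F b\<bar>) {b. \<pi> b = k}) UNIV"
    using infsum_mono[OF 1 A] le by simp
  also have "\<dots> = infsum (\<lambda>p. \<bar>F (snd p)\<bar>) ?S"
    using infsum_Sigma_banach[OF absS] by simp
  also have "\<dots> = infsum (\<lambda>b. \<bar>F b\<bar>) UNIV"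
    using infsum_reindex_bij_betw[OF bij, of "\<lambda>b. \<bar>F b\<bar>"] by simp
  finally show "infsum (\<lambda>k. \<bar>G k\<bar>) UNIV \<le> infsum (\<lambda>b. \<bar>F b\<bar>) UNIV" .
  have "(\<lambda>b. norm (w (\<pi> b) * F b)) summable_on UNIV"
  proof (rule Infinite_Sum.abs_summable_on_comparison_test)
    show "(\<lambda>b. norm (B * F b)) summable_on UNIV"
      using Fabs by (auto simp: abs_mult intro!: summable_on_cmult_right)
    show "norm (w (\<pi> b) * F b) \<le> norm (B * F b)" for b
      using w[of "\<pi> b"] by (auto simp: abs_mult intro!: mult_right_mono)
  qed
  then show 2: "(\<lambda>b. w (\<pi> b) * F b) summable_on UNIV"
    by (rule abs_summable_summable)
  have wS: "(\<lambda>p. w (\<pi> (snd p)) * F (snd p)) summable_on ?S"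
    using summable_on_reindex_bij_betw[OF bij, of "\<lambda>b. w (\<pi> b) * F b"] 2 by simp
  have in_eq: "infsum (\<lambda>b. w (\<pi> b) * F b) {b. \<pi> b = k} = w k * G k" for k
  proof -
    have "infsum (\<lambda>b. w (\<pi> b) * F b) {b. \<pi> b = k} = infsum (\<lambda>b. w k * F b) {b. \<pi> b = k}"
      by (rule infsum_cong) auto
    then show ?thesis using infsum_cmult_right[OF sumk'] by (simp add: G_def)
  qed
  have s: "(\<lambda>k. w k * G k) summable_on UNIV"
    using summable_on_Sigma_banach[of "\<lambda>k b. w (\<pi> b) * F b" UNIV "\<lambda>k. {b. \<pi> b = k}"] wS in_eq
    by (simp add: case_prod_unfold)
  have "infsum (\<lambda>k. w k * G k) UNIV = infsum (\<lambda>p. w (\<pi> (snd p)) * F (snd p)) ?S"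
    using infsum_Sigma_banach[OF wS] in_eq by simp
  also have "\<dots> = infsum (\<lambda>b. w (\<pi> b) * F b) UNIV"
    using infsum_reindex_bij_betw[OF bij, of "\<lambda>b. w (\<pi> b) * F b"] by simp
  finally show "((\<lambda>k. w k * G k) has_sum infsum (\<lambda>b. w (\<pi> b) * F b) UNIV) UNIV"
    using s by (simp add: has_sum_iff)
qed

lemma summable_on_product_real:
  fixes f :: "'a \<Rightarrow> real" and g :: "'b \<Rightarrow> real"
  assumes f: "f summable_on UNIV" and g: "g summable_on UNIV"
  shows "(\<lambda>(i, j). f i * g j) summable_on UNIV"
    and "infsum (\<lambda>(i, j). f i * g j) UNIV = infsum f UNIV * infsum g UNIV"
proof -
  have fa: "(\<lambda>i. \<bar>f i\<bar>) summable_on UNIV" and ga: "(\<lambda>i. \<bar>g i\<bar>) summable_on UNIV"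
    using f g summable_on_iff_abs_summable_on_real by force+
  have "(\<lambda>p. norm (f (fst p) * g (snd p))) summable_on Sigma UNIV (\<lambda>_. UNIV)"
    unfolding Infinite_Sum.abs_summable_on_Sigma_iff
    using fa ga by (auto simp: abs_mult infsum_cmult_right' infsum_nonneg intro!: summable_on_cmult_right summable_on_cmult_left)
  then have s: "(\<lambda>p. f (fst p) * g (snd p)) summable_on Sigma UNIV (\<lambda>_. UNIV)"
    by (rule abs_summable_summable)
  then show "(\<lambda>(i, j). f i * g j) summable_on UNIV"
    by (simp add: case_prod_unfold)
  have "infsum (\<lambda>i. infsum (\<lambda>j. f i * g j) UNIV) UNIV = infsum f UNIV * infsum g UNIV"
    by (simp add: infsum_cmult_right' infsum_cmult_left')
  then show "infsum (\<lambda>(i, j). f i * g j) UNIV = infsum f UNIV * infsum g UNIV"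
    using infsum_Sigma_banach[OF s] by (simp add: case_prod_unfold)
qed

text \<open>For real families \<open>summable_on\<close> already means absolute convergence, so no
  absolute values are needed here.\<close>

typedef 'i l1 = "{f :: 'i \<Rightarrow> real. f summable_on UNIV}" morphisms l1_coeff Abs_l1
  by (rule exI[of _ "\<lambda>_. 0"]) simp

setup_lifting type_definition_l1

lemma l1_summable [simp, intro]: "l1_coeff e summable_on UNIV"
  using l1_coeff by blast

lemma l1_abs_summable [simp, intro]: "(\<lambda>i. \<bar>l1_coeff e i\<bar>) summable_on UNIV"
  using l1_summable[of e] summable_on_iff_abs_summable_on_real by force

lemma l1_eqI: "(\<And>i. l1_coeff a i = l1_coeff b i) \<Longrightarrow> a = b"
  by (simp add: l1_coeff_inject[symmetric] fun_eq_iff)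

lemma l1_weighted_summable:
  assumes "\<And>i. \<bar>w i\<bar> \<le> B"
  shows "(\<lambda>i. w i * l1_coeff e i) summable_on UNIV"
  using summable_on_push(3)[of "l1_coeff e" w B "\<lambda>i. i"] assms by simp

instantiation l1 :: (type) real_vector
begin

lift_definition zero_l1 :: "'a l1" is "\<lambda>_. 0" by simp
lift_definition plus_l1 :: "'a l1 \<Rightarrow> 'a l1 \<Rightarrow> 'a l1" is "\<lambda>f g i. f i + g i"
  by (rule summable_on_add)
lift_definition minus_l1 :: "'a l1 \<Rightarrow> 'a l1 \<Rightarrow> 'a l1" is "\<lambda>f g i. f i - g i"
  by (simp add: diff_conv_add_uminus summable_on_add summable_on_uminus del: add_uminus_conv_diff)
lift_definition uminus_l1 :: "'a l1 \<Rightarrow> 'a l1" is "\<lambda>f i. - f i"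
  by (simp add: summable_on_uminus)
lift_definition scaleR_l1 :: "real \<Rightarrow> 'a l1 \<Rightarrow> 'a l1" is "\<lambda>c f i. c * f i"
  by (rule summable_on_cmult_right)

instance
  by standard (auto intro!: l1_eqI simp: plus_l1.rep_eq minus_l1.rep_eq uminus_l1.rep_eq zero_l1.rep_eq
      scaleR_l1.rep_eq algebra_simps)

end

instantiation l1 :: (type) real_normed_vector
begin

lift_definition norm_l1 :: "'a l1 \<Rightarrow> real" is "\<lambda>f. infsum (\<lambda>i. \<bar>f i\<bar>) UNIV" .
definition "sgn_l1 (e :: 'a l1) = e /\<^sub>R norm e"
definition "dist_l1 (a :: 'a l1) b = norm (a - b)"
definition "uniformity_l1 = (INF e\<in>{0<..}. principal {(x :: 'a l1, y). dist x y < e})"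
definition "open_l1 (U :: 'a l1 set) \<longleftrightarrow>
  (\<forall>x\<in>U. eventually (\<lambda>(x', y). x' = x \<longrightarrow> y \<in> U) uniformity)"

instance
proof
  fix a b :: "'a l1" and r :: real
  show "norm a = 0 \<longleftrightarrow> a = 0"
  proof
    assume "norm a = 0"
    then have "\<bar>l1_coeff a i\<bar> = 0" for i
      using nonneg_infsum_le_0D[of "\<lambda>i. \<bar>l1_coeff a i\<bar>" UNIV i] by (simp add: norm_l1.rep_eq)
    then show "a = 0" by (intro l1_eqI) (simp add: zero_l1.rep_eq)
  qed (simp add: norm_l1.rep_eq zero_l1.rep_eq)
  show "norm (a + b) \<le> norm a + norm b"
  proof -
    have "norm (a + b) \<le> infsum (\<lambda>i. \<bar>l1_coeff a i\<bar> + \<bar>l1_coeff b i\<bar>) UNIV"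
      unfolding norm_l1.rep_eq
    proof (rule infsum_mono)
      show "(\<lambda>i. \<bar>l1_coeff (a + b) i\<bar>) summable_on UNIV" by (rule l1_abs_summable)
    qed (auto simp: plus_l1.rep_eq intro: summable_on_add)
    then show ?thesis by (simp add: infsum_add norm_l1.rep_eq)
  qed
  show "norm (r *\<^sub>R a) = \<bar>r\<bar> * norm a"
    by (simp add: norm_l1.rep_eq scaleR_l1.rep_eq abs_mult infsum_cmult_right')
qed (auto simp: sgn_l1_def dist_l1_def uniformity_l1_def open_l1_def)

end

lemma abs_l1_coeff_le: "\<bar>l1_coeff e i\<bar> \<le> norm e"
  unfolding norm_l1.rep_eq
  using finite_sum_le_infsum[of "\<lambda>i. \<bar>l1_coeff e i\<bar>" UNIV "{i}"] by simp

lemma sum_abs_l1_coeff_le: "finite A \<Longrightarrow> (\<Sum>i\<in>A. \<bar>l1_coeff e i\<bar>) \<le> norm e"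
  unfolding norm_l1.rep_eq by (rule finite_sum_le_infsum) auto

text \<open>Finite partial sums control both membership and norm; in this form bounds pass to
  coordinatewise limits.\<close>

lemma l1_boundedI:
  assumes "\<And>A. finite A \<Longrightarrow> (\<Sum>i\<in>A. \<bar>f i\<bar>) \<le> B"
  shows "f summable_on UNIV" "norm (Abs_l1 f) \<le> B"
proof -
  have "(\<lambda>i. norm (f i)) summable_on UNIV"
    unfolding abs_summable_iff_bdd_above using assms by (auto intro!: bdd_aboveI2[of _ _ B])
  then have s: "(\<lambda>i. \<bar>f i\<bar>) summable_on UNIV" and s': "f summable_on UNIV"
    using abs_summable_summable[of f UNIV] by auto
  show "f summable_on UNIV" by (rule s')
  show "norm (Abs_l1 f) \<le> B"
    using s s' assms by (simp add: norm_l1.rep_eq Abs_l1_inverse infsum_le_finite_sums)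
qed

instance l1 :: (type) banach
proof
  fix X :: "nat \<Rightarrow> 'a l1"
  assume "Cauchy X"
  have "Cauchy (\<lambda>n. l1_coeff (X n) i)" for i
  proof (rule metric_CauchyI)
    fix e :: real assume "e > 0"
    then obtain N where "\<forall>m\<ge>N. \<forall>n\<ge>N. norm (X m - X n) < e"
      using \<open>Cauchy X\<close> unfolding Cauchy_def dist_norm by blast
    moreover have "dist (l1_coeff (X m) i) (l1_coeff (X n) i) \<le> norm (X m - X n)" for m n
      using abs_l1_coeff_le[of "X m - X n" i] by (simp add: dist_real_def minus_l1.rep_eq)
    ultimately have "\<forall>m\<ge>N. \<forall>n\<ge>N. dist (l1_coeff (X m) i) (l1_coeff (X n) i) < e"
      using le_less_trans by blast
    then show "\<exists>N. \<forall>m\<ge>N. \<forall>n\<ge>N. dist (l1_coeff (X m) i) (l1_coeff (X n) i) < e" by blast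
  qed
  then have "\<exists>l. (\<lambda>n. l1_coeff (X n) i) \<longlonglongrightarrow> l" for i
    using Cauchy_convergent convergent_def by blast
  then obtain f where f: "\<And>i. (\<lambda>n. l1_coeff (X n) i) \<longlonglongrightarrow> f i" by metis
  \<comment> \<open>The Cauchy bound survives the coordinatewise limit because only finitely many
    coordinates are summed.\<close>
  have main: "(\<Sum>i\<in>A. \<bar>l1_coeff (X m) i - f i\<bar>) \<le> e"
    if "finite A" "\<forall>n\<ge>N. norm (X m - X n) < e" for A m N e
  proof (rule tendsto_upperbound)
    show "(\<lambda>n. \<Sum>i\<in>A. \<bar>l1_coeff (X m) i - l1_coeff (X n) i\<bar>) \<longlonglongrightarrow> (\<Sum>i\<in>A. \<bar>l1_coeff (X m) i - f i\<bar>)"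
      by (intro tendsto_intros f)
    show "\<forall>\<^sub>F n in sequentially. (\<Sum>i\<in>A. \<bar>l1_coeff (X m) i - l1_coeff (X n) i\<bar>) \<le> e"
      using eventually_ge_at_top[of N]
    proof eventually_elim
      case (elim n)
      have "(\<Sum>i\<in>A. \<bar>l1_coeff (X m - X n) i\<bar>) \<le> norm (X m - X n)"
        by (rule sum_abs_l1_coeff_le[OF that(1)])
      then show ?case using that(2) elim by (fastforce simp: minus_l1.rep_eq)
    qed
  qed simp
  obtain N1 where N1: "\<forall>n\<ge>N1. norm (X N1 - X n) < 1"
    using \<open>Cauchy X\<close> unfolding Cauchy_def dist_norm by (meson order_refl zero_less_one)
  \<comment> \<open>The limit is \<open>X N1\<close> minus a summable error.\<close>
  have sf: "f summable_on UNIV"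
  proof -
    have "(\<lambda>i. l1_coeff (X N1) i - f i) summable_on UNIV"
      using l1_boundedI(1)[of "\<lambda>i. l1_coeff (X N1) i - f i" 1] main N1 by blast
    then have "(\<lambda>i. l1_coeff (X N1) i + - (l1_coeff (X N1) i - f i)) summable_on UNIV"
      using summable_on_uminus[of "\<lambda>i. l1_coeff (X N1) i - f i" UNIV]
      by (intro summable_on_add) auto
    then show ?thesis by simp
  qed
  have "X \<longlonglongrightarrow> Abs_l1 f"
  proof (rule metric_LIMSEQ_I)
    fix e :: real assume "e > 0"
    then obtain N where N: "\<forall>m\<ge>N. \<forall>n\<ge>N. norm (X m - X n) < e / 2"
      using \<open>Cauchy X\<close> unfolding Cauchy_def dist_norm by (meson half_gt_zero)
    have "dist (X m) (Abs_l1 f) < e" if "m \<ge> N" for m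
    proof -
      have "l1_coeff (X m - Abs_l1 f) = (\<lambda>i. l1_coeff (X m) i - f i)"
        using sf by (simp add: minus_l1.rep_eq Abs_l1_inverse)
      then have "X m - Abs_l1 f = Abs_l1 (\<lambda>i. l1_coeff (X m) i - f i)"
        using l1_coeff_inverse[of "X m - Abs_l1 f"] by simp
      then have "norm (X m - Abs_l1 f) \<le> e / 2"
        using l1_boundedI(2)[of "\<lambda>i. l1_coeff (X m) i - f i" "e/2"] main[of _ N m "e/2"] N that by auto
      then show ?thesis using \<open>e > 0\<close> by (simp add: dist_norm)
    qed
    then show "\<exists>N. \<forall>n\<ge>N. dist (X n) (Abs_l1 f) < e" by blast
  qed
  then show "convergent X" by (auto simp: convergent_def)
qed

text \<open>Ring laws for the convolution are checked by pairing with bounded weights: multiplication by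
  \<open>b\<close> on \<open>l1\<close> is the transpose of the operator \<open>l1_act b\<close> on bounded weights.\<close>

definition l1_pair :: "('i \<Rightarrow> real) \<Rightarrow> 'i l1 \<Rightarrow> real" where
  "l1_pair w e = infsum (\<lambda>i. w i * l1_coeff e i) UNIV"

definition l1_act :: "'i::comm_monoid_add l1 \<Rightarrow> ('i \<Rightarrow> real) \<Rightarrow> 'i \<Rightarrow> real" where
  "l1_act b w = (\<lambda>i. l1_pair (\<lambda>j. w (i + j)) b)"

lift_definition l1_single :: "'i \<Rightarrow> real \<Rightarrow> 'i l1" is "\<lambda>k x i. if i = k then x else 0"
  by (rule finite_nonzero_values_imp_summable_on) simp

lemma l1_pair_single [simp]: "l1_pair w (l1_single k x) = w k * x"
proof -
  have "l1_pair w (l1_single k x) = infsum (\<lambda>i. w i * x) {k}"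
    unfolding l1_pair_def by (rule infsum_cong_neutral) (auto simp: l1_single.rep_eq)
  then show ?thesis by simp
qed

lemma norm_l1_single [simp]: "norm (l1_single k x) = \<bar>x\<bar>"
proof -
  have "norm (l1_single k x) = infsum (\<lambda>i. \<bar>x\<bar>) {k}"
    unfolding norm_l1.rep_eq by (rule infsum_cong_neutral) (auto simp: l1_single.rep_eq)
  then show ?thesis by simp
qed

lemma l1_pair_bounded:
  assumes "\<And>i. \<bar>w i\<bar> \<le> B"
  shows "\<bar>l1_pair w e\<bar> \<le> B * norm e"
proof -
  have s: "(\<lambda>i. B * \<bar>l1_coeff e i\<bar>) summable_on UNIV"
    by (intro summable_on_cmult_right) auto
  have "\<bar>l1_pair w e\<bar> \<le> infsum (\<lambda>i. B * \<bar>l1_coeff e i\<bar>) UNIV"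
    unfolding l1_pair_def real_norm_def[symmetric]
    by (rule norm_infsum_le) (auto simp: abs_mult s[unfolded summable_iff_has_sum_infsum] intro!: mult_right_mono assms has_sum_infsum s l1_weighted_summable[of w B])
  then show ?thesis by (simp add: infsum_cmult_right' norm_l1.rep_eq)
qed

lemma l1_act_bounded: "(\<And>i. \<bar>w i\<bar> \<le> B) \<Longrightarrow> \<bar>l1_act b w i\<bar> \<le> B * norm b"
  unfolding l1_act_def by (rule l1_pair_bounded)

lemma l1_pair_add:
  assumes "\<And>i. \<bar>w i\<bar> \<le> B"
  shows "l1_pair w (a + b) = l1_pair w a + l1_pair w b"
  unfolding l1_pair_def
  using infsum_add[OF l1_weighted_summable[of w B a] l1_weighted_summable[of w B b]] assms
  by (simp add: plus_l1.rep_eq algebra_simps)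

lemma l1_pair_scaleR: "l1_pair w (c *\<^sub>R a) = c * l1_pair w a"
  unfolding l1_pair_def scaleR_l1.rep_eq infsum_cmult_right'[symmetric] by (simp add: mult.left_commute)

lemma l1_pair_weight_add:
  assumes "\<And>i. \<bar>w i\<bar> \<le> B" "\<And>i. \<bar>w' i\<bar> \<le> B'"
  shows "l1_pair (\<lambda>i. w i + w' i) a = l1_pair w a + l1_pair w' a"
  unfolding l1_pair_def
  using infsum_add[OF l1_weighted_summable[of w B a] l1_weighted_summable[of w' B' a]] assms
  by (simp add: algebra_simps)

lemma l1_pair_weight_cmult: "l1_pair (\<lambda>i. c * w i) a = c * l1_pair w a"
  unfolding l1_pair_def infsum_cmult_right'[symmetric] by (simp add: mult.assoc)

text \<open>Indicators of single indices already separate elements, and they are among the weights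
  bounded by 1.\<close>

lemma l1_eq_pairI:
  assumes "\<And>w. (\<And>i. \<bar>w i\<bar> \<le> 1) \<Longrightarrow> l1_pair w a = l1_pair w b"
  shows "a = b"
proof (rule l1_eqI)
  fix k
  have "l1_pair (\<lambda>i. if i = k then 1 else 0) e = l1_coeff e k" for e :: "'a l1"
  proof -
    have "l1_pair (\<lambda>i. if i = k then 1 else 0) e = infsum (l1_coeff e) {k}"
      unfolding l1_pair_def by (rule infsum_cong_neutral) auto
    then show ?thesis by simp
  qed
  then show "l1_coeff a k = l1_coeff b k"
    using assms[of "\<lambda>i. if i = k then 1 else 0"] by simp
qed

lemma l1_pair_push:
  assumes "F summable_on UNIV" "\<And>k. \<bar>w k\<bar> \<le> B"
  shows "l1_pair w (Abs_l1 (\<lambda>k. infsum F {b. \<pi> b = k})) = infsum (\<lambda>b. w (\<pi> b) * F b) UNIV"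
proof -
  have "(\<lambda>k. infsum F {b. \<pi> b = k}) summable_on UNIV"
    using summable_on_push(1)[OF assms(1), of "\<lambda>_. 0" 0 \<pi>] summable_on_iff_abs_summable_on_real by force
  then show ?thesis
    using summable_on_push(4)[of F w B \<pi>] assms
    by (simp add: l1_pair_def Abs_l1_inverse has_sum_iff)
qed

lemma norm_l1_push:
  assumes "F summable_on UNIV"
  shows "norm (Abs_l1 (\<lambda>k. infsum F {b. \<pi> b = k})) \<le> infsum (\<lambda>b. \<bar>F b\<bar>) UNIV"
proof -
  have "(\<lambda>k. infsum F {b. \<pi> b = k}) summable_on UNIV"
    using summable_on_push(1)[OF assms(1), of "\<lambda>_. 0" 0 \<pi>] summable_on_iff_abs_summable_on_real by force
  then show ?thesis
    using summable_on_push(2)[of F "\<lambda>_. 0" 0 \<pi>] assms by (simp add: norm_l1.rep_eq Abs_l1_inverse)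
qed

section \<open>The convolution algebra\<close>

instantiation l1 :: (comm_monoid_add) "{comm_ring_1, real_normed_algebra_1}"
begin

text \<open>The Cauchy product, as push-forward of the product family along addition of indices. The
  index monoid used later is \<open>'b \<Rightarrow> nat\<close> with pointwise addition, which
  makes this the product of power series in several variables.\<close>

definition times_l1 :: "'a l1 \<Rightarrow> 'a l1 \<Rightarrow> 'a l1" where
  "times_l1 a b = Abs_l1 (\<lambda>k. infsum (\<lambda>p. l1_coeff a (fst p) * l1_coeff b (snd p)) {p. fst p + snd p = k})"

definition one_l1 :: "'a l1" where "one_l1 = l1_single 0 1"

lemma l1_prod_summable: "(\<lambda>p. l1_coeff a (fst p) * l1_coeff b (snd p)) summable_on UNIV"
  using summable_on_product_real(1)[OF l1_summable[of a] l1_summable[of b]] by (simp add: case_prod_unfold)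

lemma l1_pair_mult_prod:
  fixes a b :: "'a l1"
  assumes "\<And>k. \<bar>w k\<bar> \<le> B"
  shows "l1_pair w (a * b) = infsum (\<lambda>p. w (fst p + snd p) * (l1_coeff a (fst p) * l1_coeff b (snd p))) UNIV"
  unfolding times_l1_def
  using l1_pair_push[OF l1_prod_summable[of a b], of w B "\<lambda>p. fst p + snd p"] assms by simp

lemma l1_pair_mult:
  fixes a b :: "'a l1"
  assumes "\<And>k. \<bar>w k\<bar> \<le> B"
  shows "l1_pair w (a * b) = l1_pair (l1_act b w) a"
proof -
  let ?F = "\<lambda>p. w (fst p + snd p) * (l1_coeff a (fst p) * l1_coeff b (snd p))"
  have s: "?F summable_on (Sigma UNIV (\<lambda>_. UNIV))"
    using summable_on_push(3)[OF l1_prod_summable[of a b], of w B "\<lambda>p. fst p + snd p"] assms by simp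
  have "infsum ?F UNIV = infsum (\<lambda>i. infsum (\<lambda>j. w (i + j) * (l1_coeff a i * l1_coeff b j)) UNIV) UNIV"
    using infsum_Sigma_banach[OF s] by simp
  also have "\<dots> = infsum (\<lambda>i. l1_act b w i * l1_coeff a i) UNIV"
    unfolding l1_act_def l1_pair_def
    by (rule infsum_cong) (simp add: infsum_cmult_right'[symmetric] infsum_cmult_left'[symmetric] algebra_simps)
  finally show ?thesis using l1_pair_mult_prod[OF assms] by (simp add: l1_pair_def)
qed

lemma l1_mult_commute: "a * b = b * (a :: 'a l1)"
proof (rule l1_eq_pairI)
  fix w :: "'a \<Rightarrow> real" assume w: "\<And>i. \<bar>w i\<bar> \<le> 1"
  have "l1_pair w (a * b) = infsum ((\<lambda>p. w (fst p + snd p) * (l1_coeff b (fst p) * l1_coeff a (snd p))) \<circ> prod.swap) UNIV"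
    using l1_pair_mult_prod[OF w, where a = a and b = b] by (simp add: o_def algebra_simps)
  also have "\<dots> = l1_pair w (b * a)"
    using l1_pair_mult_prod[OF w, where a = b and b = a] infsum_reindex[of prod.swap UNIV "\<lambda>p. w (fst p + snd p) * (l1_coeff b (fst p) * l1_coeff a (snd p))"]
    by (simp add: surj_swap)
  finally show "l1_pair w (a * b) = l1_pair w (b * a)" .
qed

instance
proof
  fix a b c :: "'a l1" and r :: real
  show "a * b = b * a" by (rule l1_mult_commute)
  show "a * b * c = a * (b * c)"
  proof (rule l1_eq_pairI)
    fix w :: "'a \<Rightarrow> real" assume w: "\<And>i. \<bar>w i\<bar> \<le> 1"
    have "l1_pair w (a * b * c) = l1_pair (l1_act b (l1_act c w)) a"
      using l1_pair_mult[OF w] l1_pair_mult[of "l1_act c w" "norm c"] l1_act_bounded[of w 1] w by simp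
    also have "l1_act b (l1_act c w) = l1_act (b * c) w"
    proof
      fix i
      have "l1_act (b * c) w i = l1_pair (l1_act c (\<lambda>j. w (i + j))) b"
        unfolding l1_act_def[of "b * c"] using l1_pair_mult[of "\<lambda>j. w (i + j)" 1 b c] w by simp
      also have "l1_act c (\<lambda>j. w (i + j)) = (\<lambda>j. l1_act c w (i + j))"
        by (simp add: l1_act_def add.assoc)
      finally show "l1_act b (l1_act c w) i = l1_act (b * c) w i"
        by (simp add: l1_act_def[of b])
    qed
    also have "l1_pair (l1_act (b * c) w) a = l1_pair w (a * (b * c))"
      using l1_pair_mult[OF w] by simp
    finally show "l1_pair w (a * b * c) = l1_pair w (a * (b * c))" .
  qed
  show distr: "(a + b) * c = a * c + b * c" for a b c :: "'a l1"
  proof (rule l1_eq_pairI)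
    fix w :: "'a \<Rightarrow> real" assume w: "\<And>i. \<bar>w i\<bar> \<le> 1"
    show "l1_pair w ((a + b) * c) = l1_pair w (a * c + b * c)"
      using l1_pair_add[of "l1_act c w" "norm c"] l1_act_bounded[of w 1 c] w
      by (simp add: l1_pair_mult[OF w] l1_pair_add[OF w])
  qed
  show "a * (b + c) = a * b + a * c"
    using distr[of b c a] by (simp add: l1_mult_commute)
  show "a * 1 = a"
    by (rule l1_eq_pairI) (simp add: l1_pair_mult[where B = 1], simp add: l1_act_def one_l1_def)
  then show "1 * a = a" by (simp add: l1_mult_commute[of 1 a])
  show sc: "(r *\<^sub>R a) * b = r *\<^sub>R (a * b)" for a b :: "'a l1"
    by (rule l1_eq_pairI) (simp add: l1_pair_mult[where B = 1] l1_pair_scaleR)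
  show "a * (r *\<^sub>R b) = r *\<^sub>R (a * b)"
    using sc[of b a] by (simp add: l1_mult_commute)
  show "norm (a * b) \<le> norm a * norm b"
  proof -
    have "norm (a * b) \<le> infsum (\<lambda>p. \<bar>l1_coeff a (fst p) * l1_coeff b (snd p)\<bar>) UNIV"
      unfolding times_l1_def by (rule norm_l1_push[OF l1_prod_summable])
    also have "\<dots> = norm a * norm b"
      using summable_on_product_real(2)[OF l1_abs_summable[of a] l1_abs_summable[of b]]
      by (simp add: norm_l1.rep_eq case_prod_unfold abs_mult)
    finally show ?thesis .
  qed
  show n1: "norm (1 :: 'a l1) = 1" by (simp add: one_l1_def)
  show "(0 :: 'a l1) \<noteq> 1"
  proof
    assume "(0 :: 'a l1) = 1"
    then have "norm (0 :: 'a l1) = 1" using n1 by simp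
    then show False by simp
  qed
qed

end

section \<open>Substitution into power series\<close>

definition monom_at :: "('b::euclidean_space \<Rightarrow> 'c::comm_monoid_mult) \<Rightarrow> ('b \<Rightarrow> nat) \<Rightarrow> 'c" where
  "monom_at g \<alpha> = (\<Prod>i\<in>Basis. g i ^ \<alpha> i)"

text \<open>Exponents range over all functions, not over the extensional ones on
  \<open>Basis\<close>, because the former are closed under pointwise addition; values outside
  \<open>Basis\<close> do not affect the monomial. The target is any commutative Banach algebra:
  over the reals this is evaluation, over \<open>l1\<close> it is substitution of series into a
  series.\<close>

definition sb :: "('b::euclidean_space \<Rightarrow> 'c::{banach, real_normed_algebra_1, comm_ring_1}) \<Rightarrow> ('b \<Rightarrow> nat) l1 \<Rightarrow> 'c" where
  "sb g e = infsum (\<lambda>\<alpha>. l1_coeff e \<alpha> *\<^sub>R monom_at g \<alpha>) UNIV"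

abbreviation ev :: "'b::euclidean_space \<Rightarrow> ('b \<Rightarrow> nat) l1 \<Rightarrow> real" where
  "ev z \<equiv> sb (\<lambda>i. z \<bullet> i)"

lemma norm_prod_le_prod:
  fixes f :: "'a \<Rightarrow> 'c::{comm_ring_1, real_normed_algebra_1}"
  shows "norm (\<Prod>i\<in>A. f i) \<le> (\<Prod>i\<in>A. norm (f i))"
proof (induction A rule: infinite_finite_induct)
  case (insert x F)
  then show ?case
    using norm_mult_ineq[of "f x" "prod f F"] mult_left_mono[of "norm (prod f F)" "\<Prod>i\<in>F. norm (f i)" "norm (f x)"]
    by simp
qed auto

lemma norm_power_le_one: "norm (x :: 'c::real_normed_algebra_1) \<le> 1 \<Longrightarrow> norm (x ^ k) \<le> 1"
  using norm_power_ineq[of x k] power_le_one[of "norm x" k] by simp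

lemma norm_monom_at_le_one:
  fixes g :: "'b::euclidean_space \<Rightarrow> 'c::{real_normed_algebra_1, comm_ring_1}"
  assumes "\<And>i. i \<in> Basis \<Longrightarrow> norm (g i) \<le> 1"
  shows "norm (monom_at g \<alpha>) \<le> 1"
proof -
  have "norm (monom_at g \<alpha>) \<le> (\<Prod>i\<in>Basis. norm (g i ^ \<alpha> i))"
    unfolding monom_at_def by (rule norm_prod_le_prod)
  also have "\<dots> \<le> 1"
    by (intro prod_le_1) (simp add: norm_power_le_one assms)
  finally show ?thesis .
qed

text \<open>One variable that really occurs contributes a factor of at most t, all others at most
  1.\<close>

lemma norm_monom_at_le:
  fixes g :: "'b::euclidean_space \<Rightarrow> 'c::{real_normed_algebra_1, comm_ring_1}"
  assumes "\<And>i. i \<in> Basis \<Longrightarrow> norm (g i) \<le> t" "t \<le> 1" "j \<in> Basis" "\<alpha> j \<noteq> 0"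
  shows "norm (monom_at g \<alpha>) \<le> t"
proof -
  have t0: "0 \<le> t" using assms(1)[OF assms(3)] norm_ge_zero order_trans by blast
  have "norm (monom_at g \<alpha>) \<le> (\<Prod>i\<in>Basis. norm (g i ^ \<alpha> i))"
    unfolding monom_at_def by (rule norm_prod_le_prod)
  also have "\<dots> = norm (g j ^ \<alpha> j) * (\<Prod>i\<in>Basis - {j}. norm (g i ^ \<alpha> i))"
    using assms(3) by (simp add: prod.remove)
  also have "\<dots> \<le> t * 1"
  proof (rule mult_mono)
    have "norm (g j ^ \<alpha> j) \<le> norm (g j) ^ \<alpha> j" by (rule norm_power_ineq)
    also have "\<dots> \<le> norm (g j) ^ 1"
      by (rule power_decreasing) (use assms order_trans[OF assms(1) assms(2)] in auto)
    finally show "norm (g j ^ \<alpha> j) \<le> t" using assms(1)[OF assms(3)] by simp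
    show "(\<Prod>i\<in>Basis - {j}. norm (g i ^ \<alpha> i)) \<le> 1"
      by (intro prod_le_1) (use assms(1,2) order_trans in \<open>fastforce intro!: norm_power_le_one\<close>)
  qed (auto intro!: prod_nonneg t0)
  finally show ?thesis by simp
qed

lemma sb_has_sum:
  assumes "\<And>i. i \<in> Basis \<Longrightarrow> norm (g i) \<le> 1"
  shows "((\<lambda>\<alpha>. l1_coeff e \<alpha> *\<^sub>R monom_at g \<alpha>) has_sum sb g e) UNIV"
proof -
  have "(\<lambda>\<alpha>. norm (l1_coeff e \<alpha> *\<^sub>R monom_at g \<alpha>)) summable_on UNIV"
    by (rule Infinite_Sum.abs_summable_on_comparison_test[of "l1_coeff e"])
      (auto intro!: mult_left_le norm_monom_at_le_one assms)
  then have "(\<lambda>\<alpha>. l1_coeff e \<alpha> *\<^sub>R monom_at g \<alpha>) summable_on UNIV"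
    by (rule abs_summable_summable)
  then show ?thesis unfolding sb_def by simp
qed

text \<open>A bound on monomials that is uniform in the exponent carries over to the whole series.
  Both the shrinking of radii and the contraction estimate rest on this.\<close>

lemma norm_sb_diff_le:
  assumes "\<And>i. i \<in> Basis \<Longrightarrow> norm (g i) \<le> 1" "\<And>i. i \<in> Basis \<Longrightarrow> norm (g' i) \<le> 1"
    and "\<And>\<alpha>. norm (monom_at g \<alpha> - monom_at g' \<alpha>) \<le> K"
  shows "norm (sb g e - sb g' e) \<le> K * norm e"
proof (rule norm_infsum_le)
  show "((\<lambda>\<alpha>. l1_coeff e \<alpha> *\<^sub>R monom_at g \<alpha> + - (l1_coeff e \<alpha> *\<^sub>R monom_at g' \<alpha>)) has_sum (sb g e - sb g' e)) UNIV"
    using has_sum_add[OF sb_has_sum[of g e] has_sum_uminusI[OF sb_has_sum[of g' e]]] assms(1,2) by simp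
  show "((\<lambda>\<alpha>. K * \<bar>l1_coeff e \<alpha>\<bar>) has_sum K * norm e) UNIV"
    unfolding norm_l1.rep_eq by (intro has_sum_cmult_right has_sum_infsum l1_abs_summable)
  fix \<alpha>
  have "norm (l1_coeff e \<alpha> *\<^sub>R monom_at g \<alpha> + - (l1_coeff e \<alpha> *\<^sub>R monom_at g' \<alpha>))
      = \<bar>l1_coeff e \<alpha>\<bar> * norm (monom_at g \<alpha> - monom_at g' \<alpha>)"
    by (simp add: scaleR_right_diff_distrib[symmetric])
  then show "norm (l1_coeff e \<alpha> *\<^sub>R monom_at g \<alpha> + - (l1_coeff e \<alpha> *\<^sub>R monom_at g' \<alpha>)) \<le> K * \<bar>l1_coeff e \<alpha>\<bar>"
    using mult_left_mono[OF assms(3), of "\<bar>l1_coeff e \<alpha>\<bar>" \<alpha>] by (simp add: mult.commute)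
qed

lemma norm_sb_le:
  assumes "\<And>i. i \<in> Basis \<Longrightarrow> norm (g i) \<le> 1"
  shows "norm (sb g e) \<le> norm e"
proof (rule norm_infsum_le[OF sb_has_sum[OF assms]])
  show "((\<lambda>\<alpha>. \<bar>l1_coeff e \<alpha>\<bar>) has_sum norm e) UNIV"
    unfolding norm_l1.rep_eq by (intro has_sum_infsum l1_abs_summable)
qed (auto intro!: mult_left_le norm_monom_at_le_one assms)

lemma sb_add:
  assumes "\<And>i. i \<in> Basis \<Longrightarrow> norm (g i) \<le> 1"
  shows "sb g (a + b) = sb g a + sb g b"
proof -
  have "((\<lambda>\<alpha>. l1_coeff (a + b) \<alpha> *\<^sub>R monom_at g \<alpha>) has_sum (sb g a + sb g b)) UNIV"
    using has_sum_add[OF sb_has_sum[of g a] sb_has_sum[of g b]] assms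
    by (simp add: plus_l1.rep_eq scaleR_left_distrib)
  then show ?thesis by (simp add: sb_def[of g "a + b"] infsumI)
qed

lemma sb_scaleR:
  assumes "\<And>i. i \<in> Basis \<Longrightarrow> norm (g i) \<le> 1"
  shows "sb g (c *\<^sub>R a) = c *\<^sub>R sb g a"
proof -
  have "((\<lambda>\<alpha>. l1_coeff (c *\<^sub>R a) \<alpha> *\<^sub>R monom_at g \<alpha>) has_sum c *\<^sub>R sb g a) UNIV"
    using has_sum_bounded_linear[OF bounded_linear_scaleR_right[of c] sb_has_sum[of g a]] assms
    by (simp add: scaleR_l1.rep_eq o_def)
  then show ?thesis by (simp add: sb_def[of g "c *\<^sub>R a"] infsumI)
qed

lemma sb_single: "sb g (l1_single \<alpha> x) = x *\<^sub>R monom_at g \<alpha>"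
proof -
  have "sb g (l1_single \<alpha> x) = infsum (\<lambda>\<beta>. x *\<^sub>R monom_at g \<alpha>) {\<alpha>}"
    unfolding sb_def by (rule infsum_cong_neutral) (auto simp: l1_single.rep_eq)
  then show ?thesis by simp
qed

lemma sb_one [simp]: "sb g 1 = 1"
  by (simp add: one_l1_def sb_single monom_at_def)

lemma sb_eq_l1_pair: "sb g e = l1_pair (monom_at g) e" for g :: "'b::euclidean_space \<Rightarrow> real"
  by (simp add: sb_def l1_pair_def mult.commute)

lemma monom_at_add: "monom_at g (\<alpha> + \<beta>) = monom_at g \<alpha> * monom_at g \<beta>"
  by (simp add: monom_at_def power_add prod.distrib)

lemma sb_mult:
  fixes g :: "'b::euclidean_space \<Rightarrow> real"
  assumes "\<And>i. i \<in> Basis \<Longrightarrow> norm (g i) \<le> 1"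
  shows "sb g (a * b) = sb g a * sb g b"
proof -
  have w: "\<bar>monom_at g \<alpha>\<bar> \<le> 1" for \<alpha>
    using norm_monom_at_le_one[of g \<alpha>] assms by simp
  have s: "(\<lambda>\<alpha>. monom_at g \<alpha> * l1_coeff e \<alpha>) summable_on UNIV" for e
    using l1_weighted_summable[OF w] .
  have "sb g (a * b) = infsum (\<lambda>p. monom_at g (fst p + snd p) * (l1_coeff a (fst p) * l1_coeff b (snd p))) UNIV"
    using l1_pair_mult_prod[OF w] by (simp add: sb_eq_l1_pair)
  also have "\<dots> = infsum (\<lambda>(i, j). (monom_at g i * l1_coeff a i) * (monom_at g j * l1_coeff b j)) UNIV"
    by (rule infsum_cong) (simp add: case_prod_unfold monom_at_add)
  also have "\<dots> = sb g a * sb g b"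
    using summable_on_product_real(2)[OF s s, of a b] by (simp add: sb_eq_l1_pair l1_pair_def)
  finally show ?thesis .
qed

text \<open>A bounded algebra homomorphism passes through the infinite sum by continuity and through
  each monomial by multiplicativity.\<close>

lemma sb_hom:
  fixes h :: "'c::{banach, real_normed_algebra_1, comm_ring_1} \<Rightarrow> 'd::{banach, real_normed_algebra_1, comm_ring_1}"
  assumes h: "bounded_linear h" "\<And>x y. h (x * y) = h x * h y" "h 1 = 1"
    and g: "\<And>i. i \<in> Basis \<Longrightarrow> norm (g i) \<le> 1"
  shows "h (sb g e) = sb (\<lambda>i. h (g i)) e"
proof -
  have pw: "h (x ^ k) = h x ^ k" for x k by (induction k) (auto simp: h)
  have pr: "h (\<Prod>i\<in>A. f i) = (\<Prod>i\<in>A. h (f i))" if "finite A" for A and f :: "'b \<Rightarrow> 'c"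
    using that by (induction A) (auto simp: h)
  have m: "h (monom_at g \<alpha>) = monom_at (\<lambda>i. h (g i)) \<alpha>" for \<alpha>
    by (simp add: monom_at_def pr pw)
  have "((\<lambda>\<alpha>. h (l1_coeff e \<alpha> *\<^sub>R monom_at g \<alpha>)) has_sum h (sb g e)) UNIV"
    using has_sum_bounded_linear[OF h(1) sb_has_sum[of g e]] g by (simp add: o_def)
  then have "((\<lambda>\<alpha>. l1_coeff e \<alpha> *\<^sub>R monom_at (\<lambda>i. h (g i)) \<alpha>) has_sum h (sb g e)) UNIV"
    by (simp add: linear_cmul[OF bounded_linear.linear[OF h(1)]] m)
  then show ?thesis by (simp add: sb_def infsumI)
qed

lemma bounded_linear_sb:
  assumes "\<And>i. i \<in> Basis \<Longrightarrow> norm (g i) \<le> 1"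
  shows "bounded_linear (sb g)"
  by (rule bounded_linear_intro[of _ 1]) (auto simp: sb_add sb_scaleR norm_sb_le assms)

text \<open>Evaluation is such a homomorphism. Hence the composite of two power series has the
  coefficient family \<open>sb g e\<close>, and no double series has to be rearranged.\<close>

lemma sb_sb:
  fixes g :: "'b::euclidean_space \<Rightarrow> ('a::euclidean_space \<Rightarrow> nat) l1" and z :: "'a \<Rightarrow> real"
  assumes "\<And>i. i \<in> Basis \<Longrightarrow> norm (g i) \<le> 1" "\<And>i. i \<in> Basis \<Longrightarrow> \<bar>z i\<bar> \<le> 1"
  shows "sb z (sb g e) = sb (\<lambda>i. sb z (g i)) e"
  by (rule sb_hom[OF bounded_linear_sb]) (auto simp: assms intro!: sb_mult)

text \<open>The power series of the coordinate i; its exponent is the unit vector at i.\<close>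

definition gen :: "'a \<Rightarrow> ('a::euclidean_space \<Rightarrow> nat) l1" where
  "gen i = l1_single (\<lambda>j. if j = i then 1 else 0) 1"

lemma norm_gen [simp]: "norm (gen i) = 1"
  by (simp add: gen_def)

lemma sb_gen: "i \<in> Basis \<Longrightarrow> sb g (gen i) = g i"
proof -
  assume "i \<in> Basis"
  then have "(\<Prod>j\<in>Basis. g j ^ (if j = i then 1 else 0)) = (\<Prod>j\<in>{i}. g j)"
    by (intro prod.mono_neutral_cong_right) auto
  then show ?thesis by (simp add: gen_def sb_single monom_at_def)
qed

lemma sb_minus:
  assumes "\<And>i. i \<in> Basis \<Longrightarrow> norm (g i) \<le> 1"
  shows "sb g (a - b) = sb g a - sb g b"
  using sb_add[of g a "-1 *\<^sub>R b"] sb_scaleR[of g "-1" b] assms by simp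

section \<open>Real analytic functions of several variables\<close>

text \<open>The coefficient of exponent \<alpha> is multiplied by \<rho> to the total degree, so
  that absolute convergence on the closed cube of half side \<rho> is membership in
  \<open>l1\<close>. A cube is used instead of a ball so that radii can be treated
  componentwise.\<close>

definition power_series_rep ::
  "('a::euclidean_space \<Rightarrow> real) \<Rightarrow> 'a \<Rightarrow> real \<Rightarrow> ('a \<Rightarrow> nat) l1 \<Rightarrow> bool" where
  "power_series_rep f p \<rho> e \<longleftrightarrow>
     \<rho> > 0 \<and> (\<forall>z. (\<forall>i\<in>Basis. \<bar>z \<bullet> i\<bar> \<le> \<rho>) \<longrightarrow> f (p + z) = sb (\<lambda>i. (z \<bullet> i) / \<rho>) e)"

lemma real_analytic_at_imp_rep:
  fixes f :: "'a::euclidean_space \<Rightarrow> real"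
  assumes "real_analytic_at f p"
  obtains \<rho> e where "power_series_rep f p \<rho> e"
proof -
  let ?P = "(Basis :: 'a set) \<rightarrow>\<^sub>E (UNIV :: nat set)"
  let ?K = "{\<alpha> :: 'a \<Rightarrow> nat. \<forall>i. i \<notin> Basis \<longrightarrow> \<alpha> i = 0}"
  from assms obtain c where
    "\<forall>\<^sub>F x in nhds p. ((\<lambda>\<alpha>. c \<alpha> * (\<Prod>i\<in>Basis. ((x - p) \<bullet> i) ^ \<alpha> i)) has_sum f x) ?P"
    unfolding real_analytic_at_def by blast
  then obtain \<epsilon> where \<epsilon>: "\<epsilon> > 0" and hs: "\<And>x. dist x p < \<epsilon> \<Longrightarrow>
      ((\<lambda>\<alpha>. c \<alpha> * (\<Prod>i\<in>Basis. ((x - p) \<bullet> i) ^ \<alpha> i)) has_sum f x) ?P"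
    unfolding eventually_nhds_metric by blast
  \<comment> \<open>The cube with this half side lies in the ball of radius \<epsilon>, since the
    norm is at most the sum of the coordinates.\<close>
  define \<rho> where "\<rho> = \<epsilon> / (2 * DIM('a))"
  have \<rho>: "\<rho> > 0" using \<epsilon> by (simp add: \<rho>_def)
  have dz: "((\<lambda>\<alpha>. c \<alpha> * (\<Prod>i\<in>Basis. (z \<bullet> i) ^ \<alpha> i)) has_sum f (p + z)) ?P"
    if "\<forall>i\<in>Basis. \<bar>z \<bullet> i\<bar> \<le> \<rho>" for z
  proof -
    have "norm z \<le> (\<Sum>i\<in>Basis. \<bar>z \<bullet> i\<bar>)" by (rule norm_le_l1)
    also have "\<dots> \<le> (\<Sum>i\<in>(Basis :: 'a set). \<rho>)" by (rule sum_mono) (use that in auto)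
    also have "\<dots> < \<epsilon>" using \<epsilon> by (simp add: \<rho>_def)
    finally show ?thesis using hs[of "p + z"] by (simp add: dist_norm)
  qed
  \<comment> \<open>Exponents that vanish outside \<open>Basis\<close> stand for the extensional
    ones of \<open>real_analytic_at\<close>; all other coefficients of F are 0.\<close>
  define r where "r = (\<lambda>\<alpha> :: 'a \<Rightarrow> nat. restrict \<alpha> Basis)"
  have bij: "bij_betw r ?K ?P"
    by (rule bij_betw_byWitness[where f' = "\<lambda>\<alpha> i. if i \<in> Basis then \<alpha> i else 0"])
      (auto simp: r_def restrict_def fun_eq_iff PiE_def extensional_def)
  define F where "F = (\<lambda>\<alpha>. if \<alpha> \<in> ?K then c (r \<alpha>) * (\<Prod>i\<in>(Basis :: 'a set). \<rho> ^ \<alpha> i) else 0)"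
  have rep: "((\<lambda>\<alpha>. F \<alpha> * (\<Prod>i\<in>Basis. ((z \<bullet> i) / \<rho>) ^ \<alpha> i)) has_sum f (p + z)) UNIV"
    if z: "\<forall>i\<in>Basis. \<bar>z \<bullet> i\<bar> \<le> \<rho>" for z
  proof -
    have "((\<lambda>\<alpha>. c (r \<alpha>) * (\<Prod>i\<in>Basis. (z \<bullet> i) ^ r \<alpha> i)) has_sum f (p + z)) ?K"
      using has_sum_reindex_bij_betw[OF bij, of "\<lambda>\<alpha>. c \<alpha> * (\<Prod>i\<in>Basis. (z \<bullet> i) ^ \<alpha> i)"] dz[OF z] by simp
    also have "?this \<longleftrightarrow> ?thesis"
    proof (rule has_sum_cong_neutral)
      fix \<alpha> assume \<alpha>: "\<alpha> \<in> ?K \<inter> UNIV"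
      have "(\<Prod>i\<in>Basis. \<rho> ^ \<alpha> i) * (\<Prod>i\<in>Basis. ((z \<bullet> i) / \<rho>) ^ \<alpha> i) = (\<Prod>i\<in>Basis. (z \<bullet> i) ^ r \<alpha> i)"
        unfolding prod.distrib[symmetric]
        by (rule prod.cong) (use \<rho> in \<open>auto simp: r_def power_divide\<close>)
      then show "c (r \<alpha>) * (\<Prod>i\<in>Basis. (z \<bullet> i) ^ r \<alpha> i) = F \<alpha> * (\<Prod>i\<in>Basis. ((z \<bullet> i) / \<rho>) ^ \<alpha> i)"
        using \<alpha> by (simp add: F_def mult.assoc)
    qed (auto simp: F_def)
    finally show ?thesis .
  qed
  have F: "F summable_on UNIV"
  proof -
    \<comment> \<open>At the corner of the cube every scaled monomial equals 1, so convergence there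
      is the summability of F.\<close>
    define z :: 'a where "z = (\<Sum>i\<in>Basis. \<rho> *\<^sub>R i)"
    have zi: "z \<bullet> i = \<rho>" if "i \<in> Basis" for i
      using that unfolding z_def by (simp add: inner_sum_left inner_Basis if_distrib cong: if_cong)
    have "((\<lambda>\<alpha>. F \<alpha> * (\<Prod>i\<in>Basis. ((z \<bullet> i) / \<rho>) ^ \<alpha> i)) has_sum f (p + z)) UNIV"
      by (rule rep) (use \<rho> zi in auto)
    moreover have "(\<Prod>i\<in>Basis. ((z \<bullet> i) / \<rho>) ^ \<alpha> i) = 1" for \<alpha> :: "'a \<Rightarrow> nat"
      by (rule prod.neutral) (use \<rho> zi in auto)
    ultimately show ?thesis using has_sum_imp_summable by fastforce
  qed
  have "power_series_rep f p \<rho> (Abs_l1 F)"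
    unfolding power_series_rep_def sb_def monom_at_def
    using \<rho> rep F by (auto simp: Abs_l1_inverse intro!: infsumI[symmetric])
  then show ?thesis by (rule that)
qed

lemma rep_imp_real_analytic_at:
  fixes f :: "'a::euclidean_space \<Rightarrow> real"
  assumes "power_series_rep f p \<rho> e"
  shows "real_analytic_at f p"
proof -
  let ?P = "(Basis :: 'a set) \<rightarrow>\<^sub>E (UNIV :: nat set)"
  from assms have \<rho>: "\<rho> > 0" and rep: "\<And>z. \<forall>i\<in>Basis. \<bar>z \<bullet> i\<bar> \<le> \<rho> \<Longrightarrow> f (p + z) = sb (\<lambda>i. (z \<bullet> i) / \<rho>) e"
    by (auto simp: power_series_rep_def)
  \<comment> \<open>Exponents that agree on \<open>Basis\<close> give the same monomial, so their
    coefficients are collected.\<close>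
  define G where "G = (\<lambda>\<alpha>. infsum (l1_coeff e) {\<beta> :: 'a \<Rightarrow> nat. restrict \<beta> Basis = \<alpha>})"
  have "((\<lambda>\<alpha>. (G \<alpha> / (\<Prod>i\<in>(Basis :: 'a set). \<rho> ^ \<alpha> i)) * (\<Prod>i\<in>Basis. ((x - p) \<bullet> i) ^ \<alpha> i)) has_sum f x) ?P"
    if "dist x p < \<rho>" for x
  proof -
    have z: "\<forall>i\<in>Basis. \<bar>(x - p) \<bullet> i\<bar> \<le> \<rho>"
    proof
      fix i :: 'a assume "i \<in> Basis"
      then show "\<bar>(x - p) \<bullet> i\<bar> \<le> \<rho>" using Basis_le_norm[of i "x - p"] that by (simp add: dist_norm)
    qed
    define g where "g = (\<lambda>i. ((x - p) \<bullet> i) / \<rho>)"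
    have g: "norm (g i) \<le> 1" if "i \<in> Basis" for i
      using z \<rho> that by (simp add: g_def)
    have "((\<lambda>\<alpha>. monom_at g \<alpha> * G \<alpha>) has_sum infsum (\<lambda>b. monom_at g (restrict b Basis) * l1_coeff e b) UNIV) UNIV"
      unfolding G_def by (rule summable_on_push(4)[where B = 1]) (use norm_monom_at_le_one[OF g] in auto)
    also have "infsum (\<lambda>b. monom_at g (restrict b Basis) * l1_coeff e b) UNIV = f x"
      using rep[OF z] by (simp add: sb_eq_l1_pair l1_pair_def g_def monom_at_def)
    also have "((\<lambda>\<alpha>. monom_at g \<alpha> * G \<alpha>) has_sum f x) UNIV \<longleftrightarrow> ?thesis"
    proof (rule has_sum_cong_neutral)
      fix \<alpha> assume "\<alpha> \<in> UNIV - ?P"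
      then have "{\<beta> :: 'a \<Rightarrow> nat. restrict \<beta> Basis = \<alpha>} = {}" by (auto simp: PiE_def)
      then show "monom_at g \<alpha> * G \<alpha> = 0" by (simp add: G_def)
    qed (auto simp: monom_at_def g_def power_divide prod_dividef)
    finally show ?thesis .
  qed
  then show ?thesis
    unfolding real_analytic_at_def eventually_nhds_metric using \<rho>
    by (intro exI[of _ "\<lambda>\<alpha>. G \<alpha> / (\<Prod>i\<in>(Basis :: 'a set). \<rho> ^ \<alpha> i)"] exI[of _ \<rho>]) auto
qed

text \<open>The new series arises by substituting the constant w_i / \<rho> plus t / \<rho> times
  the i-th variable; the hypothesis on t says that these substituted series have norm at most
  1.\<close>

lemma power_series_rep_recenter:
  fixes f :: "'a::euclidean_space \<Rightarrow> real"
  assumes "power_series_rep f p \<rho> e" "0 < t" "\<And>i. i \<in> Basis \<Longrightarrow> \<bar>w \<bullet> i\<bar> + t \<le> \<rho>"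
  shows "power_series_rep f (p + w) t (sb (\<lambda>i. ((w \<bullet> i) / \<rho>) *\<^sub>R 1 + (t / \<rho>) *\<^sub>R gen i) e)"
  unfolding power_series_rep_def
proof (intro conjI allI impI)
  fix z :: 'a assume z: "\<forall>i\<in>Basis. \<bar>z \<bullet> i\<bar> \<le> t"
  have \<rho>: "\<rho> > 0" using assms(1) by (simp add: power_series_rep_def)
  have b: "norm (((w \<bullet> i) / \<rho>) *\<^sub>R 1 + (t / \<rho>) *\<^sub>R gen i) \<le> 1" if "i \<in> Basis" for i
  proof -
    have "norm (((w \<bullet> i) / \<rho>) *\<^sub>R 1 + (t / \<rho>) *\<^sub>R gen i) \<le> \<bar>w \<bullet> i\<bar> / \<rho> + t / \<rho>"
      using \<rho> assms(2) by (intro order_trans[OF norm_triangle_ineq]) simp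
    also have "\<dots> \<le> 1" using assms(3)[OF that] \<rho> by (simp add: add_divide_distrib[symmetric])
    finally show ?thesis .
  qed
  have s: "\<bar>z \<bullet> i / t\<bar> \<le> 1" if "i \<in> Basis" for i using z that assms(2) by simp
  have "f (p + (w + z)) = sb (\<lambda>i. ((w + z) \<bullet> i) / \<rho>) e"
  proof -
    have "\<forall>i\<in>Basis. \<bar>(w + z) \<bullet> i\<bar> \<le> \<rho>"
    proof
      fix i :: 'a assume "i \<in> Basis"
      then show "\<bar>(w + z) \<bullet> i\<bar> \<le> \<rho>"
        using assms(3)[of i] z abs_triangle_ineq[of "w \<bullet> i" "z \<bullet> i"] by (force simp: inner_add_left)
    qed
    then show ?thesis using assms(1) unfolding power_series_rep_def by blast
  qed
  also have "\<dots> = sb (\<lambda>i. sb (\<lambda>i. (z \<bullet> i) / t) (((w \<bullet> i) / \<rho>) *\<^sub>R 1 + (t / \<rho>) *\<^sub>R gen i)) e"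
    unfolding sb_def[of _ e] monom_at_def
    by (intro infsum_cong arg_cong2[where f = scaleR] prod.cong refl arg_cong2[where f = power])
      (use s assms(2) in \<open>simp add: sb_add sb_scaleR sb_gen inner_add_left add_divide_distrib\<close>)
  also have "\<dots> = sb (\<lambda>i. (z \<bullet> i) / t) (sb (\<lambda>i. ((w \<bullet> i) / \<rho>) *\<^sub>R 1 + (t / \<rho>) *\<^sub>R gen i) e)"
    by (rule sb_sb[symmetric]) (use b s in auto)
  finally show "f (p + w + z) = sb (\<lambda>i. (z \<bullet> i) / t) (sb (\<lambda>i. ((w \<bullet> i) / \<rho>) *\<^sub>R 1 + (t / \<rho>) *\<^sub>R gen i) e)"
    by (simp add: add.assoc)
qed (use assms in auto)

lemma power_series_rep_analytic_inside:
  fixes f :: "'a::euclidean_space \<Rightarrow> real"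
  assumes "power_series_rep f p \<rho> e" "\<And>i. i \<in> Basis \<Longrightarrow> \<bar>w \<bullet> i\<bar> < \<rho>"
  shows "real_analytic_at f (p + w)"
proof -
  define t where "t = Min ((\<lambda>i. \<rho> - \<bar>w \<bullet> i\<bar>) ` Basis)"
  have t: "t > 0" using assms(2) by (auto simp: t_def)
  have le: "\<bar>w \<bullet> i\<bar> + t \<le> \<rho>" if "i \<in> Basis" for i
  proof -
    have "t \<le> \<rho> - \<bar>w \<bullet> i\<bar>" unfolding t_def using that by (intro Min_le) auto
    then show ?thesis by simp
  qed
  show ?thesis
    by (rule rep_imp_real_analytic_at[OF power_series_rep_recenter[OF assms(1) t le]])
qed

lemma real_analytic_at_eventually:
  fixes f :: "'a::euclidean_space \<Rightarrow> real"
  assumes "real_analytic_at f p"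
  shows "\<forall>\<^sub>F x in nhds p. real_analytic_at f x"
proof -
  obtain \<rho> e where r: "power_series_rep f p \<rho> e" using real_analytic_at_imp_rep[OF assms] by blast
  have "real_analytic_at f x" if "dist x p < \<rho>" for x
  proof -
    have "\<bar>(x - p) \<bullet> i\<bar> < \<rho>" if "i \<in> Basis" for i
      using Basis_le_norm[OF that, of "x - p"] \<open>dist x p < \<rho>\<close> by (simp add: dist_norm)
    then show ?thesis using power_series_rep_analytic_inside[OF r, of "x - p"] by simp
  qed
  then show ?thesis
    using r unfolding eventually_nhds_metric power_series_rep_def by blast
qed

lemma open_analytic_at: "open {z. real_analytic_at f z}"
proof (subst open_subopen, intro ballI)
  fix z assume "z \<in> {z. real_analytic_at f z}"
  then have "\<forall>\<^sub>F x in nhds z. x \<in> {z. real_analytic_at f z}" using real_analytic_at_eventually by auto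
  then show "\<exists>T. open T \<and> z \<in> T \<and> T \<subseteq> {z. real_analytic_at f z}" unfolding eventually_nhds by auto
qed

text \<open>Without its constant term every monomial gains a factor t / \<rho>, so shrinking the
  radius makes the series small. The bound holds for all smaller radii, which later allows a common
  radius for all components of a map.\<close>

lemma power_series_rep_small:
  fixes f :: "'a::euclidean_space \<Rightarrow> real"
  assumes "power_series_rep f p \<rho> e" "\<eta> > 0"
  obtains \<rho>0 where "\<rho>0 > 0" "\<rho>0 \<le> \<rho>"
    "\<And>\<rho>1. 0 < \<rho>1 \<Longrightarrow> \<rho>1 \<le> \<rho>0 \<Longrightarrow> \<exists>r. norm r \<le> \<eta> \<and> power_series_rep (\<lambda>x. f x - f p) p \<rho>1 r"
proof
  have \<rho>: "\<rho> > 0" using assms(1) by (simp add: power_series_rep_def)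
  \<comment> \<open>Chosen so that t / \<rho> times the norm of e is at most \<eta>; adding 1 covers
    e = 0.\<close>
  let ?\<rho>0 = "min \<rho> (\<rho> * \<eta> / (norm e + 1))"
  have ne: "norm e + 1 > 0" using norm_ge_zero[of e] by linarith
  show "?\<rho>0 > 0" "?\<rho>0 \<le> \<rho>" using \<rho> assms(2) ne by auto
  fix t assume t: "0 < t" "t \<le> ?\<rho>0"
  let ?g = "\<lambda>i. (t / \<rho>) *\<^sub>R gen i"
  have gn: "norm (?g i) \<le> t / \<rho>" for i :: 'a using t \<rho> by simp
  have t1: "t / \<rho> \<le> 1" using t \<rho> by simp
  have rep: "power_series_rep f p t (sb ?g e)"
    using power_series_rep_recenter[OF assms(1) t(1), of 0] t by simp
  have "norm (sb ?g e - sb (\<lambda>i. 0) e) \<le> t / \<rho> * norm e"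
  proof (rule norm_sb_diff_le)
    fix \<alpha> :: "'a \<Rightarrow> nat"
    show "norm (monom_at ?g \<alpha> - monom_at (\<lambda>i. 0) \<alpha>) \<le> t / \<rho>"
    proof (cases "\<exists>j\<in>Basis. \<alpha> j \<noteq> 0")
      case True
      then obtain j where j: "j \<in> Basis" "\<alpha> j \<noteq> 0" by blast
      then have "monom_at (\<lambda>i. 0 :: ('a \<Rightarrow> nat) l1) \<alpha> = 0"
        unfolding monom_at_def by (intro prod_zero bexI[of _ j]) (auto simp: zero_power)
      then show ?thesis using norm_monom_at_le[of ?g "t / \<rho>" j \<alpha>] gn t1 j by simp
    next
      case False
      then show ?thesis using t \<rho> by (simp add: monom_at_def)
    qed
  qed (use gn t1 order_trans in auto)
  also have "\<dots> \<le> \<eta>"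
  proof -
    have "t / \<rho> \<le> \<eta> / (norm e + 1)" using t \<rho> by (simp add: pos_divide_le_eq mult.commute)
    then have "t / \<rho> * (norm e + 1) \<le> \<eta>" using ne by (simp add: pos_le_divide_eq)
    moreover have "t / \<rho> * norm e \<le> t / \<rho> * (norm e + 1)" using t \<rho> by (intro mult_left_mono) auto
    ultimately show ?thesis by linarith
  qed
  finally have n: "norm (sb ?g e - sb (\<lambda>i. 0) e) \<le> \<eta>" .
  have f0: "sb (\<lambda>i. z \<bullet> i / t) (sb (\<lambda>i. 0) e) = f p" if "\<forall>i\<in>Basis. \<bar>z \<bullet> i\<bar> \<le> t" for z
  proof -
    have "sb (\<lambda>i. z \<bullet> i / t) (sb (\<lambda>i. 0) e) = sb (\<lambda>i. sb (\<lambda>i. z \<bullet> i / t) 0) e"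
      by (rule sb_sb) (use that t in auto)
    also have "\<dots> = sb (\<lambda>i. (0 \<bullet> i) / \<rho>) e" by (simp add: sb_def zero_l1.rep_eq)
    also have "\<dots> = f (p + 0)"
      using assms(1)[unfolded power_series_rep_def, THEN conjunct2, rule_format, of 0] \<rho> by simp
    finally show ?thesis by simp
  qed
  have "power_series_rep (\<lambda>x. f x - f p) p t (sb ?g e - sb (\<lambda>i. 0) e)"
    unfolding power_series_rep_def
  proof (intro conjI allI impI)
    fix z :: 'a assume z: "\<forall>i\<in>Basis. \<bar>z \<bullet> i\<bar> \<le> t"
    then have "f (p + z) = sb (\<lambda>i. z \<bullet> i / t) (sb ?g e)" using rep by (simp add: power_series_rep_def)
    then show "f (p + z) - f p = sb (\<lambda>i. z \<bullet> i / t) (sb ?g e - sb (\<lambda>i. 0) e)"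
      using z t by (subst sb_minus) (auto simp: f0)
  qed (rule t(1))
  then show "\<exists>r. norm r \<le> \<eta> \<and> power_series_rep (\<lambda>x. f x - f p) p t r" using n by blast
qed

text \<open>After subtraction of its value each inner component is shrunk to norm at most the outer
  radius \<rho>, so that the scaled components may be substituted into the outer series.\<close>

theorem real_analytic_at_compose:
  fixes f :: "'b::euclidean_space \<Rightarrow> real" and g :: "'a::euclidean_space \<Rightarrow> 'b"
  assumes f: "real_analytic_at f (g p)" and g: "\<And>i. i \<in> Basis \<Longrightarrow> real_analytic_at (\<lambda>x. g x \<bullet> i) p"
  shows "real_analytic_at (\<lambda>x. f (g x)) p"
proof -
  obtain \<rho> e where fr: "power_series_rep f (g p) \<rho> e" using real_analytic_at_imp_rep[OF f] by blast
  then have \<rho>: "\<rho> > 0" by (simp add: power_series_rep_def)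
  have "\<exists>\<rho>0>0. \<forall>\<rho>1. 0 < \<rho>1 \<longrightarrow> \<rho>1 \<le> \<rho>0 \<longrightarrow> (\<exists>r. norm r \<le> \<rho> \<and> power_series_rep (\<lambda>x. g x \<bullet> i - g p \<bullet> i) p \<rho>1 r)"
    if i: "i \<in> Basis" for i
  proof -
    obtain \<rho>' e' where *: "power_series_rep (\<lambda>x. g x \<bullet> i) p \<rho>' e'" using real_analytic_at_imp_rep[OF g[OF i]] by blast
    obtain \<rho>0 where "\<rho>0 > 0" "\<rho>0 \<le> \<rho>'"
      "\<And>\<rho>1. 0 < \<rho>1 \<Longrightarrow> \<rho>1 \<le> \<rho>0 \<Longrightarrow> \<exists>r. norm r \<le> \<rho> \<and> power_series_rep (\<lambda>x. g x \<bullet> i - g p \<bullet> i) p \<rho>1 r"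
      using power_series_rep_small[OF * \<rho>] by blast
    then show ?thesis by blast
  qed
  then obtain R where R: "\<And>i. i \<in> Basis \<Longrightarrow> R i > 0"
    "\<And>i \<rho>1. i \<in> Basis \<Longrightarrow> 0 < \<rho>1 \<Longrightarrow> \<rho>1 \<le> R i \<Longrightarrow> \<exists>r. norm r \<le> \<rho> \<and> power_series_rep (\<lambda>x. g x \<bullet> i - g p \<bullet> i) p \<rho>1 r"
    by metis
  define t where "t = Min (R ` Basis)"
  have t: "t > 0" "\<And>i. i \<in> Basis \<Longrightarrow> t \<le> R i" using R(1) by (auto simp: t_def)
  obtain r where r: "\<And>i. i \<in> Basis \<Longrightarrow> norm (r i) \<le> \<rho>"
    "\<And>i. i \<in> Basis \<Longrightarrow> power_series_rep (\<lambda>x. g x \<bullet> i - g p \<bullet> i) p t (r i)"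
    using R(2)[OF _ t(1) t(2)] by metis
  have "power_series_rep (\<lambda>x. f (g x)) p t (sb (\<lambda>i. (1 / \<rho>) *\<^sub>R r i) e)"
    unfolding power_series_rep_def
  proof (intro conjI allI impI)
    fix z :: 'a assume z: "\<forall>i\<in>Basis. \<bar>z \<bullet> i\<bar> \<le> t"
    have s: "norm (z \<bullet> i / t) \<le> 1" if "i \<in> Basis" for i using z that t(1) by simp
    have w: "(g (p + z) - g p) \<bullet> i = sb (\<lambda>i. z \<bullet> i / t) (r i)" if "i \<in> Basis" for i
      using r(2)[OF that] z by (simp add: power_series_rep_def inner_diff_left)
    have "\<bar>(g (p + z) - g p) \<bullet> i\<bar> \<le> \<rho>" if "i \<in> Basis" for i
      using w[OF that] norm_sb_le[of "\<lambda>i. z \<bullet> i / t" "r i"] s r(1)[OF that] by simp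
    then have "f (g p + (g (p + z) - g p)) = sb (\<lambda>i. ((g (p + z) - g p) \<bullet> i) / \<rho>) e"
      using fr unfolding power_series_rep_def by blast
    then have "f (g (p + z)) = sb (\<lambda>i. ((g (p + z) - g p) \<bullet> i) / \<rho>) e" by simp
    also have "\<dots> = sb (\<lambda>i. sb (\<lambda>i. z \<bullet> i / t) ((1 / \<rho>) *\<^sub>R r i)) e"
      unfolding sb_def[of _ e] monom_at_def
      by (intro infsum_cong arg_cong2[where f = scaleR] prod.cong refl arg_cong2[where f = power])
        (use w s in \<open>simp add: sb_scaleR\<close>)
    also have "\<dots> = sb (\<lambda>i. z \<bullet> i / t) (sb (\<lambda>i. (1 / \<rho>) *\<^sub>R r i) e)"
      by (rule sb_sb[symmetric]) (use s r(1) \<rho> in auto)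
    finally show "f (g (p + z)) = sb (\<lambda>i. z \<bullet> i / t) (sb (\<lambda>i. (1 / \<rho>) *\<^sub>R r i) e)" .
  qed (rule t(1))
  then show ?thesis by (rule rep_imp_real_analytic_at)
qed

section \<open>Algebra of analytic functions, and analytic maps\<close>

lemma real_analytic_at_cong:
  assumes "\<forall>\<^sub>F x in nhds p. f x = g x"
  shows "real_analytic_at f p \<longleftrightarrow> real_analytic_at g p"
proof -
  have "real_analytic_at g p" if "real_analytic_at f p" "\<forall>\<^sub>F x in nhds p. f x = g x" for f g :: "'a \<Rightarrow> real"
  proof -
    from that(1) obtain c where
      "\<forall>\<^sub>F x in nhds p. ((\<lambda>\<alpha>. c \<alpha> * (\<Prod>i\<in>Basis. ((x - p) \<bullet> i) ^ \<alpha> i)) has_sum f x) (Basis \<rightarrow>\<^sub>E UNIV)"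
      unfolding real_analytic_at_def by blast
    then have "\<forall>\<^sub>F x in nhds p. ((\<lambda>\<alpha>. c \<alpha> * (\<Prod>i\<in>Basis. ((x - p) \<bullet> i) ^ \<alpha> i)) has_sum g x) (Basis \<rightarrow>\<^sub>E UNIV)"
      using that(2) by eventually_elim simp
    then show ?thesis unfolding real_analytic_at_def by blast
  qed
  note this[of f g] this[of g f]
  moreover have "\<forall>\<^sub>F x in nhds p. g x = f x" using assms by eventually_elim simp
  ultimately show ?thesis using assms by blast
qed

lemma power_series_rep_shrink:
  fixes f :: "'a::euclidean_space \<Rightarrow> real"
  assumes "power_series_rep f p \<rho> e" "0 < t" "t \<le> \<rho>"
  shows "\<exists>e'. power_series_rep f p t e'"
  using power_series_rep_recenter[OF assms(1,2), of 0] assms(3) by auto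

lemma real_analytic_at_rep2:
  fixes f g :: "'a::euclidean_space \<Rightarrow> real"
  assumes "real_analytic_at f p" "real_analytic_at g p"
  obtains \<rho> a b where "power_series_rep f p \<rho> a" "power_series_rep g p \<rho> b"
proof -
  obtain s a where a: "power_series_rep f p s a" using real_analytic_at_imp_rep[OF assms(1)] by blast
  obtain t b where b: "power_series_rep g p t b" using real_analytic_at_imp_rep[OF assms(2)] by blast
  have "0 < min s t" using a b by (simp add: power_series_rep_def)
  then show ?thesis
    using power_series_rep_shrink[OF a, of "min s t"] power_series_rep_shrink[OF b, of "min s t"] that by auto
qed

lemma real_analytic_at_add:
  fixes f g :: "'a::euclidean_space \<Rightarrow> real"
  assumes "real_analytic_at f p" "real_analytic_at g p"
  shows "real_analytic_at (\<lambda>x. f x + g x) p"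
proof -
  obtain \<rho> a b where r: "power_series_rep f p \<rho> a" "power_series_rep g p \<rho> b"
    using real_analytic_at_rep2[OF assms] .
  then have "power_series_rep (\<lambda>x. f x + g x) p \<rho> (a + b)"
    unfolding power_series_rep_def by (auto simp: sb_add)
  then show ?thesis by (rule rep_imp_real_analytic_at)
qed

lemma real_analytic_at_mult:
  fixes f g :: "'a::euclidean_space \<Rightarrow> real"
  assumes "real_analytic_at f p" "real_analytic_at g p"
  shows "real_analytic_at (\<lambda>x. f x * g x) p"
proof -
  obtain \<rho> a b where r: "power_series_rep f p \<rho> a" "power_series_rep g p \<rho> b"
    using real_analytic_at_rep2[OF assms] .
  then have "power_series_rep (\<lambda>x. f x * g x) p \<rho> (a * b)"
    unfolding power_series_rep_def by (auto simp: sb_mult)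
  then show ?thesis by (rule rep_imp_real_analytic_at)
qed

lemma real_analytic_at_const: "real_analytic_at (\<lambda>x. c) p"
proof (rule rep_imp_real_analytic_at)
  show "power_series_rep (\<lambda>x. c) p 1 (c *\<^sub>R 1)"
    unfolding power_series_rep_def by (auto simp: sb_scaleR)
qed

lemma real_analytic_at_inner:
  assumes "i \<in> Basis"
  shows "real_analytic_at (\<lambda>x. x \<bullet> i) p"
proof (rule rep_imp_real_analytic_at)
  show "power_series_rep (\<lambda>x. x \<bullet> i) p 1 ((p \<bullet> i) *\<^sub>R 1 + gen i)"
    unfolding power_series_rep_def using assms by (auto simp: sb_add sb_scaleR sb_gen inner_add_left)
qed

lemma real_analytic_at_minus:
  fixes f :: "'a::euclidean_space \<Rightarrow> real"
  assumes "real_analytic_at f p"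
  shows "real_analytic_at (\<lambda>x. - f x) p"
  using real_analytic_at_mult[OF real_analytic_at_const[of "-1"] assms] by simp

lemma real_analytic_at_diff:
  fixes f g :: "'a::euclidean_space \<Rightarrow> real"
  assumes "real_analytic_at f p" "real_analytic_at g p"
  shows "real_analytic_at (\<lambda>x. f x - g x) p"
  using real_analytic_at_add[OF assms(1) real_analytic_at_minus[OF assms(2)]] by simp

lemma real_analytic_at_power:
  fixes f :: "'a::euclidean_space \<Rightarrow> real"
  assumes "real_analytic_at f p"
  shows "real_analytic_at (\<lambda>x. f x ^ k) p"
  by (induction k) (auto intro: real_analytic_at_mult assms real_analytic_at_const)

lemma real_analytic_at_sum:
  fixes f :: "'i \<Rightarrow> 'a::euclidean_space \<Rightarrow> real"
  assumes "\<And>i. i \<in> A \<Longrightarrow> real_analytic_at (f i) p"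
  shows "real_analytic_at (\<lambda>x. \<Sum>i\<in>A. f i x) p"
  using assms by (induction A rule: infinite_finite_induct)
    (auto intro: real_analytic_at_add real_analytic_at_const)

definition analytic_map_at :: "('a::euclidean_space \<Rightarrow> 'b::euclidean_space) \<Rightarrow> 'a \<Rightarrow> bool" where
  "analytic_map_at g p \<longleftrightarrow> (\<forall>i\<in>Basis. real_analytic_at (\<lambda>x. g x \<bullet> i) p)"

lemma analytic_map_at_real: "analytic_map_at f p \<longleftrightarrow> real_analytic_at f p"
  by (simp add: analytic_map_at_def)

lemma real_analytic_at_comp:
  assumes "real_analytic_at f (g p)" "analytic_map_at g p"
  shows "real_analytic_at (\<lambda>x. f (g x)) p"
  using assms real_analytic_at_compose[of f g p] by (auto simp: analytic_map_at_def)

lemma analytic_map_at_comp: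
  assumes "analytic_map_at f (g p)" "analytic_map_at g p"
  shows "analytic_map_at (\<lambda>x. f (g x)) p"
  using assms real_analytic_at_comp unfolding analytic_map_at_def[of f] analytic_map_at_def[of "\<lambda>x. f (g x)"]
  by blast

lemma analytic_map_at_Pair:
  assumes "analytic_map_at f p" "analytic_map_at g p"
  shows "analytic_map_at (\<lambda>x. (f x, g x)) p"
  using assms unfolding analytic_map_at_def by (auto simp: Basis_prod_def inner_Pair)

lemma analytic_map_at_id: "analytic_map_at (\<lambda>x. x) p"
  by (simp add: analytic_map_at_def real_analytic_at_inner)

lemma analytic_map_at_const: "analytic_map_at (\<lambda>x. c) p"
  by (simp add: analytic_map_at_def real_analytic_at_const)

lemma analytic_map_at_fst: "analytic_map_at fst p"
proof -
  have "real_analytic_at (\<lambda>x. x \<bullet> (i, 0)) p" if "i \<in> Basis" for i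
    by (rule real_analytic_at_inner) (use that in \<open>simp add: Basis_prod_def\<close>)
  then show ?thesis by (simp add: analytic_map_at_def inner_prod_def)
qed

lemma analytic_map_at_snd: "analytic_map_at snd p"
proof -
  have "real_analytic_at (\<lambda>x. x \<bullet> (0, i)) p" if "i \<in> Basis" for i
    by (rule real_analytic_at_inner) (use that in \<open>simp add: Basis_prod_def\<close>)
  then show ?thesis by (simp add: analytic_map_at_def inner_prod_def)
qed

lemma analytic_map_at_fst': "analytic_map_at f p \<Longrightarrow> analytic_map_at (\<lambda>x. fst (f x)) p"
  by (rule analytic_map_at_comp[OF analytic_map_at_fst])

lemma analytic_map_at_snd': "analytic_map_at f p \<Longrightarrow> analytic_map_at (\<lambda>x. snd (f x)) p"
  by (rule analytic_map_at_comp[OF analytic_map_at_snd])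

lemma analytic_map_at_realI: "real_analytic_at f p \<Longrightarrow> analytic_map_at f p"
  by (simp add: analytic_map_at_real)

lemma real_analytic_at_realD: "analytic_map_at f p \<Longrightarrow> real_analytic_at f p"
  by (simp add: analytic_map_at_real)

lemma analytic_map_at_add:
  "analytic_map_at f p \<Longrightarrow> analytic_map_at g p \<Longrightarrow> analytic_map_at (\<lambda>x. f x + g x) p"
  by (simp add: analytic_map_at_def inner_add_left real_analytic_at_add)

lemma analytic_map_at_scaleR:
  "real_analytic_at f p \<Longrightarrow> analytic_map_at g p \<Longrightarrow> analytic_map_at (\<lambda>x. f x *\<^sub>R g x) p"
  by (simp add: analytic_map_at_def real_analytic_at_mult)

text \<open>The remainder after the constant and linear terms is estimated term by term: each
  remaining monomial has degree at least 2 and is bounded by the square of norm z / \<rho>.\<close>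

lemma has_derivative_if_power_series_rep:
  fixes f :: "'a::euclidean_space \<Rightarrow> real"
  assumes "power_series_rep f p \<rho> e"
  obtains f' where "(f has_derivative f') (at p)"
proof -
  have \<rho>: "\<rho> > 0" and rep: "\<And>z. \<forall>i\<in>Basis. \<bar>z \<bullet> i\<bar> \<le> \<rho> \<Longrightarrow> f (p + z) = sb (\<lambda>i. (z \<bullet> i) / \<rho>) e"
    using assms by (auto simp: power_series_rep_def)
  \<comment> \<open>The indicator of the exponents equal to the unit vector at i; pairing with it
    extracts the linear coefficient.\<close>
  define W :: "'a \<Rightarrow> ('a \<Rightarrow> nat) \<Rightarrow> real" where "W = (\<lambda>i \<alpha>. if \<forall>j\<in>Basis. \<alpha> j = (if j = i then 1 else 0 :: nat) then 1 else 0)"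
  define L where "L = (\<lambda>z :: 'a. \<Sum>i\<in>Basis. (z \<bullet> i) / \<rho> * l1_pair (W i) e)"
  have bl: "bounded_linear L"
    unfolding L_def by (intro bounded_linear_sum bounded_linear_mult_const
        bounded_linear_compose[OF bounded_linear_divide] bounded_linear_inner_left)
  have est: "\<bar>f (p + z) - f p - L z\<bar> \<le> norm e / \<rho>\<^sup>2 * (norm z)\<^sup>2" if z: "norm z \<le> \<rho>" for z :: 'a
  proof -
    define t where "t = norm z / \<rho>"
    have t: "0 \<le> t" "t \<le> 1" using z \<rho> by (auto simp: t_def)
    define g where "g = (\<lambda>i. (z \<bullet> i) / \<rho>)"
    have g: "\<bar>g i\<bar> \<le> t" if "i \<in> Basis" for i
      using Basis_le_norm[OF that, of z] \<rho> by (simp add: g_def t_def divide_right_mono)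
    have g1: "norm (g i) \<le> 1" if "i \<in> Basis" for i using g[OF that] t by simp
    \<comment> \<open>The weight whose pairing with e is the Taylor remainder of first
      order.\<close>
    define w where "w = (\<lambda>\<alpha>. monom_at g \<alpha> + (- 1) * monom_at (\<lambda>i. 0) \<alpha> + (\<Sum>i\<in>Basis. (- g i) * W i \<alpha>))"
    have w: "\<bar>w \<alpha>\<bar> \<le> t\<^sup>2" for \<alpha>
    proof (cases "\<exists>i\<in>Basis. \<alpha> i \<noteq> 0")
      case False
      then have "W i \<alpha> = 0" if "i \<in> Basis" for i using that by (auto simp: W_def)
      then have "w \<alpha> = 0" using False by (simp add: w_def monom_at_def)
      then show ?thesis by simp
    next
      case True
      then obtain i where i: "i \<in> Basis" "\<alpha> i \<noteq> 0" by blast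
      have m0: "monom_at (\<lambda>i. 0 :: real) \<alpha> = 0"
        unfolding monom_at_def by (intro prod_zero bexI[of _ i]) (use i in auto)
      show ?thesis
      proof (cases "W i \<alpha> = 0")
        case False
        then have *: "\<And>j. j \<in> Basis \<Longrightarrow> \<alpha> j = (if j = i then 1 else 0)" by (auto simp: W_def split: if_splits)
        have "W j \<alpha> = (if j = i then 1 else 0)" if "j \<in> Basis" for j
          using * i(1) that by (auto simp: W_def)
        then have "(\<Sum>j\<in>Basis. (- g j) * W j \<alpha>) = (\<Sum>j\<in>Basis. if j = i then - g i else 0)"
          by (intro sum.cong) auto
        then have s: "(\<Sum>j\<in>Basis. (- g j) * W j \<alpha>) = - g i" using i(1) by simp
        have "monom_at g \<alpha> = (\<Prod>j\<in>Basis. if j = i then g i else 1)"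
          unfolding monom_at_def by (intro prod.cong) (auto simp: *)
        then have "monom_at g \<alpha> = g i" using i(1) by simp
        then have "w \<alpha> = 0" using s m0 by (simp add: w_def)
        then show ?thesis by simp
      next
        case True
        have "W j \<alpha> = 0" if "j \<in> Basis" for j
        proof (cases "j = i")
          case False
          then show ?thesis using i by (auto simp: W_def)
        qed (use True in simp)
        then have weq: "w \<alpha> = monom_at g \<alpha>" using m0 by (simp add: w_def)
        have "\<exists>j\<in>Basis. \<alpha> j \<noteq> (if j = i then 1 else 0)" using True by (auto simp: W_def split: if_splits)
        then obtain j where j: "j \<in> Basis" "\<alpha> j \<noteq> (if j = i then 1 else 0)" by blast
        \<comment> \<open>One factor g i is split off; the exponent left over is still nonzero and
          supplies the second factor t.\<close>
        define \<beta> where "\<beta> = \<alpha>(i := \<alpha> i - 1)"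
        have "monom_at g \<alpha> = g i ^ \<alpha> i * (\<Prod>k\<in>Basis - {i}. g k ^ \<alpha> k)"
          unfolding monom_at_def using i by (simp add: prod.remove)
        also have "\<dots> = g i * (g i ^ \<beta> i * (\<Prod>k\<in>Basis - {i}. g k ^ \<beta> k))"
          using i(2) by (simp add: \<beta>_def power_eq_if)
        also have "\<dots> = g i * monom_at g \<beta>"
          unfolding monom_at_def using i by (simp add: prod.remove)
        finally have "\<bar>monom_at g \<alpha>\<bar> = \<bar>g i\<bar> * \<bar>monom_at g \<beta>\<bar>" by (simp add: abs_mult)
        also have "\<dots> \<le> t * t"
        proof (rule mult_mono[OF g[OF i(1)]])
          have "\<beta> j \<noteq> 0" using i j by (auto simp: \<beta>_def split: if_splits)
          then show "\<bar>monom_at g \<beta>\<bar> \<le> t" using norm_monom_at_le[of g t j \<beta>] g t j(1) by simp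
        qed (use t in auto)
        finally show ?thesis using weq by (simp add: power2_eq_square)
      qed
    qed
    have f: "f (p + z) = l1_pair (monom_at g) e"
      using rep[of z] Basis_le_norm[of _ z] z by (force simp: g_def sb_eq_l1_pair)
    have f0: "f p = l1_pair (monom_at (\<lambda>i. 0)) e"
      using rep[of 0] \<rho> by (simp add: sb_eq_l1_pair)
    have b1: "\<bar>monom_at g \<alpha>\<bar> \<le> 1" for \<alpha> using norm_monom_at_le_one[of g \<alpha>] g1 by simp
    have b2: "\<bar>monom_at (\<lambda>i :: 'a. 0 :: real) \<alpha>\<bar> \<le> 1" for \<alpha> using norm_monom_at_le_one[of "\<lambda>i :: 'a. 0 :: real" \<alpha>] by simp
    have sumw: "l1_pair (\<lambda>\<alpha>. \<Sum>i\<in>A. (- g i) * W i \<alpha>) e = (\<Sum>i\<in>A. (- g i) * l1_pair (W i) e)"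
      if "finite A" for A
      using that
    proof (induction A)
      case empty then show ?case by (simp add: l1_pair_def)
    next
      case (insert x A)
      have c1: "\<bar>(- g x) * W x \<alpha>\<bar> \<le> \<bar>g x\<bar>" for \<alpha> by (simp add: W_def)
      have c2: "\<bar>\<Sum>i\<in>A. (- g i) * W i \<alpha>\<bar> \<le> (\<Sum>i\<in>A. \<bar>g i\<bar>)" for \<alpha>
        by (rule order_trans[OF sum_abs sum_mono]) (simp add: W_def)
      show ?case
        using insert l1_pair_weight_add[OF c1 c2, where a = e] l1_pair_weight_cmult[of "- g x" "W x" e] by simp
    qed
    have c3: "\<bar>(- 1) * monom_at (\<lambda>i :: 'a. 0 :: real) \<alpha>\<bar> \<le> 1" for \<alpha> using b2 by simp
    have c4: "\<bar>monom_at g \<alpha> + (- 1) * monom_at (\<lambda>i :: 'a. 0 :: real) \<alpha>\<bar> \<le> 2" for \<alpha>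
      using b1[of \<alpha>] b2[of \<alpha>] by linarith
    have c5: "\<bar>\<Sum>i\<in>Basis. (- g i) * W i \<alpha>\<bar> \<le> (\<Sum>i\<in>Basis. \<bar>g i\<bar>)" for \<alpha>
      by (rule order_trans[OF sum_abs sum_mono]) (simp add: W_def)
    have "l1_pair w e = f (p + z) - f p - L z"
      unfolding w_def l1_pair_weight_add[OF c4 c5] l1_pair_weight_add[OF b1 c3] l1_pair_weight_cmult
        sumw[OF finite_Basis] f f0 L_def
      by (simp add: g_def sum_negf)
    then have "\<bar>f (p + z) - f p - L z\<bar> \<le> t\<^sup>2 * norm e"
      using l1_pair_bounded[of w "t\<^sup>2" e] w by simp
    then show ?thesis by (simp add: t_def power_divide mult.commute)
  qed
  have "(f has_derivative L) (at p)"
    unfolding has_derivative_at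
  proof (intro conjI bl)
    define C where "C = norm e / \<rho>\<^sup>2"
    have "((\<lambda>h :: 'a. C * norm h) \<longlongrightarrow> 0) (at 0)"
      using tendsto_mult_right_zero[OF tendsto_norm_zero[OF tendsto_ident_at[of 0 UNIV]], of C] by simp
    then show "(\<lambda>h. norm (f (p + h) - f p - L h) / norm h) \<midarrow>0\<rightarrow> 0"
    proof (rule Lim_null_comparison[rotated])
      have "\<forall>\<^sub>F h in at 0. norm h < \<rho>"
        unfolding eventually_at using \<rho> by auto
      then show "\<forall>\<^sub>F h in at 0. norm (norm (f (p + h) - f p - L h) / norm h) \<le> C * norm h"
        using eventually_neq_at_within[of 0]
      proof eventually_elim
        case (elim h)
        then show ?case using est[of h]
          by (simp add: C_def pos_divide_le_eq power2_eq_square mult.assoc)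
      qed
    qed
  qed
  then show ?thesis by (rule that)
qed

lemma real_analytic_at_differentiable: "real_analytic_at f p \<Longrightarrow> f differentiable (at p)"
  using has_derivative_if_power_series_rep real_analytic_at_imp_rep unfolding differentiable_def by metis

lemma real_analytic_at_isCont: "real_analytic_at f p \<Longrightarrow> isCont f p"
  using real_analytic_at_differentiable differentiable_imp_continuous_within by blast

text \<open>Deletes the terms without the variable i and divides the others by it.\<close>

lift_definition l1_shift :: "'a \<Rightarrow> ('a \<Rightarrow> nat) l1 \<Rightarrow> ('a \<Rightarrow> nat) l1" is
  "\<lambda>i e \<alpha>. e (\<alpha>(i := Suc (\<alpha> i)))"
proof -
  fix i :: 'a and e :: "('a \<Rightarrow> nat) \<Rightarrow> real" assume e: "e summable_on UNIV"
  have "inj (\<lambda>\<alpha> :: 'a \<Rightarrow> nat. \<alpha>(i := Suc (\<alpha> i)))"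
    by (rule inj_on_inverseI[where g = "\<lambda>\<alpha>. \<alpha>(i := \<alpha> i - 1)"]) simp
  moreover have "e summable_on range (\<lambda>\<alpha>. \<alpha>(i := Suc (\<alpha> i)))"
    using e summable_on_subset_banach by blast
  ultimately show "(\<lambda>\<alpha>. e (\<alpha>(i := Suc (\<alpha> i)))) summable_on UNIV"
    using summable_on_reindex[of "\<lambda>\<alpha>. \<alpha>(i := Suc (\<alpha> i))" UNIV e] by (simp add: o_def)
qed

lemma monom_at_upd:
  assumes "i \<in> Basis"
  shows "monom_at g (\<alpha>(i := k)) = g i ^ k * (\<Prod>j\<in>Basis - {i}. g j ^ \<alpha> j)"
proof -
  have "monom_at g (\<alpha>(i := k)) = g i ^ k * (\<Prod>j\<in>Basis - {i}. g j ^ (\<alpha>(i := k)) j)"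
    unfolding monom_at_def using assms by (subst prod.remove[of _ i]) auto
  also have "(\<Prod>j\<in>Basis - {i}. g j ^ (\<alpha>(i := k)) j) = (\<Prod>j\<in>Basis - {i}. g j ^ \<alpha> j)"
    by (rule prod.cong) auto
  finally show ?thesis .
qed

lemma monom_at_remove:
  assumes "i \<in> Basis"
  shows "monom_at g \<alpha> = g i ^ \<alpha> i * (\<Prod>j\<in>Basis - {i}. g j ^ \<alpha> j)"
  using monom_at_upd[OF assms, of g \<alpha> "\<alpha> i"] by simp

text \<open>The exponents are split by whether the variable i occurs; setting it to 0 keeps exactly
  the first group.\<close>

lemma sb_shift:
  fixes g :: "'b::euclidean_space \<Rightarrow> real"
  assumes i: "i \<in> Basis" and g: "\<And>j. j \<in> Basis \<Longrightarrow> \<bar>g j\<bar> \<le> 1"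
  shows "sb g e = sb (g(i := 0)) e + g i * sb g (l1_shift i e)"
proof -
  let ?up = "\<lambda>\<alpha> :: 'b \<Rightarrow> nat. \<alpha>(i := Suc (\<alpha> i))"
  let ?F = "\<lambda>\<alpha>. l1_coeff e \<alpha> * monom_at g \<alpha>"
  have bij: "bij_betw ?up UNIV {\<alpha>. \<alpha> i \<noteq> 0}"
    by (rule bij_betw_byWitness[where f' = "\<lambda>\<alpha>. \<alpha>(i := \<alpha> i - 1)"]) (auto simp: fun_eq_iff)
  have m: "monom_at g (?up \<alpha>) = g i * monom_at g \<alpha>" for \<alpha>
    using monom_at_upd[OF i, of g \<alpha> "Suc (\<alpha> i)"] monom_at_remove[OF i, of g \<alpha>] by simp
  have "((\<lambda>\<alpha>. l1_coeff (l1_shift i e) \<alpha> * monom_at g \<alpha>) has_sum sb g (l1_shift i e)) UNIV"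
    using sb_has_sum[of g "l1_shift i e"] g by simp
  then have "((\<lambda>\<alpha>. ?F (?up \<alpha>)) has_sum g i * sb g (l1_shift i e)) UNIV"
    using has_sum_cmult_right[of "\<lambda>\<alpha>. l1_coeff (l1_shift i e) \<alpha> * monom_at g \<alpha>" UNIV _ "g i"]
    by (simp add: l1_shift.rep_eq m mult.left_commute)
  then have A: "(?F has_sum g i * sb g (l1_shift i e)) {\<alpha>. \<alpha> i \<noteq> 0}"
    using has_sum_reindex_bij_betw[OF bij, of ?F] by simp
  have "((\<lambda>\<alpha>. l1_coeff e \<alpha> * monom_at (g(i := 0)) \<alpha>) has_sum sb (g(i := 0)) e) UNIV"
    using sb_has_sum[of "g(i := 0)" e] g by simp
  also have "?this \<longleftrightarrow> (?F has_sum sb (g(i := 0)) e) {\<alpha>. \<alpha> i = 0}"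
  proof (rule has_sum_cong_neutral)
    fix \<alpha> assume "\<alpha> \<in> UNIV - {\<alpha> :: 'b \<Rightarrow> nat. \<alpha> i = 0}"
    then show "l1_coeff e \<alpha> * monom_at (g(i := 0)) \<alpha> = 0" by (simp add: monom_at_remove[OF i])
  next
    fix \<alpha> assume "\<alpha> \<in> UNIV \<inter> {\<alpha> :: 'b \<Rightarrow> nat. \<alpha> i = 0}"
    then have "monom_at (g(i := 0)) \<alpha> = monom_at g \<alpha>"
      by (auto simp: monom_at_remove[OF i] intro!: prod.cong)
    then show "l1_coeff e \<alpha> * monom_at (g(i := 0)) \<alpha> = l1_coeff e \<alpha> * monom_at g \<alpha>" by simp
  qed auto
  finally have B: "(?F has_sum sb (g(i := 0)) e) {\<alpha>. \<alpha> i = 0}" .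
  have "{\<alpha> :: 'b \<Rightarrow> nat. \<alpha> i = 0} \<union> {\<alpha>. \<alpha> i \<noteq> 0} = UNIV"
    "{\<alpha> :: 'b \<Rightarrow> nat. \<alpha> i = 0} \<inter> {\<alpha>. \<alpha> i \<noteq> 0} = {}" by auto
  then have "(?F has_sum sb (g(i := 0)) e + g i * sb g (l1_shift i e)) UNIV"
    using has_sum_Un_disjoint[OF B A] by metis
  then show ?thesis by (simp add: sb_def[of g e] infsumI)
qed

text \<open>Division in the manner of Hadamard, with a quotient analytic jointly in the variable and
  the parameter.\<close>

lemma real_analytic_at_divided:
  fixes f :: "real \<times> 'd::euclidean_space \<Rightarrow> real"
  assumes "real_analytic_at f (0, q)"
  obtains f1 where "real_analytic_at f1 (0, q)"
    "\<forall>\<^sub>F (x, w) in nhds (0, q). f (x, w) = f (0, w) + x * f1 (x, w)"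
proof -
  obtain \<rho> e where rep: "power_series_rep f (0, q) \<rho> e" using real_analytic_at_imp_rep[OF assms] .
  then have \<rho>: "\<rho> > 0" by (simp add: power_series_rep_def)
  let ?i = "(1, 0) :: real \<times> 'd"
  have i: "?i \<in> Basis" by (simp add: Basis_prod_def)
  define f1 where "f1 = (\<lambda>y. sb (\<lambda>i. ((y - (0, q)) \<bullet> i) / \<rho>) ((1 / \<rho>) *\<^sub>R l1_shift ?i e))"
  have "power_series_rep f1 (0, q) \<rho> ((1 / \<rho>) *\<^sub>R l1_shift ?i e)"
    using \<rho> by (auto simp: power_series_rep_def f1_def)
  then have a: "real_analytic_at f1 (0, q)" by (rule rep_imp_real_analytic_at)
  have "f (x, w) = f (0, w) + x * f1 (x, w)" if "dist (x, w) (0, q) < \<rho>" for x w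
  proof -
    define z where "z = (x, w) - (0, q)"
    have nz: "norm z < \<rho>" using that by (simp add: z_def dist_norm)
    have zi: "\<forall>i\<in>Basis. \<bar>z \<bullet> i\<bar> \<le> \<rho>" using Basis_le_norm[of _ z] nz by force
    have z0: "\<forall>i\<in>Basis. \<bar>(z - x *\<^sub>R ?i) \<bullet> i\<bar> \<le> \<rho>"
      using zi \<rho> by (auto simp: Basis_prod_def z_def inner_Pair)
    let ?g = "\<lambda>i. (z \<bullet> i) / \<rho>"
    have g: "\<bar>?g i\<bar> \<le> 1" if "i \<in> Basis" for i using zi that \<rho> by simp
    have "f ((0, q) + z) = sb ?g e"
      using rep[unfolded power_series_rep_def, THEN conjunct2, rule_format, of z] zi by blast
    then have "f (x, w) = sb ?g e" by (simp add: z_def)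
    also have "\<dots> = sb (?g(?i := 0)) e + ?g ?i * sb ?g (l1_shift ?i e)"
      by (rule sb_shift[OF i g])
    also have "sb (?g(?i := 0)) e = sb (\<lambda>i. ((z - x *\<^sub>R ?i) \<bullet> i) / \<rho>) e"
      unfolding sb_def monom_at_def
      by (intro infsum_cong arg_cong2[where f = scaleR] prod.cong refl arg_cong2[where f = power])
        (auto simp: Basis_prod_def z_def inner_Pair)
    also have "\<dots> = f ((0, q) + (z - x *\<^sub>R ?i))"
      using rep[unfolded power_series_rep_def, THEN conjunct2, rule_format, of "z - x *\<^sub>R ?i"] z0 by metis
    also have "(0, q) + (z - x *\<^sub>R ?i) = (0, w)" by (simp add: z_def)
    also have "?g ?i * sb ?g (l1_shift ?i e) = x * f1 (x, w)"
      unfolding f1_def using g \<rho> by (subst sb_scaleR) (auto simp: z_def inner_Pair)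
    finally show ?thesis .
  qed
  then have "\<forall>\<^sub>F (x, w) in nhds (0, q). f (x, w) = f (0, w) + x * f1 (x, w)"
    unfolding eventually_nhds_metric using \<rho> by auto
  with a show ?thesis by (rule that)
qed

section \<open>Power series in one variable and elementary functions\<close>

lemma bij_betw_PiE_real: "bij_betw (\<lambda>k. restrict (\<lambda>_. k) {1 :: real}) UNIV ((Basis :: real set) \<rightarrow>\<^sub>E (UNIV :: nat set))"
  by (rule bij_betw_byWitness[where f' = "\<lambda>\<alpha>. \<alpha> 1"])
    (auto simp: fun_eq_iff restrict_def PiE_def extensional_def)

lemma real_analytic_at_powser:
  fixes f :: "real \<Rightarrow> real"
  assumes "R > 0" and sums: "\<And>z. \<bar>z\<bar> < R \<Longrightarrow> (\<lambda>k. a k * z ^ k) sums f (p + z)"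
  shows "real_analytic_at f p"
proof -
  have "((\<lambda>\<alpha>. a (\<alpha> 1) * (\<Prod>i\<in>Basis. ((x - p) \<bullet> i) ^ \<alpha> i)) has_sum f x) (Basis \<rightarrow>\<^sub>E UNIV)"
    if x: "dist x p < R" for x
  proof -
    define z where "z = x - p"
    have z: "\<bar>z\<bar> < R" using x by (simp add: z_def dist_real_def)
    \<comment> \<open>\<open>sums\<close> may be conditional; convergence at a point of larger
      modulus makes the series at z absolutely convergent.\<close>
    define K where "K = (\<bar>z\<bar> + R) / 2"
    have K: "\<bar>z\<bar> < K" "0 < K" "\<bar>K\<bar> < R" using z by (auto simp: K_def)
    have "summable (\<lambda>k. norm (a k * z ^ k))"
      by (rule powser_insidea[of a K]) (use sums[OF K(3)] K(1,2) in \<open>auto simp: sums_iff\<close>)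
    then have "((\<lambda>k. a k * z ^ k) has_sum f (p + z)) UNIV"
      using norm_summable_imp_has_sum[OF _ sums[OF z]] by simp
    then show ?thesis
      using has_sum_reindex_bij_betw[OF bij_betw_PiE_real,
          of "\<lambda>\<alpha>. a (\<alpha> 1) * (\<Prod>i\<in>Basis. ((x - p) \<bullet> i) ^ \<alpha> i)" "f x"]
      by (simp add: z_def)
  qed
  then show ?thesis
    unfolding real_analytic_at_def eventually_nhds_metric using assms(1)
    by (intro exI[of _ "\<lambda>\<alpha>. a (\<alpha> 1)"] exI[of _ R]) auto
qed

lemma real_analytic_at_imp_fps:
  fixes f :: "real \<Rightarrow> real"
  assumes "real_analytic_at f 0"
  obtains c where "f has_fps_expansion c"
proof -
  obtain c where c: "\<forall>\<^sub>F x in nhds 0. ((\<lambda>\<alpha>. c \<alpha> * (\<Prod>i\<in>Basis. ((x - 0) \<bullet> i) ^ \<alpha> i)) has_sum f x) (Basis \<rightarrow>\<^sub>E UNIV)"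
    using assms unfolding real_analytic_at_def by blast
  have "\<forall>\<^sub>F u in nhds 0. (\<lambda>n. fps_nth (Abs_fps (\<lambda>k. c (restrict (\<lambda>_. k) {1}))) n * u ^ n) sums f u"
    using c
  proof eventually_elim
    case (elim u)
    then have "((\<lambda>k. c (restrict (\<lambda>_. k) {1}) * u ^ k) has_sum f u) UNIV"
      using has_sum_reindex_bij_betw[OF bij_betw_PiE_real,
          of "\<lambda>\<alpha>. c \<alpha> * (\<Prod>i\<in>Basis. ((u - 0) \<bullet> i) ^ \<alpha> i)" "f u"] by simp
    then show ?case using has_sum_imp_sums by simp
  qed
  then show ?thesis using has_fps_expansionI that by blast
qed

lemma real_analytic_at_inverse_real:
  fixes c :: real
  assumes "c \<noteq> 0"
  shows "real_analytic_at inverse c"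
proof (rule real_analytic_at_powser[of "\<bar>c\<bar>"])
  fix z :: real assume z: "\<bar>z\<bar> < \<bar>c\<bar>"
  then have "\<bar>- z / c\<bar> < 1" using assms by simp
  then have "(\<lambda>k. inverse c * (- z / c) ^ k) sums (inverse c * (1 / (1 - (- z / c))))"
    by (intro sums_mult geometric_sums) simp
  moreover have "c + z \<noteq> 0" using z by auto
  then have "inverse c * (1 / (1 - (- z / c))) = inverse (c + z)" using assms by (simp add: field_simps)
  moreover have "(- z / c) ^ k = (- 1 / c) ^ k * z ^ k" for k
    unfolding power_mult_distrib[symmetric] by (rule arg_cong[where f = "\<lambda>x. x ^ k"]) simp
  ultimately show "(\<lambda>k. inverse c * (- 1 / c) ^ k * z ^ k) sums inverse (c + z)" by (simp add: mult.assoc)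
qed (use assms in auto)

lemma real_analytic_at_inverse:
  assumes "real_analytic_at f p" "f p \<noteq> 0"
  shows "real_analytic_at (\<lambda>x. inverse (f x)) p"
  using real_analytic_at_comp[of inverse f p] real_analytic_at_inverse_real assms analytic_map_at_realI by blast

lemma real_analytic_at_divide:
  assumes "real_analytic_at f p" "real_analytic_at g p" "g p \<noteq> 0"
  shows "real_analytic_at (\<lambda>x. f x / g x) p"
  unfolding divide_inverse by (intro real_analytic_at_mult real_analytic_at_inverse assms)

lemma real_analytic_at_sin_real: "real_analytic_at sin (c :: real)"
  and real_analytic_at_cos_real: "real_analytic_at cos (c :: real)"
proof -
  have s0: "real_analytic_at sin (0 :: real)"
    by (rule real_analytic_at_powser[of 1 sin_coeff]) (use sin_converges[where 'a = real] in auto)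
  have c0: "real_analytic_at cos (0 :: real)"
    by (rule real_analytic_at_powser[of 1 cos_coeff]) (use cos_converges[where 'a = real] in auto)
  have d: "analytic_map_at (\<lambda>x. x - c) c"
    by (intro analytic_map_at_realI real_analytic_at_diff real_analytic_at_const real_analytic_at_realD[OF analytic_map_at_id])
  have s: "real_analytic_at (\<lambda>x. sin (x - c)) c" and cs: "real_analytic_at (\<lambda>x. cos (x - c)) c"
    using real_analytic_at_comp[OF _ d] s0 c0 by simp_all
  have "real_analytic_at (\<lambda>x. sin c * cos (x - c) + cos c * sin (x - c)) c"
    by (intro real_analytic_at_add real_analytic_at_mult real_analytic_at_const s cs)
  moreover have "sin c * cos (x - c) + cos c * sin (x - c) = sin x" for x
    using sin_add[of c "x - c"] by simp
  ultimately show "real_analytic_at sin c" by simp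
  have "real_analytic_at (\<lambda>x. cos c * cos (x - c) - sin c * sin (x - c)) c"
    by (intro real_analytic_at_diff real_analytic_at_mult real_analytic_at_const s cs)
  moreover have "cos c * cos (x - c) - sin c * sin (x - c) = cos x" for x
    using cos_add[of c "x - c"] by simp
  ultimately show "real_analytic_at cos c" by simp
qed

lemma real_analytic_at_sin: "real_analytic_at f p \<Longrightarrow> real_analytic_at (\<lambda>x. sin (f x)) p"
  and real_analytic_at_cos: "real_analytic_at f p \<Longrightarrow> real_analytic_at (\<lambda>x. cos (f x)) p"
  using real_analytic_at_comp[of sin f p] real_analytic_at_comp[of cos f p]
    real_analytic_at_sin_real real_analytic_at_cos_real analytic_map_at_realI by blast+

text \<open>The quotient is defined globally, with the derivative filled in at x = 0. So
  \<open>hquot_eq\<close> holds at every point, one function serves all base points (0, q), and the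
  operation can be iterated.\<close>

definition hquot :: "(real \<times> 'd::euclidean_space \<Rightarrow> real) \<Rightarrow> real \<times> 'd \<Rightarrow> real" where
  "hquot f = (\<lambda>(x, w). if x = 0 then deriv (\<lambda>s. f (s, w)) 0 else (f (x, w) - f (0, w)) / x)"

lemma hquot_eq: "f (x, w) = f (0, w) + x * hquot f (x, w)"
  by (simp add: hquot_def)

lemma eventually_nhds_Pair_const:
  assumes "\<forall>\<^sub>F z in nhds (x, w). P z"
  shows "\<forall>\<^sub>F s in nhds x. P (s, w)"
proof -
  have "((\<lambda>s. (s, w)) \<longlongrightarrow> (x, w)) (nhds x)"
    by (intro tendsto_intros filterlim_ident)
  then show ?thesis using assms by (simp add: filterlim_iff)
qed

lemma hquot_analytic:
  fixes f :: "real \<times> 'd::euclidean_space \<Rightarrow> real"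
  assumes "real_analytic_at f (0, q)"
  shows "real_analytic_at (hquot f) (0, q)"
proof -
  obtain f1 where f1: "real_analytic_at f1 (0, q)"
    and eq: "\<forall>\<^sub>F (x, w) in nhds (0, q). f (x, w) = f (0, w) + x * f1 (x, w)"
    using real_analytic_at_divided[OF assms] .
  have eq: "\<forall>\<^sub>F z in nhds (0, q). f z = f (0, snd z) + fst z * f1 z"
    using eq by eventually_elim auto
  \<comment> \<open>The value of \<open>hquot\<close> at (0, w) is a derivative, which requires the
    identity on a neighbourhood of (0, w) for every w near q.\<close>
  have eq': "\<forall>\<^sub>F y in nhds (0, q). \<forall>\<^sub>F z in nhds y. f z = f (0, snd z) + fst z * f1 z"
    using eq by (simp add: eventually_eventually)
  have "\<forall>\<^sub>F z in nhds (0, q). hquot f z = f1 z"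
    using real_analytic_at_eventually[OF f1] eq eq'
  proof eventually_elim
    case (elim z)
    obtain x w where z: "z = (x, w)" by (cases z)
    show ?case
    proof (cases "x = 0")
      case True
      have "isCont f1 (0, w)" using elim(1) True by (simp add: z real_analytic_at_isCont)
      then have "((\<lambda>s. f1 (s, w)) \<longlongrightarrow> f1 (0, w)) (at 0)"
        by (intro isCont_tendsto_compose[of "(0, w)" f1]) (auto intro!: tendsto_intros)
      moreover have "\<forall>\<^sub>F s in nhds 0. f (s, w) = f (0, w) + s * f1 (s, w)"
        using eventually_nhds_Pair_const[OF elim(3)[unfolded z True]] by simp
      then have "\<forall>\<^sub>F s in at 0. f1 (s, w) = (f (s, w) - f (0, w)) / s"
        unfolding eventually_at_filter by eventually_elim auto
      ultimately have "((\<lambda>s. (f (s, w) - f (0, w)) / s) \<longlongrightarrow> f1 (0, w)) (at 0)"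
        by (rule Lim_transform_eventually)
      then have "((\<lambda>s. f (s, w)) has_real_derivative f1 (0, w)) (at 0)"
        by (simp add: has_field_derivative_iff)
      then show ?thesis using True z by (simp add: hquot_def DERIV_imp_deriv)
    next
      case False
      then show ?thesis using elim(2) z by (simp add: hquot_def)
    qed
  qed
  then show ?thesis using f1 real_analytic_at_cong by fast
qed

text \<open>The derivative in direction v is the quotient of (s, x) \<mapsto> f (x + s v) at s = 0,
  so termwise differentiation in several variables is avoided.\<close>

lemma real_analytic_at_partial:
  assumes "real_analytic_at f p"
  shows "real_analytic_at (\<lambda>x. deriv (\<lambda>s. f (x + s *\<^sub>R v)) 0) p"
proof -
  let ?F = "\<lambda>z. f (snd z + fst z *\<^sub>R v)"
  have "real_analytic_at ?F (0, p)"
    by (rule real_analytic_at_comp)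
      (use assms in \<open>auto intro!: analytic_map_at_add analytic_map_at_snd analytic_map_at_scaleR
        real_analytic_at_realD analytic_map_at_fst analytic_map_at_const\<close>)
  then have "real_analytic_at (\<lambda>x. hquot ?F (0, x)) p"
    by (intro real_analytic_at_comp[of "hquot ?F" "\<lambda>x. (0, x)"] hquot_analytic analytic_map_at_Pair
        analytic_map_at_const analytic_map_at_id)
  then show ?thesis by (simp add: hquot_def)
qed

lemma real_analytic_at_has_derivative:
  "real_analytic_at f x \<Longrightarrow> (f has_derivative frechet_derivative f (at x)) (at x)"
  using real_analytic_at_differentiable frechet_derivative_works by blast

lemma real_analytic_at_chain:
  fixes f :: "'a::euclidean_space \<Rightarrow> real"
  assumes "real_analytic_at f (c t)" "(c has_vector_derivative v) (at t within S)"
  shows "((\<lambda>s. f (c s)) has_real_derivative frechet_derivative f (at (c t)) v) (at t within S)"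
proof -
  have "((\<lambda>s. f (c s)) has_derivative (\<lambda>h. frechet_derivative f (at (c t)) (h *\<^sub>R v))) (at t within S)"
    using has_derivative_compose[OF assms(2)[unfolded has_vector_derivative_def] real_analytic_at_has_derivative[OF assms(1)]] .
  moreover have "frechet_derivative f (at (c t)) (h *\<^sub>R v) = frechet_derivative f (at (c t)) v * h" for h
    using linear_cmul[OF linear_frechet_derivative[OF real_analytic_at_differentiable[OF assms(1)]]]
    by (simp add: mult.commute)
  ultimately show ?thesis by (simp add: has_field_derivative_def mult_commute_abs)
qed

lemma real_analytic_at_frechet:
  fixes f :: "'a::euclidean_space \<Rightarrow> real"
  assumes "real_analytic_at f p"
  shows "real_analytic_at (\<lambda>x. frechet_derivative f (at x) v) p"
proof -
  have "\<forall>\<^sub>F x in nhds p. deriv (\<lambda>s. f (x + s *\<^sub>R v)) 0 = frechet_derivative f (at x) v"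
    using real_analytic_at_eventually[OF assms]
  proof eventually_elim
    case (elim x)
    have "((\<lambda>s. x + s *\<^sub>R v) has_vector_derivative v) (at 0)"
      by (auto intro!: derivative_eq_intros)
    then have "((\<lambda>s. f (x + s *\<^sub>R v)) has_real_derivative frechet_derivative f (at x) v) (at 0)"
      using real_analytic_at_chain[of f "\<lambda>s. x + s *\<^sub>R v" 0 v UNIV] elim by simp
    then show ?case by (rule DERIV_imp_deriv)
  qed
  then show ?thesis using real_analytic_at_partial[OF assms, of v] real_analytic_at_cong by fast
qed

section \<open>Analytic dependence of solutions of ordinary differential equations\<close>

text \<open>Termwise integration in the variable i from 0. Coefficients are divided by exponents
  that are at least 1, so the norm does not grow.\<close>

lift_definition l1_int :: "'a \<Rightarrow> ('a \<Rightarrow> nat) l1 \<Rightarrow> ('a \<Rightarrow> nat) l1" is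
  "\<lambda>i e \<alpha>. if \<alpha> i = 0 then 0 else e (\<alpha>(i := \<alpha> i - 1)) / real (\<alpha> i)"
proof -
  fix i :: 'a and e :: "('a \<Rightarrow> nat) \<Rightarrow> real" assume e: "e summable_on UNIV"
  let ?dn = "\<lambda>\<alpha> :: 'a \<Rightarrow> nat. \<alpha>(i := \<alpha> i - 1)"
  have bij: "bij_betw ?dn {\<alpha>. \<alpha> i \<noteq> 0} UNIV"
    by (rule bij_betw_byWitness[where f' = "\<lambda>\<alpha>. \<alpha>(i := Suc (\<alpha> i))"]) auto
  have "(\<lambda>\<alpha>. norm (e \<alpha>)) summable_on UNIV"
    using e summable_on_iff_abs_summable_on_real by blast
  then have s: "(\<lambda>\<alpha>. norm (e (?dn \<alpha>))) summable_on {\<alpha>. \<alpha> i \<noteq> 0}"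
    using summable_on_reindex_bij_betw[OF bij, of "\<lambda>\<alpha>. norm (e \<alpha>)"] by simp
  have "(\<lambda>\<alpha>. norm (if \<alpha> i = 0 then 0 else e (?dn \<alpha>) / real (\<alpha> i))) summable_on {\<alpha>. \<alpha> i \<noteq> 0}"
    by (rule Infinite_Sum.abs_summable_on_comparison_test[OF s])
      (auto simp: divide_le_eq mult_le_cancel_left1)
  then have "(\<lambda>\<alpha>. if \<alpha> i = 0 then 0 else e (?dn \<alpha>) / real (\<alpha> i)) summable_on {\<alpha>. \<alpha> i \<noteq> 0}"
    by (rule abs_summable_summable)
  also have "?this \<longleftrightarrow> (\<lambda>\<alpha>. if \<alpha> i = 0 then 0 else e (?dn \<alpha>) / real (\<alpha> i)) summable_on UNIV"
    by (rule summable_on_cong_neutral) auto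
  finally show "(\<lambda>\<alpha>. if \<alpha> i = 0 then 0 else e (\<alpha>(i := \<alpha> i - 1)) / real (\<alpha> i)) summable_on UNIV" .
qed

lemma l1_int_diff: "l1_int i (a - b) = l1_int i a - l1_int i b"
  by (rule l1_eqI) (simp add: l1_int.rep_eq minus_l1.rep_eq diff_divide_distrib)

lemma norm_l1_int_le: "norm (l1_int i e) \<le> norm e" for i :: 'a and e :: "('a \<Rightarrow> nat) l1"
proof -
  let ?dn = "\<lambda>\<alpha> :: 'a \<Rightarrow> nat. \<alpha>(i := \<alpha> i - 1)"
  have bij: "bij_betw ?dn {\<alpha>. \<alpha> i \<noteq> 0} UNIV"
    by (rule bij_betw_byWitness[where f' = "\<lambda>\<alpha>. \<alpha>(i := Suc (\<alpha> i))"]) auto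
  have s: "(\<lambda>\<alpha>. \<bar>l1_coeff e (?dn \<alpha>)\<bar>) summable_on {\<alpha>. \<alpha> i \<noteq> 0}"
    using summable_on_reindex_bij_betw[OF bij, of "\<lambda>\<alpha>. \<bar>l1_coeff e \<alpha>\<bar>"] by simp
  have "norm (l1_int i e) = infsum (\<lambda>\<alpha>. \<bar>l1_coeff (l1_int i e) \<alpha>\<bar>) {\<alpha>. \<alpha> i \<noteq> 0}"
    unfolding norm_l1.rep_eq by (rule infsum_cong_neutral) (auto simp: l1_int.rep_eq)
  also have "\<dots> \<le> infsum (\<lambda>\<alpha>. \<bar>l1_coeff e (?dn \<alpha>)\<bar>) {\<alpha>. \<alpha> i \<noteq> 0}"
    by (rule infsum_mono[OF summable_on_subset_banach[OF l1_abs_summable] s])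
      (auto simp: l1_int.rep_eq divide_le_eq mult_le_cancel_left1)
  also have "\<dots> = norm e"
    unfolding norm_l1.rep_eq using infsum_reindex_bij_betw[OF bij, of "\<lambda>\<alpha>. \<bar>l1_coeff e \<alpha>\<bar>"] by simp
  finally show ?thesis .
qed

lemma monom_at_fun_upd:
  assumes "i \<in> Basis"
  shows "monom_at (g(i := x)) \<alpha> = x ^ \<alpha> i * (\<Prod>j\<in>Basis - {i}. g j ^ \<alpha> j)"
proof -
  have "(\<Prod>j\<in>Basis - {i}. (g(i := x)) j ^ \<alpha> j) = (\<Prod>j\<in>Basis - {i}. g j ^ \<alpha> j)"
    by (rule prod.cong) auto
  then show ?thesis using monom_at_remove[OF assms, of "g(i := x)" \<alpha>] by simp
qed

text \<open>Regrouping by the exponent of i yields a series in s with coefficients c, and the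
  theorem on termwise differentiation in one variable applies.\<close>

lemma sb_l1_int:
  fixes g :: "'b::euclidean_space \<Rightarrow> real"
  assumes i: "i \<in> Basis" and g: "\<And>j. j \<in> Basis \<Longrightarrow> j \<noteq> i \<Longrightarrow> \<bar>g j\<bar> \<le> 1"
  shows "sb (g(i := 0)) (l1_int i e) = 0"
    and "\<bar>s\<bar> < 1 \<Longrightarrow> ((\<lambda>s. sb (g(i := s)) (l1_int i e)) has_real_derivative sb (g(i := s)) e) (at s)"
proof -
  define F where "F = (\<lambda>\<alpha>. l1_coeff e \<alpha> * monom_at (g(i := 1)) \<alpha>)"
  define c where "c = (\<lambda>k. infsum F {\<alpha>. \<alpha> i = k})"
  have F: "F summable_on UNIV"
    using sb_has_sum[of "g(i := 1)" e] g has_sum_imp_summable by (fastforce simp: F_def)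
  have m: "monom_at (g(i := s)) \<alpha> = s ^ \<alpha> i * monom_at (g(i := 1)) \<alpha>" for s and \<alpha> :: "'b \<Rightarrow> nat"
    by (simp add: monom_at_fun_upd[OF i])
  have A: "(\<lambda>k. c k * s ^ k) sums sb (g(i := s)) e" if "\<bar>s\<bar> \<le> 1" for s
  proof -
    have "((\<lambda>k. s ^ k * c k) has_sum infsum (\<lambda>\<alpha>. s ^ \<alpha> i * F \<alpha>) UNIV) UNIV"
      unfolding c_def by (rule summable_on_push(4)[OF F, where B = 1]) (use that in \<open>simp add: power_abs power_le_one\<close>)
    also have "infsum (\<lambda>\<alpha>. s ^ \<alpha> i * F \<alpha>) UNIV = sb (g(i := s)) e"
      by (simp add: sb_def F_def m[of s] mult.left_commute)
    finally show ?thesis using has_sum_imp_sums by (simp add: mult.commute)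
  qed
  \<comment> \<open>The coefficients of the primitive with value 0 at s = 0; \<open>diffs\<close>
    leads back to c.\<close>
  define a where "a = (\<lambda>n. if n = 0 then 0 else c (n - 1) / n)"
  have B: "(\<lambda>n. a n * s ^ n) sums sb (g(i := s)) (l1_int i e)" if "\<bar>s\<bar> \<le> 1" for s
  proof -
    let ?up = "\<lambda>\<alpha> :: 'b \<Rightarrow> nat. \<alpha>(i := Suc (\<alpha> i))"
    let ?w = "\<lambda>k. s ^ Suc k / Suc k"
    have bij: "bij_betw ?up UNIV {\<alpha>. \<alpha> i \<noteq> 0}"
      by (rule bij_betw_byWitness[where f' = "\<lambda>\<alpha>. \<alpha>(i := \<alpha> i - 1)"]) (auto simp: fun_eq_iff)
    have w: "\<bar>?w k\<bar> \<le> 1" for k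
    proof -
      have "\<bar>s\<bar> ^ Suc k \<le> 1" using that power_le_one[of "\<bar>s\<bar>" "Suc k"] by simp
      then show ?thesis by (simp add: power_abs abs_mult divide_le_eq del: power_Suc)
    qed
    have "((\<lambda>k. ?w k * c k) has_sum infsum (\<lambda>\<alpha>. ?w (\<alpha> i) * F \<alpha>) UNIV) UNIV"
      unfolding c_def by (rule summable_on_push(4)[OF F w])
    also have "infsum (\<lambda>\<alpha>. ?w (\<alpha> i) * F \<alpha>) UNIV
        = infsum (\<lambda>\<alpha>. l1_coeff (l1_int i e) (?up \<alpha>) * monom_at (g(i := s)) (?up \<alpha>)) UNIV"
      by (rule infsum_cong) (simp add: l1_int.rep_eq F_def m[of s] monom_at_upd[OF i] monom_at_fun_upd[OF i])
    also have "\<dots> = infsum (\<lambda>\<alpha>. l1_coeff (l1_int i e) \<alpha> * monom_at (g(i := s)) \<alpha>) {\<alpha>. \<alpha> i \<noteq> 0}"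
      by (rule infsum_reindex_bij_betw[OF bij])
    also have "\<dots> = sb (g(i := s)) (l1_int i e)"
      unfolding sb_def by (rule infsum_cong_neutral) (auto simp: l1_int.rep_eq)
    finally have "(\<lambda>k. a (Suc k) * s ^ Suc k) sums sb (g(i := s)) (l1_int i e)"
      using has_sum_imp_sums by (simp add: a_def mult.commute)
    then show ?thesis using sums_Suc[of "\<lambda>n. a n * s ^ n"] by (simp add: a_def)
  qed
  show "sb (g(i := 0)) (l1_int i e) = 0"
    using sums_unique2[OF B[of 0]] powser_sums_zero[of a] by (auto simp: a_def)
  assume s: "\<bar>s\<bar> < 1"
  have "DERIV (\<lambda>x. \<Sum>n. a n * x ^ n) s :> (\<Sum>n. diffs a n * s ^ n)"
    using termdiffs_strong[of a 1 s] B[of 1] s by (auto simp: sums_iff)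
  moreover have "diffs a = c" by (auto simp: diffs_def a_def fun_eq_iff)
  moreover have "(\<Sum>n. c n * s ^ n) = sb (g(i := s)) e" using A[of s] s by (auto simp: sums_iff)
  ultimately have D: "DERIV (\<lambda>x. \<Sum>n. a n * x ^ n) s :> sb (g(i := s)) e" by simp
  show "((\<lambda>s. sb (g(i := s)) (l1_int i e)) has_real_derivative sb (g(i := s)) e) (at s)"
  proof (rule has_field_derivative_transform_within_open[OF D, of "ball 0 1"])
    fix x :: real assume "x \<in> ball 0 1"
    then show "(\<Sum>n. a n * x ^ n) = sb (g(i := x)) (l1_int i e)" using B[of x] by (auto simp: sums_iff dist_real_def)
  qed (use s in \<open>auto simp: dist_real_def\<close>)
qed

text \<open>On radius 1/2 the factor k (1/2)^(k-1) never exceeds 1, so the Lipschitz constant of the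
  k-th power does not grow with k.\<close>

lemma norm_power_diff_half:
  fixes a b :: "'c::{real_normed_algebra_1, comm_ring_1}"
  assumes "norm a \<le> 1 / 2" "norm b \<le> 1 / 2"
  shows "norm (a ^ k - b ^ k) \<le> norm (a - b)"
proof (induction k)
  case (Suc k)
  show ?case
  proof (cases "k = 0")
    case False
    have "norm (b ^ k) \<le> norm b ^ k" by (rule norm_power_ineq)
    also have "\<dots> \<le> norm b ^ 1" by (rule power_decreasing) (use False assms in auto)
    finally have bk: "norm (b ^ k) \<le> 1 / 2" using assms by simp
    have "a ^ Suc k - b ^ Suc k = a * (a ^ k - b ^ k) + (a - b) * b ^ k" by (simp add: algebra_simps)
    also have "norm \<dots> \<le> norm a * norm (a ^ k - b ^ k) + norm (a - b) * norm (b ^ k)"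
      by (intro order_trans[OF norm_triangle_ineq] add_mono norm_mult_ineq)
    also have "\<dots> \<le> 1 / 2 * norm (a - b) + norm (a - b) * (1 / 2)"
      by (intro add_mono mult_mono) (use assms bk Suc in auto)
    finally show ?thesis by simp
  qed simp
qed simp

text \<open>With values in \<open>l1\<close> this is the contraction estimate for the Picard
  operator; with real values it is the Lipschitz bound of the right-hand side.\<close>

lemma norm_sb_upd_diff_le:
  fixes g :: "'b::euclidean_space \<Rightarrow> 'c::{banach, real_normed_algebra_1, comm_ring_1}"
  assumes i: "i \<in> Basis" and g: "\<And>j. j \<in> Basis \<Longrightarrow> j \<noteq> i \<Longrightarrow> norm (g j) \<le> 1"
    and ab: "norm a \<le> 1 / 2" "norm b \<le> 1 / 2"
  shows "norm (sb (g(i := a)) e - sb (g(i := b)) e) \<le> norm (a - b) * norm e"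
proof (rule norm_sb_diff_le)
  fix \<alpha> :: "'b \<Rightarrow> nat"
  let ?P = "\<Prod>j\<in>Basis - {i}. g j ^ \<alpha> j"
  have r: "monom_at (g(i := x)) \<alpha> = x ^ \<alpha> i * ?P" for x
    by (rule monom_at_fun_upd[OF i])
  have "norm ?P \<le> (\<Prod>j\<in>Basis - {i}. norm (g j ^ \<alpha> j))" by (rule norm_prod_le_prod)
  also have "\<dots> \<le> 1" by (intro prod_le_1) (use g norm_power_le_one in auto)
  finally have P: "norm ?P \<le> 1" .
  have "norm (monom_at (g(i := a)) \<alpha> - monom_at (g(i := b)) \<alpha>) = norm ((a ^ \<alpha> i - b ^ \<alpha> i) * ?P)"
    by (simp add: r left_diff_distrib)
  also have "\<dots> \<le> norm (a - b) * 1"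
    by (intro order_trans[OF norm_mult_ineq] mult_mono norm_power_diff_half P ab) auto
  finally show "norm (monom_at (g(i := a)) \<alpha> - monom_at (g(i := b)) \<alpha>) \<le> norm (a - b)" by simp
qed (use g ab in auto)

lemma sb_cong: "(\<And>i. i \<in> Basis \<Longrightarrow> g i = g' i) \<Longrightarrow> sb g e = sb g' e"
  unfolding sb_def monom_at_def by (auto intro!: infsum_cong prod.cong)

text \<open>Picard iteration for coefficient families. The unknown is the series of the solution in
  elapsed time s, initial value x and \<delta> - p together, so the fixed point is jointly analytic
  at once. The radius \<rho> does not depend on the initial time a.\<close>

lemma ode_local:
  fixes f :: "real \<times> real \<times> 'd::euclidean_space \<Rightarrow> real"
  assumes "real_analytic_at f (t0, 0, p)"
  obtains \<rho> \<eta> L where "\<rho> > 0" "\<eta> > 0"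
    "\<And>t r r' \<delta>. \<bar>t - t0\<bar> < 2 * \<rho> \<Longrightarrow> \<bar>r\<bar> \<le> \<eta> \<Longrightarrow> \<bar>r'\<bar> \<le> \<eta> \<Longrightarrow> dist \<delta> p < \<rho> \<Longrightarrow>
       \<bar>f (t, r, \<delta>) - f (t, r', \<delta>)\<bar> \<le> L * \<bar>r - r'\<bar>"
    "\<And>a. \<bar>a - t0\<bar> < \<rho> \<Longrightarrow> \<exists>R. \<forall>s x \<delta>. \<bar>s\<bar> < \<rho> \<longrightarrow> \<bar>x\<bar> < \<rho> \<longrightarrow> dist \<delta> p < \<rho> \<longrightarrow>
       real_analytic_at R (s, x, \<delta>) \<and> \<bar>R (s, x, \<delta>)\<bar> \<le> \<eta> \<and> R (0, x, \<delta>) = x \<and>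
       ((\<lambda>s. R (s, x, \<delta>)) has_real_derivative f (a + s, R (s, x, \<delta>), \<delta>)) (at s)"
proof -
  obtain \<rho>0 c where rep: "power_series_rep f (t0, 0, p) \<rho>0 c" using real_analytic_at_imp_rep[OF assms] .
  then have \<rho>0: "\<rho>0 > 0" by (simp add: power_series_rep_def)
  let ?T = "(1, 0, 0) :: real \<times> real \<times> 'd" and ?R = "(0, 1, 0) :: real \<times> real \<times> 'd"
  have T: "?T \<in> Basis" and R: "?R \<in> Basis" and TR: "?T \<noteq> ?R" by (auto simp: Basis_prod_def zero_prod_def)
  define M where "M = norm c"
  have M: "M \<ge> 0" by (simp add: M_def)
  \<comment> \<open>The equation \<rho> (1 + M) = \<rho>0 / 2 does two things: it keeps the ball of
    radius \<eta> = \<rho>0 / 2 invariant, and it makes the contraction factor \<rho> M / \<rho>0 at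
    most 1/2.\<close>
  define \<rho> where "\<rho> = \<rho>0 / (2 * (1 + M))"
  have \<rho>: "\<rho> > 0" using \<rho>0 M by (simp add: \<rho>_def)
  have \<rho>M: "\<rho> * (1 + M) = \<rho>0 / 2" using M by (simp add: \<rho>_def field_simps)
  have \<rho>le: "\<rho> \<le> \<rho>0 / 2"
  proof -
    have "\<rho> * 1 \<le> \<rho> * (1 + M)" by (rule mult_left_mono) (use \<rho> M in auto)
    then show ?thesis using \<rho>M by simp
  qed
  define \<eta> where "\<eta> = \<rho>0 / 2"
  have \<eta>: "\<eta> > 0" using \<rho>0 by (simp add: \<eta>_def)
  have inner_le: "\<bar>(a, b, d) \<bullet> i\<bar> \<le> C"
    if "i \<in> Basis" "\<bar>a\<bar> \<le> C" "\<bar>b\<bar> \<le> C" "norm d \<le> C" for a b C :: real and d :: 'd and i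
    using that Basis_le_norm[of _ d] by (fastforce simp: Basis_prod_def)
  have inner_lt: "\<bar>(a, b, d) \<bullet> i\<bar> < C"
    if "i \<in> Basis" "\<bar>a\<bar> < C" "\<bar>b\<bar> < C" "norm d < C" for a b C :: real and d :: 'd and i
    using that Basis_le_norm[of _ d] by (fastforce simp: Basis_prod_def)
  have frep: "f (t, r, \<delta>) = sb (\<lambda>i. ((t - t0, r, \<delta> - p) \<bullet> i) / \<rho>0) c"
    if "\<bar>t - t0\<bar> \<le> \<rho>0" "\<bar>r\<bar> \<le> \<rho>0" "dist \<delta> p \<le> \<rho>0" for t r \<delta>
  proof -
    have "\<forall>i\<in>Basis. \<bar>(t - t0, r, \<delta> - p) \<bullet> i\<bar> \<le> \<rho>0"
      using that inner_le by (simp add: dist_norm)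
    then show ?thesis
      using rep[unfolded power_series_rep_def, THEN conjunct2, rule_format, of "(t - t0, r, \<delta> - p)"] by simp
  qed
  have lip: "\<bar>f (t, r, \<delta>) - f (t, r', \<delta>)\<bar> \<le> M / \<rho>0 * \<bar>r - r'\<bar>"
    if t: "\<bar>t - t0\<bar> < 2 * \<rho>" and r: "\<bar>r\<bar> \<le> \<eta>" "\<bar>r'\<bar> \<le> \<eta>" and d: "dist \<delta> p < \<rho>" for t r r' \<delta>
  proof -
    let ?g = "\<lambda>i. ((t - t0, 0, \<delta> - p) \<bullet> i) / \<rho>0"
    have fr: "f (t, x, \<delta>) = sb (?g(?R := x / \<rho>0)) c" if "\<bar>x\<bar> \<le> \<eta>" for x
    proof -
      have "f (t, x, \<delta>) = sb (\<lambda>i. ((t - t0, x, \<delta> - p) \<bullet> i) / \<rho>0) c"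
        by (rule frep) (use t d that \<rho>le \<eta>_def \<rho>0 in auto)
      also have "\<dots> = sb (?g(?R := x / \<rho>0)) c"
        by (rule sb_cong) (auto simp: Basis_prod_def)
      finally show ?thesis .
    qed
    have "norm (sb (?g(?R := r / \<rho>0)) c - sb (?g(?R := r' / \<rho>0)) c) \<le> norm (r / \<rho>0 - r' / \<rho>0) * norm c"
    proof (rule norm_sb_upd_diff_le[OF R])
      fix j :: "real \<times> real \<times> 'd" assume "j \<in> Basis"
      then have "\<bar>(t - t0, 0, \<delta> - p) \<bullet> j\<bar> \<le> \<rho>0"
        using t d \<rho>le \<rho>0 by (intro inner_le) (auto simp: dist_norm)
      then show "norm (?g j) \<le> 1" using \<rho>0 by simp
    qed (use r \<rho>0 in \<open>auto simp: \<eta>_def\<close>)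
    also have "norm (r / \<rho>0 - r' / \<rho>0) * norm c = M / \<rho>0 * \<bar>r - r'\<bar>"
      using \<rho>0 by (simp add: M_def diff_divide_distrib[symmetric])
    finally show ?thesis using r by (simp add: fr)
  qed
  have ex: "\<exists>Rf. \<forall>s x \<delta>. \<bar>s\<bar> < \<rho> \<longrightarrow> \<bar>x\<bar> < \<rho> \<longrightarrow> dist \<delta> p < \<rho> \<longrightarrow>
       real_analytic_at Rf (s, x, \<delta>) \<and> \<bar>Rf (s, x, \<delta>)\<bar> \<le> \<eta> \<and> Rf (0, x, \<delta>) = x \<and>
       ((\<lambda>s. Rf (s, x, \<delta>)) has_real_derivative f (a + s, Rf (s, x, \<delta>), \<delta>)) (at s)"
    if a: "\<bar>a - t0\<bar> < \<rho>" for a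
  proof -
    \<comment> \<open>The arguments of f as scaled series: time a + s - t0 and parameter \<delta> -
      p. \<open>G e\<close> puts the unknown into the slot of r.\<close>
    define G0 where "G0 = (\<lambda>i. (((a - t0, 0 :: real, 0 :: 'd) \<bullet> i) / \<rho>0) *\<^sub>R 1 + (\<rho> / \<rho>0) *\<^sub>R gen i)"
    define G where "G = (\<lambda>e. G0(?R := (1 / \<rho>0) *\<^sub>R e))"
    \<comment> \<open>Initial value plus time integral; the variable \<open>?R\<close> now stands
      for x. Both factors \<rho> undo the scaling of the variables.\<close>
    define Op where "Op = (\<lambda>e. \<rho> *\<^sub>R gen ?R + \<rho> *\<^sub>R l1_int ?T (sb (G e) c))"
    have G0: "norm (G0 i) \<le> 1" if "i \<in> Basis" for i
    proof -
      have "\<bar>(a - t0, 0 :: real, 0 :: 'd) \<bullet> i\<bar> \<le> \<rho>0 / 2" using that a \<rho>le \<rho>0 by (intro inner_le) auto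
      then have "\<bar>(a - t0, 0 :: real, 0 :: 'd) \<bullet> i\<bar> / \<rho>0 + \<rho> / \<rho>0 \<le> 1"
        using \<rho>le \<rho>0 by (simp add: add_divide_distrib[symmetric])
      moreover have "norm (G0 i) \<le> \<bar>(a - t0, 0 :: real, 0 :: 'd) \<bullet> i\<bar> / \<rho>0 + \<rho> / \<rho>0"
        unfolding G0_def using \<rho> \<rho>0 by (intro order_trans[OF norm_triangle_ineq]) simp
      ultimately show ?thesis by linarith
    qed
    have half: "norm ((1 / \<rho>0) *\<^sub>R e) \<le> 1 / 2" if "norm e \<le> \<eta>" for e :: "(real \<times> real \<times> 'd \<Rightarrow> nat) l1"
      using that \<rho>0 by (simp add: \<eta>_def field_simps)
    have G1: "norm (G e i) \<le> 1" if "i \<in> Basis" "norm e \<le> \<eta>" for e i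
    proof (cases "i = ?R")
      case True
      then have "norm (G e i) \<le> 1 / 2" unfolding G_def using half[OF that(2)] by simp
      then show ?thesis by simp
    qed (use G0[OF that(1)] in \<open>simp add: G_def\<close>)
    have "\<exists>!e\<in>cball 0 \<eta>. Op e = e"
    proof (rule Banach_fix[where c = "1 / 2"])
      show "complete (cball 0 \<eta> :: (real \<times> real \<times> 'd \<Rightarrow> nat) l1 set)" by (simp add: complete_eq_closed)
      show "cball 0 \<eta> \<noteq> ({} :: (real \<times> real \<times> 'd \<Rightarrow> nat) l1 set)" using \<eta> by simp
      show "Op ` cball 0 \<eta> \<subseteq> cball 0 \<eta>"
      proof (rule image_subsetI)
        fix e :: "(real \<times> real \<times> 'd \<Rightarrow> nat) l1" assume "e \<in> cball 0 \<eta>"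
        then have e: "norm e \<le> \<eta>" by simp
        have "norm (l1_int ?T (sb (G e) c)) \<le> M"
          unfolding M_def by (intro order_trans[OF norm_l1_int_le] norm_sb_le G1 e)
        then have "norm (Op e) \<le> \<rho> + \<rho> * M"
          unfolding Op_def using \<rho> by (intro order_trans[OF norm_triangle_ineq] add_mono) auto
        then show "Op e \<in> cball 0 \<eta>" using \<rho>M by (simp add: \<eta>_def algebra_simps)
      qed
      fix e e' :: "(real \<times> real \<times> 'd \<Rightarrow> nat) l1" assume "e \<in> cball 0 \<eta>" "e' \<in> cball 0 \<eta>"
      then have e: "norm e \<le> \<eta>" "norm e' \<le> \<eta>" by auto
      have "norm (Op e - Op e') = \<rho> * norm (l1_int ?T (sb (G e) c - sb (G e') c))"
        unfolding Op_def using \<rho> by (simp add: l1_int_diff scaleR_right_diff_distrib[symmetric])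
      also have "\<dots> \<le> \<rho> * norm (sb (G e) c - sb (G e') c)"
        using \<rho> by (intro mult_left_mono norm_l1_int_le) auto
      also have "\<dots> \<le> \<rho> * (norm ((1 / \<rho>0) *\<^sub>R e - (1 / \<rho>0) *\<^sub>R e') * M)"
        unfolding G_def M_def using \<rho>
        by (intro mult_left_mono norm_sb_upd_diff_le[OF R] G0 half e) auto
      also have "norm ((1 / \<rho>0) *\<^sub>R e - (1 / \<rho>0) *\<^sub>R e') = norm (e - e') / \<rho>0"
        using \<rho>0 by (simp add: scaleR_right_diff_distrib[symmetric])
      also have "\<rho> * (norm (e - e') / \<rho>0 * M) = (\<rho> * M / \<rho>0) * norm (e - e')" by simp
      also have "\<dots> \<le> 1 / 2 * norm (e - e')"
      proof (rule mult_right_mono)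
        have "\<rho> * M \<le> \<rho>0 / 2" using \<rho>M \<rho> by (simp add: algebra_simps)
        then show "\<rho> * M / \<rho>0 \<le> 1 / 2" using \<rho>0 by (simp add: field_simps)
      qed simp
      finally show "dist (Op e) (Op e') \<le> 1 / 2 * dist e e'" by (simp add: dist_norm)
    qed auto
    then obtain e where e: "norm e \<le> \<eta>" "Op e = e" by auto
    define Rf where "Rf = (\<lambda>y :: real \<times> real \<times> 'd. sb (\<lambda>i. ((y - (0, 0, p)) \<bullet> i) / \<rho>) e)"
    have repR: "power_series_rep Rf (0, 0, p) \<rho> e" using \<rho> by (auto simp: power_series_rep_def Rf_def)
    have main: "real_analytic_at Rf (s, x, \<delta>) \<and> \<bar>Rf (s, x, \<delta>)\<bar> \<le> \<eta> \<and> Rf (0, x, \<delta>) = x \<and>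
       ((\<lambda>s. Rf (s, x, \<delta>)) has_real_derivative f (a + s, Rf (s, x, \<delta>), \<delta>)) (at s)"
      if s: "\<bar>s\<bar> < \<rho>" and x: "\<bar>x\<bar> < \<rho>" and d: "dist \<delta> p < \<rho>" for s x \<delta>
    proof -
      define g0 where "g0 = (\<lambda>i. ((0 :: real, x, \<delta> - p) \<bullet> i) / \<rho>)"
      define E where "E = sb (G e) c"
      have g0: "\<bar>g0 i\<bar> \<le> 1" if "i \<in> Basis" for i
      proof -
        have "\<bar>(0 :: real, x, \<delta> - p) \<bullet> i\<bar> \<le> \<rho>" using that s x d by (intro inner_le) (auto simp: dist_norm)
        then show ?thesis using \<rho> by (simp add: g0_def)
      qed
      have gs: "norm ((g0(?T := s' / \<rho>)) i) \<le> 1" if "i \<in> Basis" "\<bar>s'\<bar> < \<rho>" for i s'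
        using g0[OF that(1)] that \<rho> by auto
      have Rg: "Rf (s', x, \<delta>) = sb (g0(?T := s' / \<rho>)) e" for s'
        unfolding Rf_def g0_def by (rule sb_cong) (auto simp: Basis_prod_def zero_prod_def)
      have Req: "Rf (s', x, \<delta>) = x + \<rho> * sb (g0(?T := s' / \<rho>)) (l1_int ?T E)" if "\<bar>s'\<bar> < \<rho>" for s'
      proof -
        have "Rf (s', x, \<delta>) = sb (g0(?T := s' / \<rho>)) (Op e)" by (simp add: Rg e(2))
        also have "\<dots> = \<rho> * (g0(?T := s' / \<rho>)) ?R + \<rho> * sb (g0(?T := s' / \<rho>)) (l1_int ?T E)"
          unfolding Op_def E_def using gs[OF _ that] by (subst sb_add) (auto simp: sb_scaleR sb_gen[OF R])
        also have "\<rho> * (g0(?T := s' / \<rho>)) ?R = x" using \<rho> by (simp add: g0_def)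
        finally show ?thesis .
      qed
      have 0: "Rf (0, x, \<delta>) = x"
        using Req[of 0] \<rho> sb_l1_int(1)[OF T, of g0 E] g0 by simp
      have 1: "\<bar>Rf (s, x, \<delta>)\<bar> \<le> \<eta>"
      proof -
        have "\<bar>Rf (s, x, \<delta>)\<bar> \<le> norm e"
          unfolding Rg using norm_sb_le[of "g0(?T := s / \<rho>)" e] gs[OF _ s] by simp
        then show ?thesis using e(1) by linarith
      qed
      have 2: "real_analytic_at Rf (s, x, \<delta>)"
        using power_series_rep_analytic_inside[OF repR, of "(s, x, \<delta> - p)"] inner_lt[of _ s \<rho> x "\<delta> - p"] s x d
        by (simp add: dist_norm)
      \<comment> \<open>Evaluation moves inside the substitution, so the integrand takes the value
        of f along the solution.\<close>
      have "sb (g0(?T := s / \<rho>)) E = sb (\<lambda>i. sb (g0(?T := s / \<rho>)) (G e i)) c"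
        unfolding E_def by (rule sb_sb) (use G1 e gs[OF _ s] in auto)
      also have "\<dots> = sb (\<lambda>i. ((a + s - t0, Rf (s, x, \<delta>), \<delta> - p) \<bullet> i) / \<rho>0) c"
      proof (rule sb_cong)
        fix i :: "real \<times> real \<times> 'd" assume i: "i \<in> Basis"
        show "sb (g0(?T := s / \<rho>)) (G e i) = ((a + s - t0, Rf (s, x, \<delta>), \<delta> - p) \<bullet> i) / \<rho>0"
        proof (cases "i = ?R")
          case True
          then show ?thesis using gs[OF _ s] by (simp add: G_def sb_scaleR Rg)
        next
          case False
          then have "sb (g0(?T := s / \<rho>)) (G e i) = ((a - t0, 0 :: real, 0 :: 'd) \<bullet> i) / \<rho>0 + \<rho> / \<rho>0 * (g0(?T := s / \<rho>)) i"
            using gs[OF _ s] i by (simp add: G_def G0_def sb_add sb_scaleR sb_gen)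
          also have "\<dots> = ((a + s - t0, Rf (s, x, \<delta>), \<delta> - p) \<bullet> i) / \<rho>0"
            using i False \<rho> by (auto simp: Basis_prod_def zero_prod_def g0_def add_divide_distrib[symmetric])
          finally show ?thesis .
        qed
      qed
      also have "\<dots> = f (a + s, Rf (s, x, \<delta>), \<delta>)"
        by (rule frep[symmetric]) (use a s 1 d \<rho>le \<rho>0 \<eta>_def in auto)
      finally have E: "sb (g0(?T := s / \<rho>)) E = f (a + s, Rf (s, x, \<delta>), \<delta>)" .
      have "((\<lambda>\<sigma>. sb (g0(?T := \<sigma>)) (l1_int ?T E)) has_real_derivative sb (g0(?T := s / \<rho>)) E) (at (s / \<rho>))"
        by (rule sb_l1_int(2)[OF T]) (use g0 s \<rho> in auto)
      then have D1: "((\<lambda>s. sb (g0(?T := s / \<rho>)) (l1_int ?T E)) has_real_derivative sb (g0(?T := s / \<rho>)) E * (1 / \<rho>)) (at s)"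
        by (rule DERIV_chain2) (use \<rho> in \<open>auto intro!: derivative_eq_intros\<close>)
      have "((\<lambda>s. x + \<rho> * sb (g0(?T := s / \<rho>)) (l1_int ?T E)) has_real_derivative sb (g0(?T := s / \<rho>)) E) (at s)"
        by (rule DERIV_cong[OF DERIV_add[OF DERIV_const[of x] DERIV_cmult[OF D1, of \<rho>]]]) (use \<rho> in simp)
      then have "((\<lambda>s. Rf (s, x, \<delta>)) has_real_derivative sb (g0(?T := s / \<rho>)) E) (at s)"
      proof (rule has_field_derivative_transform_within_open[of _ _ _ "ball 0 \<rho>"])
      qed (use s Req in \<open>auto simp: dist_real_def\<close>)
      then show ?thesis using 0 1 2 E by simp
    qed
    then show ?thesis by blast
  qed
  show ?thesis using that[OF \<rho> \<eta> lip ex] .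
qed

lemma gronwall_zero:
  fixes w :: "real \<Rightarrow> real"
  assumes deriv: "\<And>t. t \<in> {a..b} \<Longrightarrow> (w has_real_derivative w' t) (at t within {a..b})"
    and w: "w a = 0" "\<And>t. t \<in> {a..b} \<Longrightarrow> 0 \<le> w t" "\<And>t. t \<in> {a..b} \<Longrightarrow> w' t \<le> K * w t"
    and t: "t \<in> {a..b}"
  shows "w t = 0"
proof -
  define v where "v = (\<lambda>t. w t * exp (- K * t))"
  have dv: "(v has_real_derivative (w' s - K * w s) * exp (- K * s)) (at s within {a..b})" if "s \<in> {a..b}" for s
    unfolding v_def by (rule derivative_eq_intros deriv that refl | simp add: algebra_simps)+
  have "v t \<le> v a"
  proof (rule DERIV_nonpos_imp_decreasing_open[of a t v])
    show "continuous_on {a..t} v"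
      using DERIV_continuous_on[of "{a..b}" v] dv continuous_on_subset[of "{a..b}" v "{a..t}"] t by fastforce
    fix x assume x: "a < x" "x < t"
    then have "(v has_real_derivative (w' x - K * w x) * exp (- K * x)) (at x)"
      using dv[of x] t at_within_Icc_at[of a x b] by simp
    moreover have "(w' x - K * w x) * exp (- K * x) \<le> 0"
      using w(3)[of x] x t by (simp add: mult_le_0_iff)
    ultimately show "\<exists>y. (v has_real_derivative y) (at x) \<and> y \<le> 0" by blast
  qed (use t in auto)
  then have "w t * exp (- K * t) \<le> 0" using w(1) by (simp add: v_def)
  then show ?thesis using w(2)[OF t] by (simp add: mult_le_0_iff)
qed

section \<open>Solutions on an interval\<close>

definition ode_sol ::
  "(real \<times> real \<times> 'd \<Rightarrow> real) \<Rightarrow> 'd \<Rightarrow> real \<Rightarrow> real \<Rightarrow> (real \<Rightarrow> real) \<Rightarrow> bool" where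
  "ode_sol f \<delta> a b r \<longleftrightarrow> (\<forall>t\<in>{a..b}. (r has_real_derivative f (t, r t, \<delta>)) (at t within {a..b}))"

lemma ode_solD: "ode_sol f \<delta> a b r \<Longrightarrow> t \<in> {a..b} \<Longrightarrow> (r has_real_derivative f (t, r t, \<delta>)) (at t within {a..b})"
  by (simp add: ode_sol_def)

lemma ode_sol_subset:
  assumes "ode_sol f \<delta> a b r" "a \<le> u" "v \<le> b"
  shows "ode_sol f \<delta> u v r"
  unfolding ode_sol_def
proof
  fix t assume "t \<in> {u..v}"
  then show "(r has_real_derivative f (t, r t, \<delta>)) (at t within {u..v})"
    using assms ode_solD[OF assms(1), of t] by (auto intro: has_field_derivative_subset)
qed

lemma ode_sol_unique:
  assumes r: "ode_sol f \<delta> a b r1" "ode_sol f \<delta> a b r2" "r1 a = r2 a"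
    and lip: "\<And>t. t \<in> {a..b} \<Longrightarrow> \<bar>f (t, r1 t, \<delta>) - f (t, r2 t, \<delta>)\<bar> \<le> L * \<bar>r1 t - r2 t\<bar>"
    and t: "t \<in> {a..b}"
  shows "r1 t = r2 t"
proof -
  \<comment> \<open>The square is differentiable where the absolute value need not be; its growth
    rate is 2 L.\<close>
  have "(r1 t - r2 t)\<^sup>2 = 0"
  proof (rule gronwall_zero[where w = "\<lambda>t. (r1 t - r2 t)\<^sup>2" and K = "2 * L", OF _ _ _ _ t])
    fix s assume s: "s \<in> {a..b}"
    show "((\<lambda>t. (r1 t - r2 t)\<^sup>2) has_real_derivative
        2 * (r1 s - r2 s) * (f (s, r1 s, \<delta>) - f (s, r2 s, \<delta>))) (at s within {a..b})"
      by (rule derivative_eq_intros ode_solD[OF r(1) s] ode_solD[OF r(2) s] refl | simp)+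
    have "(r1 s - r2 s) * (f (s, r1 s, \<delta>) - f (s, r2 s, \<delta>)) \<le> \<bar>r1 s - r2 s\<bar> * \<bar>f (s, r1 s, \<delta>) - f (s, r2 s, \<delta>)\<bar>"
      by (simp add: abs_mult[symmetric])
    also have "\<dots> \<le> \<bar>r1 s - r2 s\<bar> * (L * \<bar>r1 s - r2 s\<bar>)" by (rule mult_left_mono[OF lip[OF s]]) simp
    also have "\<dots> = L * (r1 s - r2 s)\<^sup>2" by (simp add: power2_eq_square)
    finally show "2 * (r1 s - r2 s) * (f (s, r1 s, \<delta>) - f (s, r2 s, \<delta>)) \<le> 2 * L * (r1 s - r2 s)\<^sup>2"
      unfolding mult.assoc by (rule mult_left_mono) simp
  qed (use r in auto)
  then show ?thesis by simp
qed

lemma ode_sol_append: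
  assumes r1: "ode_sol f \<delta> a b r1" and r2: "ode_sol f \<delta> b c r2" and eq: "r1 b = r2 b" and le: "a \<le> b" "b \<le> c"
  shows "ode_sol f \<delta> a c (\<lambda>t. if t \<le> b then r1 t else r2 t)"
  unfolding ode_sol_def
proof
  let ?r = "\<lambda>t. if t \<le> b then r1 t else r2 t"
  fix t assume t: "t \<in> {a..c}"
  have un: "{a..c} = {a..b} \<union> {b..c}" using le by auto
  \<comment> \<open>Off the closed interval the filter is trivial and the derivative claim is void,
    so both pieces can be treated at every t of the union.\<close>
  have bot: "at s within {u..v} = bot" if "s \<notin> {u..v}" for s u v :: real
    using that by (simp add: at_within_eq_bot_iff)
  have "(?r has_real_derivative f (t, ?r t, \<delta>)) (at t within {a..b})"
  proof (cases "t \<in> {a..b}")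
    case True
    then show ?thesis
      using has_field_derivative_transform_within[OF ode_solD[OF r1 True] zero_less_one True, of ?r] by simp
  qed (simp add: has_field_derivative_iff bot)
  moreover have "(?r has_real_derivative f (t, ?r t, \<delta>)) (at t within {b..c})"
  proof (cases "t \<in> {b..c}")
    case True
    then have "?r t = r2 t" using eq by auto
    moreover have "(?r has_real_derivative f (t, r2 t, \<delta>)) (at t within {b..c})"
      by (rule has_field_derivative_transform_within[OF ode_solD[OF r2 True] zero_less_one True]) (use eq in auto)
    ultimately show ?thesis by simp
  qed (simp add: has_field_derivative_iff bot)
  ultimately show "(?r has_real_derivative f (t, ?r t, \<delta>)) (at t within {a..c})"
    unfolding un has_field_derivative_iff by (rule Lim_Un)
qed

text \<open>Bisection on the compact interval glues the local bounds: radii by minimum, constants by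
  maximum.\<close>

lemma ode_lipschitz:
  fixes f :: "real \<times> real \<times> 'd::euclidean_space \<Rightarrow> real"
  assumes "a \<le> b" and an: "\<And>t. t \<in> {a..b} \<Longrightarrow> real_analytic_at f (t, 0, p)"
  obtains \<eta> L where "\<eta> > 0" "\<And>t r r' \<delta>. t \<in> {a..b} \<Longrightarrow> \<bar>r\<bar> \<le> \<eta> \<Longrightarrow> \<bar>r'\<bar> \<le> \<eta> \<Longrightarrow> dist \<delta> p < \<eta> \<Longrightarrow>
     \<bar>f (t, r, \<delta>) - f (t, r', \<delta>)\<bar> \<le> L * \<bar>r - r'\<bar>"
proof -
  define Q where "Q = (\<lambda>u v \<eta> L. \<forall>t\<in>{u..v}. \<forall>r r' \<delta>. \<bar>r\<bar> \<le> \<eta> \<longrightarrow> \<bar>r'\<bar> \<le> \<eta> \<longrightarrow> dist \<delta> p < \<eta> \<longrightarrow>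
     \<bar>f (t, r, \<delta>) - f (t, r', \<delta>)\<bar> \<le> L * \<bar>r - r'\<bar>)"
  have "\<exists>\<eta>>0. \<exists>L. Q a b \<eta> L"
    using assms(1)
  proof (induction rule: Bolzano)
    case (trans u v w)
    then obtain \<eta>1 L1 \<eta>2 L2 where 1: "\<eta>1 > 0" "Q u v \<eta>1 L1" and 2: "\<eta>2 > 0" "Q v w \<eta>2 L2" by blast
    have "Q u w (min \<eta>1 \<eta>2) (max L1 L2)"
      unfolding Q_def
    proof (intro ballI allI impI)
      fix t r r' \<delta>
      assume *: "t \<in> {u..w}" "\<bar>r\<bar> \<le> min \<eta>1 \<eta>2" "\<bar>r'\<bar> \<le> min \<eta>1 \<eta>2" "dist \<delta> p < min \<eta>1 \<eta>2"
      have "\<bar>f (t, r, \<delta>) - f (t, r', \<delta>)\<bar> \<le> L1 * \<bar>r - r'\<bar> \<or> \<bar>f (t, r, \<delta>) - f (t, r', \<delta>)\<bar> \<le> L2 * \<bar>r - r'\<bar>"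
      proof (cases "t \<le> v")
        case True
        then show ?thesis using 1(2) * unfolding Q_def by auto
      next
        case False
        then show ?thesis using 2(2) * unfolding Q_def by auto
      qed
      moreover have "L1 * \<bar>r - r'\<bar> \<le> max L1 L2 * \<bar>r - r'\<bar>" "L2 * \<bar>r - r'\<bar> \<le> max L1 L2 * \<bar>r - r'\<bar>"
        by (auto intro: mult_right_mono)
      ultimately show "\<bar>f (t, r, \<delta>) - f (t, r', \<delta>)\<bar> \<le> max L1 L2 * \<bar>r - r'\<bar>" by linarith
    qed
    then show ?case using 1(1) 2(1) by (meson min_less_iff_conj)
  next
    case (local x)
    obtain \<rho> \<eta> L where *: "\<rho> > 0" "\<eta> > 0"
      "\<And>t r r' \<delta>. \<bar>t - x\<bar> < 2 * \<rho> \<Longrightarrow> \<bar>r\<bar> \<le> \<eta> \<Longrightarrow> \<bar>r'\<bar> \<le> \<eta> \<Longrightarrow> dist \<delta> p < \<rho> \<Longrightarrow>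
         \<bar>f (t, r, \<delta>) - f (t, r', \<delta>)\<bar> \<le> L * \<bar>r - r'\<bar>"
      using ode_local[OF an[of x]] local by (metis atLeastAtMost_iff)
    have "Q u v (min \<eta> \<rho>) L" if "u \<le> x" "x \<le> v" "v - u < \<rho>" for u v
      unfolding Q_def using *(1) that by (auto intro!: *(3))
    then show ?case using *(1,2) by (intro exI[of _ \<rho>]) (metis min_less_iff_conj)
  qed
  then show ?thesis using that unfolding Q_def by blast
qed

text \<open>The germ at (0, p) of the flow map from a to b around the zero solution. Smallness of
  the orbits, for every \<eta>, keeps them where f is Lipschitz and thereby determines the
  germ.\<close>

definition ode_flow ::
  "(real \<times> real \<times> 'd::euclidean_space \<Rightarrow> real) \<Rightarrow> 'd \<Rightarrow> real \<Rightarrow> real \<Rightarrow> (real \<times> 'd \<Rightarrow> real) \<Rightarrow> bool" where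
  "ode_flow f p a b S \<longleftrightarrow> real_analytic_at S (0, p) \<and> S (0, p) = 0 \<and>
     (\<forall>\<eta>>0. \<forall>\<^sub>F y in nhds (0, p). \<exists>r. ode_sol f (snd y) a b r \<and> r a = fst y \<and> r b = S y \<and>
        (\<forall>t\<in>{a..b}. \<bar>r t\<bar> < \<eta>))"

lemma open_analytic_less:
  fixes g :: "'a::euclidean_space \<Rightarrow> real"
  shows "open {z. real_analytic_at g z \<and> \<bar>g z\<bar> < C}"
proof (subst open_subopen, intro ballI)
  fix z assume z: "z \<in> {z. real_analytic_at g z \<and> \<bar>g z\<bar> < C}"
  have "isCont (\<lambda>z. \<bar>g z\<bar>) z" using z real_analytic_at_isCont by (intro continuous_intros) auto
  then have "((\<lambda>z. \<bar>g z\<bar>) \<longlongrightarrow> \<bar>g z\<bar>) (nhds z)"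
    unfolding isCont_def by (rule tendsto_at_iff_tendsto_nhds[THEN iffD1])
  then have "\<forall>\<^sub>F x in nhds z. \<bar>g x\<bar> < C" by (rule order_tendstoD(2)) (use z in auto)
  moreover have "\<forall>\<^sub>F x in nhds z. real_analytic_at g x" using z real_analytic_at_eventually by blast
  ultimately have "\<forall>\<^sub>F x in nhds z. x \<in> {z. real_analytic_at g z \<and> \<bar>g z\<bar> < C}"
    by eventually_elim simp
  then show "\<exists>T. open T \<and> z \<in> T \<and> T \<subseteq> {z. real_analytic_at g z \<and> \<bar>g z\<bar> < C}"
    unfolding eventually_nhds by auto
qed

text \<open>The local series solution, started at u and evaluated at elapsed time v - u, is the flow
  germ.\<close>

lemma ode_flow_local:
  fixes f :: "real \<times> real \<times> 'd::euclidean_space \<Rightarrow> real"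
  assumes an: "real_analytic_at f (x, 0, p)"
  shows "\<exists>d>0. \<forall>u v. u \<le> x \<and> x \<le> v \<and> v - u < d \<longrightarrow> (\<forall>t\<in>{u..v}. f (t, 0, p) = 0) \<longrightarrow> (\<exists>S. ode_flow f p u v S)"
proof -
  obtain \<rho> \<eta> L where \<rho>: "\<rho> > 0" "\<eta> > 0"
    and lip: "\<And>t r r' \<delta>. \<bar>t - x\<bar> < 2 * \<rho> \<Longrightarrow> \<bar>r\<bar> \<le> \<eta> \<Longrightarrow> \<bar>r'\<bar> \<le> \<eta> \<Longrightarrow> dist \<delta> p < \<rho> \<Longrightarrow>
         \<bar>f (t, r, \<delta>) - f (t, r', \<delta>)\<bar> \<le> L * \<bar>r - r'\<bar>"
    and ex: "\<And>a. \<bar>a - x\<bar> < \<rho> \<Longrightarrow> \<exists>R. \<forall>s x \<delta>. \<bar>s\<bar> < \<rho> \<longrightarrow> \<bar>x\<bar> < \<rho> \<longrightarrow> dist \<delta> p < \<rho> \<longrightarrow>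
       real_analytic_at R (s, x, \<delta>) \<and> \<bar>R (s, x, \<delta>)\<bar> \<le> \<eta> \<and> R (0, x, \<delta>) = x \<and>
       ((\<lambda>s. R (s, x, \<delta>)) has_real_derivative f (a + s, R (s, x, \<delta>), \<delta>)) (at s)"
    by (rule ode_local[OF an]) blast
  have "\<exists>S. ode_flow f p u v S" if uv: "u \<le> x" "x \<le> v" "v - u < \<rho>" and f0: "\<And>t. t \<in> {u..v} \<Longrightarrow> f (t, 0, p) = 0" for u v
  proof -
    have "\<bar>u - x\<bar> < \<rho>" using uv by auto
    from ex[OF this] obtain R where R: "\<And>s x \<delta>. \<bar>s\<bar> < \<rho> \<Longrightarrow> \<bar>x\<bar> < \<rho> \<Longrightarrow> dist \<delta> p < \<rho> \<Longrightarrow>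
       real_analytic_at R (s, x, \<delta>) \<and> \<bar>R (s, x, \<delta>)\<bar> \<le> \<eta> \<and> R (0, x, \<delta>) = x \<and>
       ((\<lambda>s. R (s, x, \<delta>)) has_real_derivative f (u + s, R (s, x, \<delta>), \<delta>)) (at s)" by blast
    define r where "r = (\<lambda>y t. R (t - u, y))"
    have sol: "ode_sol f \<delta> u v (r (z, \<delta>))" if "\<bar>z\<bar> < \<rho>" "dist \<delta> p < \<rho>" for z \<delta>
      unfolding ode_sol_def
    proof
      fix t assume t: "t \<in> {u..v}"
      then have "\<bar>t - u\<bar> < \<rho>" using uv by auto
      then have "((\<lambda>s. R (s, z, \<delta>)) has_real_derivative f (u + (t - u), R (t - u, z, \<delta>), \<delta>)) (at (t - u))"
        using R that by blast
      then have "((\<lambda>t. R (t - u, z, \<delta>)) has_real_derivative f (u + (t - u), R (t - u, z, \<delta>), \<delta>) * 1) (at t)"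
        by (rule DERIV_chain2) (auto intro!: derivative_eq_intros)
      then show "(r (z, \<delta>) has_real_derivative f (t, r (z, \<delta>) t, \<delta>)) (at t within {u..v})"
        by (simp add: r_def has_field_derivative_at_within)
    qed
    \<comment> \<open>At the parameter p the zero function is a solution, so uniqueness forces R to
      vanish there.\<close>
    have R0: "R (s, 0, p) = 0" if "s \<in> {0..v - u}" for s
    proof -
      have "r (0, p) (u + s) = 0"
      proof (rule ode_sol_unique[of f p u v "r (0, p)" "\<lambda>_. 0" L "u + s"])
        show "ode_sol f p u v (r (0, p))" by (rule sol) (use \<rho> in auto)
        show "ode_sol f p u v (\<lambda>_. 0)" unfolding ode_sol_def using f0 by (auto intro!: derivative_eq_intros)
        show "r (0, p) u = 0" using R[of 0 0 p] \<rho> by (simp add: r_def)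
        show "u + s \<in> {u..v}" using that by auto
        fix t assume t: "t \<in> {u..v}"
        then have "\<bar>t - u\<bar> < \<rho>" using uv by auto
        then have "\<bar>r (0, p) t\<bar> \<le> \<eta>" using R[of "t - u" 0 p] \<rho> by (simp add: r_def)
        moreover have "\<bar>t - x\<bar> < 2 * \<rho>" using t uv \<rho> by auto
        ultimately show "\<bar>f (t, r (0, p) t, p) - f (t, 0, p)\<bar> \<le> L * \<bar>r (0, p) t - 0\<bar>"
          using \<rho> by (intro lip) auto
      qed
      then show ?thesis by (simp add: r_def)
    qed
    define S where "S = (\<lambda>y. R (v - u, y))"
    have "ode_flow f p u v S"
      unfolding ode_flow_def
    proof (intro conjI allI impI)
      have "\<bar>v - u\<bar> < \<rho>" using uv by auto
      then have "real_analytic_at R (v - u, 0, p)" using R[of "v - u" 0 p] \<rho> by auto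
      then show "real_analytic_at S (0, p)" unfolding S_def
        by (intro real_analytic_at_comp[of R "\<lambda>y. (v - u, y)"] analytic_map_at_Pair analytic_map_at_const analytic_map_at_id)
      show "S (0, p) = 0" using R0[of "v - u"] uv by (simp add: S_def)
      fix \<epsilon> :: real assume \<epsilon>: "\<epsilon> > 0"
      \<comment> \<open>The zero orbit is compact, so one radius e makes all nearby orbits smaller
        than \<epsilon> at all times.\<close>
      let ?K = "(\<lambda>s. (s, 0 :: real, p)) ` {0..v - u}"
      have "compact ?K" by (intro compact_continuous_image continuous_intros) auto
      moreover have "?K \<subseteq> {z. real_analytic_at R z \<and> \<bar>R z\<bar> < \<epsilon>}"
      proof
        fix z assume "z \<in> ?K"
        then obtain s where s: "s \<in> {0..v - u}" "z = (s, 0, p)" by auto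
        then have "\<bar>s\<bar> < \<rho>" using uv by auto
        then show "z \<in> {z. real_analytic_at R z \<and> \<bar>R z\<bar> < \<epsilon>}" using R[of s 0 p] R0[OF s(1)] s \<rho> \<epsilon> by auto
      qed
      ultimately obtain e where e: "e > 0" "(\<Union>z\<in>?K. ball z e) \<subseteq> {z. real_analytic_at R z \<and> \<bar>R z\<bar> < \<epsilon>}"
        using compact_subset_open_imp_ball_epsilon_subset[OF _ open_analytic_less, of ?K R \<epsilon>] by blast
      have "\<exists>r'. ode_sol f (snd y) u v r' \<and> r' u = fst y \<and> r' v = S y \<and> (\<forall>t\<in>{u..v}. \<bar>r' t\<bar> < \<epsilon>)"
        if y: "dist y (0, p) < min e \<rho>" for y
      proof (intro exI[of _ "r y"] conjI ballI)
        obtain z \<delta> where yz: "y = (z, \<delta>)" by (cases y)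
        have d: "\<bar>z\<bar> < \<rho>" "dist \<delta> p < \<rho>"
          using y dist_fst_le[of y "(0, p)"] dist_snd_le[of y "(0, p)"] by (auto simp: yz dist_real_def)
        show "ode_sol f (snd y) u v (r y)" using sol[OF d] by (simp add: yz)
        show "r y u = fst y" using R[of 0 z \<delta>] d \<rho> by (simp add: r_def yz)
        show "r y v = S y" by (simp add: r_def S_def)
        fix t assume t: "t \<in> {u..v}"
        have "dist (t - u, 0, p) (t - u, y) = dist (0, p) y" by (simp add: dist_Pair_Pair)
        then have "(t - u, y) \<in> ball (t - u, 0, p) e" using y by (simp add: dist_commute)
        then have "(t - u, y) \<in> (\<Union>z\<in>?K. ball z e)" using t by force
        then have "(t - u, y) \<in> {z. real_analytic_at R z \<and> \<bar>R z\<bar> < \<epsilon>}" using e(2) by blast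
        then show "\<bar>r y t\<bar> < \<epsilon>" by (simp add: r_def)
      qed
      then show "\<forall>\<^sub>F y in nhds (0, p). \<exists>r'. ode_sol f (snd y) u v r' \<and> r' u = fst y \<and> r' v = S y \<and> (\<forall>t\<in>{u..v}. \<bar>r' t\<bar> < \<epsilon>)"
        unfolding eventually_nhds_metric using e(1) \<rho> by (intro exI[of _ "min e \<rho>"]) auto
    qed
    then show ?thesis by blast
  qed
  then show ?thesis using \<rho>(1) by blast
qed

lemma analytic_map_at_tendsto:
  assumes "analytic_map_at g p"
  shows "(g \<longlongrightarrow> g p) (nhds p)"
  unfolding tendsto_componentwise_iff[of g]
proof
  fix i :: 'b assume "i \<in> Basis"
  then have "isCont (\<lambda>x. g x \<bullet> i) p"
    using assms real_analytic_at_isCont by (auto simp: analytic_map_at_def)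
  then show "((\<lambda>x. g x \<bullet> i) \<longlongrightarrow> g p \<bullet> i) (nhds p)"
    unfolding isCont_def by (rule tendsto_at_iff_tendsto_nhds[THEN iffD1])
qed

lemma ode_flow_append:
  assumes 1: "ode_flow f p a b S1" and 2: "ode_flow f p b c S2" and le: "a \<le> b" "b \<le> c"
  shows "ode_flow f p a c (\<lambda>y. S2 (S1 y, snd y))"
  unfolding ode_flow_def
proof (intro conjI allI impI)
  let ?g = "\<lambda>y. (S1 y, snd y)"
  have g0: "?g (0, p) = (0, p)" using 1 by (simp add: ode_flow_def)
  have ga: "analytic_map_at ?g (0, p)"
    using 1 by (intro analytic_map_at_Pair analytic_map_at_snd analytic_map_at_realI) (simp add: ode_flow_def)
  show "real_analytic_at (\<lambda>y. S2 (S1 y, snd y)) (0, p)"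
    using real_analytic_at_comp[of S2 ?g "(0, p)"] ga 2 g0 by (simp add: ode_flow_def)
  show "S2 (S1 (0, p), snd (0, p)) = 0" using 1 2 by (simp add: ode_flow_def)
  fix \<eta> :: real assume \<eta>: "\<eta> > 0"
  have "(?g \<longlongrightarrow> ?g (0, p)) (nhds (0, p))" by (rule analytic_map_at_tendsto[OF ga])
  then have gl: "filterlim ?g (nhds (0, p)) (nhds (0, p))" using g0 by simp
  have "\<forall>\<^sub>F y in nhds (0, p). \<exists>r. ode_sol f (snd y) b c r \<and> r b = fst y \<and> r c = S2 y \<and> (\<forall>t\<in>{b..c}. \<bar>r t\<bar> < \<eta>)"
    using 2 \<eta> by (simp add: ode_flow_def)
  from filterlim_iff[THEN iffD1, OF gl, rule_format, OF this]
  have e2: "\<forall>\<^sub>F y in nhds (0, p). \<exists>r. ode_sol f (snd y) b c r \<and> r b = S1 y \<and> r c = S2 (S1 y, snd y) \<and> (\<forall>t\<in>{b..c}. \<bar>r t\<bar> < \<eta>)"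
    by simp
  have "\<forall>\<^sub>F y in nhds (0, p). \<exists>r. ode_sol f (snd y) a b r \<and> r a = fst y \<and> r b = S1 y \<and> (\<forall>t\<in>{a..b}. \<bar>r t\<bar> < \<eta>)"
    using 1 \<eta> by (simp add: ode_flow_def)
  then show "\<forall>\<^sub>F y in nhds (0, p). \<exists>r. ode_sol f (snd y) a c r \<and> r a = fst y \<and> r c = S2 (S1 y, snd y) \<and> (\<forall>t\<in>{a..c}. \<bar>r t\<bar> < \<eta>)"
    using e2
  proof eventually_elim
    case (elim y)
    then obtain r1 r2 where r1: "ode_sol f (snd y) a b r1" "r1 a = fst y" "r1 b = S1 y" "\<forall>t\<in>{a..b}. \<bar>r1 t\<bar> < \<eta>"
      and r2: "ode_sol f (snd y) b c r2" "r2 b = S1 y" "r2 c = S2 (S1 y, snd y)" "\<forall>t\<in>{b..c}. \<bar>r2 t\<bar> < \<eta>" by blast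
    show ?case
    proof (intro exI[of _ "\<lambda>t. if t \<le> b then r1 t else r2 t"] conjI)
      show "ode_sol f (snd y) a c (\<lambda>t. if t \<le> b then r1 t else r2 t)"
        by (rule ode_sol_append[OF r1(1) r2(1) _ le]) (use r1 r2 in auto)
      show "(if c \<le> b then r1 c else r2 c) = S2 (S1 y, snd y)"
        using r1 r2 le by (cases "c = b") auto
    qed (use r1 r2 le in auto)
  qed
qed

text \<open>Along the zero solution germs can be composed, so bisection extends the local flows to
  an interval of any length.\<close>

theorem ode_flow_exists:
  fixes f :: "real \<times> real \<times> 'd::euclidean_space \<Rightarrow> real"
  assumes "a \<le> b" and an: "\<And>t. t \<in> {a..b} \<Longrightarrow> real_analytic_at f (t, 0, p)"
    and f0: "\<And>t. t \<in> {a..b} \<Longrightarrow> f (t, 0, p) = 0"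
  shows "\<exists>S. ode_flow f p a b S"
proof -
  have "a \<le> a \<and> b \<le> b \<longrightarrow> (\<exists>S. ode_flow f p a b S)"
    using assms(1)
  proof (induction rule: Bolzano[where P = "\<lambda>u v. a \<le> u \<and> v \<le> b \<longrightarrow> (\<exists>S. ode_flow f p u v S)"])
    case (trans u v w)
    then show ?case using ode_flow_append[of f p u v _ w] by fastforce
  next
    case (local x)
    obtain d where "d > 0"
      "\<forall>u v. u \<le> x \<and> x \<le> v \<and> v - u < d \<longrightarrow> (\<forall>t\<in>{u..v}. f (t, 0, p) = 0) \<longrightarrow> (\<exists>S. ode_flow f p u v S)"
      using ode_flow_local[OF an[of x]] local by auto
    then show ?case using f0 by (intro exI[of _ d]) auto
  qed
  then show ?thesis by simp
qed

section \<open>Expansions in one real variable\<close>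

lemma has_fps_expansion_imp_real_analytic:
  fixes f :: "real \<Rightarrow> real"
  assumes "f has_fps_expansion c"
  shows "real_analytic_at f 0"
proof -
  have c: "fps_conv_radius c > 0" "\<forall>\<^sub>F z in nhds 0. eval_fps c z = f z"
    using assms by (auto simp: has_fps_expansion_def)
  obtain R where R: "0 < ereal R" "ereal R < fps_conv_radius c"
    using c(1) ereal_dense2 by blast
  have "real_analytic_at (eval_fps c) 0"
  proof (rule real_analytic_at_powser[of R])
    fix z :: real assume "\<bar>z\<bar> < R"
    then have "ereal (norm z) < fps_conv_radius c"
      using R(2) by (metis less_ereal.simps(1) less_trans real_norm_def)
    then show "(\<lambda>k. fps_nth c k * z ^ k) sums eval_fps c (0 + z)" using sums_eval_fps[of z c] by simp
  qed (use R in simp)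
  then show ?thesis using real_analytic_at_cong[OF c(2)] by simp
qed

lemma has_fps_expansion_cong_ev:
  assumes "f has_fps_expansion c" "\<forall>\<^sub>F x in nhds 0. f x = g x"
  shows "g has_fps_expansion c"
proof -
  have "\<forall>\<^sub>F z in nhds 0. eval_fps c z = f z" using assms(1) by (simp add: has_fps_expansion_def)
  then have "\<forall>\<^sub>F z in nhds 0. eval_fps c z = g z" using assms(2) by eventually_elim simp
  then show ?thesis using assms(1) by (simp add: has_fps_expansion_def)
qed

text \<open>The return map is compared with the flow for x > 0 alone, which calls for a one-sided
  identity theorem: after division by the leading power, the limit from the right is the leading
  coefficient.\<close>

lemma has_fps_expansion_zero_right:
  fixes f :: "real \<Rightarrow> real"
  assumes f: "f has_fps_expansion c" and 0: "\<forall>\<^sub>F x in at_right 0. f x = 0"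
  shows "c = 0"
proof (rule ccontr)
  assume "c \<noteq> 0"
  define n where "n = subdegree c"
  have nz: "fps_nth c n \<noteq> 0" using \<open>c \<noteq> 0\<close> by (simp add: n_def)
  let ?g = "\<lambda>x. if x = 0 then fps_nth c n else f x / x ^ n"
  have "?g has_fps_expansion fps_shift n c"
    by (rule has_fps_expansion_shift[OF f]) (auto simp: n_def)
  then have "isCont ?g 0" by (rule has_fps_expansion_imp_continuous)
  then have "(?g \<longlongrightarrow> fps_nth c n) (at 0)" by (simp add: isCont_def)
  then have "(?g \<longlongrightarrow> fps_nth c n) (at_right 0)" by (rule tendsto_within_subset) simp
  moreover have "\<forall>\<^sub>F x in at_right 0. ?g x = 0"
    using 0 eventually_at_right_less[of 0] by eventually_elim simp
  then have "(?g \<longlongrightarrow> 0) (at_right 0)" by (rule tendsto_eventually)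
  ultimately have "fps_nth c n = 0" by (intro tendsto_unique[of "at_right (0 :: real)" ?g]) auto
  then show False using nz by simp
qed

lemma has_fps_expansion_unique_right:
  fixes f g :: "real \<Rightarrow> real"
  assumes "f has_fps_expansion c" "g has_fps_expansion d" "\<forall>\<^sub>F x in at_right 0. f x = g x"
  shows "c = d"
proof -
  have "(\<lambda>x. f x - g x) has_fps_expansion (c - d)" by (intro fps_expansion_intros assms)
  moreover have "\<forall>\<^sub>F x in at_right 0. f x - g x = 0" using assms(3) by eventually_elim simp
  ultimately show ?thesis using has_fps_expansion_zero_right by fastforce
qed

lemma has_fps_expansion_unique_real:
  fixes f :: "real \<Rightarrow> real"
  assumes "f has_fps_expansion c" "f has_fps_expansion d"
  shows "c = d"
  by (rule has_fps_expansion_unique_right[OF assms]) simp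

lemma has_fps_expansion_0_eq: "f has_fps_expansion c \<Longrightarrow> fps_nth c 0 = f (0 :: real)"
  unfolding has_fps_expansion_def using eventually_nhds_x_imp_x[of _ "0 :: real"] by (force simp: eval_fps_at_0)

lemma has_fps_expansion_power_real:
  fixes f :: "real \<Rightarrow> real"
  assumes "f has_fps_expansion F"
  shows "(\<lambda>x. f x ^ k) has_fps_expansion F ^ k"
  by (induction k) (auto intro!: fps_expansion_intros assms)

text \<open>Analyticity of the composite provides some expansion; its coefficients are then
  identified one at a time.\<close>

lemma has_fps_expansion_compose_real:
  fixes f g :: "real \<Rightarrow> real"
  assumes f: "f has_fps_expansion F" and g: "g has_fps_expansion G" and G0: "fps_nth G 0 = 0"
  shows "(\<lambda>x. f (g x)) has_fps_expansion (F oo G)"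
proof -
  have g0: "g 0 = 0" using has_fps_expansion_0_eq[OF g] G0 by simp
  have comp: "\<exists>c. (\<lambda>x. k (g x)) has_fps_expansion c" if "k has_fps_expansion K" for k K
  proof -
    have "real_analytic_at (\<lambda>x. k (g x)) 0"
      using real_analytic_at_comp[of k g 0] has_fps_expansion_imp_real_analytic[OF that]
        has_fps_expansion_imp_real_analytic[OF g] g0 by (simp add: analytic_map_at_real)
    then show ?thesis using real_analytic_at_imp_fps by metis
  qed
  obtain c where c: "(\<lambda>x. f (g x)) has_fps_expansion c" using comp[OF f] by blast
  have "fps_nth c m = fps_nth (F oo G) m" for m
  proof -
    \<comment> \<open>The truncation of F at degree m. The rest of f is y^(m+1) times an analytic
      function, and y = g(x) vanishes at 0, so the rest cannot reach the coefficient of index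
      m.\<close>
    define F0 where "F0 = (\<Sum>k=0..m. fps_const (fps_nth F k) * fps_X ^ k)"
    define p where "p = (\<lambda>x :: real. \<Sum>k=0..m. fps_nth F k * x ^ k)"
    have p: "p has_fps_expansion F0" unfolding p_def F0_def by (intro fps_expansion_intros)
    have F0n: "fps_nth F0 j = (if j \<le> m then fps_nth F j else 0)" for j
    proof -
      have "fps_nth F0 j = (\<Sum>k=0..m. if k = j then fps_nth F k else 0)"
        unfolding F0_def by (simp add: fps_sum_nth fps_mult_left_const_nth fps_X_power_nth if_distrib cong: if_cong)
      then show ?thesis by simp
    qed
    have rd: "(\<lambda>x. f x - p x) has_fps_expansion (F - F0)" by (intro fps_expansion_intros f p)
    define k where "k = (\<lambda>x. if x = 0 then fps_nth (F - F0) (Suc m) else (f x - p x) / x ^ Suc m)"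
    have "k has_fps_expansion fps_shift (Suc m) (F - F0)"
      unfolding k_def
    \<comment> \<open>The zero series needs its own case because its \<open>subdegree\<close> is
      0.\<close>
    proof (cases "F - F0 = 0")
      case True
      have "eventually (\<lambda>x. f x - p x = 0) (nhds 0)"
        using rd unfolding has_fps_expansion_def True by (auto elim: eventually_mono)
      then have "eventually (\<lambda>x. (if x = 0 then fps_nth (F - F0) (Suc m) else (f x - p x) / x ^ Suc m) = 0) (nhds 0)"
        by eventually_elim (simp add: True)
      then show "(\<lambda>x. if x = 0 then fps_nth (F - F0) (Suc m) else (f x - p x) / x ^ Suc m)
          has_fps_expansion fps_shift (Suc m) (F - F0)"
        unfolding has_fps_expansion_def True by (auto elim: eventually_mono)
    next
      case False
      then have "Suc m \<le> subdegree (F - F0)" by (intro subdegree_geI) (auto simp: F0n)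
      then show "(\<lambda>x. if x = 0 then fps_nth (F - F0) (Suc m) else (f x - p x) / x ^ Suc m)
          has_fps_expansion fps_shift (Suc m) (F - F0)"
        by (intro has_fps_expansion_shift[OF rd]) auto
    qed
    then obtain d where d: "(\<lambda>x. k (g x)) has_fps_expansion d" using comp by blast
    have fk: "f y = p y + y ^ Suc m * k y" for y
    proof (cases "y = 0")
      case True
      have "f 0 - p 0 = 0" using has_fps_expansion_0_eq[OF rd] F0n[of 0] by simp
      then show ?thesis using True by simp
    qed (simp add: k_def)
    have "(\<lambda>x. (\<Sum>k=0..m. fps_nth F k * g x ^ k) + g x ^ Suc m * k (g x)) has_fps_expansion
        ((\<Sum>k=0..m. fps_const (fps_nth F k) * G ^ k) + G ^ Suc m * d)"
      by (intro has_fps_expansion_add has_fps_expansion_sum has_fps_expansion_mult has_fps_expansion_const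
          has_fps_expansion_power_real g d)
    then have "(\<lambda>x. f (g x)) has_fps_expansion ((\<Sum>k=0..m. fps_const (fps_nth F k) * G ^ k) + G ^ Suc m * d)"
      unfolding fk p_def .
    then have ceq: "c = (\<Sum>k=0..m. fps_const (fps_nth F k) * G ^ k) + G ^ Suc m * d"
      by (rule has_fps_expansion_unique_real[OF c])
    have "fps_nth (G ^ Suc m * d) m = 0"
    proof -
      have "fps_nth (G ^ Suc m) i = 0" if "i \<le> m" for i
        using startsby_zero_power_prefix[OF G0] that by (simp add: less_Suc_eq_le del: power_Suc)
      then show ?thesis unfolding fps_mult_nth by (intro sum.neutral) (auto simp del: power_Suc)
    qed
    then show ?thesis unfolding ceq by (simp add: fps_compose_nth fps_sum_nth fps_mult_left_const_nth del: power_Suc)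
  qed
  then have "c = F oo G" by (rule fps_ext)
  then show ?thesis using c by simp
qed

lemma analytic_restrict_snd:
  assumes "real_analytic_at S (0 :: real, \<delta>)"
  shows "real_analytic_at (\<lambda>x. S (x, \<delta>)) 0"
  using assms by (intro real_analytic_at_comp[of S "\<lambda>x. (x, \<delta>)"] analytic_map_at_Pair analytic_map_at_id analytic_map_at_const)

lemma hquot_power_analytic:
  "real_analytic_at S (0, \<delta>) \<Longrightarrow> real_analytic_at ((hquot ^^ j) S) (0, \<delta>)"
  by (induction j) (auto intro: hquot_analytic)

lemma hquot_fps:
  assumes an: "real_analytic_at S (0, \<delta>)" and c: "(\<lambda>x. S (x, \<delta>)) has_fps_expansion c"
  shows "(\<lambda>x. hquot S (x, \<delta>)) has_fps_expansion fps_shift 1 c"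
proof -
  obtain d where d: "(\<lambda>x. hquot S (x, \<delta>)) has_fps_expansion d"
    using real_analytic_at_imp_fps[OF analytic_restrict_snd[OF hquot_analytic[OF an]]] .
  have "(\<lambda>x. S (0, \<delta>) + x * hquot S (x, \<delta>)) has_fps_expansion (fps_const (S (0, \<delta>)) + fps_X * d)"
    by (intro fps_expansion_intros d)
  then have "c = fps_const (S (0, \<delta>)) + fps_X * d"
    using has_fps_expansion_unique_real[OF c] hquot_eq[of S _ \<delta>, symmetric] by simp
  then have "fps_shift 1 c = d" by (intro fps_ext) simp
  then show ?thesis using d by simp
qed

text \<open>Taylor coefficients become values of an analytic function at (0, \<delta>), so they
  depend analytically on \<delta>.\<close>

lemma fps_nth_eq_hquot_power:
  assumes "real_analytic_at S (0, \<delta>)" "(\<lambda>x. S (x, \<delta>)) has_fps_expansion c"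
  shows "fps_nth c j = (hquot ^^ j) S (0, \<delta>)"
  using assms
proof (induction j arbitrary: S c)
  case 0
  then show ?case using has_fps_expansion_0_eq[OF 0(2)] by simp
next
  case (Suc j)
  have "fps_nth (fps_shift 1 c) j = (hquot ^^ j) (hquot S) (0, \<delta>)"
    by (rule Suc.IH[OF hquot_analytic[OF Suc.prems(1)] hquot_fps[OF Suc.prems]])
  then show ?case by (simp add: funpow_swap1)
qed

section \<open>Taylor coefficients of the flow as functions of the parameter\<close>

text \<open>Change of base point: the germ at (0, p) also describes the flow at nearby parameters,
  since the small orbits of both germs solve the same equation within the Lipschitz region.\<close>

lemma ode_flow_agree:
  fixes f :: "real \<times> real \<times> 'd::euclidean_space \<Rightarrow> real"
  assumes "a \<le> b" and an: "\<And>t. t \<in> {a..b} \<Longrightarrow> real_analytic_at f (t, 0, p)" and S: "ode_flow f p a b S"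
  shows "\<forall>\<^sub>F \<delta> in nhds p. \<forall>S'. ode_flow f \<delta> a b S' \<longrightarrow> (\<forall>\<^sub>F x in nhds 0. S' (x, \<delta>) = S (x, \<delta>))"
proof -
  obtain \<eta> L where \<eta>: "\<eta> > 0" and lip: "\<And>t r r' \<delta>. t \<in> {a..b} \<Longrightarrow> \<bar>r\<bar> \<le> \<eta> \<Longrightarrow> \<bar>r'\<bar> \<le> \<eta> \<Longrightarrow> dist \<delta> p < \<eta> \<Longrightarrow>
     \<bar>f (t, r, \<delta>) - f (t, r', \<delta>)\<bar> \<le> L * \<bar>r - r'\<bar>"
    using ode_lipschitz[OF assms(1) an] by blast
  have ev: "\<forall>\<^sub>F y in nhds (0, p). \<exists>r. ode_sol f (snd y) a b r \<and> r a = fst y \<and> r b = S y \<and> (\<forall>t\<in>{a..b}. \<bar>r t\<bar> < \<eta>)"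
    using S \<eta> by (simp add: ode_flow_def)
  then obtain e where e: "e > 0" "\<And>y. dist y (0, p) < e \<Longrightarrow>
     \<exists>r. ode_sol f (snd y) a b r \<and> r a = fst y \<and> r b = S y \<and> (\<forall>t\<in>{a..b}. \<bar>r t\<bar> < \<eta>)"
    unfolding eventually_nhds_metric by blast
  \<comment> \<open>Half of e is reserved for x and half for \<delta>, so that the pair stays within
    e of (0, p).\<close>
  have "\<forall>\<^sub>F x in nhds 0. S' (x, \<delta>) = S (x, \<delta>)"
    if d: "dist \<delta> p < min \<eta> (e / 2)" and S': "ode_flow f \<delta> a b S'" for \<delta> S'
  proof -
    have "\<forall>\<^sub>F y in nhds (0, \<delta>). \<exists>r. ode_sol f (snd y) a b r \<and> r a = fst y \<and> r b = S' y \<and> (\<forall>t\<in>{a..b}. \<bar>r t\<bar> < \<eta>)"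
      using S' \<eta> by (simp add: ode_flow_def)
    from eventually_nhds_Pair_const[OF this]
    have 1: "\<forall>\<^sub>F x in nhds 0. \<exists>r. ode_sol f \<delta> a b r \<and> r a = x \<and> r b = S' (x, \<delta>) \<and> (\<forall>t\<in>{a..b}. \<bar>r t\<bar> < \<eta>)"
      by simp
    have "\<forall>\<^sub>F x in nhds (0 :: real). dist x 0 < e / 2"
      using e(1) by (intro eventually_nhds_metric[THEN iffD2] exI[of _ "e / 2"]) auto
    then show ?thesis using 1
    proof eventually_elim
      case (elim x)
      have "dist (x, \<delta>) (0, p) \<le> dist x 0 + dist \<delta> p"
        using sqrt_sum_squares_le_sum[of "dist x 0" "dist \<delta> p"] by (simp add: dist_Pair_Pair)
      then have "dist (x, \<delta>) (0, p) < e" using elim(1) d by simp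
      from e(2)[OF this] obtain r where r: "ode_sol f \<delta> a b r" "r a = x" "r b = S (x, \<delta>)" "\<forall>t\<in>{a..b}. \<bar>r t\<bar> < \<eta>" by auto
      obtain r' where r': "ode_sol f \<delta> a b r'" "r' a = x" "r' b = S' (x, \<delta>)" "\<forall>t\<in>{a..b}. \<bar>r' t\<bar> < \<eta>"
        using elim(2) by auto
      have "r' b = r b"
      proof (rule ode_sol_unique[OF r'(1) r(1), of L b])
        fix t assume t: "t \<in> {a..b}"
        have "\<bar>r' t\<bar> \<le> \<eta>" "\<bar>r t\<bar> \<le> \<eta>" using r(4) r'(4) t by (auto simp: less_imp_le)
        then show "\<bar>f (t, r' t, \<delta>) - f (t, r t, \<delta>)\<bar> \<le> L * \<bar>r' t - r t\<bar>"
          using d by (intro lip[OF t]) auto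
      qed (use r r' assms(1) in auto)
      then show ?case using r r' by simp
    qed
  qed
  then show ?thesis
    unfolding eventually_nhds_metric using \<eta> e(1) by (intro exI[of _ "min \<eta> (e / 2)"]) auto
qed

text \<open>The equation keeps the zero solution at all parameters, not just over D, so flow germs
  exist on an open set around D.\<close>

theorem ode_flow_coefficients:
  fixes f :: "real \<times> real \<times> 'd::euclidean_space \<Rightarrow> real"
  assumes "a \<le> b" and an: "\<And>p t. p \<in> D \<Longrightarrow> t \<in> {a..b} \<Longrightarrow> real_analytic_at f (t, 0, p)"
    and f0: "\<And>t \<delta>. f (t, 0, \<delta>) = 0"
  obtains U \<sigma> where "open U" "D \<subseteq> U" "\<And>j p. p \<in> U \<Longrightarrow> real_analytic_at (\<sigma> j) p"
    "\<And>p. p \<in> D \<Longrightarrow> \<exists>S. ode_flow f p a b S \<and> (\<lambda>x. S (x, p)) has_fps_expansion Abs_fps (\<lambda>j. \<sigma> j p)"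
proof -
  \<comment> \<open>Openness of U is a tube argument over the compact interval.\<close>
  define U where "U = {p. \<forall>t\<in>{a..b}. real_analytic_at f (t, 0, p)}"
  have "open U"
    unfolding open_dist
  proof
    fix p assume p: "p \<in> U"
    let ?K = "(\<lambda>t. (t, 0 :: real, p)) ` {a..b}"
    have "compact ?K" by (intro compact_continuous_image continuous_intros) auto
    moreover have "?K \<subseteq> {z. real_analytic_at f z}" using p by (auto simp: U_def)
    ultimately obtain e where e: "e > 0" "(\<Union>z\<in>?K. ball z e) \<subseteq> {z. real_analytic_at f z}"
      using compact_subset_open_imp_ball_epsilon_subset[OF _ open_analytic_at, of ?K f] by blast
    have "q \<in> U" if q: "dist q p < e" for q
    proof -
      have "real_analytic_at f (t, 0, q)" if t: "t \<in> {a..b}" for t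
      proof -
        have "(t, 0, q) \<in> ball (t, 0, p) e" using q by (simp add: dist_Pair_Pair dist_commute)
        then show ?thesis using e(2) t by blast
      qed
      then show ?thesis by (simp add: U_def)
    qed
    then show "\<exists>e>0. \<forall>q. dist q p < e \<longrightarrow> q \<in> U" using e(1) by blast
  qed
  have DU: "D \<subseteq> U" using an by (auto simp: U_def)
  have anU: "real_analytic_at f (t, 0, p)" if "p \<in> U" "t \<in> {a..b}" for p t using that by (simp add: U_def)
  \<comment> \<open>The germs are chosen independently at each parameter;
    \<open>ode_flow_agree\<close> makes the coefficients insensitive to the choice.\<close>
  define Sf where "Sf = (\<lambda>p. SOME S. ode_flow f p a b S)"
  have Sf: "ode_flow f p a b (Sf p)" if "p \<in> U" for p
    unfolding Sf_def using ode_flow_exists[OF assms(1) anU[OF that] f0] by (rule someI_ex)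
  define \<sigma> where "\<sigma> = (\<lambda>j p. (hquot ^^ j) (Sf p) (0, p))"
  have Sa: "real_analytic_at (Sf p) (0, p)" if "p \<in> U" for p using Sf[OF that] by (simp add: ode_flow_def)
  have fps: "(\<lambda>x. Sf p (x, p)) has_fps_expansion Abs_fps (\<lambda>j. \<sigma> j p)" if p: "p \<in> U" for p
  proof -
    obtain c where c: "(\<lambda>x. Sf p (x, p)) has_fps_expansion c"
      using real_analytic_at_imp_fps[OF analytic_restrict_snd[OF Sa[OF p]]] .
    have "c = Abs_fps (\<lambda>j. \<sigma> j p)"
      by (rule fps_ext) (simp add: \<sigma>_def fps_nth_eq_hquot_power[OF Sa[OF p] c])
    then show ?thesis using c by simp
  qed
  have \<sigma>: "real_analytic_at (\<sigma> j) p" if p: "p \<in> U" for j p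
  proof -
    have ga: "real_analytic_at (\<lambda>\<delta>. (hquot ^^ j) (Sf p) (0, \<delta>)) p"
      using hquot_power_analytic[OF Sa[OF p], of j]
      by (intro real_analytic_at_comp[of "(hquot ^^ j) (Sf p)" "\<lambda>\<delta>. (0, \<delta>)"] analytic_map_at_Pair analytic_map_at_id analytic_map_at_const)
    have "\<forall>\<^sub>F y in nhds (0, p). real_analytic_at (Sf p) y" using real_analytic_at_eventually[OF Sa[OF p]] .
    moreover have "filterlim (\<lambda>\<delta>. (0 :: real, \<delta>)) (nhds (0, p)) (nhds p)"
      by (intro tendsto_intros filterlim_ident)
    ultimately have e1: "\<forall>\<^sub>F \<delta> in nhds p. real_analytic_at (Sf p) (0, \<delta>)" by (simp add: filterlim_iff)
    have e2: "\<forall>\<^sub>F \<delta> in nhds p. \<delta> \<in> U" using p \<open>open U\<close> by (simp add: eventually_nhds_in_open)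
    have e0: "\<forall>\<^sub>F \<delta> in nhds p. \<forall>S'. ode_flow f \<delta> a b S' \<longrightarrow> (\<forall>\<^sub>F x in nhds 0. S' (x, \<delta>) = Sf p (x, \<delta>))"
      by (rule ode_flow_agree[OF assms(1) _ Sf[OF p]]) (rule anU[OF p])
    \<comment> \<open>Near p all coefficients can be read off from the single germ
      \<open>Sf p\<close>, whose iterated quotients are analytic.\<close>
    have "\<forall>\<^sub>F \<delta> in nhds p. (hquot ^^ j) (Sf p) (0, \<delta>) = \<sigma> j \<delta>"
      using e0 e1 e2
    proof eventually_elim
      case (elim \<delta>)
      then have "\<forall>\<^sub>F x in nhds 0. Sf \<delta> (x, \<delta>) = Sf p (x, \<delta>)" using Sf[OF elim(3)] by blast
      then have "(\<lambda>x. Sf p (x, \<delta>)) has_fps_expansion Abs_fps (\<lambda>j. \<sigma> j \<delta>)"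
        using has_fps_expansion_cong_ev[OF fps[OF elim(3)]] by simp
      then show ?case using fps_nth_eq_hquot_power[OF elim(2), of _ j] by fastforce
    qed
    then show ?thesis using ga real_analytic_at_cong by fast
  qed
  show ?thesis
  proof (rule that[of U \<sigma>])
    fix p assume "p \<in> D"
    then have "p \<in> U" using DU by blast
    then show "\<exists>S. ode_flow f p a b S \<and> (\<lambda>x. S (x, p)) has_fps_expansion Abs_fps (\<lambda>j. \<sigma> j p)"
      using fps Sf by blast
  qed (use \<open>open U\<close> DU \<sigma> in auto)
qed

section \<open>Ideals of focus values\<close>

lemma real_analytic_on_cong:
  assumes "real_analytic_on f S" "\<And>x. x \<in> S \<Longrightarrow> f x = g x"
  shows "real_analytic_on g S"
proof -
  obtain U h where "open U" "S \<subseteq> U" "\<forall>p\<in>U. real_analytic_at h p" "\<forall>x\<in>S. h x = f x"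
    using assms(1) unfolding real_analytic_on_def by blast
  then show ?thesis unfolding real_analytic_on_def using assms(2) by (intro exI[of _ U] exI[of _ h]) auto
qed

lemma real_analytic_onI:
  assumes "open U" "S \<subseteq> U" "\<And>p. p \<in> U \<Longrightarrow> real_analytic_at f p"
  shows "real_analytic_on f S"
  unfolding real_analytic_on_def using assms by blast

lemma real_analytic_on_binop:
  fixes f g :: "'a::euclidean_space \<Rightarrow> real"
  assumes "real_analytic_on f S" "real_analytic_on g S"
    and op: "\<And>(f :: 'a \<Rightarrow> real) g p. real_analytic_at f p \<Longrightarrow> real_analytic_at g p \<Longrightarrow> real_analytic_at (\<lambda>x. F (f x) (g x)) p"
  shows "real_analytic_on (\<lambda>x. F (f x) (g x)) S"
proof -
  obtain U h where 1: "open U" "S \<subseteq> U" "\<forall>p\<in>U. real_analytic_at h p" "\<forall>x\<in>S. h x = f x"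
    using assms(1) unfolding real_analytic_on_def by blast
  obtain V k where 2: "open V" "S \<subseteq> V" "\<forall>p\<in>V. real_analytic_at k p" "\<forall>x\<in>S. k x = g x"
    using assms(2) unfolding real_analytic_on_def by blast
  have "\<forall>p\<in>U \<inter> V. real_analytic_at (\<lambda>x. F (h x) (k x)) p"
  proof
    fix p assume "p \<in> U \<inter> V"
    then show "real_analytic_at (\<lambda>x. F (h x) (k x)) p" using 1(3) 2(3) by (intro op) auto
  qed
  then show ?thesis
    unfolding real_analytic_on_def using 1 2
    by (intro exI[of _ "U \<inter> V"] exI[of _ "\<lambda>x. F (h x) (k x)"]) auto
qed

lemma real_analytic_on_add:
  "real_analytic_on f S \<Longrightarrow> real_analytic_on g S \<Longrightarrow> real_analytic_on (\<lambda>x. f x + g x) S"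
  by (rule real_analytic_on_binop) (auto intro: real_analytic_at_add)

lemma real_analytic_on_diff:
  "real_analytic_on f S \<Longrightarrow> real_analytic_on g S \<Longrightarrow> real_analytic_on (\<lambda>x. f x - g x) S"
  by (rule real_analytic_on_binop) (auto intro: real_analytic_at_diff)

lemma real_analytic_on_mult:
  "real_analytic_on f S \<Longrightarrow> real_analytic_on g S \<Longrightarrow> real_analytic_on (\<lambda>x. f x * g x) S"
  by (rule real_analytic_on_binop) (auto intro: real_analytic_at_mult)

lemma real_analytic_on_const: "real_analytic_on (\<lambda>x. c) S"
  by (rule real_analytic_onI[of UNIV]) (auto intro: real_analytic_at_const)

lemma real_analytic_on_sum:
  "(\<And>i. i \<in> A \<Longrightarrow> real_analytic_on (f i) S) \<Longrightarrow> real_analytic_on (\<lambda>x. \<Sum>i\<in>A. f i x) S"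
  by (induction A rule: infinite_finite_induct) (auto intro: real_analytic_on_add real_analytic_on_const)

lemma real_analytic_on_power: "real_analytic_on f S \<Longrightarrow> real_analytic_on (\<lambda>x. f x ^ k) S"
  by (induction k) (auto intro: real_analytic_on_mult real_analytic_on_const)

text \<open>The denominator is nonzero on S, so the neighbourhood is cut down to where its extension
  is nonzero.\<close>

lemma real_analytic_on_divide:
  assumes "real_analytic_on f S" "real_analytic_on g S" "\<And>x. x \<in> S \<Longrightarrow> g x \<noteq> 0"
  shows "real_analytic_on (\<lambda>x. f x / g x) S"
proof -
  obtain U h where 1: "open U" "S \<subseteq> U" "\<forall>p\<in>U. real_analytic_at h p" "\<forall>x\<in>S. h x = f x"
    using assms(1) unfolding real_analytic_on_def by blast
  obtain V k where 2: "open V" "S \<subseteq> V" "\<forall>p\<in>V. real_analytic_at k p" "\<forall>x\<in>S. k x = g x"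
    using assms(2) unfolding real_analytic_on_def by blast
  have "continuous_on V k"
    using 2 real_analytic_at_isCont by (intro continuous_at_imp_continuous_on) blast
  then have "open (k -` (- {0}) \<inter> V)"
    using continuous_open_preimage[OF _ 2(1) open_Compl[OF closed_singleton], of k 0] by (simp add: Int_commute)
  then show ?thesis
    unfolding real_analytic_on_def using 1 2 assms(3)
    by (intro exI[of _ "U \<inter> (k -` (- {0}) \<inter> V)"] exI[of _ "\<lambda>x. h x / k x"])
      (auto intro!: real_analytic_at_divide)
qed

section \<open>Formal power series with analytic coefficients, and elimination of
  coefficients\<close>

lemma real_analytic_on_fps_mult:
  assumes "\<And>i. real_analytic_on (\<lambda>x. fps_nth (a x) i) S" "\<And>i. real_analytic_on (\<lambda>x. fps_nth (b x) i) S"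
  shows "real_analytic_on (\<lambda>x. fps_nth (a x * b x) i) S"
  unfolding fps_mult_nth by (intro real_analytic_on_sum real_analytic_on_mult assms)

lemma real_analytic_on_fps_power:
  assumes "\<And>i. real_analytic_on (\<lambda>x. fps_nth (a x) i) S"
  shows "real_analytic_on (\<lambda>x. fps_nth (a x ^ k) i) S"
proof (induction k arbitrary: i)
  case 0
  then show ?case by (simp add: fps_one_nth real_analytic_on_const)
next
  case (Suc k)
  then show ?case by (simp add: real_analytic_on_fps_mult assms)
qed

lemma real_analytic_on_fps_compose:
  assumes "\<And>i. real_analytic_on (\<lambda>x. fps_nth (a x) i) S" "\<And>i. real_analytic_on (\<lambda>x. fps_nth (b x) i) S"
  shows "real_analytic_on (\<lambda>x. fps_nth (a x oo b x) i) S"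
  unfolding fps_compose_nth by (intro real_analytic_on_sum real_analytic_on_mult assms real_analytic_on_fps_power)

text \<open>The polynomial quotient of P^k - x^k by P - x.\<close>

definition fps_secant :: "nat \<Rightarrow> real fps \<Rightarrow> real fps" where
  "fps_secant k P = (\<Sum>i<k. P ^ i * fps_X ^ (k - Suc i))"

lemma fps_secant: "P ^ k - fps_X ^ k = (P - fps_X) * fps_secant k P"
  unfolding fps_secant_def using diff_power_eq_sum[of P _ fps_X]
  by (cases k) (simp_all add: lessThan_Suc_atMost[symmetric] power_diff_sumr2 mult.commute)

lemma fps_secant_nth_0:
  assumes "fps_nth P 0 = 0"
  shows "fps_nth (fps_secant k P) 0 = (if k = 1 then 1 else 0)"
proof -
  have "fps_nth (P ^ i * fps_X ^ (k - Suc i)) 0 = (if k = 1 then 1 else 0)" if "i < k" for i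
    using that assms by (auto simp: fps_power_zeroth power_0_left)
  then have "fps_nth (fps_secant k P) 0 = (\<Sum>i<k. if k = 1 then 1 else 0)"
    unfolding fps_secant_def fps_sum_nth by (intro sum.cong) auto
  then show ?thesis by simp
qed

lemma real_analytic_on_fps_secant:
  assumes "\<And>i. real_analytic_on (\<lambda>x. fps_nth (P x) i) S"
  shows "real_analytic_on (\<lambda>x. fps_nth (fps_secant k (P x)) i) S"
  unfolding fps_secant_def fps_sum_nth
  by (intro real_analytic_on_sum real_analytic_on_fps_mult real_analytic_on_fps_power assms)
    (simp add: fps_X_power_nth real_analytic_on_const)

text \<open>Each difference P^k - x^k contains the factor P - x, so every coefficient of
  \<open>(h oo P) - h\<close> is linear in those of P - x, with weights polynomial in h and
  P.\<close>

lemma fps_compose_diff_nth: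
  assumes "fps_nth P 0 = (0 :: real)"
  shows "fps_nth ((h oo P) - h) m = (\<Sum>j=0..m. fps_nth (P - fps_X) j * (\<Sum>k=0..m. fps_nth h k * fps_nth (fps_secant k P) (m - j)))"
proof -
  have hX: "fps_nth h m = (\<Sum>k=0..m. fps_nth h k * fps_nth (fps_X ^ k) m)"
    using fps_compose_nth[of h fps_X m] by simp
  have "fps_nth ((h oo P) - h) m = (\<Sum>k=0..m. fps_nth h k * fps_nth (P ^ k) m) - (\<Sum>k=0..m. fps_nth h k * fps_nth (fps_X ^ k) m)"
    using hX by (simp add: fps_compose_nth)
  also have "\<dots> = (\<Sum>k=0..m. fps_nth h k * fps_nth (P ^ k - fps_X ^ k) m)"
    unfolding sum_subtractf[symmetric] fps_sub_nth right_diff_distrib ..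
  also have "\<dots> = (\<Sum>k=0..m. \<Sum>j=0..m. fps_nth (P - fps_X) j * (fps_nth h k * fps_nth (fps_secant k P) (m - j)))"
    unfolding fps_secant fps_mult_nth sum_distrib_left by (intro sum.cong refl) (simp add: mult.left_commute)
  also have "\<dots> = (\<Sum>j=0..m. fps_nth (P - fps_X) j * (\<Sum>k=0..m. fps_nth h k * fps_nth (fps_secant k P) (m - j)))"
    by (subst sum.swap) (simp add: sum_distrib_left)
  finally show ?thesis .
qed

text \<open>Both functional equations \<open>P \<circ> h = h \<circ> P\<close> and \<open>P \<circ> h \<circ> P = h\<close> have the form
  \<open>d \<circ> g = \<epsilon> (h \<circ> P - h)\<close> with \<open>d = P - x\<close>; since \<open>h \<circ> P - h\<close> is a multiple of \<open>d\<close>, comparing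
  coefficients expresses \<open>d\<^sub>m\<close> linearly through lower coefficients of \<open>d\<close>.\<close>

lemma fps_focus_relation:
  fixes P h g :: "real fps"
  assumes 0: "fps_nth P 0 = 0" "fps_nth g 0 = 0" and m: "m \<ge> 1"
    and eq: "(P - fps_X) oo g = fps_const \<epsilon> * ((h oo P) - h)"
  shows "fps_nth (P - fps_X) m * (fps_nth g 1 ^ m - \<epsilon> * fps_nth h 1) =
    (\<Sum>j\<in>{1..<m}. fps_nth (P - fps_X) j *
       (\<epsilon> * (\<Sum>k=0..m. fps_nth h k * fps_nth (fps_secant k P) (m - j)) - fps_nth (g ^ j) m))"
proof -
  define d where "d = P - fps_X"
  define s where "s = (\<lambda>j. \<Sum>k=0..m. fps_nth h k * fps_nth (fps_secant k P) (m - j))"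
  have d0: "fps_nth d 0 = 0" using 0 by (simp add: d_def)
  \<comment> \<open>At j = m only the constant terms of the secants enter; they vanish except for k
    = 1. This isolates the leading factor of the relation.\<close>
  have sm: "s m = fps_nth h 1"
  proof -
    have "s m = (\<Sum>k=0..m. if k = 1 then fps_nth h 1 else 0)"
      unfolding s_def by (intro sum.cong) (auto simp: fps_secant_nth_0[OF 0(1)])
    then show ?thesis using m by simp
  qed
  have gm: "fps_nth (g ^ m) m = fps_nth g 1 ^ m"
    using startsby_zero_power_nth_same[OF 0(2)] by simp
  have "(\<Sum>j=0..m. fps_nth d j * fps_nth (g ^ j) m) = \<epsilon> * (\<Sum>j=0..m. fps_nth d j * s j)"
    using arg_cong[OF eq, of "\<lambda>c. fps_nth c m"] fps_compose_diff_nth[OF 0(1), of h m]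
    by (simp add: fps_compose_nth d_def s_def fps_mult_left_const_nth)
  then have "(\<Sum>j=0..m. fps_nth d j * (\<epsilon> * s j - fps_nth (g ^ j) m)) = 0"
    by (simp add: right_diff_distrib sum_subtractf sum_distrib_left mult.left_commute)
  also have "(\<Sum>j=0..m. fps_nth d j * (\<epsilon> * s j - fps_nth (g ^ j) m)) =
     (\<Sum>j\<in>{1..<m}. fps_nth d j * (\<epsilon> * s j - fps_nth (g ^ j) m)) + fps_nth d m * (\<epsilon> * s m - fps_nth (g ^ m) m)"
  proof -
    have "{0..m} = insert 0 (insert m {1..<m})" using m by auto
    then show ?thesis using m d0 by simp
  qed
  finally have "(\<Sum>j\<in>{1..<m}. fps_nth d j * (\<epsilon> * s j - fps_nth (g ^ j) m)) = fps_nth d m * (fps_nth g 1 ^ m - \<epsilon> * fps_nth h 1)"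
    unfolding sm gm by (simp only: right_diff_distrib)
  then show ?thesis by (simp only: d_def s_def)
qed

text \<open>Strong induction: the relation expresses v m through all lower v j, and those with bad
  index have already been expressed through good ones; the nonvanishing e m is then divided
  out.\<close>

lemma ideal_elimination:
  fixes v :: "nat \<Rightarrow> 'd::euclidean_space \<Rightarrow> real" and good :: "nat \<Rightarrow> bool"
  assumes w: "\<And>m j. real_analytic_on (w m j) D" and e: "\<And>m. real_analytic_on (e m) D"
    and ne: "\<And>m \<delta>. m \<ge> 1 \<Longrightarrow> \<not> good m \<Longrightarrow> \<delta> \<in> D \<Longrightarrow> e m \<delta> \<noteq> 0"
    and rel: "\<And>m \<delta>. m \<ge> 1 \<Longrightarrow> \<not> good m \<Longrightarrow> \<delta> \<in> D \<Longrightarrow> v m \<delta> * e m \<delta> = (\<Sum>j\<in>{1..<m}. v j \<delta> * w m j \<delta>)"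
  shows "m \<ge> 1 \<Longrightarrow> \<not> good m \<Longrightarrow>
    \<exists>\<psi>. (\<forall>i. real_analytic_on (\<psi> i) D) \<and> (\<forall>\<delta>\<in>D. v m \<delta> = (\<Sum>i | 1 \<le> i \<and> i < m \<and> good i. \<psi> i \<delta> * v i \<delta>))"
proof (induction m rule: less_induct)
  case (less m)
  let ?G = "\<lambda>m. {i. 1 \<le> i \<and> i < m \<and> good i}" and ?B = "{j. 1 \<le> j \<and> j < m \<and> \<not> good j}"
  have "\<forall>j\<in>?B. \<exists>\<psi>. (\<forall>i. real_analytic_on (\<psi> i) D) \<and> (\<forall>\<delta>\<in>D. v j \<delta> = (\<Sum>i\<in>?G j. \<psi> i \<delta> * v i \<delta>))"
    using less.IH by auto
  from bchoice[OF this] obtain \<psi> where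
    "\<forall>j\<in>?B. (\<forall>i. real_analytic_on (\<psi> j i) D) \<and> (\<forall>\<delta>\<in>D. v j \<delta> = (\<Sum>i\<in>?G j. \<psi> j i \<delta> * v i \<delta>))" ..
  then have \<psi>: "\<And>j i. j \<in> ?B \<Longrightarrow> real_analytic_on (\<psi> j i) D"
    "\<And>j \<delta>. j \<in> ?B \<Longrightarrow> \<delta> \<in> D \<Longrightarrow> v j \<delta> = (\<Sum>i\<in>?G j. \<psi> j i \<delta> * v i \<delta>)"
    by blast+
  have fin: "finite (?G k)" "finite ?B" for k by auto
  \<comment> \<open>The direct weight of v i, plus what arrives through the bad indices j; such a j
    involves only generators with i < j.\<close>
  define \<xi> where "\<xi> = (\<lambda>i \<delta>. (w m i \<delta> + (\<Sum>j\<in>?B. if i < j then w m j \<delta> * \<psi> j i \<delta> else 0)) / e m \<delta>)"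
  define \<xi>' where "\<xi>' = (\<lambda>i \<delta>. (w m i \<delta> + (\<Sum>j\<in>?B. if i < j then w m j \<delta> * \<psi> j i \<delta> else 0)))"
  have \<xi>'a: "real_analytic_on (\<xi>' i) D" for i
  proof -
    have "real_analytic_on (\<lambda>\<delta>. if i < j then w m j \<delta> * \<psi> j i \<delta> else 0) D" if "j \<in> ?B" for j
      using real_analytic_on_mult[OF w \<psi>(1)[OF that]] real_analytic_on_const by (cases "i < j") auto
    then show ?thesis unfolding \<xi>'_def by (intro real_analytic_on_add real_analytic_on_sum w)
  qed
  have \<xi>a: "real_analytic_on (\<xi> i) D" for i
    using real_analytic_on_divide[OF \<xi>'a e] ne less.prems unfolding \<xi>_def \<xi>'_def by blast
  have "v m \<delta> = (\<Sum>i\<in>?G m. \<xi> i \<delta> * v i \<delta>)" if \<delta>: "\<delta> \<in> D" for \<delta>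
  proof -
    have "{1..<m} = ?G m \<union> ?B" "?G m \<inter> ?B = {}" by auto
    then have "v m \<delta> * e m \<delta> = (\<Sum>i\<in>?G m. v i \<delta> * w m i \<delta>) + (\<Sum>j\<in>?B. v j \<delta> * w m j \<delta>)"
      using rel[OF less.prems \<delta>] fin by (simp add: sum.union_disjoint)
    also have "(\<Sum>j\<in>?B. v j \<delta> * w m j \<delta>) = (\<Sum>j\<in>?B. \<Sum>i\<in>?G m. (if i < j then w m j \<delta> * \<psi> j i \<delta> else 0) * v i \<delta>)"
    proof (rule sum.cong[OF refl])
      fix j assume j: "j \<in> ?B"
      have "(\<Sum>i\<in>?G m. (if i < j then w m j \<delta> * \<psi> j i \<delta> else 0) * v i \<delta>) = (\<Sum>i\<in>?G j. w m j \<delta> * \<psi> j i \<delta> * v i \<delta>)"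
        by (rule sum.mono_neutral_cong_right) (use j fin in auto)
      then show "v j \<delta> * w m j \<delta> = (\<Sum>i\<in>?G m. (if i < j then w m j \<delta> * \<psi> j i \<delta> else 0) * v i \<delta>)"
        using \<psi>(2)[OF j \<delta>] by (simp add: sum_distrib_left mult_ac)
    qed
    also have "\<dots> = (\<Sum>i\<in>?G m. (\<Sum>j\<in>?B. if i < j then w m j \<delta> * \<psi> j i \<delta> else 0) * v i \<delta>)"
      by (subst sum.swap) (simp add: sum_distrib_right)
    also have "(\<Sum>i\<in>?G m. v i \<delta> * w m i \<delta>) + \<dots> = (\<Sum>i\<in>?G m. \<xi>' i \<delta> * v i \<delta>)"
      unfolding \<xi>'_def sum.distrib[symmetric] by (intro sum.cong refl) (simp add: algebra_simps)
    finally have "v m \<delta> = (\<Sum>i\<in>?G m. \<xi>' i \<delta> * v i \<delta>) / e m \<delta>"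
      using ne[OF less.prems \<delta>] by (simp add: field_simps)
    also have "\<dots> = (\<Sum>i\<in>?G m. \<xi> i \<delta> * v i \<delta>)"
      unfolding sum_divide_distrib by (intro sum.cong refl) (simp add: \<xi>_def \<xi>'_def)
    finally show ?thesis .
  qed
  then show ?case using \<xi>a by blast
qed

text \<open>All weights are polynomials in finitely many coefficients of P, h and g, hence analytic
  on D.\<close>

lemma focus_ideal:
  fixes P h g :: "'d::euclidean_space \<Rightarrow> real fps" and good :: "nat \<Rightarrow> bool"
  assumes an: "\<And>j. real_analytic_on (\<lambda>\<delta>. fps_nth (P \<delta>) j) D" "\<And>j. real_analytic_on (\<lambda>\<delta>. fps_nth (h \<delta>) j) D"
      "\<And>j. real_analytic_on (\<lambda>\<delta>. fps_nth (g \<delta>) j) D"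
    and 0: "\<And>\<delta>. \<delta> \<in> D \<Longrightarrow> fps_nth (P \<delta>) 0 = 0" "\<And>\<delta>. \<delta> \<in> D \<Longrightarrow> fps_nth (g \<delta>) 0 = 0"
    and eq: "\<And>\<delta>. \<delta> \<in> D \<Longrightarrow> (P \<delta> - fps_X) oo g \<delta> = fps_const \<epsilon> * ((h \<delta> oo P \<delta>) - h \<delta>)"
    and ne: "\<And>m \<delta>. m \<ge> 1 \<Longrightarrow> \<not> good m \<Longrightarrow> \<delta> \<in> D \<Longrightarrow> fps_nth (g \<delta>) 1 ^ m - \<epsilon> * fps_nth (h \<delta>) 1 \<noteq> 0"
    and m: "m \<ge> 1" "\<not> good m"
  shows "\<exists>\<psi>. (\<forall>i. real_analytic_on (\<psi> i) D) \<and> (\<forall>\<delta>\<in>D. fps_nth (P \<delta> - fps_X) m =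
     (\<Sum>i | 1 \<le> i \<and> i < m \<and> good i. \<psi> i \<delta> * fps_nth (P \<delta> - fps_X) i))"
proof (rule ideal_elimination[where v = "\<lambda>m \<delta>. fps_nth (P \<delta> - fps_X) m"
      and e = "\<lambda>m \<delta>. fps_nth (g \<delta>) 1 ^ m - \<epsilon> * fps_nth (h \<delta>) 1"
      and w = "\<lambda>m j \<delta>. \<epsilon> * (\<Sum>k=0..m. fps_nth (h \<delta>) k * fps_nth (fps_secant k (P \<delta>)) (m - j)) - fps_nth (g \<delta> ^ j) m"])
  fix m j
  show "real_analytic_on (\<lambda>\<delta>. \<epsilon> * (\<Sum>k=0..m. fps_nth (h \<delta>) k * fps_nth (fps_secant k (P \<delta>)) (m - j)) - fps_nth (g \<delta> ^ j) m) D"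
    by (intro real_analytic_on_diff real_analytic_on_mult real_analytic_on_const real_analytic_on_sum
        real_analytic_on_fps_secant real_analytic_on_fps_power an)
  show "real_analytic_on (\<lambda>\<delta>. fps_nth (g \<delta>) 1 ^ m - \<epsilon> * fps_nth (h \<delta>) 1) D"
    by (intro real_analytic_on_diff real_analytic_on_mult real_analytic_on_const real_analytic_on_power an)
next
  fix m :: nat and \<delta> assume "1 \<le> m" "\<not> good m" "\<delta> \<in> D"
  then show "fps_nth (P \<delta> - fps_X) m * (fps_nth (g \<delta>) 1 ^ m - \<epsilon> * fps_nth (h \<delta>) 1) = (\<Sum>j\<in>{1..<m}.
     fps_nth (P \<delta> - fps_X) j * (\<epsilon> * (\<Sum>k=0..m. fps_nth (h \<delta>) k * fps_nth (fps_secant k (P \<delta>)) (m - j)) - fps_nth (g \<delta> ^ j) m))"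
    by (intro fps_focus_relation 0 eq)
qed (use ne m in auto)

section \<open>Analytic solutions of implicit equations\<close>

lemmas analytic_intros =
  real_analytic_at_add real_analytic_at_diff real_analytic_at_mult real_analytic_at_minus
  real_analytic_at_power real_analytic_at_const real_analytic_at_sum
  analytic_map_at_Pair analytic_map_at_id analytic_map_at_const analytic_map_at_fst analytic_map_at_snd
  analytic_map_at_fst' analytic_map_at_snd'

lemma dist_triple_less:
  fixes x y x' y' :: real
  assumes "\<bar>x - x'\<bar> < e / 3" "\<bar>y - y'\<bar> < e / 3" "dist \<delta> p < e / 3"
  shows "dist (x, y, \<delta>) (x', y', p) < e"
proof -
  have "dist (x, y, \<delta>) (x', y', p) \<le> dist x x' + dist (y, \<delta>) (y', p)"
    using sqrt_sum_squares_le_sum[of "dist x x'" "dist (y, \<delta>) (y', p)"] by (simp add: dist_Pair_Pair)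
  also have "dist (y, \<delta>) (y', p) \<le> dist y y' + dist \<delta> p"
    using sqrt_sum_squares_le_sum[of "dist y y'" "dist \<delta> p"] by (simp add: dist_Pair_Pair)
  finally show ?thesis using assms by (simp add: dist_real_def)
qed

lemma frechet_scaled:
  assumes "real_analytic_at f z"
  shows "frechet_derivative f (at z) (c *\<^sub>R v) = c * frechet_derivative f (at z) v"
  using linear_cmul[OF linear_frechet_derivative[OF real_analytic_at_differentiable[OF assms]]] by simp

lemma frechet_add:
  assumes "real_analytic_at f z"
  shows "frechet_derivative f (at z) (v + w) = frechet_derivative f (at z) v + frechet_derivative f (at z) w"
  using linear_add[OF linear_frechet_derivative[OF real_analytic_at_differentiable[OF assms]]] by simp

lemma eventually_nhds_triple:
  fixes x0 y0 :: real
  assumes "\<epsilon> > 0"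
  shows "\<forall>\<^sub>F z in nhds (x0, y0, p). \<bar>fst z - x0\<bar> < \<epsilon> \<and> \<bar>fst (snd z) - y0\<bar> < \<epsilon> \<and> dist (snd (snd z)) p < \<epsilon>"
proof -
  have "\<bar>fst z - x0\<bar> < \<epsilon> \<and> \<bar>fst (snd z) - y0\<bar> < \<epsilon> \<and> dist (snd (snd z)) p < \<epsilon>" if "dist z (x0, y0, p) < \<epsilon>" for z
    using that dist_fst_le[of z "(x0, y0, p)"] dist_snd_le[of z "(x0, y0, p)"]
      dist_fst_le[of "snd z" "(y0, p)"] dist_snd_le[of "snd z" "(y0, p)"]
    by (auto simp: dist_real_def)
  then show ?thesis unfolding eventually_nhds_metric using assms by blast
qed

text \<open>The implicit function theorem by continuation: solutions r(t) of r + t H(x, r, \<delta>)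
  = u start at r = u and obey r' = - H / (1 + t Hy), so r(1) is an analytic flow. Compactness of D
  makes \<eta> uniform.\<close>

lemma analytic_implicit:
  fixes H :: "real \<times> real \<times> 'd::euclidean_space \<Rightarrow> real"
  defines "Hy \<equiv> \<lambda>z. frechet_derivative H (at z) (0, 1, 0)"
  assumes D: "compact D" and an: "\<And>p. p \<in> D \<Longrightarrow> real_analytic_at H (0, 0, p)"
    and H0: "\<And>p. p \<in> D \<Longrightarrow> H (0, 0, p) = 0" and Hy0: "\<And>p. p \<in> D \<Longrightarrow> Hy (0, 0, p) = 0"
  obtains \<eta> yy where "\<eta> > 0"
    "\<forall>p\<in>D. \<forall>x y. \<bar>x\<bar> < \<eta> \<longrightarrow> \<bar>y\<bar> < \<eta> \<longrightarrow> real_analytic_at H (x, y, p) \<and> \<bar>Hy (x, y, p)\<bar> < 1 / 2"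
    "\<forall>p\<in>D. \<forall>x y y'. \<bar>x\<bar> < \<eta> \<longrightarrow> \<bar>y\<bar> < \<eta> \<longrightarrow> \<bar>y'\<bar> < \<eta> \<longrightarrow> y + H (x, y, p) = y' + H (x, y', p) \<longrightarrow> y = y'"
    "\<forall>p\<in>D. real_analytic_at yy (0, 0, p) \<and> yy (0, 0, p) = 0"
    "\<forall>p\<in>D. \<forall>\<^sub>F z in nhds (0, 0, p). \<bar>yy z\<bar> < \<eta> \<and> yy z + H (fst z, yy z, snd (snd z)) = fst (snd z)"
proof -
  \<comment> \<open>With Hy below 1/2 in modulus, y + H is strictly increasing in y and the
    denominators 1 + t Hy stay away from 0 for t in [0, 1].\<close>
  let ?W = "{z. real_analytic_at Hy z \<and> \<bar>Hy z\<bar> < 1 / 2} \<inter> {z. real_analytic_at H z}"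
  let ?K = "(\<lambda>p. (0 :: real, 0 :: real, p)) ` D"
  have oW: "open ?W" by (intro open_Int open_analytic_less open_analytic_at)
  have K: "compact ?K" by (intro compact_continuous_image continuous_intros D)
  have anHy: "real_analytic_at Hy z" if "real_analytic_at H z" for z
    unfolding Hy_def by (rule real_analytic_at_frechet[OF that])
  have KW: "?K \<subseteq> ?W" using an anHy Hy0 by auto
  obtain e where e: "e > 0" "(\<Union>z\<in>?K. ball z e) \<subseteq> ?W"
    using compact_subset_open_imp_ball_epsilon_subset[OF K oW KW] by blast
  define \<eta> where "\<eta> = e / 3"
  have \<eta>: "\<eta> > 0" using e by (simp add: \<eta>_def)
  have W: "real_analytic_at H (x, y, \<delta>) \<and> \<bar>Hy (x, y, \<delta>)\<bar> < 1 / 2"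
    if "p \<in> D" "dist \<delta> p < \<eta>" "\<bar>x\<bar> < \<eta>" "\<bar>y\<bar> < \<eta>" for p \<delta> x y
  proof -
    have "dist (x, y, \<delta>) (0, 0, p) < e" by (rule dist_triple_less) (use that in \<open>auto simp: \<eta>_def\<close>)
    then have "(x, y, \<delta>) \<in> ball (0, 0, p) e" by (simp add: dist_commute)
    then show ?thesis using e(2) that(1) by blast
  qed
  have mono: "y + H (x, y, \<delta>) < y' + H (x, y', \<delta>)"
    if "p \<in> D" "dist \<delta> p < \<eta>" "\<bar>x\<bar> < \<eta>" "\<bar>y\<bar> < \<eta>" "\<bar>y'\<bar> < \<eta>" "y < y'" for p \<delta> x y y'
  proof (rule DERIV_pos_imp_increasing[OF that(6)])
    fix s assume "y \<le> s" "s \<le> y'"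
    then have s: "\<bar>s\<bar> < \<eta>" using that by auto
    have "((\<lambda>s. (x, s, \<delta>)) has_vector_derivative (0, 1, 0)) (at s)"
      by (auto intro!: derivative_eq_intros has_vector_derivative_Pair)
    then have "((\<lambda>s. H (x, s, \<delta>)) has_real_derivative Hy (x, s, \<delta>)) (at s)"
      unfolding Hy_def using W[OF that(1-3) s] by (intro real_analytic_at_chain[of H "\<lambda>s. (x, s, \<delta>)"]) auto
    then have "((\<lambda>s. s + H (x, s, \<delta>)) has_real_derivative 1 + Hy (x, s, \<delta>)) (at s)"
      by (auto intro!: derivative_eq_intros)
    then show "\<exists>d. ((\<lambda>s. s + H (x, s, \<delta>)) has_real_derivative d) (at s) \<and> 0 < d"
      using W[OF that(1-3) s] by (intro exI[of _ "1 + Hy (x, s, \<delta>)"]) auto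
  qed
  have inj: "y = y'" if "p \<in> D" "dist \<delta> p < \<eta>" "\<bar>x\<bar> < \<eta>" "\<bar>y\<bar> < \<eta>" "\<bar>y'\<bar> < \<eta>"
      "y + H (x, y, \<delta>) = y' + H (x, y', \<delta>)" for p \<delta> x y y'
    using mono[of p \<delta> x y y'] mono[of p \<delta> x y' y] that by (cases y y' rule: linorder_cases) auto
  \<comment> \<open>Uniqueness of the solution permits one definition for all parameters in D; the
    flow germs below only prove it analytic.\<close>
  define yy where "yy = (\<lambda>z. THE y. \<bar>y\<bar> < \<eta> \<and> y + H (fst z, y, snd (snd z)) = fst (snd z))"
  have main: "real_analytic_at yy (0, 0, p) \<and> yy (0, 0, p) = 0 \<and>
      (\<forall>\<^sub>F z in nhds (0, 0, p). \<bar>yy z\<bar> < \<eta> \<and> yy z + H (fst z, yy z, snd (snd z)) = fst (snd z))"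
    if p: "p \<in> D" for p
  proof -
    \<comment> \<open>For this auxiliary equation x is part of the parameter and u is the initial
      value.\<close>
    define f where "f = (\<lambda>q :: real \<times> real \<times> real \<times> 'd.
      - H (fst (snd (snd q)), fst (snd q), snd (snd (snd q))) /
        (1 + fst q * Hy (fst (snd (snd q)), fst (snd q), snd (snd (snd q)))))"
    have fa: "real_analytic_at f (t, 0, 0, p)" for t
      unfolding f_def
    proof (rule real_analytic_at_divide)
      have g: "analytic_map_at (\<lambda>q :: real \<times> real \<times> real \<times> 'd. (fst (snd (snd q)), fst (snd q), snd (snd (snd q)))) (t, 0, 0, p)"
        by (intro analytic_intros)
      show "real_analytic_at (\<lambda>q :: real \<times> real \<times> real \<times> 'd. - H (fst (snd (snd q)), fst (snd q), snd (snd (snd q)))) (t, 0, 0, p)"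
        using real_analytic_at_comp[of H, OF _ g] an[OF p] by (intro analytic_intros) simp
      show "real_analytic_at (\<lambda>q :: real \<times> real \<times> real \<times> 'd. 1 + fst q * Hy (fst (snd (snd q)), fst (snd q), snd (snd (snd q)))) (t, 0, 0, p)"
        using real_analytic_at_comp[of Hy, OF _ g] anHy[OF an[OF p]]
        by (intro analytic_intros real_analytic_at_realD[OF analytic_map_at_fst]) simp
    qed (use Hy0[OF p] in simp)
    have "\<exists>S. ode_flow f (0, p) 0 1 S"
      by (rule ode_flow_exists) (use fa H0[OF p] in \<open>auto simp: f_def\<close>)
    then obtain S where S: "ode_flow f (0, p) 0 1 S" ..
    then have evS: "\<forall>\<^sub>F y in nhds (0, 0, p). \<exists>r. ode_sol f (snd y) 0 1 r \<and> r 0 = fst y \<and> r 1 = S y \<and> (\<forall>t\<in>{0..1}. \<bar>r t\<bar> < \<eta>)"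
      using \<eta> by (simp add: ode_flow_def)
    \<comment> \<open>The flow takes the initial value u before x.\<close>
    define perm where "perm = (\<lambda>z :: real \<times> real \<times> 'd. (fst (snd z), fst z, snd (snd z)))"
    have pa: "analytic_map_at perm (0, 0, p)" unfolding perm_def by (intro analytic_intros)
    have "filterlim perm (nhds (0, 0, p)) (nhds (0, 0, p))"
      using analytic_map_at_tendsto[OF pa] by (simp add: perm_def)
    from filterlim_iff[THEN iffD1, OF this, rule_format, OF evS]
    have "\<forall>\<^sub>F z in nhds (0, 0, p). \<exists>r. ode_sol f (fst z, snd (snd z)) 0 1 r \<and> r 0 = fst (snd z) \<and> r 1 = S (perm z) \<and> (\<forall>t\<in>{0..1}. \<bar>r t\<bar> < \<eta>)"
      by (simp add: perm_def)
    then have ev: "\<forall>\<^sub>F z in nhds (0, 0, p). yy z = S (perm z) \<and> \<bar>yy z\<bar> < \<eta> \<and> yy z + H (fst z, yy z, snd (snd z)) = fst (snd z)"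
      using eventually_nhds_triple[OF \<eta>, of 0 0 p]
    proof eventually_elim
      case (elim z)
      obtain x u \<delta> where z: "z = (x, u, \<delta>)" by (cases z)
      from elim obtain r where r: "ode_sol f (x, \<delta>) 0 1 r" "r 0 = u" "r 1 = S (perm z)" "\<And>t. t \<in> {0..1} \<Longrightarrow> \<bar>r t\<bar> < \<eta>"
        by (auto simp: z)
      have xd: "\<bar>x\<bar> < \<eta>" "dist \<delta> p < \<eta>" using elim(2) by (auto simp: z)
      \<comment> \<open>The continued equation is a first integral: its left-hand side equals u at t
        = 0, hence also at t = 1.\<close>
      have "\<exists>c. \<forall>t\<in>{0..1}. r t + t * H (x, r t, \<delta>) = c"
      proof (rule has_field_derivative_zero_constant)
        fix t :: real assume t: "t \<in> {0..1}"
        have Wt: "real_analytic_at H (x, r t, \<delta>)" "\<bar>Hy (x, r t, \<delta>)\<bar> < 1 / 2" using W[OF p xd(2,1) r(4)[OF t]] by auto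
        have dr: "(r has_real_derivative f (t, r t, x, \<delta>)) (at t within {0..1})" using ode_solD[OF r(1) t] .
        have "((\<lambda>t. (x, r t, \<delta>)) has_vector_derivative (0, f (t, r t, x, \<delta>), 0)) (at t within {0..1})"
          using dr by (auto intro!: derivative_eq_intros has_vector_derivative_Pair simp: has_real_derivative_iff_has_vector_derivative)
        then have "((\<lambda>t. H (x, r t, \<delta>)) has_real_derivative frechet_derivative H (at (x, r t, \<delta>)) (0, f (t, r t, x, \<delta>), 0)) (at t within {0..1})"
          using Wt by (intro real_analytic_at_chain[of H "\<lambda>t. (x, r t, \<delta>)"])
        moreover have "frechet_derivative H (at (x, r t, \<delta>)) (0, f (t, r t, x, \<delta>), 0) = f (t, r t, x, \<delta>) * Hy (x, r t, \<delta>)"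
          using frechet_scaled[OF Wt(1), of "f (t, r t, x, \<delta>)" "(0, 1, 0)"] by (simp add: Hy_def)
        ultimately have dH: "((\<lambda>t. H (x, r t, \<delta>)) has_real_derivative f (t, r t, x, \<delta>) * Hy (x, r t, \<delta>)) (at t within {0..1})" by simp
        have "\<bar>t * Hy (x, r t, \<delta>)\<bar> \<le> 1 * (1 / 2)"
          unfolding abs_mult using t Wt(2) by (intro mult_mono) auto
        then have nz: "1 + t * Hy (x, r t, \<delta>) \<noteq> 0" by linarith
        have "((\<lambda>t. r t + t * H (x, r t, \<delta>)) has_real_derivative
            f (t, r t, x, \<delta>) + (1 * H (x, r t, \<delta>) + f (t, r t, x, \<delta>) * Hy (x, r t, \<delta>) * t)) (at t within {0..1})"
          by (intro DERIV_add dr DERIV_mult DERIV_ident dH)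
        moreover have "f (t, r t, x, \<delta>) + (1 * H (x, r t, \<delta>) + f (t, r t, x, \<delta>) * Hy (x, r t, \<delta>) * t) = 0"
          using nz by (simp add: f_def field_simps)
        ultimately show "((\<lambda>t. r t + t * H (x, r t, \<delta>)) has_real_derivative 0) (at t within {0..1})" by simp
      qed simp
      then obtain c where "\<And>t. t \<in> {0..1} \<Longrightarrow> r t + t * H (x, r t, \<delta>) = c" by blast
      from this[of 0] this[of 1] have "r 1 + H (x, r 1, \<delta>) = u" using r(2) by simp
      moreover have "\<bar>r 1\<bar> < \<eta>" using r(4)[of 1] by simp
      ultimately have "yy z = r 1"
        unfolding yy_def using inj[OF p xd(2,1)] by (intro the_equality) (auto simp: z)
      then show ?case using \<open>r 1 + H (x, r 1, \<delta>) = u\<close> \<open>\<bar>r 1\<bar> < \<eta>\<close> r(3) by (simp add: z)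
    qed
    have "real_analytic_at (\<lambda>z. S (perm z)) (0, 0, p)"
      using S by (intro real_analytic_at_comp[of S perm, OF _ pa]) (simp add: perm_def ode_flow_def)
    moreover have "\<forall>\<^sub>F z in nhds (0, 0, p). yy z = S (perm z)" using ev by eventually_elim simp
    ultimately have "real_analytic_at yy (0, 0, p)" using real_analytic_at_cong by fast
    moreover have "yy (0, 0, p) = 0"
      using eventually_nhds_x_imp_x[OF ev] S by (simp add: perm_def ode_flow_def)
    ultimately show ?thesis using ev by (auto elim: eventually_mono)
  qed
  show ?thesis
  proof (rule that[of \<eta> yy])
    show "\<forall>p\<in>D. \<forall>x y. \<bar>x\<bar> < \<eta> \<longrightarrow> \<bar>y\<bar> < \<eta> \<longrightarrow> real_analytic_at H (x, y, p) \<and> \<bar>Hy (x, y, p)\<bar> < 1 / 2"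
    proof (intro ballI allI impI)
      fix p x y assume "p \<in> D" "\<bar>x\<bar> < \<eta>" "\<bar>y\<bar> < \<eta>"
      then show "real_analytic_at H (x, y, p) \<and> \<bar>Hy (x, y, p)\<bar> < 1 / 2" using W[of p p x y] \<eta> by simp
    qed
    show "\<forall>p\<in>D. \<forall>x y y'. \<bar>x\<bar> < \<eta> \<longrightarrow> \<bar>y\<bar> < \<eta> \<longrightarrow> \<bar>y'\<bar> < \<eta> \<longrightarrow> y + H (x, y, p) = y' + H (x, y', p) \<longrightarrow> y = y'"
    proof (intro ballI allI impI)
      fix p x y y' assume "p \<in> D" "\<bar>x\<bar> < \<eta>" "\<bar>y\<bar> < \<eta>" "\<bar>y'\<bar> < \<eta>" "y + H (x, y, p) = y' + H (x, y', p)"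
      then show "y = y'" using inj[of p p x y y'] \<eta> by simp
    qed
  qed (use \<eta> main in auto)
qed

section \<open>Preparations for the reduction\<close>

lemma real_analytic_at_lipschitz:
  fixes f :: "'a::euclidean_space \<Rightarrow> real"
  assumes "real_analytic_at f z0"
  obtains e L where "e > 0" "L \<ge> 0" "\<And>z z'. dist z z0 < e \<Longrightarrow> dist z' z0 < e \<Longrightarrow> \<bar>f z - f z'\<bar> \<le> L * dist z z'"
proof -
  define B where "B = (\<lambda>i. \<bar>frechet_derivative f (at z0) i\<bar> + 1)"
  have "\<forall>\<^sub>F z in nhds z0. \<forall>i\<in>Basis. \<bar>frechet_derivative f (at z) i\<bar> < B i"
  proof (subst eventually_ball_finite_distrib[OF finite_Basis], intro ballI)
    fix i :: 'a
    have "z0 \<in> {z. real_analytic_at (\<lambda>z. frechet_derivative f (at z) i) z \<and> \<bar>frechet_derivative f (at z) i\<bar> < B i}"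
      using real_analytic_at_frechet[OF assms] by (simp add: B_def)
    then have "\<forall>\<^sub>F z in nhds z0. z \<in> {z. real_analytic_at (\<lambda>z. frechet_derivative f (at z) i) z \<and> \<bar>frechet_derivative f (at z) i\<bar> < B i}"
      by (rule eventually_nhds_in_open[OF open_analytic_less])
    then show "\<forall>\<^sub>F z in nhds z0. \<bar>frechet_derivative f (at z) i\<bar> < B i" by eventually_elim simp
  qed
  then have "\<forall>\<^sub>F z in nhds z0. real_analytic_at f z \<and> (\<forall>i\<in>Basis. \<bar>frechet_derivative f (at z) i\<bar> < B i)"
    using real_analytic_at_eventually[OF assms] by eventually_elim simp
  then obtain e where e: "e > 0" "\<And>z. dist z z0 < e \<Longrightarrow> real_analytic_at f z \<and> (\<forall>i\<in>Basis. \<bar>frechet_derivative f (at z) i\<bar> < B i)"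
    unfolding eventually_nhds_metric by blast
  define L where "L = (\<Sum>i\<in>Basis. B i)"
  have L: "L \<ge> 0" by (auto simp: L_def B_def intro!: sum_nonneg)
  have "\<bar>f z - f z'\<bar> \<le> L * dist z z'" if z: "dist z z0 < e" "dist z' z0 < e" for z z'
  proof -
    let ?c = "\<lambda>s. z' + s *\<^sub>R (z - z')"
    have inb: "dist (?c s) z0 < e" if "0 \<le> s" "s \<le> 1" for s
    proof -
      have "?c s \<in> ball z0 e"
        using convexD_alt[OF convex_ball, of z' z0 e z s] that z by (simp add: dist_commute algebra_simps)
      then show ?thesis by (simp add: dist_commute)
    qed
    have d: "((\<lambda>s. f (?c s)) has_real_derivative frechet_derivative f (at (?c s)) (z - z')) (at s)"
      if "0 \<le> s" "s \<le> 1" for s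
      using e(2)[OF inb[OF that]] by (intro real_analytic_at_chain[of f ?c]) (auto intro!: derivative_eq_intros)
    obtain s where s: "0 < s" "s < 1" "f (?c 1) - f (?c 0) = (1 - 0) * frechet_derivative f (at (?c s)) (z - z')"
      using MVT2[OF zero_less_one, of "\<lambda>s. f (?c s)" "\<lambda>s. frechet_derivative f (at (?c s)) (z - z')"] d by blast
    let ?f' = "frechet_derivative f (at (?c s))"
    have an: "real_analytic_at f (?c s)" and Bs: "\<And>i. i \<in> Basis \<Longrightarrow> \<bar>?f' i\<bar> < B i"
      using e(2)[OF inb[of s]] s by auto
    have lin: "linear ?f'" using linear_frechet_derivative[OF real_analytic_at_differentiable[OF an]] .
    have "?f' (z - z') = ?f' (\<Sum>i\<in>Basis. ((z - z') \<bullet> i) *\<^sub>R i)" by (simp add: euclidean_representation)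
    also have "\<dots> = (\<Sum>i\<in>Basis. ((z - z') \<bullet> i) * ?f' i)" by (simp add: linear_sum[OF lin] linear_cmul[OF lin])
    finally have "\<bar>?f' (z - z')\<bar> \<le> (\<Sum>i\<in>Basis. \<bar>((z - z') \<bullet> i) * ?f' i\<bar>)" by (simp add: sum_abs)
    also have "\<dots> \<le> (\<Sum>i\<in>Basis. norm (z - z') * B i)"
      unfolding abs_mult by (intro sum_mono mult_mono Basis_le_norm less_imp_le[OF Bs]) auto
    also have "\<dots> = L * dist z z'" by (simp add: L_def sum_distrib_left[symmetric] sum_distrib_right[symmetric] dist_norm mult.commute)
    finally show ?thesis using s(3) by simp
  qed
  with e(1) L show ?thesis by (rule that)
qed

text \<open>At a parameter where g is known to vanish to order N, the N-fold quotient removes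
  exactly x^N, and continuity of V suffices to find its value at 0. At other parameters the same
  quotient discards the lower coefficients.\<close>

lemma hquot_power_vanish:
  fixes g :: "real \<times> 'd::euclidean_space \<Rightarrow> real"
  assumes "real_analytic_at g (0, \<delta>)" "\<forall>\<^sub>F x in nhds 0. g (x, \<delta>) = x ^ N * V x" "isCont V 0"
  shows "g (x, \<delta>) = x ^ N * (hquot ^^ N) g (x, \<delta>)" and "(hquot ^^ N) g (0, \<delta>) = V 0"
proof -
  have "(\<forall>x. g (x, \<delta>) = x ^ N * (hquot ^^ N) g (x, \<delta>)) \<and> (hquot ^^ N) g (0, \<delta>) = V 0"
    using assms
  proof (induction N arbitrary: g)
    case 0
    then show ?case using eventually_nhds_x_imp_x[OF 0(2)] by simp
  next
    case (Suc N)
    have g0: "g (0, \<delta>) = 0" using eventually_nhds_x_imp_x[OF Suc.prems(2)] by simp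
    have eq: "g (x, \<delta>) = x * hquot g (x, \<delta>)" for x using hquot_eq[of g x \<delta>] g0 by simp
    have ha: "real_analytic_at (hquot g) (0, \<delta>)" by (rule hquot_analytic[OF Suc.prems(1)])
    have c1: "isCont (\<lambda>x. hquot g (x, \<delta>)) 0" by (rule real_analytic_at_isCont[OF analytic_restrict_snd[OF ha]])
    have c2: "isCont (\<lambda>x. x ^ N * V x) 0" using Suc.prems(3) by (intro continuous_intros)
    have e: "\<forall>\<^sub>F x in at 0. hquot g (x, \<delta>) = x ^ N * V x"
      using Suc.prems(2) unfolding eventually_at_filter
    proof eventually_elim
      case (elim x)
      then show ?case using eq[of x] by auto
    qed
    have "((\<lambda>x. x ^ N * V x) \<longlongrightarrow> hquot g (0, \<delta>)) (at 0)"
      using Lim_transform_eventually[OF c1[unfolded isCont_def] e] .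
    then have "hquot g (0, \<delta>) = 0 ^ N * V 0"
      using c2 tendsto_unique[of "at (0 :: real)"] by (auto simp: isCont_def)
    then have "\<forall>\<^sub>F x in nhds 0. hquot g (x, \<delta>) = x ^ N * V x"
      using e unfolding eventually_at_filter by (auto elim: eventually_mono)
    from Suc.IH[OF ha this Suc.prems(3)] show ?case
      by (simp add: funpow_swap1 eq mult.assoc)
  qed
  then show "g (x, \<delta>) = x ^ N * (hquot ^^ N) g (x, \<delta>)" "(hquot ^^ N) g (0, \<delta>) = V 0" by auto
qed

text \<open>The quadratic bound is converted into pointwise facts at the origin by restricting it to
  x = 0: the value and the y-derivative of the extension vanish.\<close>

lemma admissible_extension:
  fixes X :: "real \<Rightarrow> real \<Rightarrow> 'd::euclidean_space \<Rightarrow> real"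
  assumes "admissible_perturbation D X"
  obtains H \<epsilon> where "\<epsilon> > 0"
    "\<And>x y p. p \<in> D \<Longrightarrow> norm (x, y) < \<epsilon> \<Longrightarrow> real_analytic_at H (x, y, p) \<and> H (x, y, p) = X x y p"
    "\<And>p. p \<in> D \<Longrightarrow> H (0, 0, p) = 0 \<and> frechet_derivative H (at (0, 0, p)) (0, 1, 0) = 0"
proof -
  obtain \<epsilon> where \<epsilon>: "\<epsilon> > 0" "real_analytic_on (\<lambda>(x, y, \<delta>). X x y \<delta>) {(x, y, \<delta>). norm (x, y) < \<epsilon> \<and> \<delta> \<in> D}"
    and O: "(\<lambda>((x, y), \<delta>). X x y \<delta>) \<in> O[nhds (0, 0) \<times>\<^sub>F principal D](\<lambda>((x, y), \<delta>). norm (x, y) ^ 2)"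
    using assms unfolding admissible_perturbation_def by blast
  obtain U H where UH: "open U" "{(x, y, \<delta>). norm (x, y) < \<epsilon> \<and> \<delta> \<in> D} \<subseteq> U" "\<forall>p\<in>U. real_analytic_at H p"
    "\<forall>z\<in>{(x, y, \<delta>). norm (x, y) < \<epsilon> \<and> \<delta> \<in> D}. H z = (case z of (x, y, \<delta>) \<Rightarrow> X x y \<delta>)"
    using \<epsilon>(2) unfolding real_analytic_on_def by blast
  have 1: "real_analytic_at H (x, y, p) \<and> H (x, y, p) = X x y p" if "p \<in> D" "norm (x, y) < \<epsilon>" for x y p
    using UH that by auto
  have 2: "H (0, 0, p) = 0 \<and> frechet_derivative H (at (0, 0, p)) (0, 1, 0) = 0" if p: "p \<in> D" for p
  proof -
    from O obtain c where c: "c > 0" "\<forall>\<^sub>F z in nhds (0, 0) \<times>\<^sub>F principal D.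
        norm ((\<lambda>((x, y), \<delta>). X x y \<delta>) z) \<le> c * norm ((\<lambda>((x, y), \<delta>). norm (x, y) ^ 2) z)"
      by (rule landau_o.bigE)
    then obtain P Q where PQ: "eventually P (nhds (0 :: real, 0 :: real))" "eventually Q (principal D)"
      "\<And>z \<delta>. P z \<Longrightarrow> Q \<delta> \<Longrightarrow> \<bar>X (fst z) (snd z) \<delta>\<bar> \<le> c * (norm z)\<^sup>2"
      unfolding eventually_prod_filter by (force simp: case_prod_unfold)
    have "Q p" using PQ(2) p by (simp add: eventually_principal)
    have "\<forall>\<^sub>F y in nhds 0. P (0, y)"
      using PQ(1) filterlim_iff[of "\<lambda>y. (0 :: real, y :: real)" "nhds (0, 0)" "nhds 0"]
      by (auto intro!: tendsto_intros filterlim_ident)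
    moreover have "\<forall>\<^sub>F y in nhds (0 :: real). norm y < \<epsilon>"
      using \<epsilon>(1) by (intro eventually_nhds_metric[THEN iffD2] exI[of _ \<epsilon>]) auto
    ultimately have ev: "\<forall>\<^sub>F y in nhds 0. \<bar>H (0, y, p)\<bar> \<le> c * y\<^sup>2"
    proof eventually_elim
      case (elim y)
      then show ?case using PQ(3)[OF elim(1) \<open>Q p\<close>] 1[OF p, of 0 y] by (simp add: norm_Pair)
    qed
    have H0: "H (0, 0, p) = 0" using eventually_nhds_x_imp_x[OF ev] by simp
    have d1: "((\<lambda>y. H (0, y, p)) has_real_derivative frechet_derivative H (at (0, 0, p)) (0, 1, 0)) (at 0)"
      using 1[OF p, of 0 0] \<epsilon>(1) by (intro real_analytic_at_chain[of H "\<lambda>y. (0, y, p)"])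
        (auto intro!: derivative_eq_intros has_vector_derivative_Pair)
    have "((\<lambda>y. (H (0, y, p) - H (0, 0, p)) / (y - 0)) \<longlongrightarrow> 0) (at 0)"
    proof (rule Lim_null_comparison)
      show "\<forall>\<^sub>F y in at 0. norm ((H (0, y, p) - H (0, 0, p)) / (y - 0)) \<le> c * \<bar>y\<bar>"
        using ev unfolding eventually_at_filter
        by eventually_elim (auto simp: H0 pos_divide_le_eq power2_eq_square mult.assoc)
      show "((\<lambda>y. c * \<bar>y\<bar>) \<longlongrightarrow> 0) (at (0 :: real))" by (auto intro!: tendsto_eq_intros)
    qed
    then have "((\<lambda>y. H (0, y, p)) has_real_derivative 0) (at 0)" by (simp add: has_field_derivative_iff)
    then show ?thesis using H0 DERIV_unique[OF d1] by blast
  qed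
  show ?thesis by (rule that[OF \<epsilon>(1) 1 2])
qed

text \<open>The filter \<open>nhds 0\<close> contains the point 0 itself, so the bound forces r 0 =
  0.\<close>

lemma bigo_id_isCont:
  fixes r :: "real \<Rightarrow> real"
  assumes "r \<in> O[nhds 0](\<lambda>x. x)"
  shows "r 0 = 0" "isCont r 0"
proof -
  obtain c where c: "\<forall>\<^sub>F x in nhds 0. norm (r x) \<le> c * norm x"
    using assms by (elim landau_o.bigE)
  show r0: "r 0 = 0" using eventually_nhds_x_imp_x[OF c] by simp
  have "(r \<longlongrightarrow> 0) (at 0)"
  proof (rule Lim_null_comparison)
    show "\<forall>\<^sub>F x in at 0. norm (r x) \<le> c * norm x" using c unfolding eventually_at_filter by eventually_elim simp
    show "((\<lambda>x. c * norm x) \<longlongrightarrow> 0) (at (0 :: real))" by (auto intro!: tendsto_eq_intros)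
  qed
  then show "isCont r 0" using r0 by (simp add: isCont_def)
qed

lemma leading_power_isCont:
  fixes f :: "real \<Rightarrow> real"
  assumes "\<forall>\<^sub>F x in nhds 0. ((\<lambda>j. b j * x ^ j) has_sum f x) {m..}"
  obtains W where "isCont W 0" "W 0 = b m" "\<forall>\<^sub>F x in nhds 0. f x = x ^ m * W x"
proof -
  define c where "c = Abs_fps (\<lambda>j. if j < m then 0 else b j)"
  have "\<forall>\<^sub>F x in nhds 0. (\<lambda>j. fps_nth c j * x ^ j) sums f x"
    using assms
  proof eventually_elim
    case (elim x)
    have "((\<lambda>j. fps_nth c j * x ^ j) has_sum f x) UNIV \<longleftrightarrow> ((\<lambda>j. b j * x ^ j) has_sum f x) {m..}"
      by (rule has_sum_cong_neutral) (auto simp: c_def)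
    then show ?case using elim has_sum_imp_sums by blast
  qed
  then have fc: "f has_fps_expansion c" by (rule has_fps_expansionI)
  define W where "W = (\<lambda>x. if x = 0 then b m else f x / x ^ m)"
  have "isCont W 0"
  proof (cases "c = 0")
    case False
    then have "m \<le> subdegree c" by (intro subdegree_geI) (auto simp: c_def)
    then have "W has_fps_expansion fps_shift m c"
      unfolding W_def by (intro has_fps_expansion_shift[OF fc]) (auto simp: c_def)
    then show ?thesis by (rule has_fps_expansion_imp_continuous)
  next
    case True
    have "fps_nth c m = b m" by (simp add: c_def)
    then have bm: "b m = 0" using True by simp
    have "\<forall>\<^sub>F x in nhds 0. f x = 0" using fc True by (auto simp: has_fps_expansion_def elim: eventually_mono)
    then have "\<forall>\<^sub>F x in nhds 0. W x = 0" by eventually_elim (simp add: W_def bm)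
    then show ?thesis using isCont_cong[of W "\<lambda>_. 0" 0] by simp
  qed
  moreover have "f 0 = 0 ^ m * b m"
    using has_fps_expansion_0_eq[OF fc] by (cases m) (auto simp: c_def)
  then have "\<forall>\<^sub>F x in nhds 0. f x = x ^ m * W x"
    by (intro always_eventually) (auto simp: W_def)
  ultimately show ?thesis using that[of W] by (simp add: W_def)
qed

section \<open>Reduction to a system of Lienard type\<close>

text \<open>\<open>\<Phi>\<close> inverts the substitution \<open>u = y + X(x, y, \<delta>)\<close>. The low order Taylor coefficients of the
  resulting right-hand side vanish for \<open>\<delta> \<in> D\<close> only, so \<open>C\<^sub>0\<close>, \<open>C\<^sub>1\<close> and \<open>B\<close> describe the original system only
  over \<open>D\<close>; off \<open>D\<close> they define an analytic continuation that keeps the normal form.\<close>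

lemma reduced_system:
  fixes X Y :: "real \<Rightarrow> real \<Rightarrow> 'd::euclidean_space \<Rightarrow> real"
  assumes D: "compact D" and adX: "admissible_perturbation D X" and adY: "admissible_perturbation D Y"
    and br: "implicit_branch D X F" and n: "n \<ge> 1"
    and g: "\<And>p. p \<in> D \<Longrightarrow> \<exists>r \<in> O[nhds 0](\<lambda>x. x). \<forall>\<^sub>F x in nhds 0. fun_g Y F x p = x ^ (2 * n - 1) * (a p + r x)"
    and f: "\<And>p. p \<in> D \<Longrightarrow> \<forall>\<^sub>F x in nhds 0. ((\<lambda>j. b j p * x ^ j) has_sum fun_f X Y F x p) {n - 1..}"
  obtains C0 C1 :: "real \<times> 'd \<Rightarrow> real" and B \<Phi> :: "real \<times> real \<times> 'd \<Rightarrow> real" where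
    "\<forall>p\<in>D. real_analytic_at C0 (0, p) \<and> real_analytic_at C1 (0, p) \<and> real_analytic_at B (0, 0, p)"
    "\<forall>p\<in>D. C0 (0, p) = - a p \<and> C1 (0, p) = - b (n - 1) p"
    "\<forall>p\<in>D. \<exists>\<rho> \<rho>' L. 0 < \<rho> \<and> \<rho> \<le> \<rho>' \<and> 0 \<le> L \<and>
       (\<forall>x u. \<bar>x\<bar> < \<rho> \<longrightarrow> \<bar>u\<bar> < \<rho> \<longrightarrow> \<bar>\<Phi> (x, u, p)\<bar> < \<rho>' \<and> \<Phi> (x, u, p) + X x (\<Phi> (x, u, p)) p = u) \<and>
       (\<forall>x. \<bar>x\<bar> < \<rho> \<longrightarrow> \<Phi> (x, 0, p) = F x p \<and> F x p + X x (F x p) p = 0) \<and>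
       (\<forall>xf uf S t. t \<in> S \<longrightarrow> (\<forall>s\<in>S. \<bar>xf s\<bar> < \<rho> \<and> \<bar>uf s\<bar> < \<rho>) \<longrightarrow>
          (xf has_real_derivative uf t) (at t within S) \<longrightarrow>
          (uf has_real_derivative xf t ^ (2 * n - 1) * C0 (xf t, p) + uf t * xf t ^ (n - 1) * C1 (xf t, p)
             + (uf t)\<^sup>2 * B (uf t, xf t, p)) (at t within S) \<longrightarrow>
          ((\<lambda>s. \<Phi> (xf s, uf s, p)) has_real_derivative Y (xf t) (\<Phi> (xf t, uf t, p)) p) (at t within S)) \<and>
       (\<forall>x y x' y'. \<bar>x\<bar> < 2 * \<rho>' \<longrightarrow> \<bar>y\<bar> < 2 * \<rho>' \<longrightarrow> \<bar>x'\<bar> < 2 * \<rho>' \<longrightarrow> \<bar>y'\<bar> < 2 * \<rho>' \<longrightarrow>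
          \<bar>X x y p - X x' y' p\<bar> \<le> L * (\<bar>x - x'\<bar> + \<bar>y - y'\<bar>) \<and> \<bar>Y x y p - Y x' y' p\<bar> \<le> L * (\<bar>x - x'\<bar> + \<bar>y - y'\<bar>))"
proof -
  obtain H eX where eX: "eX > 0"
    and HX: "\<And>x y p. p \<in> D \<Longrightarrow> norm (x, y) < eX \<Longrightarrow> real_analytic_at H (x, y, p) \<and> H (x, y, p) = X x y p"
    and H0: "\<And>p. p \<in> D \<Longrightarrow> H (0, 0, p) = 0 \<and> frechet_derivative H (at (0, 0, p)) (0, 1, 0) = 0"
    by (rule admissible_extension[OF adX]) blast
  obtain K eY where eY: "eY > 0"
    and KY: "\<And>x y p. p \<in> D \<Longrightarrow> norm (x, y) < eY \<Longrightarrow> real_analytic_at K (x, y, p) \<and> K (x, y, p) = Y x y p"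
    and K0: "\<And>p. p \<in> D \<Longrightarrow> K (0, 0, p) = 0 \<and> frechet_derivative K (at (0, 0, p)) (0, 1, 0) = 0"
    by (rule admissible_extension[OF adY]) blast
  define Hx where "Hx = (\<lambda>z. frechet_derivative H (at z) (1, 0, 0))"
  define Hy where "Hy = (\<lambda>z. frechet_derivative H (at z) (0, 1, 0))"
  have anH: "real_analytic_at H (0, 0, p)" and anK: "real_analytic_at K (0, 0, p)" if "p \<in> D" for p
    using HX[OF that, of 0 0] KY[OF that, of 0 0] eX eY by auto
  obtain \<eta> yy where \<eta>: "\<eta> > 0"
    and 1: "\<forall>p\<in>D. \<forall>x y. \<bar>x\<bar> < \<eta> \<longrightarrow> \<bar>y\<bar> < \<eta> \<longrightarrow> real_analytic_at H (x, y, p) \<and> \<bar>Hy (x, y, p)\<bar> < 1 / 2"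
    and 2: "\<forall>p\<in>D. \<forall>x y y'. \<bar>x\<bar> < \<eta> \<longrightarrow> \<bar>y\<bar> < \<eta> \<longrightarrow> \<bar>y'\<bar> < \<eta> \<longrightarrow> y + H (x, y, p) = y' + H (x, y', p) \<longrightarrow> y = y'"
    and 3: "\<forall>p\<in>D. real_analytic_at yy (0, 0, p) \<and> yy (0, 0, p) = 0"
    and 4: "\<forall>p\<in>D. \<forall>\<^sub>F z in nhds (0, 0, p). \<bar>yy z\<bar> < \<eta> \<and> yy z + H (fst z, yy z, snd (snd z)) = fst (snd z)"
    unfolding Hy_def by (rule analytic_implicit[OF D, of H, OF anH H0[THEN conjunct1] H0[THEN conjunct2]], assumption, assumption, assumption) (rule that[unfolded Hy_def])
  have etaH: "real_analytic_at H (x, y, p) \<and> \<bar>Hy (x, y, p)\<bar> < 1 / 2" if "p \<in> D" "\<bar>x\<bar> < \<eta>" "\<bar>y\<bar> < \<eta>" for p x y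
    using 1 that by blast
  have inj: "y = y'" if "p \<in> D" "\<bar>x\<bar> < \<eta>" "\<bar>y\<bar> < \<eta>" "\<bar>y'\<bar> < \<eta>" "y + H (x, y, p) = y' + H (x, y', p)" for p x y y'
    using 2 that by blast
  have yy: "real_analytic_at yy (0, 0, p) \<and> yy (0, 0, p) = 0" if "p \<in> D" for p using 3 that by blast
  have yyeq: "\<forall>\<^sub>F z in nhds (0, 0, p). \<bar>yy z\<bar> < \<eta> \<and> yy z + H (fst z, yy z, snd (snd z)) = fst (snd z)" if "p \<in> D" for p
    using 4 that by blast
  define \<gamma> where "\<gamma> = (\<lambda>z :: real \<times> real \<times> 'd. (fst z, yy z, snd (snd z)))"
  \<comment> \<open>The time derivative of u = y + X: X_x times x' = u, plus y' = Y times 1 + X_y,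
    in the coordinates (x, u).\<close>
  define Zf where "Zf = (\<lambda>z. fst (snd z) * Hx (\<gamma> z) + K (\<gamma> z) * (1 + Hy (\<gamma> z)))"
  define A0 where "A0 = (\<lambda>q :: real \<times> 'd. Zf (fst q, 0, snd q))"
  define Zu where "Zu = (\<lambda>w :: real \<times> real \<times> 'd. Zf (fst (snd w), fst w, snd (snd w)))"
  define A1 where "A1 = (\<lambda>q. hquot Zu (0, q))"
  define B where "B = hquot (hquot Zu)"
  \<comment> \<open>\<open>Zf\<close> is expanded in u as A0 + u A1 + u^2 B; the quotients then
    strip x^(2n-1) from A0 and x^(n-1) from A1.\<close>
  define C0 where "C0 = (hquot ^^ (2 * n - 1)) A0"
  define C1 where "C1 = (hquot ^^ (n - 1)) A1"
  have Zsplit: "Zf (x, u, p) = A0 (x, p) + u * A1 (x, p) + u\<^sup>2 * B (u, x, p)" for x u p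
  proof -
    have "Zf (x, u, p) = Zu (u, x, p)" by (simp add: Zu_def)
    also have "\<dots> = Zu (0, x, p) + u * hquot Zu (u, x, p)" by (rule hquot_eq)
    also have "hquot Zu (u, x, p) = A1 (x, p) + u * B (u, x, p)" unfolding A1_def B_def by (rule hquot_eq)
    also have "Zu (0, x, p) = A0 (x, p)" by (simp add: Zu_def A0_def)
    finally show ?thesis by (simp add: algebra_simps power2_eq_square)
  qed
  have \<gamma>a: "analytic_map_at \<gamma> z" if "real_analytic_at yy z" for z
    unfolding \<gamma>_def using that by (intro analytic_intros analytic_map_at_realI)
  have \<gamma>0: "\<gamma> (0, 0, p) = (0, 0, p)" if "p \<in> D" for p using yy[OF that] by (simp add: \<gamma>_def)
  have anHx: "real_analytic_at Hx z" and anHy: "real_analytic_at Hy z" if "real_analytic_at H z" for z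
    unfolding Hx_def Hy_def using that by (auto intro: real_analytic_at_frechet)
  have anZ: "real_analytic_at Zf (0, 0, p)" if p: "p \<in> D" for p
    unfolding Zf_def
    by (intro analytic_intros real_analytic_at_realD[OF analytic_map_at_fst'] real_analytic_at_comp[OF _ \<gamma>a])
      (use yy[OF p] anHx anHy anH[OF p] anK[OF p] \<gamma>0[OF p] in auto)
  have anZu: "real_analytic_at Zu (0, 0, p)" if p: "p \<in> D" for p
    unfolding Zu_def by (rule real_analytic_at_comp[of Zf]) (use anZ[OF p] in \<open>auto intro!: analytic_intros\<close>)
  have anA0: "real_analytic_at A0 (0, p)" if p: "p \<in> D" for p
    unfolding A0_def by (rule real_analytic_at_comp[of Zf]) (use anZ[OF p] in \<open>auto intro!: analytic_intros\<close>)
  have anA1: "real_analytic_at A1 (0, p)" if p: "p \<in> D" for p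
    unfolding A1_def by (rule real_analytic_at_comp[of "hquot Zu"])
      (use hquot_analytic[OF anZu[OF p]] in \<open>auto intro!: analytic_intros\<close>)
  have "real_analytic_at C0 (0, p) \<and> real_analytic_at C1 (0, p) \<and> real_analytic_at B (0, 0, p)" if p: "p \<in> D" for p
    unfolding C0_def C1_def B_def
    using hquot_power_analytic[OF anA0[OF p]] hquot_power_analytic[OF anA1[OF p]] hquot_analytic[OF hquot_analytic[OF anZu[OF p]]] by blast
  moreover have main: "C0 (0, p) = - a p \<and> C1 (0, p) = - b (n - 1) p \<and> (\<forall>x. A0 (x, p) = x ^ (2 * n - 1) * C0 (x, p)) \<and>
      (\<forall>x. A1 (x, p) = x ^ (n - 1) * C1 (x, p)) \<and> (\<forall>\<^sub>F x in nhds 0. yy (x, 0, p) = F x p \<and> F x p + X x (F x p) p = 0)"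
    if p: "p \<in> D" for p
  proof -
    obtain r where r: "r \<in> O[nhds 0](\<lambda>x. x)" "\<forall>\<^sub>F x in nhds 0. fun_g Y F x p = x ^ (2 * n - 1) * (a p + r x)"
      using g[OF p] by blast
    obtain W where W: "isCont W 0" "W 0 = b (n - 1) p" "\<forall>\<^sub>F x in nhds 0. fun_f X Y F x p = x ^ (n - 1) * W x"
      by (rule leading_power_isCont[OF f[OF p]]) blast
    have F0: "F 0 p = 0" "isCont (\<lambda>x. F x p) 0" "\<forall>\<^sub>F x in nhds 0. F x p + X x (F x p) p = 0"
      using br p by (auto simp: implicit_branch_def)
    have Fl: "((\<lambda>x. F x p) \<longlongrightarrow> 0) (nhds 0)" using F0(2) F0(1) unfolding isCont_def
      by (metis tendsto_at_iff_tendsto_nhds)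
    define e where "e = min eX eY"
    have e: "e > 0" using eX eY by (simp add: e_def)
    have Fs: "\<forall>\<^sub>F x in nhds 0. \<bar>F x p\<bar> < min \<eta> (e / 2)" using tendsto_rabs[OF Fl] \<eta> e by (auto dest!: order_tendstoD(2)[of _ _ _ "min \<eta> (e / 2)"])
    have xs: "\<forall>\<^sub>F x in nhds (0 :: real). \<bar>x\<bar> < min \<eta> (e / 2)"
      using \<eta> e by (intro eventually_nhds_metric[THEN iffD2] exI[of _ "min \<eta> (e / 2)"]) auto
    have lim: "filterlim (\<lambda>x. (x, 0 :: real, p)) (nhds (0, 0, p)) (nhds 0)" by (intro tendsto_intros filterlim_ident)
    have y1: "\<forall>\<^sub>F x in nhds 0. \<forall>\<^sub>F z in nhds (x, 0, p). \<bar>yy z\<bar> < \<eta> \<and> yy z + H (fst z, yy z, snd (snd z)) = fst (snd z)"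
      using yyeq[OF p] lim unfolding filterlim_iff by (subst (asm) eventually_eventually[symmetric]) blast
    have y2: "\<forall>\<^sub>F x in nhds 0. real_analytic_at yy (x, 0, p)"
      using real_analytic_at_eventually[of yy "(0, 0, p)"] yy[OF p] lim unfolding filterlim_iff by blast
    have both: "\<forall>\<^sub>F x in nhds 0. real_analytic_at yy (x, 0, p) \<and> yy (x, 0, p) = F x p \<and> F x p + X x (F x p) p = 0 \<and>
        norm (x, F x p) < e \<and> \<bar>x\<bar> < \<eta> \<and> \<bar>F x p\<bar> < \<eta> \<and>
        (\<forall>\<^sub>F z in nhds (x, 0, p). \<bar>yy z\<bar> < \<eta> \<and> yy z + H (fst z, yy z, snd (snd z)) = fst (snd z))"
      using y1 y2 F0(3) Fs xs
    proof eventually_elim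
      case (elim x)
      have nx: "norm (x, F x p) < e" using norm_Pair_le[of x "F x p"] elim(4,5) by simp
      have "yy (x, 0, p) = F x p"
        using inj[OF p, of x "yy (x, 0, p)" "F x p"] eventually_nhds_x_imp_x[OF elim(1)] elim(3-5) HX[OF p, of x "F x p"] nx
        by (simp add: e_def)
      then show ?case using elim nx by auto
    qed
    \<comment> \<open>At u = 0 the point lies on y = F(x), where Y = - g, so that A0 = - g (1 +
      Hy).\<close>
    define V0 where "V0 = (\<lambda>x. - (a p + r x) * (1 + Hy (\<gamma> (x, 0, p))))"
    define M where "M = (\<lambda>x. frechet_derivative yy (at (x, 0, p)) (0, 1, 0) * frechet_derivative Hy (at (\<gamma> (x, 0, p))) (0, 1, 0))"
    \<comment> \<open>The u-derivative of \<open>Zf\<close> at u = 0 works out to - f - g M. Since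
      2n - 1 = (n - 1) + n, the term with g is absorbed with a spare factor x^n.\<close>
    define V1 where "V1 = (\<lambda>x. - W x - x ^ n * (a p + r x) * M x)"
    have c\<gamma>: "isCont (\<lambda>x. G (\<gamma> (x, 0, p))) 0" if "real_analytic_at G (0, 0, p)" for G
    proof (rule real_analytic_at_isCont)
      have "analytic_map_at (\<lambda>x. (x, 0 :: real, p)) (0 :: real)"
        by (rule analytic_map_at_Pair[OF analytic_map_at_id analytic_map_at_const])
      moreover have "analytic_map_at \<gamma> (0, 0, p)" by (rule \<gamma>a[OF yy[OF p, THEN conjunct1]])
      ultimately have "analytic_map_at (\<lambda>x. \<gamma> (x, 0, p)) 0"
        using analytic_map_at_comp[of \<gamma> "\<lambda>x. (x, 0, p)" 0] by blast
      then show "real_analytic_at (\<lambda>x. G (\<gamma> (x, 0, p))) 0"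
        using real_analytic_at_comp[of G "\<lambda>x. \<gamma> (x, 0, p)" 0] that \<gamma>0[OF p] by simp
    qed
    have cV0: "isCont V0 0" unfolding V0_def
      by (intro continuous_intros bigo_id_isCont(2)[OF r(1)] c\<gamma> anHy anH p)
    have "isCont (\<lambda>x. frechet_derivative yy (at (x, 0, p)) (0, 1, 0)) 0"
      by (rule real_analytic_at_isCont, rule real_analytic_at_comp[of "\<lambda>z. frechet_derivative yy (at z) (0, 1, 0)"])
        (use yy[OF p] in \<open>auto intro!: analytic_intros real_analytic_at_frechet\<close>)
    then have cM: "isCont M 0" unfolding M_def
      by (intro continuous_intros c\<gamma> real_analytic_at_frechet anHy anH p)
    have cV1: "isCont V1 0" unfolding V1_def
      by (intro continuous_intros bigo_id_isCont(2)[OF r(1)] cM W(1))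
    have evA0: "\<forall>\<^sub>F x in nhds 0. A0 (x, p) = x ^ (2 * n - 1) * V0 x"
      using both r(2)
    proof eventually_elim
      case (elim x)
      have "K (\<gamma> (x, 0, p)) = - fun_g Y F x p"
        using elim(1) KY[OF p, of x "F x p"] by (simp add: \<gamma>_def fun_g_def e_def)
      then have "K (\<gamma> (x, 0, p)) = x ^ (2 * n - 1) * - (a p + r x)" using elim(2) by (simp only: mult_minus_right)
      then show ?case by (simp only: A0_def Zf_def V0_def fst_conv snd_conv mult.assoc mult_zero_left add_0_left)
    qed
    have evA1: "\<forall>\<^sub>F x in nhds 0. A1 (x, p) = x ^ (n - 1) * V1 x"
      using both r(2) W(3)
    proof eventually_elim
      case (elim x)
      define z0 where "z0 = (x, F x p, p)"
      define q where "q = frechet_derivative yy (at (x, 0, p)) (0, 1, 0)"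
      have \<gamma>z: "\<gamma> (x, 0, p) = z0" using elim(1) by (simp add: \<gamma>_def z0_def)
      have Hz: "real_analytic_at H z0" and Kz: "real_analytic_at K z0"
        using HX[OF p, of x "F x p"] KY[OF p, of x "F x p"] elim(1) by (auto simp: z0_def e_def)
      have dyy: "((\<lambda>u. yy (x, u, p)) has_real_derivative q) (at 0)"
        unfolding q_def using elim(1) by (intro real_analytic_at_chain[of yy "\<lambda>u. (x, u, p)"])
          (auto intro!: derivative_eq_intros has_vector_derivative_Pair)
      then have d\<gamma>: "((\<lambda>u. \<gamma> (x, u, p)) has_vector_derivative (q *\<^sub>R (0, 1, 0))) (at 0)"
        unfolding \<gamma>_def by (auto intro!: derivative_eq_intros has_vector_derivative_Pair simp: has_real_derivative_iff_has_vector_derivative)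
      have dG: "((\<lambda>u. G (\<gamma> (x, u, p))) has_real_derivative q * frechet_derivative G (at z0) (0, 1, 0)) (at 0)"
        if "real_analytic_at G z0" for G
        using real_analytic_at_chain[of G "\<lambda>u. \<gamma> (x, u, p)" 0, OF _ d\<gamma>] that frechet_scaled[OF that] by (simp add: \<gamma>z del: scaleR_Pair)
      \<comment> \<open>Differentiating y + H = u in u gives q (1 + Hy) = 1, which cancels the
        factor in front of Y_y and leaves the divergence X_x + Y_y = - f.\<close>
      have "\<forall>\<^sub>F u in nhds 0. yy (x, u, p) + H (\<gamma> (x, u, p)) = u"
      proof -
        have "filterlim (\<lambda>u. (x, u, p)) (nhds (x, 0, p)) (nhds 0)" by (intro tendsto_intros filterlim_ident)
        from this[unfolded filterlim_iff, rule_format, OF elim(1)[THEN conjunct2, THEN conjunct2, THEN conjunct2, THEN conjunct2, THEN conjunct2, THEN conjunct2]]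
        show ?thesis by eventually_elim (simp add: \<gamma>_def)
      qed
      then have "((\<lambda>u. yy (x, u, p) + H (\<gamma> (x, u, p))) has_real_derivative 1) (at 0) \<longleftrightarrow> ((\<lambda>u. u) has_real_derivative 1) (at (0 :: real))"
        by (intro DERIV_cong_ev) auto
      then have "((\<lambda>u. yy (x, u, p) + H (\<gamma> (x, u, p))) has_real_derivative 1) (at 0)" by simp
      moreover have "((\<lambda>u. yy (x, u, p) + H (\<gamma> (x, u, p))) has_real_derivative q + q * Hy z0) (at 0)"
        unfolding Hy_def by (intro DERIV_add dyy dG Hz)
      ultimately have q1: "q * (1 + Hy z0) = 1" using DERIV_unique by (fastforce simp: distrib_left)
      have "((\<lambda>u. Zu (u, x, p)) has_real_derivative
          (1 * Hx (\<gamma> (x, 0, p)) + (q * frechet_derivative Hx (at z0) (0, 1, 0)) * 0) +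
          ((q * frechet_derivative K (at z0) (0, 1, 0)) * (1 + Hy (\<gamma> (x, 0, p))) +
           (0 + q * frechet_derivative Hy (at z0) (0, 1, 0)) * K (\<gamma> (x, 0, p)))) (at 0)"
        unfolding Zu_def Zf_def fst_conv snd_conv
        by (intro DERIV_add DERIV_mult DERIV_ident DERIV_const dG Kz anHx anHy Hz)
      then have "A1 (x, p) = (1 * Hx (\<gamma> (x, 0, p)) + (q * frechet_derivative Hx (at z0) (0, 1, 0)) * 0) +
          ((q * frechet_derivative K (at z0) (0, 1, 0)) * (1 + Hy (\<gamma> (x, 0, p))) +
           (0 + q * frechet_derivative Hy (at z0) (0, 1, 0)) * K (\<gamma> (x, 0, p)))"
        by (simp add: A1_def hquot_def DERIV_imp_deriv)
      also have "\<dots> = Hx z0 + frechet_derivative K (at z0) (0, 1, 0) * (q * (1 + Hy z0)) + K z0 * M x"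
        by (simp add: \<gamma>z M_def q_def algebra_simps)
      also have "K z0 = - fun_g Y F x p"
        using elim(1) KY[OF p, of x "F x p"] by (simp add: z0_def fun_g_def e_def)
      also have "Hx z0 + frechet_derivative K (at z0) (0, 1, 0) * (q * (1 + Hy z0)) = - fun_f X Y F x p"
      proof -
        have op: "open {s. norm (s, F x p) < e}" "open {s. norm (x, s) < e}"
          by (intro open_Collect_less continuous_intros)+
        have "((\<lambda>s. H (s, F x p, p)) has_real_derivative Hx z0) (at x)"
          unfolding Hx_def z0_def using Hz[unfolded z0_def] by (intro real_analytic_at_chain[of H "\<lambda>s. (s, F x p, p)"])
            (auto intro!: derivative_eq_intros has_vector_derivative_Pair simp: zero_prod_def)
        then have "((\<lambda>s. X s (F x p) p) has_real_derivative Hx z0) (at x)"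
          by (rule has_field_derivative_transform_within_open[OF _ op(1)]) (use elim(1) HX[OF p] in \<open>auto simp: e_def\<close>)
        moreover have "((\<lambda>s. K (x, s, p)) has_real_derivative frechet_derivative K (at z0) (0, 1, 0)) (at (F x p))"
          unfolding z0_def using Kz[unfolded z0_def] by (intro real_analytic_at_chain[of K "\<lambda>s. (x, s, p)"])
            (auto intro!: derivative_eq_intros has_vector_derivative_Pair)
        then have "((\<lambda>s. Y x s p) has_real_derivative frechet_derivative K (at z0) (0, 1, 0)) (at (F x p))"
          by (rule has_field_derivative_transform_within_open[OF _ op(2)]) (use elim(1) KY[OF p] in \<open>auto simp: e_def\<close>)
        ultimately show ?thesis unfolding fun_f_def q1 by (simp add: DERIV_imp_deriv)
      qed
      also have "- fun_f X Y F x p + - fun_g Y F x p * M x = x ^ (n - 1) * V1 x"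
      proof -
        have "x ^ (2 * n - 1) = x ^ (n - 1) * x ^ n"
          unfolding power_add[symmetric] using n by (intro arg_cong[where f = "\<lambda>k. x ^ k"]) simp
        then show ?thesis by (simp only: elim(2,3) V1_def) (simp add: algebra_simps)
      qed
      finally show ?case .
    qed
    have Hy00: "Hy (0, 0, p) = 0" using H0[OF p] by (simp add: Hy_def)
    have "V0 0 = - a p" using bigo_id_isCont(1)[OF r(1)] \<gamma>0[OF p] Hy00 by (simp add: V0_def)
    moreover have "V1 0 = - b (n - 1) p" using W(2) n by (simp add: V1_def)
    moreover have "\<forall>\<^sub>F x in nhds 0. yy (x, 0, p) = F x p \<and> F x p + X x (F x p) p = 0" using both by eventually_elim simp
    ultimately show ?thesis
      using hquot_power_vanish[OF anA0[OF p] evA0 cV0] hquot_power_vanish[OF anA1[OF p] evA1 cV1]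
      by (simp add: C0_def C1_def)
  qed
  \<comment> \<open>The box of size \<rho> is for (x, u), the bound \<rho>' for y. The Lipschitz
    bound is asked on a box of twice that size, since competing solutions of the original system are
    not known to stay in the smaller one.\<close>
  moreover have "\<exists>\<rho> \<rho>' L. 0 < \<rho> \<and> \<rho> \<le> \<rho>' \<and> 0 \<le> L \<and>
       (\<forall>x u. \<bar>x\<bar> < \<rho> \<longrightarrow> \<bar>u\<bar> < \<rho> \<longrightarrow> \<bar>yy (x, u, p)\<bar> < \<rho>' \<and> yy (x, u, p) + X x (yy (x, u, p)) p = u) \<and>
       (\<forall>x. \<bar>x\<bar> < \<rho> \<longrightarrow> yy (x, 0, p) = F x p \<and> F x p + X x (F x p) p = 0) \<and>
       (\<forall>xf uf S t. t \<in> S \<longrightarrow> (\<forall>s\<in>S. \<bar>xf s\<bar> < \<rho> \<and> \<bar>uf s\<bar> < \<rho>) \<longrightarrow>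
          (xf has_real_derivative uf t) (at t within S) \<longrightarrow>
          (uf has_real_derivative xf t ^ (2 * n - 1) * C0 (xf t, p) + uf t * xf t ^ (n - 1) * C1 (xf t, p)
             + (uf t)\<^sup>2 * B (uf t, xf t, p)) (at t within S) \<longrightarrow>
          ((\<lambda>s. yy (xf s, uf s, p)) has_real_derivative Y (xf t) (yy (xf t, uf t, p)) p) (at t within S)) \<and>
       (\<forall>x y x' y'. \<bar>x\<bar> < 2 * \<rho>' \<longrightarrow> \<bar>y\<bar> < 2 * \<rho>' \<longrightarrow> \<bar>x'\<bar> < 2 * \<rho>' \<longrightarrow> \<bar>y'\<bar> < 2 * \<rho>' \<longrightarrow>
          \<bar>X x y p - X x' y' p\<bar> \<le> L * (\<bar>x - x'\<bar> + \<bar>y - y'\<bar>) \<and> \<bar>Y x y p - Y x' y' p\<bar> \<le> L * (\<bar>x - x'\<bar> + \<bar>y - y'\<bar>))"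
    if p: "p \<in> D" for p
  proof -
    obtain e1 L1 where e1: "e1 > 0" "L1 \<ge> 0"
      "\<And>z z'. dist z (0, 0, p) < e1 \<Longrightarrow> dist z' (0, 0, p) < e1 \<Longrightarrow> \<bar>H z - H z'\<bar> \<le> L1 * dist z z'"
      by (rule real_analytic_at_lipschitz[OF anH[OF p]]) blast
    obtain e2 L2 where e2: "e2 > 0" "L2 \<ge> 0"
      "\<And>z z'. dist z (0, 0, p) < e2 \<Longrightarrow> dist z' (0, 0, p) < e2 \<Longrightarrow> \<bar>K z - K z'\<bar> \<le> L2 * dist z z'"
      by (rule real_analytic_at_lipschitz[OF anK[OF p]]) blast
    define e where "e = min (min e1 e2) (min eX eY)"
    have e: "e > 0" using e1 e2 eX eY by (simp add: e_def)
    \<comment> \<open>With 2 \<rho>' at most e / 3, the doubled box meets the requirement of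
      \<open>dist_triple_less\<close>.\<close>
    define \<rho>' where "\<rho>' = min (e / 6) \<eta>"
    have \<rho>': "\<rho>' > 0" "\<rho>' \<le> e / 6" "\<rho>' \<le> \<eta>" using e \<eta> by (auto simp: \<rho>'_def)
    have nsm: "norm (x, y) < e" if "\<bar>x\<bar> < 2 * \<rho>'" "\<bar>y\<bar> < 2 * \<rho>'" for x y :: real
      using norm_Pair_le[of x y] that \<rho>' by simp
    have HKX: "H (x, y, p) = X x y p" "K (x, y, p) = Y x y p" "real_analytic_at H (x, y, p)" "real_analytic_at K (x, y, p)"
      if "\<bar>x\<bar> < 2 * \<rho>'" "\<bar>y\<bar> < 2 * \<rho>'" for x y
      using HX[OF p, of x y] KY[OF p, of x y] nsm[OF that] by (auto simp: e_def)
    define L where "L = max L1 L2"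
    have lip: "\<bar>X x y p - X x' y' p\<bar> \<le> L * (\<bar>x - x'\<bar> + \<bar>y - y'\<bar>) \<and> \<bar>Y x y p - Y x' y' p\<bar> \<le> L * (\<bar>x - x'\<bar> + \<bar>y - y'\<bar>)"
      if "\<bar>x\<bar> < 2 * \<rho>'" "\<bar>y\<bar> < 2 * \<rho>'" "\<bar>x'\<bar> < 2 * \<rho>'" "\<bar>y'\<bar> < 2 * \<rho>'" for x y x' y'
    proof -
      have d: "dist (x, y, p) (0, 0, p) < e" "dist (x', y', p) (0, 0, p) < e"
        by (rule dist_triple_less; use that \<rho>' e in simp)+
      have dd: "dist (x, y, p) (x', y', p) \<le> \<bar>x - x'\<bar> + \<bar>y - y'\<bar>"
        using sqrt_sum_squares_le_sum[of "dist x x'" "dist y y'"] by (simp add: dist_Pair_Pair dist_real_def)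
      have "L1 * dist (x, y, p) (x', y', p) \<le> L * (\<bar>x - x'\<bar> + \<bar>y - y'\<bar>)"
        "L2 * dist (x, y, p) (x', y', p) \<le> L * (\<bar>x - x'\<bar> + \<bar>y - y'\<bar>)"
        using dd e1(2) e2(2) by (auto simp: L_def intro!: mult_mono)
      moreover have "\<bar>X x y p - X x' y' p\<bar> \<le> L1 * dist (x, y, p) (x', y', p)"
        using e1(3)[of "(x, y, p)" "(x', y', p)"] d HKX(1) that by (simp add: e_def)
      moreover have "\<bar>Y x y p - Y x' y' p\<bar> \<le> L2 * dist (x, y, p) (x', y', p)"
        using e2(3)[of "(x, y, p)" "(x', y', p)"] d HKX(2) that by (simp add: e_def)
      ultimately show ?thesis by linarith
    qed
    have "(yy \<longlongrightarrow> yy (0, 0, p)) (nhds (0, 0, p))"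
      using analytic_map_at_tendsto[of yy "(0, 0, p)"] yy[OF p] by (simp add: analytic_map_at_real)
    then have yl: "(yy \<longlongrightarrow> 0) (nhds (0, 0, p))" using yy[OF p] by simp
    have "\<forall>\<^sub>F z in nhds (0, 0, p). \<bar>yy z\<bar> < \<rho>'"
      using tendsto_rabs[OF yl] \<rho>'(1) by (auto dest!: order_tendstoD(2)[of _ _ _ \<rho>'])
    then have "\<forall>\<^sub>F z in nhds (0, 0, p). \<bar>yy z\<bar> < \<rho>' \<and> real_analytic_at yy z \<and> yy z + H (fst z, yy z, snd (snd z)) = fst (snd z)"
      using yyeq[OF p] real_analytic_at_eventually[of yy "(0, 0, p)"] yy[OF p]
      by (auto elim: eventually_elim2 intro: eventually_conj)
    then obtain d where d: "d > 0" "\<And>z. dist z (0, 0, p) < d \<Longrightarrow>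
        \<bar>yy z\<bar> < \<rho>' \<and> real_analytic_at yy z \<and> yy z + H (fst z, yy z, snd (snd z)) = fst (snd z)"
      unfolding eventually_nhds_metric by blast
    obtain d' where d': "d' > 0" "\<And>x. \<bar>x\<bar> < d' \<Longrightarrow> yy (x, 0, p) = F x p \<and> F x p + X x (F x p) p = 0"
      using main[OF p] unfolding eventually_nhds_metric by (auto simp: dist_real_def)
    define \<rho> where "\<rho> = min (min (d / 3) d') \<rho>'"
    have \<rho>: "\<rho> > 0" "\<rho> \<le> d / 3" "\<rho> \<le> d'" "\<rho> \<le> \<rho>'" using d d' \<rho>' by (auto simp: \<rho>_def)
    have box: "\<bar>yy (x, u, p)\<bar> < \<rho>' \<and> real_analytic_at yy (x, u, p) \<and> yy (x, u, p) + H (x, yy (x, u, p), p) = u"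
      if "\<bar>x\<bar> < \<rho>" "\<bar>u\<bar> < \<rho>" for x u
      using d(2)[of "(x, u, p)"] dist_triple_less[of x 0 d u 0 p p] that \<rho> d(1) by simp
    have A: "\<bar>yy (x, u, p)\<bar> < \<rho>' \<and> yy (x, u, p) + X x (yy (x, u, p)) p = u" if "\<bar>x\<bar> < \<rho>" "\<bar>u\<bar> < \<rho>" for x u
      using box[OF that] HKX(1)[of x "yy (x, u, p)"] that \<rho> \<rho>' by auto
    have Cc: "((\<lambda>s. yy (xf s, uf s, p)) has_real_derivative Y (xf t) (yy (xf t, uf t, p)) p) (at t within S)"
      if t: "t \<in> S" and bd: "\<forall>s\<in>S. \<bar>xf s\<bar> < \<rho> \<and> \<bar>uf s\<bar> < \<rho>"
        and dx: "(xf has_real_derivative uf t) (at t within S)"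
        and du: "(uf has_real_derivative xf t ^ (2 * n - 1) * C0 (xf t, p) + uf t * xf t ^ (n - 1) * C1 (xf t, p)
             + (uf t)\<^sup>2 * B (uf t, xf t, p)) (at t within S)" for xf uf S t
    \<comment> \<open>The other case compares two derivatives of u, which determine each other only
      along a nontrivial filter.\<close>
    proof (cases "at t within S = bot")
      case True
      then show ?thesis by (simp add: has_field_derivative_iff)
    next
      case False
      have bt: "\<bar>xf t\<bar> < \<rho>" "\<bar>uf t\<bar> < \<rho>" using bd t by auto
      define y0 where "y0 = yy (xf t, uf t, p)"
      have y0: "\<bar>y0\<bar> < \<rho>'" "y0 + H (xf t, y0, p) = uf t" and yya: "real_analytic_at yy (xf t, uf t, p)"
        using box[OF bt] by (auto simp: y0_def)
      have xt: "\<bar>xf t\<bar> < 2 * \<rho>'" "\<bar>y0\<bar> < 2 * \<rho>'" using bt y0 \<rho> \<rho>' by auto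
      have Ha: "real_analytic_at H (xf t, y0, p)" by (rule HKX(3)[OF xt])
      have Zt: "xf t ^ (2 * n - 1) * C0 (xf t, p) + uf t * xf t ^ (n - 1) * C1 (xf t, p) + (uf t)\<^sup>2 * B (uf t, xf t, p)
          = uf t * Hx (xf t, y0, p) + K (xf t, y0, p) * (1 + Hy (xf t, y0, p))"
        using Zsplit[of "xf t" "uf t" p] main[OF p] by (simp add: Zf_def \<gamma>_def y0_def mult.assoc)
      have "((\<lambda>s. (xf s, uf s, p)) has_vector_derivative (uf t, uf t * Hx (xf t, y0, p) + K (xf t, y0, p) * (1 + Hy (xf t, y0, p)), 0)) (at t within S)"
        using dx du unfolding Zt
        by (auto intro!: derivative_eq_intros has_vector_derivative_Pair simp: has_real_derivative_iff_has_vector_derivative)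
      \<comment> \<open>At first the derivative y1 of y along the curve is merely known to exist.
        Differentiating y + H = u and comparing with the equation for u determines it, because 1 +
        Hy is nonzero.\<close>
      from real_analytic_at_chain[of yy "\<lambda>s. (xf s, uf s, p)", OF _ this] yya
      obtain y1 where y1: "((\<lambda>s. yy (xf s, uf s, p)) has_real_derivative y1) (at t within S)" by blast
      then have "((\<lambda>s. (xf s, yy (xf s, uf s, p), p)) has_vector_derivative (uf t, y1, 0)) (at t within S)"
        using dx by (auto intro!: derivative_eq_intros has_vector_derivative_Pair simp: has_real_derivative_iff_has_vector_derivative)
      moreover have "frechet_derivative H (at (xf t, y0, p)) (uf t, y1, 0) = uf t * Hx (xf t, y0, p) + y1 * Hy (xf t, y0, p)"
        using frechet_add[OF Ha, of "uf t *\<^sub>R (1, 0, 0)" "y1 *\<^sub>R (0, 1, 0)"]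
          frechet_scaled[OF Ha, of "uf t" "(1, 0, 0)"] frechet_scaled[OF Ha, of "y1" "(0, 1, 0)"]
        by (simp add: Hx_def Hy_def)
      ultimately have dH: "((\<lambda>s. H (xf s, yy (xf s, uf s, p), p)) has_real_derivative uf t * Hx (xf t, y0, p) + y1 * Hy (xf t, y0, p)) (at t within S)"
        using real_analytic_at_chain[of H "\<lambda>s. (xf s, yy (xf s, uf s, p), p)" t "(uf t, y1, 0)" S] Ha by (simp add: y0_def)
      have "((\<lambda>s. yy (xf s, uf s, p) + H (xf s, yy (xf s, uf s, p), p)) has_real_derivative y1 + (uf t * Hx (xf t, y0, p) + y1 * Hy (xf t, y0, p))) (at t within S)"
        by (intro DERIV_add y1 dH)
      then have "(uf has_real_derivative y1 + (uf t * Hx (xf t, y0, p) + y1 * Hy (xf t, y0, p))) (at t within S)"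
        by (rule has_field_derivative_transform_within[OF _ zero_less_one t]) (use box bd in auto)
      then have "y1 + (uf t * Hx (xf t, y0, p) + y1 * Hy (xf t, y0, p)) = uf t * Hx (xf t, y0, p) + K (xf t, y0, p) * (1 + Hy (xf t, y0, p))"
        using has_field_derivative_unique[OF _ du False] unfolding Zt by blast
      then have "(y1 - K (xf t, y0, p)) * (1 + Hy (xf t, y0, p)) = 0" by (simp add: algebra_simps)
      moreover have "1 + Hy (xf t, y0, p) \<noteq> 0" using etaH[OF p, of "xf t" y0] bt y0 \<rho> \<rho>' by force
      ultimately have "y1 = Y (xf t) y0 p" using HKX(2)[OF xt] by simp
      then show ?thesis using y1 by (simp add: y0_def)
    qed
    show ?thesis
      by (rule exI[of _ \<rho>], rule exI[of _ \<rho>'], rule exI[of _ L])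
        (use A Cc lip \<rho> d' e1 in \<open>auto simp: L_def\<close>)
  qed
  ultimately show ?thesis by (intro that[of C0 C1 B yy]) auto
qed

section \<open>Weighted polar coordinates\<close>

text \<open>With \<open>x = r cos \<phi>\<close>, \<open>u = - r\<^sup>n sin \<phi>\<close> the system \<open>x' = u\<close>,
  \<open>u' = x\<^bsup>2n-1\<^esup> C\<^sub>0(x) + u x\<^bsup>n-1\<^esup> C\<^sub>1(x) + u\<^sup>2 B(u, x)\<close> has \<open>u' = r\<^bsup>2n-1\<^esup> polar_Z\<close>,
  \<open>\<phi>' = r\<^bsup>n-1\<^esup> polar_N / (cos\<^sup>2 \<phi> + n sin\<^sup>2 \<phi>)\<close> and \<open>dr/d\<phi> = polar_f\<close>.\<close>

definition polar_Z where
  "polar_Z n C0 C1 B \<phi> r \<delta> = cos \<phi> ^ (2 * n - 1) * C0 (r * cos \<phi>, \<delta>) - sin \<phi> * cos \<phi> ^ (n - 1) * C1 (r * cos \<phi>, \<delta>)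
     + r * (sin \<phi>)\<^sup>2 * B (- (r ^ n * sin \<phi>), r * cos \<phi>, \<delta>)"

definition polar_N where
  "polar_N n C0 C1 B \<phi> r \<delta> = real n * (sin \<phi>)\<^sup>2 - cos \<phi> * polar_Z n C0 C1 B \<phi> r \<delta>"

definition polar_f ::
  "nat \<Rightarrow> (real \<times> 'd \<Rightarrow> real) \<Rightarrow> (real \<times> 'd \<Rightarrow> real) \<Rightarrow> (real \<times> real \<times> 'd \<Rightarrow> real) \<Rightarrow> real \<times> real \<times> 'd \<Rightarrow> real" where
  "polar_f n C0 C1 B = (\<lambda>(\<phi>, r, \<delta>). r * (- sin \<phi> * (cos \<phi> + polar_Z n C0 C1 B \<phi> r \<delta>) / polar_N n C0 C1 B \<phi> r \<delta>))"

lemma polar_f_zero: "polar_f n C0 C1 B (\<phi>, 0, \<delta>) = 0"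
  by (simp add: polar_f_def)

text \<open>For odd n the pairs (\<phi> + pi, r) and (\<phi>, - r) are the same point (x, u);
  replacing r by - r at equal angular speed reverses dr/d\<phi>.\<close>

lemma polar_f_odd:
  assumes "odd n"
  shows "polar_f n C0 C1 B (\<phi> + pi, r, \<delta>) = - polar_f n C0 C1 B (\<phi>, - r, \<delta>)"
proof -
  have n: "n \<ge> 1" using assms by (cases n) auto
  have e: "(- cos \<phi>) ^ (2 * n - 1) = - (cos \<phi> ^ (2 * n - 1))" "(- cos \<phi>) ^ (n - 1) = cos \<phi> ^ (n - 1)"
    "(- r) ^ n = - (r ^ n)"
    using assms n by (auto simp: uminus_power_if)
  have Z: "polar_Z n C0 C1 B (\<phi> + pi) r \<delta> = - polar_Z n C0 C1 B \<phi> (- r) \<delta>"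
    by (simp add: polar_Z_def e[unfolded One_nat_def])
  have neg: "- polar_Z n C0 C1 B \<phi> (- r) \<delta> - cos \<phi> = - (cos \<phi> + polar_Z n C0 C1 B \<phi> (- r) \<delta>)" by simp
  show ?thesis
    by (simp add: polar_f_def polar_N_def Z neg del: minus_add_distrib)
qed

text \<open>For even n the pairs (pi - \<phi>, r) and (\<phi>, - r) are the same point; here r and
  \<phi> both change sign, which leaves dr/d\<phi> as it is.\<close>

lemma polar_f_even:
  assumes "even n" "n \<ge> 1"
  shows "polar_f n C0 C1 B (pi - \<phi>, r, \<delta>) = polar_f n C0 C1 B (\<phi>, - r, \<delta>)"
proof -
  have sc: "sin (pi - \<phi>) = sin \<phi>" "cos (pi - \<phi>) = - cos \<phi>" by (simp_all add: sin_diff cos_diff)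
  have e: "(- cos \<phi>) ^ (2 * n - 1) = - (cos \<phi> ^ (2 * n - 1))" "(- cos \<phi>) ^ (n - 1) = - (cos \<phi> ^ (n - 1))"
    "(- r) ^ n = r ^ n"
    using assms by (auto simp: uminus_power_if)
  have Z: "polar_Z n C0 C1 B (pi - \<phi>) r \<delta> = - polar_Z n C0 C1 B \<phi> (- r) \<delta>"
    by (simp add: polar_Z_def e[unfolded One_nat_def] sc)
  have N: "polar_N n C0 C1 B (pi - \<phi>) r \<delta> = polar_N n C0 C1 B \<phi> (- r) \<delta>"
    by (simp add: polar_N_def Z sc)
  have neg: "- polar_Z n C0 C1 B \<phi> (- r) \<delta> - cos \<phi> = - (cos \<phi> + polar_Z n C0 C1 B \<phi> (- r) \<delta>)" by simp
  show ?thesis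
    by (simp add: polar_f_def N Z sc neg del: minus_add_distrib)
qed

lemma polar_f_periodic: "polar_f n C0 C1 B (\<phi> + 2 * pi, r, \<delta>) = polar_f n C0 C1 B (\<phi>, r, \<delta>)"
  by (simp add: polar_f_def polar_N_def polar_Z_def)

text \<open>One fixed parameter value. Analyticity at the base points is enough for the whole circle
  r = 0, since x = r cos \<phi> and u are 0 on it.\<close>

locale polar_system =
  fixes n :: nat and C0 C1 :: "real \<times> 'd::euclidean_space \<Rightarrow> real" and B :: "real \<times> real \<times> 'd \<Rightarrow> real"
    and p :: 'd and a b :: real
  assumes n1: "n \<ge> 1"
    and an: "real_analytic_at C0 (0, p)" "real_analytic_at C1 (0, p)" "real_analytic_at B (0, 0, p)"
    and C0p: "C0 (0, p) = - a" and C1p: "C1 (0, p) = - b"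
    and a: "a > 0" and disc: "b\<^sup>2 - 4 * real n * a < 0"
begin

abbreviation "pZ \<equiv> polar_Z n C0 C1 B"
abbreviation "pN \<equiv> polar_N n C0 C1 B"
abbreviation "pf \<equiv> polar_f n C0 C1 B"

text \<open>At r = 0 this is the quadratic form n s^2 - b s c + a c^2 in s = sin \<phi> and c =
  cos^n \<phi>, of discriminant b^2 - 4 n a; completing the square proves it positive.\<close>

lemma polar_N_pos: "pN \<phi> 0 p > 0"
proof -
  have pw: "cos \<phi> * cos \<phi> ^ (2 * n - 1) = (cos \<phi> ^ n)\<^sup>2" "cos \<phi> * cos \<phi> ^ (n - 1) = cos \<phi> ^ n"
    using n1 by (auto simp: power_Suc[symmetric] power_mult[symmetric] mult.commute simp del: power_Suc)
  have N: "pN \<phi> 0 p = real n * (sin \<phi>)\<^sup>2 - b * sin \<phi> * cos \<phi> ^ n + a * (cos \<phi> ^ n)\<^sup>2"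
  proof -
    have "pN \<phi> 0 p = real n * (sin \<phi>)\<^sup>2 - b * sin \<phi> * (cos \<phi> * cos \<phi> ^ (n - 1)) + a * (cos \<phi> * cos \<phi> ^ (2 * n - 1))"
      unfolding polar_N_def polar_Z_def by (simp add: C0p C1p algebra_simps)
    then show ?thesis by (simp only: pw)
  qed
  have eq: "4 * a * pN \<phi> 0 p = (2 * a * cos \<phi> ^ n - b * sin \<phi>)\<^sup>2 + (4 * real n * a - b\<^sup>2) * (sin \<phi>)\<^sup>2"
    unfolding N by (simp add: power2_eq_square algebra_simps)
  have "4 * a * pN \<phi> 0 p > 0"
  proof (cases "sin \<phi> = 0")
    case True
    then have "cos \<phi> \<noteq> 0" using sin_cos_squared_add[of \<phi>] by auto
    then show ?thesis unfolding eq using True a by simp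
  next
    case False
    then show ?thesis unfolding eq using disc by (intro add_nonneg_pos mult_pos_pos) auto
  qed
  then show ?thesis using a by (simp add: zero_less_mult_iff)
qed

lemma polar_analytic:
  "real_analytic_at (\<lambda>q. pZ (fst q) (fst (snd q)) (snd (snd q))) (\<phi>, 0, p)"
  "real_analytic_at (\<lambda>q. pN (fst q) (fst (snd q)) (snd (snd q))) (\<phi>, 0, p)"
  "real_analytic_at pf (\<phi>, 0, p)"
proof -
  let ?\<phi> = "\<lambda>q :: real \<times> real \<times> 'd. fst q" and ?r = "\<lambda>q :: real \<times> real \<times> 'd. fst (snd q)" and ?d = "\<lambda>q :: real \<times> real \<times> 'd. snd (snd q)"
  let ?q = "(\<phi>, 0, p) :: real \<times> real \<times> 'd"
  have s: "real_analytic_at (\<lambda>q. sin (?\<phi> q)) ?q" and c: "real_analytic_at (\<lambda>q. cos (?\<phi> q)) ?q"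
    by (intro real_analytic_at_sin real_analytic_at_cos real_analytic_at_realD[OF analytic_map_at_fst])+
  have r: "real_analytic_at ?r ?q" by (intro real_analytic_at_realD analytic_map_at_fst' analytic_map_at_snd)
  have d: "analytic_map_at ?d ?q" by (intro analytic_map_at_snd' analytic_map_at_snd)
  have x: "analytic_map_at (\<lambda>q. (?r q * cos (?\<phi> q), ?d q)) ?q"
    by (intro analytic_map_at_Pair d analytic_map_at_realI real_analytic_at_mult r c)
  have u: "analytic_map_at (\<lambda>q. (- (?r q ^ n * sin (?\<phi> q)), ?r q * cos (?\<phi> q), ?d q)) ?q"
    by (intro analytic_map_at_Pair d analytic_map_at_realI real_analytic_at_mult real_analytic_at_minus real_analytic_at_power r c s)
  have "real_analytic_at (\<lambda>q. C0 (?r q * cos (?\<phi> q), ?d q)) ?q" "real_analytic_at (\<lambda>q. C1 (?r q * cos (?\<phi> q), ?d q)) ?q"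
    "real_analytic_at (\<lambda>q. B (- (?r q ^ n * sin (?\<phi> q)), ?r q * cos (?\<phi> q), ?d q)) ?q"
    using real_analytic_at_comp[OF _ x, of C0] real_analytic_at_comp[OF _ x, of C1] real_analytic_at_comp[OF _ u, of B] an n1
    by (simp_all add: power_0_left)
  then show Z: "real_analytic_at (\<lambda>q. pZ (?\<phi> q) (?r q) (?d q)) ?q"
    unfolding polar_Z_def
    by (intro real_analytic_at_add real_analytic_at_diff real_analytic_at_mult real_analytic_at_power s c r)
  then show N: "real_analytic_at (\<lambda>q. pN (?\<phi> q) (?r q) (?d q)) ?q"
    unfolding polar_N_def
    by (intro real_analytic_at_diff real_analytic_at_mult real_analytic_at_power real_analytic_at_const s c)
  have "real_analytic_at (\<lambda>q. ?r q * (- sin (?\<phi> q) * (cos (?\<phi> q) + pZ (?\<phi> q) (?r q) (?d q)) / pN (?\<phi> q) (?r q) (?d q))) ?q"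
    using polar_N_pos[of \<phi>]
    by (intro real_analytic_at_mult real_analytic_at_divide real_analytic_at_minus real_analytic_at_add r s c Z N) simp
  then show "real_analytic_at pf (\<phi>, 0, p)" by (simp add: polar_f_def case_prod_unfold)
qed

end

text \<open>The explicit exponential bound serves twice: it keeps the radius positive along an
  orbit, and it bounds the derivative of the flow at 0 from below.\<close>

lemma ode_sol_positive:
  assumes r: "ode_sol f \<delta> a b r" and lip: "\<And>t. t \<in> {a..b} \<Longrightarrow> \<bar>f (t, r t, \<delta>)\<bar> \<le> L * \<bar>r t\<bar>"
    and ra: "r a > 0" and t: "t \<in> {a..b}"
  shows "r t \<ge> r a * exp (- L * (t - a))"
proof -
  have ge: "(r s)\<^sup>2 \<ge> (r a * exp (- L * (s - a)))\<^sup>2" if s: "s \<in> {a..b}" for s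
  proof -
    \<comment> \<open>The square of r times exp (2 L (s - a)) is nondecreasing; this excludes zeros,
      and the sign then follows from the intermediate value theorem.\<close>
    define w where "w = (\<lambda>s. - ((r s)\<^sup>2 * exp (2 * L * (s - a))))"
    have dw: "(w has_real_derivative - ((2 * (r u * f (u, r u, \<delta>) + L * (r u)\<^sup>2)) * exp (2 * L * (u - a)))) (at u within {a..b})"
      if "u \<in> {a..b}" for u
      unfolding w_def by (rule derivative_eq_intros ode_solD[OF r that] refl | simp add: algebra_simps power2_eq_square)+
    have "w s \<le> w a"
    proof (rule DERIV_nonpos_imp_decreasing_open[of a s w])
      show "continuous_on {a..s} w"
        using DERIV_continuous_on[of "{a..b}" w] dw continuous_on_subset[of "{a..b}" w "{a..s}"] s by fastforce
      fix x assume x: "a < x" "x < s"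
      then have xb: "x \<in> {a..b}" using s by auto
      have "(w has_real_derivative - ((2 * (r x * f (x, r x, \<delta>) + L * (r x)\<^sup>2)) * exp (2 * L * (x - a)))) (at x)"
        using dw[OF xb] x s at_within_Icc_at[of a x b] by simp
      moreover have ab: "- (r x * f (x, r x, \<delta>)) \<le> \<bar>r x\<bar> * \<bar>f (x, r x, \<delta>)\<bar>"
        by (metis abs_ge_minus_self abs_mult)
      have "- (r x * f (x, r x, \<delta>)) \<le> L * (r x)\<^sup>2"
      proof -
        have "\<bar>r x\<bar> * \<bar>f (x, r x, \<delta>)\<bar> \<le> \<bar>r x\<bar> * (L * \<bar>r x\<bar>)" by (rule mult_left_mono[OF lip[OF xb]]) simp
        also have "\<dots> = L * (\<bar>r x\<bar> * \<bar>r x\<bar>)" by (rule mult.left_commute)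
        also have "\<dots> = L * (r x)\<^sup>2" by (simp add: power2_eq_square)
        finally show ?thesis using ab by linarith
      qed
      then have "- ((2 * (r x * f (x, r x, \<delta>) + L * (r x)\<^sup>2)) * exp (2 * L * (x - a))) \<le> 0" by simp
      ultimately show "\<exists>y. (w has_real_derivative y) (at x) \<and> y \<le> 0" by blast
    qed (use s in auto)
    then have "(r a)\<^sup>2 \<le> (r s)\<^sup>2 * exp (2 * L * (s - a))" by (simp add: w_def)
    then have "(r a)\<^sup>2 * exp (- (2 * L * (s - a))) \<le> (r s)\<^sup>2"
      by (simp add: exp_minus divide_inverse[symmetric] pos_divide_le_eq)
    moreover have "exp (- (2 * L * (s - a))) = (exp (- L * (s - a)))\<^sup>2" by (simp add: exp_double[symmetric] algebra_simps)
    ultimately show ?thesis by (simp add: power_mult_distrib)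
  qed
  have pos: "r a * exp (- L * (s - a)) > 0" for s using ra by simp
  have nz: "r s \<noteq> 0" if "s \<in> {a..b}" for s
  proof
    assume "r s = 0"
    then have "(r a * exp (- L * (s - a)))\<^sup>2 \<le> 0" using ge[OF that] by simp
    then show False using pos[of s] by simp
  qed
  have cont: "continuous_on {a..b} r"
    by (rule DERIV_continuous_on) (rule ode_solD[OF r])
  have "r t > 0"
  proof (rule ccontr)
    assume "\<not> r t > 0"
    then have "r t \<le> 0" by simp
    then obtain s where "a \<le> s" "s \<le> t" "r s = 0"
      using IVT2'[of r t 0 a] ra t continuous_on_subset[OF cont, of "{a..t}"] by force
    then show False using nz[of s] t by auto
  qed
  then show ?thesis using ge[OF t] power2_le_imp_le[of "r a * exp (- L * (t - a))" "r t"] by simp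
qed

section \<open>Symmetries of the angular equation and functional equations of its flow\<close>

lemma ode_sol_reflect:
  assumes r: "ode_sol f \<delta> u v r" and f: "\<And>t x. f (c - t, x, \<delta>) = f (t, - x, \<delta>)"
  shows "ode_sol f \<delta> (c - v) (c - u) (\<lambda>t. - r (c - t))"
  unfolding ode_sol_def
proof
  fix t assume t: "t \<in> {c - v..c - u}"
  have im: "(\<lambda>t. c - t) ` {c - v..c - u} = {u..v}" by (auto simp: image_iff intro!: bexI[of _ "c - _"])
  have "(r has_real_derivative f (c - t, r (c - t), \<delta>)) (at (c - t) within (\<lambda>t. c - t) ` {c - v..c - u})"
    unfolding im using t by (intro ode_solD[OF r]) auto
  moreover have "((\<lambda>t. c - t) has_real_derivative - 1) (at t within {c - v..c - u})"
    by (auto intro!: derivative_eq_intros)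
  ultimately have "((\<lambda>t. r (c - t)) has_real_derivative f (c - t, r (c - t), \<delta>) * - 1) (at t within {c - v..c - u})"
    by (rule DERIV_image_chain[unfolded o_def])
  then have "((\<lambda>t. - r (c - t)) has_real_derivative f (t, - r (c - t), \<delta>)) (at t within {c - v..c - u})"
    using DERIV_minus f[of t "r (c - t)"] by fastforce
  then show "((\<lambda>t. - r (c - t)) has_real_derivative f (t, - r (c - t), \<delta>)) (at t within {c - v..c - u})" .
qed

lemma ode_sol_translate:
  assumes r: "ode_sol f \<delta> u v r" and f: "\<And>t x. f (t + c, x, \<delta>) = - f (t, - x, \<delta>)"
  shows "ode_sol f \<delta> (u - c) (v - c) (\<lambda>t. - r (t + c))"
  unfolding ode_sol_def
proof
  fix t assume t: "t \<in> {u - c..v - c}"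
  have im: "(\<lambda>t. t + c) ` {u - c..v - c} = {u..v}" by simp
  have "(r has_real_derivative f (t + c, r (t + c), \<delta>)) (at (t + c) within (\<lambda>t. t + c) ` {u - c..v - c})"
    unfolding im using t by (intro ode_solD[OF r]) auto
  moreover have "((\<lambda>t. t + c) has_real_derivative 1) (at t within {u - c..v - c})"
    by (auto intro!: derivative_eq_intros)
  ultimately have "((\<lambda>t. r (t + c)) has_real_derivative f (t + c, r (t + c), \<delta>) * 1) (at t within {u - c..v - c})"
    by (rule DERIV_image_chain[unfolded o_def])
  then show "((\<lambda>t. - r (t + c)) has_real_derivative f (t, - r (t + c), \<delta>)) (at t within {u - c..v - c})"
    using DERIV_minus f[of t "r (t + c)"] by fastforce
qed

lemma ode_flow_section:
  assumes "ode_flow f p a b S" "\<eta> > 0"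
  shows "\<forall>\<^sub>F x in nhds 0. \<exists>r. ode_sol f p a b r \<and> r a = x \<and> r b = S (x, p) \<and> (\<forall>t\<in>{a..b}. \<bar>r t\<bar> < \<eta>)"
proof -
  have "\<forall>\<^sub>F y in nhds (0, p). \<exists>r. ode_sol f (snd y) a b r \<and> r a = fst y \<and> r b = S y \<and> (\<forall>t\<in>{a..b}. \<bar>r t\<bar> < \<eta>)"
    using assms by (simp add: ode_flow_def)
  from eventually_nhds_Pair_const[OF this] show ?thesis by simp
qed

lemma ode_flow_section_tendsto:
  assumes "ode_flow f p a b S"
  shows "((\<lambda>x. S (x, p)) \<longlongrightarrow> 0) (nhds 0)"
proof -
  have "isCont (\<lambda>x. S (x, p)) 0"
    using assms by (intro real_analytic_at_isCont analytic_restrict_snd) (simp add: ode_flow_def)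
  then show ?thesis using assms tendsto_at_iff_tendsto_nhds[of "\<lambda>x. S (x, p)" 0]
    by (simp add: isCont_def ode_flow_def)
qed

context polar_system
begin

lemma lipschitz_polar:
  obtains \<eta> L where "\<eta> > 0" "\<forall>t r r'. t \<in> {0..2 * pi} \<longrightarrow> \<bar>r\<bar> \<le> \<eta> \<longrightarrow> \<bar>r'\<bar> \<le> \<eta> \<longrightarrow>
     \<bar>pf (t, r, p) - pf (t, r', p)\<bar> \<le> L * \<bar>r - r'\<bar>"
proof -
  obtain \<eta> L where \<eta>: "\<eta> > 0" and lip: "\<And>t r r' \<delta>. t \<in> {0..2 * pi} \<Longrightarrow> \<bar>r\<bar> \<le> \<eta> \<Longrightarrow> \<bar>r'\<bar> \<le> \<eta> \<Longrightarrow> dist \<delta> p < \<eta> \<Longrightarrow>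
     \<bar>pf (t, r, \<delta>) - pf (t, r', \<delta>)\<bar> \<le> L * \<bar>r - r'\<bar>"
    by (rule ode_lipschitz[of 0 "2 * pi" pf p, OF _ polar_analytic(3)]) (simp, blast)
  have "\<forall>t r r'. t \<in> {0..2 * pi} \<longrightarrow> \<bar>r\<bar> \<le> \<eta> \<longrightarrow> \<bar>r'\<bar> \<le> \<eta> \<longrightarrow> \<bar>pf (t, r, p) - pf (t, r', p)\<bar> \<le> L * \<bar>r - r'\<bar>"
    using lip[of _ _ _ p] \<eta> by simp
  then show ?thesis using \<eta> by (rule that[rotated])
qed

text \<open>A symmetry maps a piece of an orbit to a piece of another orbit, which uniqueness
  identifies from its initial value.\<close>

lemma flow_relations:
  assumes S1: "ode_flow pf p 0 pi S1" and S2: "ode_flow pf p 0 (2 * pi) S2"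
  shows "odd n \<Longrightarrow> \<forall>\<^sub>F x in nhds 0. S2 (x, p) = - S1 (- S1 (x, p), p)"
    and "even n \<Longrightarrow> \<forall>\<^sub>F x in nhds 0. S2 (- S1 (S2 (x, p), p), p) = - S1 (x, p)"
proof -
  obtain \<eta> L where \<eta>: "\<eta> > 0" and lip0: "\<forall>t r r'. t \<in> {0..2 * pi} \<longrightarrow> \<bar>r\<bar> \<le> \<eta> \<longrightarrow> \<bar>r'\<bar> \<le> \<eta> \<longrightarrow>
     \<bar>pf (t, r, p) - pf (t, r', p)\<bar> \<le> L * \<bar>r - r'\<bar>"
    by (rule lipschitz_polar) (rule that)
  \<comment> \<open>At angle pi the point of radius r has abscissa - r, hence the sign.\<close>
  define h where "h = (\<lambda>x. - S1 (x, p))"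
  define Pm where "Pm = (\<lambda>x. S2 (x, p))"
  have uniq: "r1 t = r2 t"
    if "ode_sol pf p u v r1" "ode_sol pf p u v r2" "r1 u = r2 u" "\<And>s. s \<in> {u..v} \<Longrightarrow> \<bar>r1 s\<bar> < \<eta>" "\<And>s. s \<in> {u..v} \<Longrightarrow> \<bar>r2 s\<bar> < \<eta>"
      "0 \<le> u" "v \<le> 2 * pi" "t \<in> {u..v}" for u v r1 r2 t
  proof (rule ode_sol_unique[OF that(1-3) _ that(8), of L])
    fix s assume s: "s \<in> {u..v}"
    then show "\<bar>pf (s, r1 s, p) - pf (s, r2 s, p)\<bar> \<le> L * \<bar>r1 s - r2 s\<bar>"
      using lip0 that(4,5)[OF s] that(6,7) by auto
  qed
  define Q1 where "Q1 = (\<lambda>x r. ode_sol pf p 0 pi r \<and> r 0 = x \<and> r pi = - h x \<and> (\<forall>t\<in>{0..pi}. \<bar>r t\<bar> < \<eta>))"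
  define Q2 where "Q2 = (\<lambda>x r. ode_sol pf p 0 (2 * pi) r \<and> r 0 = x \<and> r (2 * pi) = Pm x \<and> (\<forall>t\<in>{0..2 * pi}. \<bar>r t\<bar> < \<eta>))"
  have e1: "\<forall>\<^sub>F x in nhds 0. \<exists>r. Q1 x r"
    using ode_flow_section[OF S1 \<eta>] by (simp add: Q1_def h_def)
  have e2: "\<forall>\<^sub>F x in nhds 0. \<exists>r. Q2 x r"
    using ode_flow_section[OF S2 \<eta>] by (simp add: Q2_def Pm_def)
  have hl: "filterlim h (nhds 0) (nhds 0)" and Pl: "filterlim Pm (nhds 0) (nhds 0)"
    using tendsto_minus[OF ode_flow_section_tendsto[OF S1]] ode_flow_section_tendsto[OF S2] by (simp_all add: h_def Pm_def)
  have e1h: "\<forall>\<^sub>F x in nhds 0. \<exists>r. Q1 (h x) r" by (rule eventually_compose_filterlim[OF e1 hl])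
  have Q12: "r pi = - h x" if "Q1 x q" "Q2 x r" for x q r
  proof -
    have "q pi = r pi"
      by (rule uniq[of 0 pi q r]) (use that in \<open>auto simp: Q1_def Q2_def intro: ode_sol_subset\<close>)
    then show ?thesis using that by (simp add: Q1_def)
  qed
  show "\<forall>\<^sub>F x in nhds 0. S2 (x, p) = - S1 (- S1 (x, p), p)" if "odd n"
    using e1 e2 e1h
  proof eventually_elim
    case (elim x)
    then obtain q r s where q: "Q1 x q" and r: "Q2 x r" and s: "Q1 (h x) s" by blast
    have "ode_sol pf p pi (2 * pi) r" using r by (auto simp: Q2_def intro: ode_sol_subset)
    then have "ode_sol pf p (pi - pi) (2 * pi - pi) (\<lambda>t. - r (t + pi))"
      by (rule ode_sol_translate) (rule polar_f_odd[OF that])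
    then have T0: "ode_sol pf p 0 pi (\<lambda>t. - r (t + pi))" by simp
    have ssol: "ode_sol pf p 0 pi s" using s by (simp add: Q1_def)
    have "- r (pi + pi) = s pi"
    proof (rule uniq[OF T0 ssol])
      show "- r (0 + pi) = s 0" using Q12[OF q r] s by (simp add: Q1_def)
      fix t assume "t \<in> {0..pi}"
      then show "\<bar>- r (t + pi)\<bar> < \<eta>" "\<bar>s t\<bar> < \<eta>" using r s by (simp_all add: Q1_def Q2_def)
    qed auto
    then have "Pm x = h (h x)" using r s by (simp add: Q1_def Q2_def)
    then show ?case by (simp add: Pm_def h_def)
  qed
  show "\<forall>\<^sub>F x in nhds 0. S2 (- S1 (S2 (x, p), p), p) = - S1 (x, p)" if ev: "even n"
  proof -
    have hP: "filterlim (\<lambda>x. h (Pm x)) (nhds 0) (nhds 0)" by (rule filterlim_compose[OF hl Pl])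
    \<comment> \<open>Reflected in the angle pi / 2, the first half of an orbit runs backwards, from
      h x to x.\<close>
    have "\<forall>\<^sub>F x in nhds 0. h (h x) = x"
      using e1 e1h
    proof eventually_elim
      case (elim x)
      then obtain r s where r: "Q1 x r" and s: "Q1 (h x) s" by blast
      have "ode_sol pf p 0 pi r" using r by (simp add: Q1_def)
      then have "ode_sol pf p (pi - pi) (pi - 0) (\<lambda>t. - r (pi - t))"
        by (rule ode_sol_reflect) (rule polar_f_even[OF ev n1])
      then have T0: "ode_sol pf p 0 pi (\<lambda>t. - r (pi - t))" by simp
      have ssol: "ode_sol pf p 0 pi s" using s by (simp add: Q1_def)
      have "- r (pi - pi) = s pi"
      proof (rule uniq[OF T0 ssol])
        show "- r (pi - 0) = s 0" using r s by (simp add: Q1_def)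
        fix t assume "t \<in> {0..pi}"
        then show "\<bar>- r (pi - t)\<bar> < \<eta>" "\<bar>s t\<bar> < \<eta>" using r s by (simp_all add: Q1_def)
      qed auto
      then show ?case using r s by (simp add: Q1_def)
    qed
    then have hh: "\<forall>\<^sub>F x in nhds 0. h (h (Pm x)) = Pm x" by (rule eventually_compose_filterlim[OF _ Pl])
    have e3: "\<forall>\<^sub>F x in nhds 0. \<exists>r. Q2 (h (Pm x)) r" by (rule eventually_compose_filterlim[OF e2 hP])
    have e4: "\<forall>\<^sub>F x in nhds 0. \<exists>r. Q1 (h (Pm x)) r" by (rule eventually_compose_filterlim[OF e1 hP])
    show ?thesis
      using hh e1 e2 e3 e4
    proof eventually_elim
      case (elim x)
      then obtain q0 r q q1 where q0: "Q1 x q0" and r: "Q2 x r" and q: "Q2 (h (Pm x)) q" and q1: "Q1 (h (Pm x)) q1" by blast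
      \<comment> \<open>Reflecting the second half in 3 pi / 2 gives the second half of the orbit of
        h (Pm x): by h (h (Pm x)) = Pm x the values at pi agree, and the values at 2 pi are the
        claim.\<close>
      have "ode_sol pf p pi (2 * pi) r" using r by (auto simp: Q2_def intro: ode_sol_subset)
      then have "ode_sol pf p (3 * pi - 2 * pi) (3 * pi - pi) (\<lambda>t. - r (3 * pi - t))"
      proof (rule ode_sol_reflect)
        fix t x show "pf (3 * pi - t, x, p) = pf (t, - x, p)"
          using polar_f_even[OF ev n1, of C0 C1 B t x p] polar_f_periodic[of n C0 C1 B "pi - t" x p]
          by (simp add: algebra_simps)
      qed
      then have s: "ode_sol pf p pi (2 * pi) (\<lambda>t. - r (3 * pi - t))" by simp
      have "- r (3 * pi - 2 * pi) = q (2 * pi)"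
      proof (rule uniq[OF s])
        show "ode_sol pf p pi (2 * pi) q" using q by (auto simp: Q2_def intro: ode_sol_subset)
        show "- r (3 * pi - pi) = q pi"
          using Q12[OF q1 q] r elim(1) by (simp add: Q2_def)
        fix t assume "t \<in> {pi..2 * pi}"
        then show "\<bar>- r (3 * pi - t)\<bar> < \<eta>" "\<bar>q t\<bar> < \<eta>" using r q by (simp_all add: Q2_def)
      qed auto
      then have "Pm (h (Pm x)) = h x" using Q12[OF q0 r] q by (simp add: Q2_def)
      then show ?case by (simp add: Pm_def h_def)
    qed
  qed
qed

text \<open>For x > 0 the quotient S(x) / x is at least exp (- L T), and this bound passes to the
  limit.\<close>

lemma flow_derivative_pos:
  assumes S: "ode_flow pf p 0 T S" and T: "0 \<le> T" "T \<le> 2 * pi" and c: "(\<lambda>x. S (x, p)) has_fps_expansion c"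
  shows "fps_nth c 0 = 0" "fps_nth c 1 > 0"
proof -
  obtain \<eta> L where \<eta>: "\<eta> > 0" and lip0: "\<forall>t r r'. t \<in> {0..2 * pi} \<longrightarrow> \<bar>r\<bar> \<le> \<eta> \<longrightarrow> \<bar>r'\<bar> \<le> \<eta> \<longrightarrow>
     \<bar>pf (t, r, p) - pf (t, r', p)\<bar> \<le> L * \<bar>r - r'\<bar>"
    by (rule lipschitz_polar) (rule that)
  have Sa: "real_analytic_at S (0, p)" and S0: "S (0, p) = 0" using S by (simp_all add: ode_flow_def)
  show "fps_nth c 0 = 0" using has_fps_expansion_0_eq[OF c] S0 by simp
  have "\<forall>\<^sub>F x in at_right 0. exp (- L * T) \<le> hquot S (x, p)"
    using ode_flow_section[OF S \<eta>, THEN filter_leD[OF at_within_le_nhds]] eventually_at_right_less[of 0]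
  proof eventually_elim
    case (elim x)
    then obtain r where r: "ode_sol pf p 0 T r" "r 0 = x" "r T = S (x, p)" "\<forall>t\<in>{0..T}. \<bar>r t\<bar> < \<eta>" by blast
    have "r T \<ge> r 0 * exp (- L * (T - 0))"
    proof (rule ode_sol_positive[OF r(1)])
      fix t assume t: "t \<in> {0..T}"
      have "\<bar>r t\<bar> \<le> \<eta>" using r(4) t by (simp add: less_imp_le)
      then show "\<bar>pf (t, r t, p)\<bar> \<le> L * \<bar>r t\<bar>"
        using lip0[rule_format, of t "r t" 0] t T \<eta> by (simp add: polar_f_zero)
    qed (use elim r T in auto)
    then have "x * exp (- L * T) \<le> x * hquot S (x, p)" using hquot_eq[of S x p] S0 r by simp
    then show ?case using elim by simp
  qed
  moreover have "((\<lambda>x. hquot S (x, p)) \<longlongrightarrow> hquot S (0, p)) (at_right 0)"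
    using real_analytic_at_isCont[OF analytic_restrict_snd[OF hquot_analytic[OF Sa]]]
    by (auto simp: isCont_def intro: tendsto_within_subset)
  ultimately have "exp (- L * T) \<le> hquot S (0, p)"
    by (intro tendsto_lowerbound[of "\<lambda>x. hquot S (x, p)" _ "at_right 0"]) auto
  moreover have "fps_nth c 1 = hquot S (0, p)"
    using fps_nth_eq_hquot_power[OF Sa c, of 1] by simp
  ultimately show "fps_nth c 1 > 0" using exp_gt_zero[of "- L * T"] by linarith
qed

text \<open>Odd n: P = h o h commutes with h. Even n: P o (h o P) = h, and subtracting h o P gives
  the form d o g with g = h o P and the sign - 1.\<close>

lemma flow_fps_relations:
  assumes S1: "ode_flow pf p 0 pi S1" and S2: "ode_flow pf p 0 (2 * pi) S2"
    and s1: "(\<lambda>x. S1 (x, p)) has_fps_expansion s1" and P: "(\<lambda>x. S2 (x, p)) has_fps_expansion P"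
  defines "h \<equiv> - s1"
  shows "odd n \<Longrightarrow> (P - fps_X) oo h = fps_const 1 * ((h oo P) - h)"
    and "even n \<Longrightarrow> (P - fps_X) oo (h oo P) = fps_const (- 1) * ((h oo P) - h)"
proof -
  have hx: "(\<lambda>x. - S1 (x, p)) has_fps_expansion h" unfolding h_def by (intro fps_expansion_intros s1)
  have h0: "fps_nth h 0 = 0" and P0: "fps_nth P 0 = 0"
    using flow_derivative_pos(1)[OF S1 _ _ s1] flow_derivative_pos(1)[OF S2 _ _ P] by (simp_all add: h_def)
  have X: "(A - fps_X) oo k = (A oo k) - k" if "fps_nth k 0 = 0" for A k :: "real fps"
    using that by (simp add: fps_compose_sub_distrib fps_X_fps_compose_startby0)
  show "(P - fps_X) oo h = fps_const 1 * ((h oo P) - h)" if "odd n"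
  proof -
    have "(\<lambda>x. - S1 (- S1 (x, p), p)) has_fps_expansion (h oo h)"
      by (rule has_fps_expansion_compose_real[OF hx hx h0])
    moreover have "\<forall>\<^sub>F x in nhds 0. - S1 (- S1 (x, p), p) = S2 (x, p)"
      using flow_relations(1)[OF S1 S2 that] by eventually_elim simp
    ultimately have "(\<lambda>x. S2 (x, p)) has_fps_expansion (h oo h)" by (rule has_fps_expansion_cong_ev)
    then have "P = h oo h" by (rule has_fps_expansion_unique_real[OF P])
    then have "P oo h = h oo P" using fps_compose_assoc[OF h0 h0, of h] by simp
    then show ?thesis by (simp add: X[OF h0])
  qed
  show "(P - fps_X) oo (h oo P) = fps_const (- 1) * ((h oo P) - h)" if "even n"
  proof -
    have hPx: "(\<lambda>x. - S1 (S2 (x, p), p)) has_fps_expansion (h oo P)"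
      by (rule has_fps_expansion_compose_real[OF hx P P0])
    have hP0: "fps_nth (h oo P) 0 = 0" using h0 by simp
    have "(\<lambda>x. S2 (- S1 (S2 (x, p), p), p)) has_fps_expansion (P oo (h oo P))"
      by (rule has_fps_expansion_compose_real[OF P hPx hP0])
    then have "(\<lambda>x. - S1 (x, p)) has_fps_expansion (P oo (h oo P))"
      by (rule has_fps_expansion_cong_ev) (rule flow_relations(2)[OF S1 S2 that])
    then have "P oo (h oo P) = h" by (rule has_fps_expansion_unique_real) (rule hx)
    then show ?thesis by (simp add: X[OF hP0] fps_const_neg[symmetric] del: fps_const_neg)
  qed
qed

end

section \<open>The return map\<close>

text \<open>Bounds are known for the first solution alone. By continuation, wherever the second
  agrees with it, it stays within 2 R for a short time, and on the doubled box the vector field is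
  Lipschitz.\<close>

lemma system_unique:
  fixes X Y :: "real \<Rightarrow> real \<Rightarrow> 'd \<Rightarrow> real"
  assumes m: "0 \<le> m" and s1: "solves_system X Y p m x y" and s2: "solves_system X Y p m x' y'"
    and eq0: "x 0 = x' 0" "y 0 = y' 0" and bd: "\<And>t. t \<in> {0..m} \<Longrightarrow> \<bar>x t\<bar> < R \<and> \<bar>y t\<bar> < R" and L: "L \<ge> 0"
    and lip: "\<forall>x y x' y'. \<bar>x\<bar> < 2 * R \<longrightarrow> \<bar>y\<bar> < 2 * R \<longrightarrow> \<bar>x'\<bar> < 2 * R \<longrightarrow> \<bar>y'\<bar> < 2 * R \<longrightarrow>
       \<bar>X x y p - X x' y' p\<bar> \<le> L * (\<bar>x - x'\<bar> + \<bar>y - y'\<bar>) \<and> \<bar>Y x y p - Y x' y' p\<bar> \<le> L * (\<bar>x - x'\<bar> + \<bar>y - y'\<bar>)"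
    and t: "t \<in> {0..m}"
  shows "x t = x' t \<and> y t = y' t"
proof -
  have R: "R > 0" using bd[of 0] m abs_ge_zero[of "x 0"] by auto
  have d: "(x has_real_derivative y s + X (x s) (y s) p) (at s within {0..m})"
    "(y has_real_derivative Y (x s) (y s) p) (at s within {0..m})"
    "(x' has_real_derivative y' s + X (x' s) (y' s) p) (at s within {0..m})"
    "(y' has_real_derivative Y (x' s) (y' s) p) (at s within {0..m})" if "s \<in> {0..m}" for s
    using s1 s2 that by (auto simp: solves_system_def)
  define w where "w = (\<lambda>s. (x s - x' s)\<^sup>2 + (y s - y' s)\<^sup>2)"
  have w0: "w s = 0 \<longleftrightarrow> x s = x' s \<and> y s = y' s" for s by (auto simp: w_def sum_power2_eq_zero_iff)
  have cont: "continuous_on {0..m} x'" "continuous_on {0..m} y'" "continuous_on {0..m} w"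
  proof -
    have c: "continuous_on {0..m} x" "continuous_on {0..m} y"
      by (rule DERIV_continuous_on[OF d(1)], assumption, rule DERIV_continuous_on[OF d(2)], assumption)
    show c': "continuous_on {0..m} x'" by (rule DERIV_continuous_on[OF d(3)])
    show c'': "continuous_on {0..m} y'" by (rule DERIV_continuous_on[OF d(4)])
    show "continuous_on {0..m} w" unfolding w_def by (intro continuous_intros c c' c'')
  qed
  have "0 \<le> (0 :: real) \<and> m \<le> m \<longrightarrow> w 0 = 0 \<longrightarrow> (\<forall>t\<in>{0..m}. w t = 0)"
    using m
  proof (induction rule: Bolzano[where P = "\<lambda>c e. 0 \<le> c \<and> e \<le> m \<longrightarrow> w c = 0 \<longrightarrow> (\<forall>t\<in>{c..e}. w t = 0)"])
    case (trans a b c)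
    show ?case
    proof (intro impI ballI)
      fix t assume *: "0 \<le> a \<and> c \<le> m" "w a = 0" "t \<in> {a..c}"
      have "0 \<le> a \<and> b \<le> m" "0 \<le> b \<and> c \<le> m" using * trans(3,4) by linarith+
      then have 1: "\<forall>t\<in>{a..b}. w t = 0" using trans(1) *(2) by blast
      then have "w b = 0" using trans(3) by simp
      then have "\<forall>t\<in>{b..c}. w t = 0" using trans(2) \<open>0 \<le> b \<and> c \<le> m\<close> by blast
      then show "w t = 0" using 1 * by (cases "t \<le> b") auto
    qed
  next
    case (local t0)
    then have t0: "t0 \<in> {0..m}" by simp
    show ?case
    \<comment> \<open>If w t0 is nonzero, w has no zero nearby and the premise w a = 0 fails on
      short intervals.\<close>
    proof (cases "w t0 = 0")
      case False
      have "(w \<longlongrightarrow> w t0) (at t0 within {0..m})" using cont(3) t0 by (simp add: continuous_on_def)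
      then have "\<forall>\<^sub>F s in at t0 within {0..m}. w s \<noteq> 0" using tendsto_imp_eventually_ne False by blast
      then obtain e where e: "e > 0" "\<And>s. s \<in> {0..m} \<Longrightarrow> s \<noteq> t0 \<Longrightarrow> dist s t0 < e \<Longrightarrow> w s \<noteq> 0"
        unfolding eventually_at by blast
      show ?thesis
      proof (intro exI[of _ e] conjI e(1) allI impI)
        fix a b t assume *: "a \<le> t0 \<and> t0 \<le> b \<and> b - a < e" "0 \<le> a \<and> b \<le> m" "w a = 0"
        have "w a \<noteq> 0" using e(2)[of a] False * t0 by (cases "a = t0") (auto simp: dist_real_def)
        then show "\<forall>t\<in>{a..b}. w t = 0" using * by simp
      qed
    next
      case True
      have "(x' \<longlongrightarrow> x' t0) (at t0 within {0..m})" "(y' \<longlongrightarrow> y' t0) (at t0 within {0..m})"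
        using cont t0 by (simp_all add: continuous_on_def)
      from tendsto_rabs[OF this(1)] tendsto_rabs[OF this(2)]
      have "\<forall>\<^sub>F s in at t0 within {0..m}. \<bar>x' s\<bar> < 2 * R" "\<forall>\<^sub>F s in at t0 within {0..m}. \<bar>y' s\<bar> < 2 * R"
        using True bd[OF t0] R by (auto simp: w0 intro!: order_tendstoD(2))
      then have "\<forall>\<^sub>F s in at t0 within {0..m}. \<bar>x' s\<bar> < 2 * R \<and> \<bar>y' s\<bar> < 2 * R" by eventually_elim simp
      then obtain e where e: "e > 0" "\<And>s. s \<in> {0..m} \<Longrightarrow> s \<noteq> t0 \<Longrightarrow> dist s t0 < e \<Longrightarrow> \<bar>x' s\<bar> < 2 * R \<and> \<bar>y' s\<bar> < 2 * R"
        unfolding eventually_at by blast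
      show ?thesis
      proof (intro exI[of _ e] conjI e(1) allI impI)
        fix a b assume *: "a \<le> t0 \<and> t0 \<le> b \<and> b - a < e" "0 \<le> a \<and> b \<le> m" "w a = 0"
        have sub: "{a..b} \<subseteq> {0..m}" using * by auto
        have bd': "\<bar>x' s\<bar> < 2 * R \<and> \<bar>y' s\<bar> < 2 * R" if "s \<in> {a..b}" for s
        proof (cases "s = t0")
          case True
          then show ?thesis using \<open>w t0 = 0\<close> bd[OF t0] R by (auto simp: w0)
        next
          case False
          then show ?thesis using e(2)[of s] that * by (auto simp: dist_real_def)
        qed
        define w' where "w' = (\<lambda>s. 2 * (x s - x' s) * ((y s + X (x s) (y s) p) - (y' s + X (x' s) (y' s) p))
           + 2 * (y s - y' s) * (Y (x s) (y s) p - Y (x' s) (y' s) p))"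
        show "\<forall>t\<in>{a..b}. w t = 0"
        proof
          fix t assume t: "t \<in> {a..b}"
          show "w t = 0"
          proof (rule gronwall_zero[of a b w w' "1 + 4 * L", OF _ *(3) _ _ t])
            fix s assume s: "s \<in> {a..b}"
            then have sm: "s \<in> {0..m}" using sub by auto
            note ds = d[OF sm, THEN has_field_derivative_subset, OF sub]
            show "(w has_real_derivative w' s) (at s within {a..b})"
              unfolding w_def w'_def by (rule derivative_eq_intros ds refl | simp add: algebra_simps)+
            show "0 \<le> w s" by (simp add: w_def)
            define \<alpha> \<beta> where "\<alpha> = \<bar>x s - x' s\<bar>" and "\<beta> = \<bar>y s - y' s\<bar>"
            have lt: "\<bar>x s\<bar> < 2 * R" "\<bar>y s\<bar> < 2 * R" "\<bar>x' s\<bar> < 2 * R" "\<bar>y' s\<bar> < 2 * R"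
              using bd[OF sm] bd'[OF s] R by auto
            have l: "\<bar>X (x s) (y s) p - X (x' s) (y' s) p\<bar> \<le> L * (\<alpha> + \<beta>)" "\<bar>Y (x s) (y s) p - Y (x' s) (y' s) p\<bar> \<le> L * (\<alpha> + \<beta>)"
              using lip[rule_format, OF lt] by (simp_all add: \<alpha>_def \<beta>_def)
            have prod: "A * B \<le> \<bar>A\<bar> * M" if "\<bar>B\<bar> \<le> M" for A B M :: real
              using mult_left_mono[OF that, of "\<bar>A\<bar>"] abs_ge_self[of "A * B"] by (simp add: abs_mult)
            have "\<bar>(y s + X (x s) (y s) p) - (y' s + X (x' s) (y' s) p)\<bar> \<le> \<beta> + L * (\<alpha> + \<beta>)"
            proof -
              have "\<bar>(y s + X (x s) (y s) p) - (y' s + X (x' s) (y' s) p)\<bar> \<le> \<beta> + \<bar>X (x s) (y s) p - X (x' s) (y' s) p\<bar>"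
                unfolding \<beta>_def by linarith
              then show ?thesis using l(1) by linarith
            qed
            then have "(x s - x' s) * ((y s + X (x s) (y s) p) - (y' s + X (x' s) (y' s) p)) \<le> \<alpha> * (\<beta> + L * (\<alpha> + \<beta>))"
              unfolding \<alpha>_def by (rule prod)
            moreover have "(y s - y' s) * (Y (x s) (y s) p - Y (x' s) (y' s) p) \<le> \<beta> * (L * (\<alpha> + \<beta>))"
              using prod[OF l(2), of "y s - y' s"] by (simp only: \<beta>_def)
            ultimately have "w' s \<le> 2 * (\<alpha> * (\<beta> + L * (\<alpha> + \<beta>))) + 2 * (\<beta> * (L * (\<alpha> + \<beta>)))"
              unfolding w'_def by linarith
            \<comment> \<open>Both mixed terms are bounded through the nonnegative square of
              \<alpha> - \<beta>; this is the origin of 1 + 4 L.\<close>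
            also have "\<dots> = 2 * \<alpha> * \<beta> + 2 * L * (\<alpha> + \<beta>)\<^sup>2" by (simp add: power2_eq_square algebra_simps)
            also have "\<dots> \<le> (\<alpha>\<^sup>2 + \<beta>\<^sup>2) + 2 * L * (2 * (\<alpha>\<^sup>2 + \<beta>\<^sup>2))"
            proof (intro add_mono mult_left_mono)
              have sq: "0 \<le> (\<alpha> - \<beta>)\<^sup>2" by simp
              then show "2 * \<alpha> * \<beta> \<le> \<alpha>\<^sup>2 + \<beta>\<^sup>2" by (simp add: power2_diff)
              show "(\<alpha> + \<beta>)\<^sup>2 \<le> 2 * (\<alpha>\<^sup>2 + \<beta>\<^sup>2)" using sq by (simp add: power2_diff power2_sum)
            qed (use L in simp)
            also have "\<dots> = (1 + 4 * L) * w s" by (simp add: w_def \<alpha>_def \<beta>_def algebra_simps)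
            finally show "w' s \<le> (1 + 4 * L) * w s" .
          qed
        qed
      qed
    qed
  qed
  then have "w t = 0" using t eq0 by (auto simp: w0)
  then show ?thesis by (simp add: w0)
qed

text \<open>The description in \<open>return_map\<close> ranges over all solutions and all times.
  Competing solutions coincide up to the smaller time, which would contradict the minimality of the
  larger one if the times differed.\<close>

lemma first_return_unique:
  assumes f1: "first_return X Y F p x0 \<tau> x y" and f2: "first_return X Y F p x0 \<tau>' x' y'"
    and bd: "\<And>t. t \<in> {0..\<tau>} \<Longrightarrow> \<bar>x t\<bar> < R \<and> \<bar>y t\<bar> < R" and L: "L \<ge> 0"
    and lip: "\<forall>x y x' y'. \<bar>x\<bar> < 2 * R \<longrightarrow> \<bar>y\<bar> < 2 * R \<longrightarrow> \<bar>x'\<bar> < 2 * R \<longrightarrow> \<bar>y'\<bar> < 2 * R \<longrightarrow>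
       \<bar>X x y p - X x' y' p\<bar> \<le> L * (\<bar>x - x'\<bar> + \<bar>y - y'\<bar>) \<and> \<bar>Y x y p - Y x' y' p\<bar> \<le> L * (\<bar>x - x'\<bar> + \<bar>y - y'\<bar>)"
  shows "x' \<tau>' = x \<tau>"
proof -
  have restrict: "solves_system X Y p m x y" if "solves_system X Y p T x y" "m \<le> T" for m T x y
  proof -
    have sub: "{0..m} \<subseteq> {0..T}" using that(2) by auto
    show ?thesis using that(1) sub unfolding solves_system_def
      by (meson has_field_derivative_subset subsetD)
  qed
  define m where "m = min \<tau> \<tau>'"
  have m: "0 < m" "m \<le> \<tau>" "m \<le> \<tau>'" using f1 f2 by (auto simp: m_def first_return_def)
  have eq: "x t = x' t \<and> y t = y' t" if "t \<in> {0..m}" for t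
  proof (rule system_unique[of m X Y p x y x' y' R L t])
    show "solves_system X Y p m x y" "solves_system X Y p m x' y'"
      using restrict m f1 f2 by (auto simp: first_return_def)
    show "x 0 = x' 0" "y 0 = y' 0" using f1 f2 by (auto simp: first_return_def)
    show "\<bar>x t\<bar> < R \<and> \<bar>y t\<bar> < R" if "t \<in> {0..m}" for t using bd[of t] that m by auto
  qed (use m L lip that in auto)
  have "\<tau> = \<tau>'"
  proof (rule ccontr)
    assume "\<tau> \<noteq> \<tau>'"
    then consider "\<tau> < \<tau>'" | "\<tau>' < \<tau>" by linarith
    then show False
    proof cases
      case 1
      then have "m = \<tau>" by (simp add: m_def)
      then show False using 1 eq[of \<tau>] m f1 f2 unfolding first_return_def by auto
    next
      case 2
      then have "m = \<tau>'" by (simp add: m_def)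
      then show False using 2 eq[of \<tau>'] m f1 f2 unfolding first_return_def by auto
    qed
  qed
  then show ?thesis using eq[of \<tau>] m by (simp add: m_def)
qed

text \<open>Recovers time from the angle: w is dt/d\<phi>, the antiderivative gives t as a function
  of \<phi>, and its inverse is the angle at time t.\<close>

lemma inverse_of_antiderivative:
  fixes w :: "real \<Rightarrow> real"
  assumes ab: "a < b" and w: "continuous_on {a..b} w" and pos: "\<And>s. s \<in> {a..b} \<Longrightarrow> w s > 0"
  obtains \<tau> \<phi> where "\<tau> > 0" "\<phi> 0 = a" "\<phi> \<tau> = b" "\<And>t. t \<in> {0..\<tau>} \<Longrightarrow> \<phi> t \<in> {a..b}"
    "\<And>t. 0 < t \<Longrightarrow> t < \<tau> \<Longrightarrow> a < \<phi> t \<and> \<phi> t < b"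
    "\<And>t. t \<in> {0..\<tau>} \<Longrightarrow> (\<phi> has_real_derivative inverse (w (\<phi> t))) (at t)"
proof -
  \<comment> \<open>Extending w by its end values makes the antiderivative invertible on a larger
    interval, so that the derivatives at both ends are two-sided.\<close>
  define W where "W = (\<lambda>s. w (max a (min s b)))"
  have cW: "continuous_on UNIV W"
    unfolding W_def by (rule continuous_on_compose2[OF w]) (use ab in \<open>auto intro!: continuous_intros\<close>)
  have Wpos: "W s > 0" for s unfolding W_def using ab by (intro pos) auto
  have Ww: "W s = w s" if "s \<in> {a..b}" for s using that by (simp add: W_def)
  obtain g where g: "\<And>s. s \<in> {a - 2..b + 2} \<Longrightarrow> (g has_vector_derivative W s) (at s within {a - 2..b + 2})"
    using antiderivative_continuous[OF continuous_on_subset[OF cW subset_UNIV], of "a - 2" "b + 2"] by metis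
  define T where "T = (\<lambda>s. g s - g a)"
  have dT: "(T has_real_derivative W s) (at s)" if "s \<in> {a - 1..b + 1}" for s
  proof -
    have "(g has_real_derivative W s) (at s)"
      using g[of s] that at_within_Icc_at[of "a - 2" s "b + 2"] by (simp add: has_real_derivative_iff_has_vector_derivative)
    then show ?thesis unfolding T_def by (auto intro!: derivative_eq_intros)
  qed
  have mono: "T s < T s'" if "a - 1 \<le> s" "s < s'" "s' \<le> b + 1" for s s'
  proof (rule DERIV_pos_imp_increasing[OF that(2)])
    fix x assume "s \<le> x" "x \<le> s'"
    then show "\<exists>d. (T has_real_derivative d) (at x) \<and> d > 0"
      using dT[of x] Wpos[of x] that by (intro exI[of _ "W x"]) auto
  qed
  have inj: "inj_on T {a - 1..b + 1}"
    by (rule inj_onI) (metis atLeastAtMost_iff less_irrefl linorder_neqE_linordered_idom mono)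
  define \<phi> where "\<phi> = the_inv_into {a - 1..b + 1} T"
  have \<phi>T: "\<phi> (T s) = s" if "s \<in> {a - 1..b + 1}" for s
    unfolding \<phi>_def by (rule the_inv_into_f_f[OF inj that])
  have cT: "isCont T s" if "s \<in> {a - 1..b + 1}" for s using dT[OF that] DERIV_isCont by blast
  have onto: "\<exists>s\<in>{a - 1..b + 1}. T s = t" if "T (a - 1) \<le> t" "t \<le> T (b + 1)" for t
    using IVT[of T "a - 1" t "b + 1"] that cT ab by force
  define \<tau> where "\<tau> = T b"
  have T0: "T a = 0" by (simp add: T_def)
  have bnds: "T (a - 1) < 0" "\<tau> < T (b + 1)" "0 < \<tau>"
    using mono[of "a - 1" a] mono[of b "b + 1"] mono[of a b] T0 ab by (auto simp: \<tau>_def)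
  have rng: "\<exists>s\<in>{a..b}. T s = t" if t: "t \<in> {0..\<tau>}" for t
  proof -
    obtain s where s: "s \<in> {a - 1..b + 1}" "T s = t" using onto[of t] t bnds by auto
    have "\<not> s < a" using mono[of s a] s T0 t ab by auto
    moreover have "\<not> b < s" using mono[of b s] s t ab by (auto simp: \<tau>_def)
    ultimately show ?thesis using s by force
  qed
  show ?thesis
  proof (rule that[of \<tau> \<phi>])
    show "\<tau> > 0" by (rule bnds)
    show "\<phi> 0 = a" using \<phi>T[of a] T0 ab by simp
    show "\<phi> \<tau> = b" using \<phi>T[of b] ab by (simp add: \<tau>_def)
    show "\<phi> t \<in> {a..b}" if "t \<in> {0..\<tau>}" for t
      using rng[OF that] \<phi>T by force
    show "a < \<phi> t \<and> \<phi> t < b" if "0 < t" "t < \<tau>" for t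
    proof -
      have "t \<in> {0..\<tau>}" using that by simp
      then obtain s where s: "s \<in> {a..b}" "T s = t" using rng by metis
      have "s \<noteq> a" "s \<noteq> b" using s that T0 by (auto simp: \<tau>_def)
      then show ?thesis using \<phi>T[of s] s by auto
    qed
    show "(\<phi> has_real_derivative inverse (w (\<phi> t))) (at t)" if t: "t \<in> {0..\<tau>}" for t
    proof (rule DERIV_inverse_function[where f = T and a = "T (a - 1)" and b = "T (b + 1)"])
      obtain s where s: "s \<in> {a..b}" "T s = t" using rng[OF t] by blast
      have \<phi>t: "\<phi> t = s" using \<phi>T[of s] s by auto
      show "(T has_real_derivative w (\<phi> t)) (at (\<phi> t))" using dT[of s] Ww[OF s(1)] s by (simp add: \<phi>t)
      show "w (\<phi> t) \<noteq> 0" using pos[OF s(1)] by (simp add: \<phi>t)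
      show "T (a - 1) < t" "t < T (b + 1)" using t bnds by auto
      show "T (\<phi> y) = y" if "T (a - 1) < y" "y < T (b + 1)" for y
        using onto[of y] that \<phi>T by force
      have "isCont \<phi> (T s)"
        by (rule isCont_inverse_function2[of "a - 1" s "b + 1" \<phi> T]) (use s \<phi>T cT in auto)
      then show "isCont \<phi> t" using s by simp
    qed
  qed
qed

section \<open>From the angular orbit back to time\<close>

context polar_system
begin

text \<open>The set of angles is compact, so positivity at r = 0 persists on a tube.\<close>

lemma polar_N_pos_near:
  obtains \<eta> where "\<eta> > 0" "\<And>t r. t \<in> {0..2 * pi} \<Longrightarrow> \<bar>r\<bar> < \<eta> \<Longrightarrow>
     pN t r p > 0 \<and> real_analytic_at (\<lambda>q. pN (fst q) (fst (snd q)) (snd (snd q))) (t, r, p)"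
proof -
  let ?N = "\<lambda>q :: real \<times> real \<times> 'd. pN (fst q) (fst (snd q)) (snd (snd q))"
  let ?M = "\<lambda>q. inverse (?N q)"
  let ?K = "(\<lambda>t. (t, 0, p)) ` {0..2 * pi}"
  define V where "V = {q. real_analytic_at ?N q \<and> ?N q > 0}"
  have "open V"
  proof (subst open_subopen, intro ballI)
    fix q assume q: "q \<in> V"
    then have "(?N \<longlongrightarrow> ?N q) (nhds q)"
      using real_analytic_at_isCont[of ?N q] tendsto_at_iff_tendsto_nhds[of ?N q] by (simp add: V_def isCont_def)
    then have "\<forall>\<^sub>F z in nhds q. ?N z > 0" by (rule order_tendstoD(1)) (use q in \<open>simp add: V_def\<close>)
    moreover have "\<forall>\<^sub>F z in nhds q. real_analytic_at ?N z" using q by (simp add: V_def real_analytic_at_eventually)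
    ultimately have "\<forall>\<^sub>F z in nhds q. z \<in> V" by eventually_elim (simp add: V_def)
    then show "\<exists>T. open T \<and> q \<in> T \<and> T \<subseteq> V" unfolding eventually_nhds by auto
  qed
  moreover have "compact ?K" by (intro compact_continuous_image continuous_intros compact_Icc)
  moreover have "?K \<subseteq> V" using polar_analytic(2) polar_N_pos by (auto simp: V_def)
  ultimately obtain e where e: "e > 0" "(\<Union>q\<in>?K. ball q e) \<subseteq> V"
    using compact_subset_open_imp_ball_epsilon_subset by metis
  show ?thesis
  proof (rule that[of "e / 3"])
    fix t r :: real assume t: "t \<in> {0..2 * pi}" and r: "\<bar>r\<bar> < e / 3"
    have "dist (t, 0, p) (t, r, p) < e" by (rule dist_triple_less) (use r e in auto)
    then have "(t, r, p) \<in> (\<Union>q\<in>?K. ball q e)" using t by auto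
    then have "(t, r, p) \<in> V" using e(2) by blast
    then show "pN t r p > 0 \<and> real_analytic_at ?N (t, r, p)" by (simp add: V_def)
  qed (use e in simp)
qed

text \<open>The polar equations solve the linear system for (r', \<phi>') given by x' and u'; the
  Jacobian determinant of (x, u) in (r, \<phi>) is - R^n \<Delta>, which explains the
  denominator.\<close>

lemma polar_velocity:
  fixes R \<phi> :: real
  defines "u \<equiv> - (R ^ n * sin \<phi>)" and "x \<equiv> R * cos \<phi>" and "\<Delta> \<equiv> (cos \<phi>)\<^sup>2 + real n * (sin \<phi>)\<^sup>2"
  defines "\<theta> \<equiv> R ^ (n - 1) * pN \<phi> R p / \<Delta>"
  assumes N: "pN \<phi> R p \<noteq> 0"
  shows "pf (\<phi>, R, p) * \<theta> * cos \<phi> - R * sin \<phi> * \<theta> = u"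
    and "- (real n * R ^ (n - 1) * (pf (\<phi>, R, p) * \<theta>) * sin \<phi> + R ^ n * (cos \<phi> * \<theta>)) =
       x ^ (2 * n - 1) * C0 (x, p) + u * x ^ (n - 1) * C1 (x, p) + u\<^sup>2 * B (u, x, p)"
proof -
  define Z where "Z = pZ \<phi> R p"
  define s c where "s = sin \<phi>" and "c = cos \<phi>"
  define K where "K = R ^ (n - 1)"
  have K': "R ^ (n - Suc 0) = K" by (simp add: K_def)
  have Rn: "R ^ n = R * K" unfolding K_def using n1 by (cases n) auto
  have R2n: "R ^ (2 * n - 1) = R * K\<^sup>2"
  proof -
    have "2 * n - 1 = Suc (2 * (n - 1))" using n1 by simp
    then have "R ^ (2 * n - 1) = R * R ^ (2 * (n - 1))" by simp
    also have "\<dots> = R * K\<^sup>2" by (simp add: K_def power_mult[symmetric] mult.commute)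
    finally show ?thesis .
  qed
  have \<Delta>: "\<Delta> > 0"
  proof -
    have "(cos \<phi>)\<^sup>2 + 1 * (sin \<phi>)\<^sup>2 \<le> \<Delta>" unfolding \<Delta>_def using n1 by (intro add_left_mono mult_right_mono) auto
    then show ?thesis using sin_cos_squared_add2[of \<phi>] by simp
  qed
  have Neq: "pN \<phi> R p = real n * s\<^sup>2 - c * Z" by (simp add: polar_N_def Z_def s_def c_def)
  have De: "\<Delta> = c\<^sup>2 + real n * s\<^sup>2" by (simp add: \<Delta>_def s_def c_def)
  define v where "v = pf (\<phi>, R, p) * \<theta>"
  have v: "v = - (R * K * s * (c + Z)) / \<Delta>"
    unfolding v_def
    using N \<Delta> by (simp add: polar_f_def \<theta>_def Z_def[symmetric] s_def[symmetric] c_def[symmetric] K' field_simps)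
  have \<theta>: "\<theta> = K * (real n * s\<^sup>2 - c * Z) / \<Delta>" by (simp add: \<theta>_def K_def Neq)
  have "v * c - R * s * \<theta> = - (R * K * s) * \<Delta> / \<Delta>"
    unfolding v \<theta> times_divide_eq_left times_divide_eq_right diff_divide_distrib[symmetric]
    by (rule arg_cong[of _ _ "\<lambda>q. q / \<Delta>"]) (simp add: De power2_eq_square algebra_simps)
  then show "pf (\<phi>, R, p) * \<theta> * cos \<phi> - R * sin \<phi> * \<theta> = u"
    using \<Delta> by (simp add: u_def Rn s_def c_def v_def)
  have "- (real n * K * v * s + R * K * (c * \<theta>)) = R * K\<^sup>2 * Z * \<Delta> / \<Delta>"
    unfolding v \<theta> times_divide_eq_left times_divide_eq_right add_divide_distrib[symmetric] minus_divide_left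
    by (rule arg_cong[of _ _ "\<lambda>q. q / \<Delta>"]) (simp add: De power2_eq_square algebra_simps)
  then have u': "- (real n * K * v * s + R * K * (c * \<theta>)) = R ^ (2 * n - 1) * Z"
    using \<Delta> by (simp add: R2n del: One_nat_def)
  have "R ^ (2 * n - 1) * Z = x ^ (2 * n - 1) * C0 (x, p) + u * x ^ (n - 1) * C1 (x, p) + u\<^sup>2 * B (u, x, p)"
  proof -
    have "R ^ (2 * n - 1) * Z = (R ^ (2 * n - 1) * c ^ (2 * n - 1)) * C0 (x, p) - R * K\<^sup>2 * s * c ^ (n - 1) * C1 (x, p)
       + R * R * K\<^sup>2 * s\<^sup>2 * B (u, x, p)"
      unfolding R2n Z_def polar_Z_def by (simp add: s_def c_def x_def u_def algebra_simps)
    also have "R ^ (2 * n - 1) * c ^ (2 * n - 1) = x ^ (2 * n - 1)" by (simp add: x_def c_def power_mult_distrib)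
    also have "R * K\<^sup>2 * s * c ^ (n - 1) = - (u * x ^ (n - 1))"
      by (simp add: x_def u_def c_def s_def Rn power_mult_distrib K' power2_eq_square)
    also have "R * R * K\<^sup>2 * s\<^sup>2 = u\<^sup>2" by (simp add: u_def Rn s_def power_mult_distrib power2_eq_square)
    finally show ?thesis by simp
  qed
  then show "- (real n * R ^ (n - 1) * (pf (\<phi>, R, p) * \<theta>) * sin \<phi> + R ^ n * (cos \<phi> * \<theta>)) =
       x ^ (2 * n - 1) * C0 (x, p) + u * x ^ (n - 1) * C1 (x, p) + u\<^sup>2 * B (u, x, p)"
    using u' by (simp only: K_def[symmetric] Rn s_def[symmetric] c_def[symmetric] v_def)
qed

text \<open>The orbit over [0, 2 pi] is parametrised by time and carried back by \<Phi>. In between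
  it meets y = F(x) only at angle pi, on the negative side.\<close>

lemma first_return_polar:
  fixes X Y :: "real \<Rightarrow> real \<Rightarrow> 'd \<Rightarrow> real"
  assumes r: "ode_sol pf p 0 (2 * pi) r" and r0: "r 0 = x0" and rb: "\<And>t. t \<in> {0..2 * pi} \<Longrightarrow> 0 < r t \<and> r t < \<rho> \<and> r t < 1"
    and N: "\<And>t. t \<in> {0..2 * pi} \<Longrightarrow> pN t (r t) p > 0 \<and>
       real_analytic_at (\<lambda>q. pN (fst q) (fst (snd q)) (snd (snd q))) (t, r t, p)"
    and A: "\<And>x u. \<bar>x\<bar> < \<rho> \<Longrightarrow> \<bar>u\<bar> < \<rho> \<Longrightarrow> \<bar>\<Phi> (x, u, p)\<bar> < \<rho>' \<and> \<Phi> (x, u, p) + X x (\<Phi> (x, u, p)) p = u"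
    and Br: "\<And>x. \<bar>x\<bar> < \<rho> \<Longrightarrow> \<Phi> (x, 0, p) = F x p \<and> F x p + X x (F x p) p = 0"
    and dPhi: "\<forall>xf uf S t. t \<in> S \<longrightarrow> (\<forall>s\<in>S. \<bar>xf s\<bar> < \<rho> \<and> \<bar>uf s\<bar> < \<rho>) \<longrightarrow>
          (xf has_real_derivative uf t) (at t within S) \<longrightarrow>
          (uf has_real_derivative xf t ^ (2 * n - 1) * C0 (xf t, p) + uf t * xf t ^ (n - 1) * C1 (xf t, p)
             + (uf t)\<^sup>2 * B (uf t, xf t, p)) (at t within S) \<longrightarrow>
          ((\<lambda>s. \<Phi> (xf s, uf s, p)) has_real_derivative Y (xf t) (\<Phi> (xf t, uf t, p)) p) (at t within S)"
    and \<rho>: "\<rho> \<le> \<rho>'"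
  shows "\<exists>\<tau> x y. first_return X Y F p x0 \<tau> x y \<and> x \<tau> = r (2 * pi) \<and> (\<forall>t\<in>{0..\<tau>}. \<bar>x t\<bar> < \<rho>' \<and> \<bar>y t\<bar> < \<rho>')"
proof -
  define \<Delta> where "\<Delta> = (\<lambda>\<phi>. (cos \<phi>)\<^sup>2 + real n * (sin \<phi>)\<^sup>2)"
  have \<Delta>: "\<Delta> \<phi> > 0" for \<phi>
  proof -
    have "(cos \<phi>)\<^sup>2 + 1 * (sin \<phi>)\<^sup>2 \<le> \<Delta> \<phi>" unfolding \<Delta>_def using n1 by (intro add_left_mono mult_right_mono) auto
    then show ?thesis using sin_cos_squared_add2[of \<phi>] by simp
  qed
  \<comment> \<open>The time per unit of angle, dt/d\<phi>.\<close>
  define w where "w = (\<lambda>\<phi>. \<Delta> \<phi> / (r \<phi> ^ (n - 1) * pN \<phi> (r \<phi>) p))"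
  have wpos: "w s > 0" if "s \<in> {0..2 * pi}" for s
    using \<Delta> N[OF that] rb[OF that] by (simp add: w_def)
  have cr: "continuous_on {0..2 * pi} r" by (rule DERIV_continuous_on[OF ode_solD[OF r]])
  have cN: "continuous_on {0..2 * pi} (\<lambda>\<phi>. pN \<phi> (r \<phi>) p)"
  proof -
    let ?N = "\<lambda>q :: real \<times> real \<times> 'd. pN (fst q) (fst (snd q)) (snd (snd q))"
    have "continuous_on ((\<lambda>t. (t, r t, p)) ` {0..2 * pi}) ?N"
      using N real_analytic_at_isCont by (intro continuous_at_imp_continuous_on) blast
    from continuous_on_compose2[OF this, of "{0..2 * pi}" "\<lambda>t. (t, r t, p)"] show ?thesis
      by (simp add: continuous_on_Pair continuous_on_id continuous_on_const cr)
  qed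
  have cw: "continuous_on {0..2 * pi} w"
    unfolding w_def \<Delta>_def using N rb by (intro continuous_intros cr cN) force
  obtain \<tau> \<phi> where \<tau>: "\<tau> > 0" and \<phi>e: "\<phi> 0 = 0" "\<phi> \<tau> = 2 * pi" and \<phi>r: "\<And>t. t \<in> {0..\<tau>} \<Longrightarrow> \<phi> t \<in> {0..2 * pi}"
    and \<phi>i: "\<And>t. 0 < t \<Longrightarrow> t < \<tau> \<Longrightarrow> 0 < \<phi> t \<and> \<phi> t < 2 * pi"
    and d\<phi>: "\<And>t. t \<in> {0..\<tau>} \<Longrightarrow> (\<phi> has_real_derivative inverse (w (\<phi> t))) (at t)"
    by (rule inverse_of_antiderivative[OF _ cw wpos]) auto
  define xf where "xf = (\<lambda>t. r (\<phi> t) * cos (\<phi> t))"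
  define uf where "uf = (\<lambda>t. - (r (\<phi> t) ^ n * sin (\<phi> t)))"
  define yf where "yf = (\<lambda>t. \<Phi> (xf t, uf t, p))"
  have rt: "0 < r (\<phi> t) \<and> r (\<phi> t) < \<rho> \<and> r (\<phi> t) < 1" if "t \<in> {0..\<tau>}" for t using rb \<phi>r that by blast
  have bd: "\<bar>xf t\<bar> < \<rho> \<and> \<bar>uf t\<bar> < \<rho>" if t: "t \<in> {0..\<tau>}" for t
  proof
    have "r (\<phi> t) * \<bar>cos (\<phi> t)\<bar> \<le> r (\<phi> t) * 1" using rt[OF t] by (intro mult_left_mono) auto
    moreover have "\<bar>xf t\<bar> = r (\<phi> t) * \<bar>cos (\<phi> t)\<bar>" using rt[OF t] by (simp add: xf_def abs_mult)
    ultimately show "\<bar>xf t\<bar> < \<rho>" using rt[OF t] by linarith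
    \<comment> \<open>Here r < 1 and n \<ge> 1 bound u by the radius.\<close>
    have "r (\<phi> t) ^ n \<le> r (\<phi> t) ^ 1" using rt[OF t] n1 by (intro power_decreasing) auto
    moreover have "r (\<phi> t) ^ n * \<bar>sin (\<phi> t)\<bar> \<le> r (\<phi> t) ^ n * 1" using rt[OF t] by (intro mult_left_mono) auto
    moreover have "\<bar>uf t\<bar> = r (\<phi> t) ^ n * \<bar>sin (\<phi> t)\<bar>" using rt[OF t] by (simp add: uf_def abs_mult)
    ultimately show "\<bar>uf t\<bar> < \<rho>" using rt[OF t] unfolding power_one_right by linarith
  qed
  have d: "(xf has_real_derivative uf t) (at t within {0..\<tau>}) \<and>
     (uf has_real_derivative xf t ^ (2 * n - 1) * C0 (xf t, p) + uf t * xf t ^ (n - 1) * C1 (xf t, p)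
             + (uf t)\<^sup>2 * B (uf t, xf t, p)) (at t within {0..\<tau>})" if t: "t \<in> {0..\<tau>}" for t
  proof -
    define \<theta> where "\<theta> = r (\<phi> t) ^ (n - 1) * pN (\<phi> t) (r (\<phi> t)) p / \<Delta> (\<phi> t)"
    have d1: "(\<phi> has_real_derivative \<theta>) (at t within {0..\<tau>})"
      using has_field_derivative_at_within[OF d\<phi>[OF t]] by (simp add: w_def \<theta>_def)
    have "(r has_real_derivative pf (\<phi> t, r (\<phi> t), p)) (at (\<phi> t) within \<phi> ` {0..\<tau>})"
      by (rule has_field_derivative_subset[OF ode_solD[OF r \<phi>r[OF t]]]) (use \<phi>r in blast)
    from DERIV_image_chain[OF this d1]
    have d2: "((\<lambda>t. r (\<phi> t)) has_real_derivative pf (\<phi> t, r (\<phi> t), p) * \<theta>) (at t within {0..\<tau>})"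
      by (simp add: o_def)
    have Nt: "pN (\<phi> t) (r (\<phi> t)) p \<noteq> 0" using N[OF \<phi>r[OF t]] by simp
    have v: "pf (\<phi> t, r (\<phi> t), p) * \<theta> * cos (\<phi> t) - r (\<phi> t) * sin (\<phi> t) * \<theta> = uf t"
      "- (real n * r (\<phi> t) ^ (n - 1) * (pf (\<phi> t, r (\<phi> t), p) * \<theta>) * sin (\<phi> t) + r (\<phi> t) ^ n * (cos (\<phi> t) * \<theta>)) =
       xf t ^ (2 * n - 1) * C0 (xf t, p) + uf t * xf t ^ (n - 1) * C1 (xf t, p) + (uf t)\<^sup>2 * B (uf t, xf t, p)"
      using polar_velocity[OF Nt] by (simp_all only: \<theta>_def \<Delta>_def xf_def uf_def)
    have "(xf has_real_derivative pf (\<phi> t, r (\<phi> t), p) * \<theta> * cos (\<phi> t) - r (\<phi> t) * sin (\<phi> t) * \<theta>) (at t within {0..\<tau>})"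
      unfolding xf_def by (rule derivative_eq_intros d1 d2 refl)+ (simp add: algebra_simps)
    moreover have "(uf has_real_derivative - (real n * r (\<phi> t) ^ (n - 1) * (pf (\<phi> t, r (\<phi> t), p) * \<theta>) * sin (\<phi> t)
        + r (\<phi> t) ^ n * (cos (\<phi> t) * \<theta>))) (at t within {0..\<tau>})"
      unfolding uf_def by (rule derivative_eq_intros d1 d2 refl)+ (simp add: algebra_simps)
    ultimately show ?thesis by (simp only: v)
  qed
  have dy: "(yf has_real_derivative Y (xf t) (yf t) p) (at t within {0..\<tau>})" if t: "t \<in> {0..\<tau>}" for t
    unfolding yf_def using dPhi[rule_format, of t "{0..\<tau>}" xf uf] bd d[OF t] t by blast
  have ends: "yf t = F (xf t) p" if "t \<in> {0..\<tau>}" "uf t = 0" for t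
    using Br[of "xf t"] bd[OF that(1)] that(2) by (simp add: yf_def)
  have fr: "first_return X Y F p x0 \<tau> xf yf"
    unfolding first_return_def
  proof (intro conjI allI impI)
    show "\<tau> > 0" by (rule \<tau>)
    show "solves_system X Y p \<tau> xf yf"
      unfolding solves_system_def
    proof
      fix t assume t: "t \<in> {0..\<tau>}"
      have "yf t + X (xf t) (yf t) p = uf t" using A[of "xf t" "uf t"] bd[OF t] by (simp add: yf_def)
      then show "(xf has_real_derivative yf t + X (xf t) (yf t) p) (at t within {0..\<tau>}) \<and>
        (yf has_real_derivative Y (xf t) (yf t) p) (at t within {0..\<tau>})" using d[OF t] dy[OF t] by simp
    qed
    show x0: "xf 0 = x0" by (simp add: xf_def \<phi>e r0)
    show "yf 0 = F x0 p" using ends[of 0] x0 \<tau> by (simp add: uf_def \<phi>e)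
    show "yf \<tau> = F (xf \<tau>) p" using ends[of \<tau>] \<tau> by (simp add: uf_def \<phi>e)
    show "x0 * xf \<tau> > 0" using rb[of 0] rb[of "2 * pi"] r0 by (simp add: xf_def \<phi>e)
    fix s assume s: "0 < s \<and> s < \<tau>"
    then have st: "s \<in> {0..\<tau>}" by simp
    show "\<not> (yf s = F (xf s) p \<and> x0 * xf s > 0)"
    proof
      assume *: "yf s = F (xf s) p \<and> x0 * xf s > 0"
      \<comment> \<open>On the curve y = F(x) the quantity u = y + X vanishes.\<close>
      have "uf s = 0" using A[of "xf s" "uf s"] Br[of "xf s"] bd[OF st] * by (simp add: yf_def)
      then have "sin (\<phi> s) = 0" using rt[OF st] by (simp add: uf_def)
      moreover have "0 < \<phi> s" "\<phi> s < 2 * pi" using \<phi>i s by auto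
      ultimately have "\<phi> s = pi"
        using sin_gt_zero[of "\<phi> s"] sin_lt_zero[of "\<phi> s"] by (cases "\<phi> s" pi rule: linorder_cases) auto
      then have "xf s < 0" using rt[OF st] by (simp add: xf_def)
      moreover have "x0 > 0" using rb[of 0] r0 by simp
      ultimately show False using * by (simp add: zero_less_mult_iff)
    qed
  qed
  have "\<bar>xf t\<bar> < \<rho>' \<and> \<bar>yf t\<bar> < \<rho>'" if "t \<in> {0..\<tau>}" for t
    using bd[OF that] A[of "xf t" "uf t"] \<rho> by (simp add: yf_def)
  moreover have "xf \<tau> = r (2 * pi)" by (simp add: xf_def \<phi>e)
  ultimately show ?thesis using fr by blast
qed

text \<open>For x0 > 0 the initial radius is x0 and the radius at angle 2 pi is the abscissa of the
  return.\<close>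

lemma return_map_eq_flow:
  fixes X Y :: "real \<Rightarrow> real \<Rightarrow> 'd \<Rightarrow> real"
  assumes S: "ode_flow pf p 0 (2 * pi) S" and \<rho>: "0 < \<rho>" "\<rho> \<le> \<rho>'" and L: "0 \<le> L"
    and A: "\<forall>x u. \<bar>x\<bar> < \<rho> \<longrightarrow> \<bar>u\<bar> < \<rho> \<longrightarrow> \<bar>\<Phi> (x, u, p)\<bar> < \<rho>' \<and> \<Phi> (x, u, p) + X x (\<Phi> (x, u, p)) p = u"
    and Br: "\<forall>x. \<bar>x\<bar> < \<rho> \<longrightarrow> \<Phi> (x, 0, p) = F x p \<and> F x p + X x (F x p) p = 0"
    and dPhi: "\<forall>xf uf S t. t \<in> S \<longrightarrow> (\<forall>s\<in>S. \<bar>xf s\<bar> < \<rho> \<and> \<bar>uf s\<bar> < \<rho>) \<longrightarrow>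
          (xf has_real_derivative uf t) (at t within S) \<longrightarrow>
          (uf has_real_derivative xf t ^ (2 * n - 1) * C0 (xf t, p) + uf t * xf t ^ (n - 1) * C1 (xf t, p)
             + (uf t)\<^sup>2 * B (uf t, xf t, p)) (at t within S) \<longrightarrow>
          ((\<lambda>s. \<Phi> (xf s, uf s, p)) has_real_derivative Y (xf t) (\<Phi> (xf t, uf t, p)) p) (at t within S)"
    and lip: "\<forall>x y x' y'. \<bar>x\<bar> < 2 * \<rho>' \<longrightarrow> \<bar>y\<bar> < 2 * \<rho>' \<longrightarrow> \<bar>x'\<bar> < 2 * \<rho>' \<longrightarrow> \<bar>y'\<bar> < 2 * \<rho>' \<longrightarrow>
       \<bar>X x y p - X x' y' p\<bar> \<le> L * (\<bar>x - x'\<bar> + \<bar>y - y'\<bar>) \<and> \<bar>Y x y p - Y x' y' p\<bar> \<le> L * (\<bar>x - x'\<bar> + \<bar>y - y'\<bar>)"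
  shows "\<forall>\<^sub>F x0 in at_right 0. return_map X Y F x0 p = S (x0, p)"
proof -
  obtain \<eta>1 K where \<eta>1: "\<eta>1 > 0" and lipf: "\<forall>t r r'. t \<in> {0..2 * pi} \<longrightarrow> \<bar>r\<bar> \<le> \<eta>1 \<longrightarrow> \<bar>r'\<bar> \<le> \<eta>1 \<longrightarrow>
     \<bar>pf (t, r, p) - pf (t, r', p)\<bar> \<le> K * \<bar>r - r'\<bar>"
    by (rule lipschitz_polar) (rule that)
  obtain \<eta>2 where \<eta>2: "\<eta>2 > 0" and N: "\<And>t r. t \<in> {0..2 * pi} \<Longrightarrow> \<bar>r\<bar> < \<eta>2 \<Longrightarrow>
     pN t r p > 0 \<and> real_analytic_at (\<lambda>q. pN (fst q) (fst (snd q)) (snd (snd q))) (t, r, p)"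
    by (rule polar_N_pos_near) (rule that)
  \<comment> \<open>\<open>\<eta>1\<close> serves positivity of r, \<open>\<eta>2\<close> that of
    the angular speed, 1 the estimate r^n \<le> r, and \<rho> the domain of \<Phi>.\<close>
  define \<eta> where "\<eta> = min (min \<eta>1 \<eta>2) (min 1 \<rho>)"
  have \<eta>: "\<eta> > 0" "\<eta> \<le> \<eta>1" "\<eta> \<le> \<eta>2" "\<eta> \<le> 1" "\<eta> \<le> \<rho>" using \<eta>1 \<eta>2 \<rho> by (auto simp: \<eta>_def)
  show ?thesis
    using ode_flow_section[OF S \<eta>(1), THEN filter_leD[OF at_within_le_nhds]] eventually_at_right_less[of 0]
  proof eventually_elim
    case (elim x0)
    then obtain r where r: "ode_sol pf p 0 (2 * pi) r" "r 0 = x0" "r (2 * pi) = S (x0, p)" "\<forall>t\<in>{0..2 * pi}. \<bar>r t\<bar> < \<eta>"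
      by blast
    have rpos: "0 < r t" if t: "t \<in> {0..2 * pi}" for t
    proof -
      have "r t \<ge> r 0 * exp (- K * (t - 0))"
      proof (rule ode_sol_positive[OF r(1) _ _ t])
        fix s assume s: "s \<in> {0..2 * pi}"
        have "\<bar>r s\<bar> \<le> \<eta>1" using r(4) s \<eta>(2) by fastforce
        then show "\<bar>pf (s, r s, p)\<bar> \<le> K * \<bar>r s\<bar>"
          using lipf[rule_format, of s "r s" 0] s \<eta>1 by (simp add: polar_f_zero)
      qed (use elim r in auto)
      moreover have "r 0 * exp (- K * (t - 0)) > 0" using elim r(2) by simp
      ultimately show ?thesis by linarith
    qed
    have "\<exists>\<tau> x y. first_return X Y F p x0 \<tau> x y \<and> x \<tau> = r (2 * pi) \<and> (\<forall>t\<in>{0..\<tau>}. \<bar>x t\<bar> < \<rho>' \<and> \<bar>y t\<bar> < \<rho>')"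
    proof (rule first_return_polar[OF r(1,2), where X = X and Y = Y and F = F and \<rho> = \<rho> and \<rho>' = \<rho>' and \<Phi> = \<Phi>, OF _ _ A[rule_format] Br[rule_format] dPhi \<rho>(2)], goal_cases)
      case (1 t)
      then show ?case using rpos[OF 1] r(4) \<eta> by fastforce
    next
      case (2 t)
      have "\<bar>r t\<bar> < \<eta>2" using r(4) 2 \<eta>(3) by fastforce
      then show ?case by (rule N[OF 2])
    qed
    then obtain \<tau> x y where fr: "first_return X Y F p x0 \<tau> x y" "x \<tau> = r (2 * pi)"
      and bd: "\<forall>t\<in>{0..\<tau>}. \<bar>x t\<bar> < \<rho>' \<and> \<bar>y t\<bar> < \<rho>'" by blast
    have uniq: "x' \<tau>' = x \<tau>" if "first_return X Y F p x0 \<tau>' x' y'" for \<tau>' x' y'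
      by (rule first_return_unique[OF fr(1) that _ L lip]) (use bd in blast)
    have "(THE q. \<exists>\<tau> x y. first_return X Y F p x0 \<tau> x y \<and> q = x \<tau>) = x \<tau>"
      by (rule the_equality) (use fr uniq in blast)+
    then show ?case using elim fr(2) r(3) by (simp add: return_map_def)
  qed
qed

end

text \<open>Whatever germ is selected for \<open>return_map_bar\<close>, it agrees with S to the
  right of 0 and hence has the same expansion.\<close>

lemma focus_coeff_eq:
  assumes S: "(\<lambda>x. S (x, \<delta>)) has_fps_expansion P" and ev: "\<forall>\<^sub>F x in at_right 0. return_map X Y F x \<delta> = S (x, \<delta>)"
  shows "focus_coeff X Y F j \<delta> = fps_nth (P - fps_X) j"
proof -
  let ?Q = "\<lambda>p. (\<exists>c. p has_fps_expansion c) \<and> (\<forall>\<^sub>F x0 in at_right 0. p x0 = return_map X Y F x0 \<delta>)"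
  have "?Q (\<lambda>x. S (x, \<delta>))"
    using S ev by (auto elim: eventually_mono)
  then have "?Q (return_map_bar X Y F \<delta>)" unfolding return_map_bar_def by (rule someI[of ?Q])
  then obtain c where c: "return_map_bar X Y F \<delta> has_fps_expansion c"
    and "\<forall>\<^sub>F x in at_right 0. return_map_bar X Y F \<delta> x = return_map X Y F x \<delta>" by blast
  from this(2) ev have "\<forall>\<^sub>F x in at_right 0. return_map_bar X Y F \<delta> x = S (x, \<delta>)" by eventually_elim simp
  from has_fps_expansion_unique_right[OF c S this] have "return_map_bar X Y F \<delta> has_fps_expansion P" using c by simp
  then have "(\<lambda>x. return_map_bar X Y F \<delta> x - x) has_fps_expansion (P - fps_X)"
    by (intro fps_expansion_intros)
  then have "displacement_bar X Y F \<delta> has_fps_expansion (P - fps_X)"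
    unfolding displacement_bar_def .
  then have "(THE c. displacement_bar X Y F \<delta> has_fps_expansion c) = P - fps_X"
    using has_fps_expansion_unique_real by (intro the_equality) blast+
  then show ?thesis by (simp add: focus_coeff_def)
qed

lemma bounded_index_even: "{i :: nat. 1 \<le> i \<and> i < 2 * k + 1 \<and> even i} = (\<lambda>i. 2 * i) ` {1..k}"
  by (auto elim!: evenE)

lemma bounded_index_odd: "{i :: nat. 1 \<le> i \<and> i < 2 * k \<and> odd i} = (\<lambda>i. 2 * i - 1) ` {1..k}"
proof (intro set_eqI iffI)
  fix i :: nat assume "i \<in> {i. 1 \<le> i \<and> i < 2 * k \<and> odd i}"
  then obtain j where "i = 2 * j + 1" "i < 2 * k" by (auto elim!: oddE)
  then show "i \<in> (\<lambda>i. 2 * i - 1) ` {1..k}" by (intro image_eqI[of _ _ "Suc j"]) auto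
qed auto

theorem theorem1p5:
  fixes X Y :: "real \<Rightarrow> real \<Rightarrow> real ^ 'm \<Rightarrow> real"
    and F :: "real \<Rightarrow> real ^ 'm \<Rightarrow> real"
    and D :: "(real ^ 'm) set"
    and n :: nat
    and a :: "real ^ 'm \<Rightarrow> real"
    and b v :: "nat \<Rightarrow> real ^ 'm \<Rightarrow> real"
  defines "v \<equiv> focus_coeff X Y F"
  assumes "compact D"
    and "admissible_perturbation D X"
    and "admissible_perturbation D Y"
    and "implicit_branch D X F"
    and "n \<ge> 2"
    and "\<And>\<delta>. \<delta> \<in> D \<Longrightarrow>
           \<exists>r \<in> O[nhds 0](\<lambda>x. x). \<forall>\<^sub>F x in nhds 0. fun_g Y F x \<delta> = x ^ (2 * n - 1) * (a \<delta> + r x)"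
    and "\<And>\<delta>. \<delta> \<in> D \<Longrightarrow> a \<delta> > 0"
    and "\<And>\<delta>. \<delta> \<in> D \<Longrightarrow>
           \<forall>\<^sub>F x in nhds 0. ((\<lambda>j. b j \<delta> * x ^ j) has_sum fun_f X Y F x \<delta>) {n - 1..}"
    and "\<And>\<delta>. \<delta> \<in> D \<Longrightarrow> (b (n - 1) \<delta>)\<^sup>2 - 4 * real n * a \<delta> < 0"
  shows "(odd n \<longrightarrow> (\<forall>k\<ge>1. analytic_O D (v (2 * k)) {1..k} (\<lambda>i. v (2 * i - 1)))) \<and>
         (even n \<longrightarrow> (\<forall>\<delta>\<in>D. v 1 \<delta> = 0) \<and>
           (\<forall>k\<ge>1. analytic_O D (v (2 * k + 1)) {1..k} (\<lambda>i. v (2 * i))))"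
proof -
  note D = assms(2) and adX = assms(3) and adY = assms(4) and br = assms(5) and n2 = assms(6)
    and gh = assms(7) and apos = assms(8) and fh = assms(9) and disc = assms(10)
  have n1: "n \<ge> 1" using n2 by simp
  obtain C0 C1 :: "real \<times> (real ^ 'm) \<Rightarrow> real" and B \<Phi> :: "real \<times> real \<times> (real ^ 'm) \<Rightarrow> real" where
    an: "\<forall>p\<in>D. real_analytic_at C0 (0, p) \<and> real_analytic_at C1 (0, p) \<and> real_analytic_at B (0, 0, p)"
    and Cp: "\<forall>p\<in>D. C0 (0, p) = - a p \<and> C1 (0, p) = - b (n - 1) p"
    and loc: "\<forall>p\<in>D. \<exists>\<rho> \<rho>' L. 0 < \<rho> \<and> \<rho> \<le> \<rho>' \<and> 0 \<le> L \<and>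
       (\<forall>x u. \<bar>x\<bar> < \<rho> \<longrightarrow> \<bar>u\<bar> < \<rho> \<longrightarrow> \<bar>\<Phi> (x, u, p)\<bar> < \<rho>' \<and> \<Phi> (x, u, p) + X x (\<Phi> (x, u, p)) p = u) \<and>
       (\<forall>x. \<bar>x\<bar> < \<rho> \<longrightarrow> \<Phi> (x, 0, p) = F x p \<and> F x p + X x (F x p) p = 0) \<and>
       (\<forall>xf uf S t. t \<in> S \<longrightarrow> (\<forall>s\<in>S. \<bar>xf s\<bar> < \<rho> \<and> \<bar>uf s\<bar> < \<rho>) \<longrightarrow>
          (xf has_real_derivative uf t) (at t within S) \<longrightarrow>
          (uf has_real_derivative xf t ^ (2 * n - 1) * C0 (xf t, p) + uf t * xf t ^ (n - 1) * C1 (xf t, p)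
             + (uf t)\<^sup>2 * B (uf t, xf t, p)) (at t within S) \<longrightarrow>
          ((\<lambda>s. \<Phi> (xf s, uf s, p)) has_real_derivative Y (xf t) (\<Phi> (xf t, uf t, p)) p) (at t within S)) \<and>
       (\<forall>x y x' y'. \<bar>x\<bar> < 2 * \<rho>' \<longrightarrow> \<bar>y\<bar> < 2 * \<rho>' \<longrightarrow> \<bar>x'\<bar> < 2 * \<rho>' \<longrightarrow> \<bar>y'\<bar> < 2 * \<rho>' \<longrightarrow>
          \<bar>X x y p - X x' y' p\<bar> \<le> L * (\<bar>x - x'\<bar> + \<bar>y - y'\<bar>) \<and> \<bar>Y x y p - Y x' y' p\<bar> \<le> L * (\<bar>x - x'\<bar> + \<bar>y - y'\<bar>))"
    by (rule reduced_system[OF D adX adY br n1 gh fh]) (assumption | rule that)+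
  define f where "f = polar_f n C0 C1 B"
  have ps: "polar_system n C0 C1 B p (a p) (b (n - 1) p)" if "p \<in> D" for p
    using that n1 an Cp apos disc by (intro polar_system.intro) auto
  have anf: "real_analytic_at f (t, 0, p)" if "p \<in> D" for t p
    unfolding f_def by (rule polar_system.polar_analytic(3)[OF ps[OF that]])
  have f0: "f (t, 0, \<delta>) = 0" for t \<delta> by (simp add: f_def polar_f_zero)
  obtain U1 \<sigma>1 where U1: "open U1" "D \<subseteq> U1" "\<And>j p. p \<in> U1 \<Longrightarrow> real_analytic_at (\<sigma>1 j) p"
    and S1: "\<And>p. p \<in> D \<Longrightarrow> \<exists>S. ode_flow f p 0 pi S \<and> (\<lambda>x. S (x, p)) has_fps_expansion Abs_fps (\<lambda>j. \<sigma>1 j p)"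
    by (rule ode_flow_coefficients[of 0 pi D f]) (use anf f0 in auto)
  obtain U2 \<sigma>2 where U2: "open U2" "D \<subseteq> U2" "\<And>j p. p \<in> U2 \<Longrightarrow> real_analytic_at (\<sigma>2 j) p"
    and S2: "\<And>p. p \<in> D \<Longrightarrow> \<exists>S. ode_flow f p 0 (2 * pi) S \<and> (\<lambda>x. S (x, p)) has_fps_expansion Abs_fps (\<lambda>j. \<sigma>2 j p)"
    by (rule ode_flow_coefficients[of 0 "2 * pi" D f]) (use anf f0 in auto)
  \<comment> \<open>P belongs to a full turn, s1 to half a turn. Their coefficients are analytic
    near D; the functional equations are proved over D.\<close>
  define P where "P = (\<lambda>\<delta>. Abs_fps (\<lambda>j. \<sigma>2 j \<delta>))"
  define s1 where "s1 = (\<lambda>\<delta>. Abs_fps (\<lambda>j. \<sigma>1 j \<delta>))"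
  define h where "h = (\<lambda>\<delta>. - s1 \<delta>)"
  have anP: "real_analytic_on (\<lambda>\<delta>. fps_nth (P \<delta>) j) D" for j
    unfolding P_def by (simp, rule real_analytic_onI[OF U2])
  have anh: "real_analytic_on (\<lambda>\<delta>. fps_nth (h \<delta>) j) D" for j
    unfolding h_def s1_def by (simp, rule real_analytic_onI[OF U1(1,2)], rule real_analytic_at_minus, rule U1(3))
  have P01: "fps_nth (P \<delta>) 0 = 0 \<and> fps_nth (P \<delta>) 1 > 0" and h01: "fps_nth (h \<delta>) 0 = 0 \<and> fps_nth (h \<delta>) 1 < 0"
    and rel: "odd n \<Longrightarrow> (P \<delta> - fps_X) oo h \<delta> = fps_const 1 * ((h \<delta> oo P \<delta>) - h \<delta>)"
      "even n \<Longrightarrow> (P \<delta> - fps_X) oo (h \<delta> oo P \<delta>) = fps_const (- 1) * ((h \<delta> oo P \<delta>) - h \<delta>)"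
    and v: "v j \<delta> = fps_nth (P \<delta> - fps_X) j" if \<delta>: "\<delta> \<in> D" for \<delta> j
  proof -
    interpret polar_system n C0 C1 B \<delta> "a \<delta>" "b (n - 1) \<delta>" by (rule ps[OF \<delta>])
    obtain T1 where T1: "ode_flow f \<delta> 0 pi T1" "(\<lambda>x. T1 (x, \<delta>)) has_fps_expansion s1 \<delta>"
      using S1[OF \<delta>] by (auto simp: s1_def)
    obtain T2 where T2: "ode_flow f \<delta> 0 (2 * pi) T2" "(\<lambda>x. T2 (x, \<delta>)) has_fps_expansion P \<delta>"
      using S2[OF \<delta>] by (auto simp: P_def)
    note T1 = T1[unfolded f_def] and T2 = T2[unfolded f_def]
    show "fps_nth (P \<delta>) 0 = 0 \<and> fps_nth (P \<delta>) 1 > 0"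
      using flow_derivative_pos[OF T2(1) _ _ T2(2)] by simp
    show "fps_nth (h \<delta>) 0 = 0 \<and> fps_nth (h \<delta>) 1 < 0"
      using flow_derivative_pos[OF T1(1) _ _ T1(2)] by (simp add: h_def)
    show "odd n \<Longrightarrow> (P \<delta> - fps_X) oo h \<delta> = fps_const 1 * ((h \<delta> oo P \<delta>) - h \<delta>)"
      "even n \<Longrightarrow> (P \<delta> - fps_X) oo (h \<delta> oo P \<delta>) = fps_const (- 1) * ((h \<delta> oo P \<delta>) - h \<delta>)"
      using flow_fps_relations[OF T1(1) T2(1) T1(2) T2(2)] by (simp_all add: h_def)
    obtain \<rho> \<rho>' L where \<rho>: "0 < \<rho>" "\<rho> \<le> \<rho>'" "0 \<le> L"
       "\<forall>x u. \<bar>x\<bar> < \<rho> \<longrightarrow> \<bar>u\<bar> < \<rho> \<longrightarrow> \<bar>\<Phi> (x, u, \<delta>)\<bar> < \<rho>' \<and> \<Phi> (x, u, \<delta>) + X x (\<Phi> (x, u, \<delta>)) \<delta> = u"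
       "\<forall>x. \<bar>x\<bar> < \<rho> \<longrightarrow> \<Phi> (x, 0, \<delta>) = F x \<delta> \<and> F x \<delta> + X x (F x \<delta>) \<delta> = 0"
       "\<forall>xf uf S t. t \<in> S \<longrightarrow> (\<forall>s\<in>S. \<bar>xf s\<bar> < \<rho> \<and> \<bar>uf s\<bar> < \<rho>) \<longrightarrow>
          (xf has_real_derivative uf t) (at t within S) \<longrightarrow>
          (uf has_real_derivative xf t ^ (2 * n - 1) * C0 (xf t, \<delta>) + uf t * xf t ^ (n - 1) * C1 (xf t, \<delta>)
             + (uf t)\<^sup>2 * B (uf t, xf t, \<delta>)) (at t within S) \<longrightarrow>
          ((\<lambda>s. \<Phi> (xf s, uf s, \<delta>)) has_real_derivative Y (xf t) (\<Phi> (xf t, uf t, \<delta>)) \<delta>) (at t within S)"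
       "\<forall>x y x' y'. \<bar>x\<bar> < 2 * \<rho>' \<longrightarrow> \<bar>y\<bar> < 2 * \<rho>' \<longrightarrow> \<bar>x'\<bar> < 2 * \<rho>' \<longrightarrow> \<bar>y'\<bar> < 2 * \<rho>' \<longrightarrow>
          \<bar>X x y \<delta> - X x' y' \<delta>\<bar> \<le> L * (\<bar>x - x'\<bar> + \<bar>y - y'\<bar>) \<and> \<bar>Y x y \<delta> - Y x' y' \<delta>\<bar> \<le> L * (\<bar>x - x'\<bar> + \<bar>y - y'\<bar>)"
      using bspec[OF loc \<delta>] by (elim exE conjE) (rule that)
    have "\<forall>\<^sub>F x0 in at_right 0. return_map X Y F x0 \<delta> = T2 (x0, \<delta>)"
      by (rule return_map_eq_flow[where X = X and Y = Y and F = F and \<Phi> = \<Phi>, OF T2(1) \<rho>])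
    from focus_coeff_eq[OF T2(2) this] show "v j \<delta> = fps_nth (P \<delta> - fps_X) j" by (simp only: assms(1))
  qed
  have anv: "real_analytic_on (v j) D" for j
    by (rule real_analytic_on_cong[OF real_analytic_on_diff[OF anP real_analytic_on_const]]) (simp add: v)
  \<comment> \<open>\<open>good\<close> marks the parity of the generators: odd indices for odd n,
    even indices for even n.\<close>
  have ideal: "\<exists>\<psi>. (\<forall>i. real_analytic_on (\<psi> i) D) \<and> (\<forall>\<delta>\<in>D. v m \<delta> =
     (\<Sum>i | 1 \<le> i \<and> i < m \<and> good i. \<psi> i \<delta> * v i \<delta>))"
    if good: "good = odd \<and> odd n \<or> good = even \<and> even n" and m: "m \<ge> 1" "\<not> good m" for good :: "nat \<Rightarrow> bool" and m
  proof -
    have "\<exists>\<psi>. (\<forall>i. real_analytic_on (\<psi> i) D) \<and> (\<forall>\<delta>\<in>D. fps_nth (P \<delta> - fps_X) m =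
       (\<Sum>i | 1 \<le> i \<and> i < m \<and> good i. \<psi> i \<delta> * fps_nth (P \<delta> - fps_X) i))"
      using good
    proof
      assume g: "good = odd \<and> odd n"
      show ?thesis
      proof (rule focus_ideal[of P D h h "1" good m, OF anP anh anh _ _ _ _ m])
        fix m \<delta> assume "\<not> good m" "\<delta> \<in> D"
        \<comment> \<open>Here m is even, so h'(0)^m is nonnegative while h'(0) is negative.\<close>
        then have "fps_nth (h \<delta>) 1 < 0" "fps_nth (h \<delta>) 1 ^ m \<ge> 0" using g h01 by (auto simp: zero_le_even_power)
        then show "fps_nth (h \<delta>) 1 ^ m - 1 * fps_nth (h \<delta>) 1 \<noteq> 0" by linarith
      qed (use g P01 h01 rel(1) in auto)
    next
      assume g: "good = even \<and> even n"
      have lin: "fps_nth (h \<delta> oo P \<delta>) 1 = fps_nth (h \<delta>) 1 * fps_nth (P \<delta>) 1" if "\<delta> \<in> D" for \<delta>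
        by (simp add: fps_compose_nth)
      show ?thesis
      proof (rule focus_ideal[of P D h "\<lambda>\<delta>. h \<delta> oo P \<delta>" "- 1" good m, OF anP anh _ _ _ _ _ m])
        show "real_analytic_on (\<lambda>\<delta>. fps_nth (h \<delta> oo P \<delta>) j) D" for j
          by (rule real_analytic_on_fps_compose[OF anh anP])
        fix m \<delta> assume *: "\<not> good m" "\<delta> \<in> D"
        \<comment> \<open>Here m is odd: the m-th power of h'(0) P'(0) and h'(0) itself are both
          negative, and with the sign - 1 they add up.\<close>
        then have "fps_nth (h \<delta>) 1 * fps_nth (P \<delta>) 1 < 0" "fps_nth (h \<delta>) 1 < 0" using h01 P01 by (auto simp: mult_less_0_iff)
        moreover have "odd m" using * g by simp
        ultimately have "fps_nth (h \<delta> oo P \<delta>) 1 ^ m < 0" "fps_nth (h \<delta>) 1 < 0"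
          unfolding lin[OF *(2)] by (simp_all add: power_less_zero_eq)
        then show "fps_nth (h \<delta> oo P \<delta>) 1 ^ m - - 1 * fps_nth (h \<delta>) 1 \<noteq> 0" by linarith
      qed (use g P01 h01 rel(2) in auto)
    qed
    then show ?thesis by (simp add: v cong: sum.cong)
  qed
  have O: "analytic_O D (v m) {1..k} (\<lambda>i. v (c i))"
    if \<psi>: "\<exists>\<psi>. (\<forall>i. real_analytic_on (\<psi> i) D) \<and> (\<forall>\<delta>\<in>D. v m \<delta> = (\<Sum>i\<in>c ` {1..k}. \<psi> i \<delta> * v i \<delta>))"
      and c: "inj_on c {1..k}" for m k and c :: "nat \<Rightarrow> nat"
  proof -
    obtain \<psi> where "\<forall>i. real_analytic_on (\<psi> i) D" "\<forall>\<delta>\<in>D. v m \<delta> = (\<Sum>i\<in>c ` {1..k}. \<psi> i \<delta> * v i \<delta>)"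
      using \<psi> by blast
    then have "(\<forall>i\<in>{1..k}. real_analytic_on (\<psi> (c i)) D) \<and> (\<forall>\<delta>\<in>D. v m \<delta> = (\<Sum>i\<in>{1..k}. \<psi> (c i) \<delta> * v (c i) \<delta>))"
      by (simp only: sum.reindex[OF c] o_def) simp
    then show ?thesis
      unfolding analytic_O_def using anv by (intro conjI ballI exI[of _ "\<lambda>i. \<psi> (c i)"]) simp_all
  qed
  show ?thesis
  proof (intro conjI impI allI ballI)
    fix k :: nat assume n: "odd n" and k: "k \<ge> 1"
    show "analytic_O D (v (2 * k)) {1..k} (\<lambda>i. v (2 * i - 1))"
    proof (rule O)
      show "\<exists>\<psi>. (\<forall>i. real_analytic_on (\<psi> i) D) \<and> (\<forall>\<delta>\<in>D. v (2 * k) \<delta> = (\<Sum>i\<in>(\<lambda>i. 2 * i - 1) ` {1..k}. \<psi> i \<delta> * v i \<delta>))"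
        using ideal[of odd "2 * k"] n k unfolding bounded_index_odd by simp
    qed (auto simp: inj_on_def)
  next
    fix \<delta> assume n: "even n" and \<delta>: "\<delta> \<in> D"
    \<comment> \<open>For m = 1 there are no generators of lower index, so the representation is the
      empty sum.\<close>
    have none: "{i. 1 \<le> i \<and> i < (1 :: nat) \<and> even i} = {}" by auto
    show "v 1 \<delta> = 0" using ideal[of even 1] n \<delta> unfolding none by auto
  next
    fix k :: nat assume n: "even n" and k: "k \<ge> 1"
    show "analytic_O D (v (2 * k + 1)) {1..k} (\<lambda>i. v (2 * i))"
    proof (rule O)
      show "\<exists>\<psi>. (\<forall>i. real_analytic_on (\<psi> i) D) \<and> (\<forall>\<delta>\<in>D. v (2 * k + 1) \<delta> = (\<Sum>i\<in>(\<lambda>i. 2 * i) ` {1..k}. \<psi> i \<delta> * v i \<delta>))"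
        using ideal[of even "2 * k + 1"] n unfolding bounded_index_even by simp
    qed (auto simp: inj_on_def)
  qed
qed

end
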